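(* Let $n\geq 2$ and $k\in\{1,\dots,n\}$. There is a constant $D_{n,k}$ depending only on $n$ and $k$ such that the following holds. Let $g:\mathbb{R}\to\mathbb{R}$ be a nonnegative locally Lipschitz function, let $u\in W^{1,k+1}(B_1,|x|^{1-k})$ be a semistable radial solution of $S_k(D^2u)=g(u)$ in $B_1$, and set $C=D_{n,k}\,\|u\|_{W^{1,k+1}(B_1\setminus\overline{B_{1/2}},|x|^{1-k})}$. (i) If $n<2k+8$, then $|u(r)|\leq C$ for all $r\in(0,1]$. (ii) If $n=2k+8$, then $|u(r)|\leq C(|\log r|+1)$ for all $r\in(0,1]$. (iii) If $n>2k+8$, then $$|u(r)|\leq C\,r^{\frac{-(k+1)n+2\sqrt{2(k+1)n-4k}+2k^2+6k}{(k+1)^2}}\quad\text{for all } r\in(0,1].$$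
   Context: $B_\rho$ is the open ball of radius $\rho$ centered at $0$ in $\mathbb{R}^n$, $c_{n,k}=\binom{n}{k}/n$, $(\cdot,\cdot)$ is the Euclidean inner product. A function is radial if $u(x)=u(r)$, $r=|x|$; $u'$ is its derivative in $r$. For open $A\subset B_1$, $W^{1,k+1}(A,|x|^{1-k})$ is the space of weakly differentiable $u\in L^{k+1}(A)$ with $\int_{A}|x|^{1-k}|\nabla u|^{k+1}dx<\infty$, normed by $\|u\|=\left(\int_A|u|^{k+1}dx+\int_A|x|^{1-k}|\nabla u|^{k+1}dx\right)^{1/(k+1)}$. $S_k(D^2u)=\sigma_k(\lambda(D^2u))$ is the $k$-th elementary symmetric function of the eigenvalues of the Hessian $D^2u$, and $S_k^{ij}(D^2u)=\frac{\partial}{\partial u_{ij}}S_k(D^2u)$, where $u_i=u_{x_i}$, $u_{ij}=u_{x_ix_j}$. For radial $u$, with $\lambda_1=u''$ and $\lambda_2=u'/r$, one has at $x\neq0$ $$S_k^{ij}(D^2u)=k\,c_{n,k}\left(\lambda_2^{k-1}\delta_{ij}+\frac{k-1}{n-1}\lambda_2^{k-2}(\lambda_1-\lambda_2)\Big(\delta_{ij}-\frac{x_ix_j}{|x|^2}\Big)\right)$$ (the second term is absent when $k=1$). Classical solution: $u\in C^2(B_1)\cap C(\overline{B_1})$, $u=0$ on $\partial B_1$, $\sigma_i(\lambda(D^2u))>0$ in $B_1$ for $i=1,\dots,k$, and $S_k(D^2u)=g(u)$ in $B_1$. Weak solution: $u\in L^{k+1}(B_1)$, $\int_{B_1}\sum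 u_iu_jS_k^{ij}(D^2u)<\infty$, $g(u)\in L^1(B_1)$ and $\int_{B_1}\{\frac1k\sum u_i\eta_jS_k^{ij}(D^2u)+g(u)\eta\}=0$ for all $\eta\in C_c^1(B_1)$ (for radial $u$, $\sum u_iu_jS_k^{ij}(D^2u)=k\,c_{n,k}(u'/r)^{k-1}(u')^2$ and $\sum u_i\eta_jS_k^{ij}(D^2u)=k\,c_{n,k}(u'/r)^k(x,\nabla\eta)$, which do not involve $u''$). "Solution" means classical or weak solution. Radial solutions are understood with $u'\ge0$; $u$ denotes the continuous representative on $(0,1]$. A solution $u$ is semistable if $\int_{B_1}\{\sum\varphi_i\varphi_jS_k^{ij}(D^2u)+g'(u)\varphi^2\}dx\ge0$ for all $\varphi\in C_c^1(B_1\setminus\{0\})$. *)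

theory Defs
  imports "HOL-Analysis.Analysis" "HOL-Computational_Algebra.Polynomial"
begin

section \<open>Classical derivatives and test functions\<close>

definition partial :: "'n::finite \<Rightarrow> (real^'n \<Rightarrow> real) \<Rightarrow> real^'n \<Rightarrow> real" where
  "partial i f x = deriv (\<lambda>t. f (x + t *\<^sub>R axis i 1)) 0"

definition grad :: "(real^'n::finite \<Rightarrow> real) \<Rightarrow> real^'n \<Rightarrow> real^'n" where
  "grad f x = (\<chi> i. partial i f x)"

definition hessian :: "(real^'n::finite \<Rightarrow> real) \<Rightarrow> real^'n \<Rightarrow> real^'n^'n" where
  "hessian f x = (\<chi> i j. partial j (partial i f) x)"

definition C1_on :: "(real^'n::finite) set \<Rightarrow> (real^'n \<Rightarrow> real) \<Rightarrow> bool" where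
  "C1_on A f \<longleftrightarrow>
     (\<forall>x\<in>A. f differentiable (at x)) \<and> (\<forall>i. continuous_on A (partial i f))"

definition C2_on :: "(real^'n::finite) set \<Rightarrow> (real^'n \<Rightarrow> real) \<Rightarrow> bool" where
  "C2_on A f \<longleftrightarrow> C1_on A f \<and> (\<forall>i. C1_on A (partial i f))"

text \<open>Elements of \<open>C\<^sub>c\<^sup>1(A)\<close> are represented by their extensions by zero to the whole space.\<close>

definition Cc1 :: "(real^'n::finite) set \<Rightarrow> (real^'n \<Rightarrow> real) set" where
  "Cc1 A = {\<eta>. C1_on UNIV \<eta> \<and> compact (closure {x. \<eta> x \<noteq> 0}) \<and> closure {x. \<eta> x \<noteq> 0} \<subseteq> A}"

section \<open>Weak gradients and the weighted Sobolev space\<close>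

definition has_weak_gradient ::
    "(real^'n::finite) set \<Rightarrow> (real^'n \<Rightarrow> real) \<Rightarrow> (real^'n \<Rightarrow> real^'n) \<Rightarrow> bool" where
  "has_weak_gradient A u Du \<longleftrightarrow>
     (\<forall>K. compact K \<and> K \<subseteq> A \<longrightarrow>
        u absolutely_integrable_on K \<and> Du absolutely_integrable_on K) \<and>
     (\<forall>\<eta>\<in>Cc1 A. \<forall>i.
        (LINT x:A|lebesgue. u x * partial i \<eta> x) = - (LINT x:A|lebesgue. Du x $ i * \<eta> x))"

text \<open>\<open>in_W k A u Du\<close> says that \<open>u\<close> belongs to \<open>W\<^sup>1\<^sup>,\<^sup>k\<^sup>+\<^sup>1(A, |x|\<^sup>1\<^sup>-\<^sup>k)\<close> and that \<open>Du\<close> is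
  (a representative of) its weak gradient, which is unique up to null sets.\<close>

definition in_W :: "nat \<Rightarrow> (real^'n::finite) set \<Rightarrow> (real^'n \<Rightarrow> real) \<Rightarrow> (real^'n \<Rightarrow> real^'n) \<Rightarrow> bool" where
  "in_W k A u Du \<longleftrightarrow>
     has_weak_gradient A u Du \<and>
     set_borel_measurable lebesgue A u \<and>
     (\<lambda>x. \<bar>u x\<bar> ^ (k + 1)) absolutely_integrable_on A \<and>
     (\<lambda>x. norm x powr (1 - real k) * norm (Du x) ^ (k + 1)) absolutely_integrable_on A"

definition W_norm :: "nat \<Rightarrow> (real^'n::finite) set \<Rightarrow> (real^'n \<Rightarrow> real) \<Rightarrow> (real^'n \<Rightarrow> real^'n) \<Rightarrow> real" where
  "W_norm k A u Du =
     ((LINT x:A|lebesgue. \<bar>u x\<bar> ^ (k + 1)) +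
      (LINT x:A|lebesgue. norm x powr (1 - real k) * norm (Du x) ^ (k + 1)))
     powr (1 / (real k + 1))"

section \<open>The k-Hessian operator\<close>

definition elem_sym :: "nat \<Rightarrow> ('n::finite \<Rightarrow> 'a::comm_ring_1) \<Rightarrow> 'a" where
  "elem_sym k l = (\<Sum>I\<in>{I. card I = k}. \<Prod>i\<in>I. l i)"

definition charpoly :: "real^'n^'n::finite \<Rightarrow> complex poly" where
  "charpoly A = det (\<chi> i j. (if i = j then [:0, 1:] else 0) - [:of_real (A $ i $ j):])"

text \<open>The eigenvalues with algebraic multiplicity, enumerated in some order by the index type.
  They are complex because the partial derivatives of \<open>S\<^sub>k\<close> below treat all entries of the matrix
  as independent variables, so that \<open>S\<^sub>k\<close> is also evaluated at nonsymmetric matrices.  Taking the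
  real part in \<open>S_op\<close> loses nothing: the symmetric functions of the eigenvalues of a real matrix
  are real.\<close>

definition eigenvals :: "real^'n^'n::finite \<Rightarrow> 'n \<Rightarrow> complex" where
  "eigenvals A = (SOME l. charpoly A = (\<Prod>i\<in>UNIV. [:- l i, 1:]))"

definition S_op :: "nat \<Rightarrow> real^'n^'n::finite \<Rightarrow> real" where
  "S_op k A = Re (elem_sym k (eigenvals A))"

definition S_deriv :: "nat \<Rightarrow> real^'n^'n::finite \<Rightarrow> 'n \<Rightarrow> 'n \<Rightarrow> real" where
  "S_deriv k A i j =
     deriv (\<lambda>t. S_op k (\<chi> a b. A $ a $ b + (if a = i \<and> b = j then t else 0))) 0"

section \<open>Solutions\<close>

definition locally_Lipschitz :: "(real \<Rightarrow> real) \<Rightarrow> bool" where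
  "locally_Lipschitz g \<longleftrightarrow> (\<forall>t. \<exists>e>0. \<exists>L. L-lipschitz_on (cball t e) g)"

definition classical_solution :: "nat \<Rightarrow> (real \<Rightarrow> real) \<Rightarrow> (real^'n::finite \<Rightarrow> real) \<Rightarrow> bool" where
  "classical_solution k g u \<longleftrightarrow>
     C2_on (ball 0 1) u \<and> continuous_on (cball 0 1) u \<and>
     (\<forall>x\<in>sphere 0 1. u x = 0) \<and>
     (\<forall>x\<in>ball 0 1. \<forall>i\<in>{1..k}. S_op i (hessian u x) > 0) \<and>
     (\<forall>x\<in>ball 0 1. S_op k (hessian u x) = g (u x))"

definition c_const :: "nat \<Rightarrow> nat \<Rightarrow> real" where
  "c_const n k = real (n choose k) / real n"

text \<open>The derivative \<open>u'\<close> with respect to \<open>r = |x|\<close>, expressed by the weak gradient.\<close>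

definition radial_deriv :: "(real^'n::finite \<Rightarrow> real^'n) \<Rightarrow> real^'n \<Rightarrow> real" where
  "radial_deriv Du x = (Du x \<bullet> x) / norm x"

text \<open>For a radial weakly differentiable \<open>u\<close> with weak gradient \<open>Du\<close>, the sums
  \<open>\<Sum> u\<^sub>i u\<^sub>j S\<^sub>k\<^sup>i\<^sup>j(D\<^sup>2u)\<close> and \<open>\<Sum> u\<^sub>i \<eta>\<^sub>j S\<^sub>k\<^sup>i\<^sup>j(D\<^sup>2u)\<close> involve first derivatives only and
  are given by the following two expressions; for such \<open>u\<close> they are what the weak formulation
  means, because no second derivatives are available.\<close>

definition energy_density :: "nat \<Rightarrow> (real^'n::finite \<Rightarrow> real^'n) \<Rightarrow> real^'n \<Rightarrow> real" where
  "energy_density k Du x =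
     real k * c_const CARD('n) k * (radial_deriv Du x / norm x) ^ (k - 1) * (radial_deriv Du x)\<^sup>2"

definition weak_form ::
    "nat \<Rightarrow> (real^'n::finite \<Rightarrow> real^'n) \<Rightarrow> (real^'n \<Rightarrow> real) \<Rightarrow> real^'n \<Rightarrow> real" where
  "weak_form k Du \<eta> x =
     real k * c_const CARD('n) k * (radial_deriv Du x / norm x) ^ k * (x \<bullet> grad \<eta> x)"

definition radial_weak_solution ::
    "nat \<Rightarrow> (real \<Rightarrow> real) \<Rightarrow> (real^'n::finite \<Rightarrow> real) \<Rightarrow> (real^'n \<Rightarrow> real^'n) \<Rightarrow> bool" where
  "radial_weak_solution k g u Du \<longleftrightarrow>
     has_weak_gradient (ball 0 1) u Du \<and>
     set_borel_measurable lebesgue (ball 0 1) u \<and>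
     (\<lambda>x. \<bar>u x\<bar> ^ (k + 1)) absolutely_integrable_on ball 0 1 \<and>
     energy_density k Du absolutely_integrable_on ball 0 1 \<and>
     (\<lambda>x. g (u x)) absolutely_integrable_on ball 0 1 \<and>
     (\<forall>\<eta>\<in>Cc1 (ball 0 1).
        (LINT x:ball 0 1|lebesgue. 1 / real k * weak_form k Du \<eta> x + g (u x) * \<eta> x) = 0)"

section \<open>Semistability\<close>

text \<open>A locally Lipschitz function is differentiable almost everywhere; at the remaining points
  its derivative is set to 0.\<close>

definition ae_deriv :: "(real \<Rightarrow> real) \<Rightarrow> real \<Rightarrow> real" where
  "ae_deriv g t = (if g differentiable (at t) then deriv g t else 0)"

text \<open>Here \<open>D\<^sup>2u\<close> is the pointwise Hessian.  This is also meaningful for a radial weak solution that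
  is continuous away from the origin and has \<open>u' \<ge> 0\<close>: by the equation it is twice continuously
  differentiable in the punctured ball, except possibly on the single sphere bounding the ball
  where \<open>u' = 0\<close>.\<close>

definition stability_density ::
    "nat \<Rightarrow> (real \<Rightarrow> real) \<Rightarrow> (real^'n::finite \<Rightarrow> real) \<Rightarrow> (real^'n \<Rightarrow> real) \<Rightarrow> real^'n \<Rightarrow> real" where
  "stability_density k g u \<phi> x =
     (\<Sum>i\<in>UNIV. \<Sum>j\<in>UNIV. partial i \<phi> x * partial j \<phi> x * S_deriv k (hessian u x) i j)
     + ae_deriv g (u x) * (\<phi> x)\<^sup>2"

definition semistable :: "nat \<Rightarrow> (real \<Rightarrow> real) \<Rightarrow> (real^'n::finite \<Rightarrow> real) \<Rightarrow> bool" where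
  "semistable k g u \<longleftrightarrow>
     (\<forall>\<phi>\<in>Cc1 (ball 0 1 - {0}).
        stability_density k g u \<phi> absolutely_integrable_on ball 0 1 \<and>
        (LINT x:ball 0 1|lebesgue. stability_density k g u \<phi> x) \<ge> 0)"

end

theory Submission
  imports Defs "HOL-Computational_Algebra.Fundamental_Theorem_Algebra" "HOL-Real_Asymp.Real_Asymp"
begin

lemma coeff_prod_linear:
  fixes l :: "'n::finite \<Rightarrow> complex"
  assumes "k \<le> CARD('n)"
  shows "elem_sym k l = (-1)^k * coeff (\<Prod>i\<in>UNIV. [:- l i, 1:]) (CARD('n) - k)"
proof -
  have "(\<Prod>i\<in>UNIV. [:- l i, 1:]) = (\<Prod>i\<in>UNIV. [:- l i:] + monom 1 1)"
    by (simp add: monom_altdef)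
  also have "\<dots> = (\<Sum>I\<in>Pow UNIV. (\<Prod>i\<in>I. [:- l i:]) * (\<Prod>i\<in>UNIV - I. monom 1 1))"
    by (rule prod_add) simp
  also have "\<dots> = (\<Sum>I\<in>UNIV. monom ((-1)^card I * (\<Prod>i\<in>I. l i)) (CARD('n) - card I))"
  proof -
    have 1: "(\<Prod>i\<in>I. [:- l i:]) = [:(-1)^card I * (\<Prod>i\<in>I. l i):]" for I
    proof (induction I rule: infinite_finite_induct)
      case (insert x F) then show ?case by (simp add: mult.commute mult.left_commute)
    qed (simp_all add: one_pCons)
    have 2: "(\<Prod>i\<in>UNIV - I. monom 1 1 :: complex poly) = monom 1 (CARD('n) - card I)" for I :: "'n set"
      by (simp add: monom_power card_Diff_subset)
    show ?thesis unfolding 1 2 by (simp add: smult_monom)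
  qed
  finally have "coeff (\<Prod>i\<in>UNIV. [:- l i, 1:]) (CARD('n) - k)
      = (\<Sum>I\<in>UNIV. if card I = k then (-1)^k * (\<Prod>i\<in>I. l i) else 0)"
  proof -
    assume eq: "(\<Prod>i\<in>UNIV. [:- l i, 1:]) = (\<Sum>I\<in>UNIV. monom ((-1)^card I * (\<Prod>i\<in>I. l i)) (CARD('n) - card I))"
    have *: "CARD('n) - card I = CARD('n) - k \<longleftrightarrow> card I = k" for I :: "'n set"
      using assms card_mono[of UNIV I] by auto
    show ?thesis unfolding eq coeff_sum coeff_monom
      by (rule sum.cong) (auto simp: *)
  qed
  also have "\<dots> = (\<Sum>I\<in>{I. card I = k}. (-1)^k * (\<Prod>i\<in>I. l i))"
    by (subst sum.inter_filter[symmetric]) auto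
  also have "\<dots> = (-1)^k * elem_sym k l"
    by (simp add: elem_sym_def sum_distrib_left)
  finally show ?thesis by (simp add: mult.assoc[symmetric] power_mult_distrib[symmetric])
qed

lemma degree_charpoly:
  fixes A :: "real^'n^'n"
  shows "degree (charpoly A) = CARD('n::finite)" "lead_coeff (charpoly A) = 1"
proof -
  define M where "M = (\<lambda>i j. (if i = j then [:0, 1:] else 0) - [:complex_of_real (A $ i $ j):])"
  define T where "T = (\<lambda>p. of_int (sign p) * (\<Prod>i\<in>UNIV. M i (p i)))"
  have cp: "charpoly A = (\<Sum>p | p permutes UNIV. T p)"
    by (simp add: charpoly_def det_def T_def M_def)
  have T1: "T id = (\<Prod>i\<in>UNIV. [:- of_real (A $ i $ i), 1:])"
    by (simp add: T_def M_def sign_id)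
  have monic: "lead_coeff (T id) = 1" "degree (T id) = CARD('n)"
    unfolding T1 lead_coeff_prod by (simp, subst degree_prod_eq_sum_degree) auto
  have dM: "degree (M i j) \<le> (if i = j then 1 else 0)" for i j
    by (auto simp: M_def intro: degree_diff_le)
  have dT: "degree (T p) < CARD('n)" if p: "p permutes UNIV" "p \<noteq> id" for p
  proof -
    have "degree (T p) \<le> degree (of_int (sign p) :: complex poly) + degree (\<Prod>i\<in>UNIV. M i (p i))"
      unfolding T_def by (rule degree_mult_le)
    also have "\<dots> \<le> (\<Sum>i\<in>UNIV. degree (M i (p i)))"
      using degree_prod_sum_le[of UNIV "\<lambda>i. M i (p i)"] by (simp add: o_def)
    also have "\<dots> \<le> (\<Sum>i\<in>UNIV. if i = p i then 1 else 0)"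
      by (intro sum_mono dM)
    also have "\<dots> < (\<Sum>i\<in>(UNIV::'n set). 1)"
    proof -
      obtain x where "p x \<noteq> x" using p(2) by (auto simp: fun_eq_iff)
      then show ?thesis by (intro sum_strict_mono_ex1) (auto intro!: exI[of _ x] bexI[of _ x])
    qed
    finally show ?thesis by simp
  qed
  have split: "charpoly A = T id + (\<Sum>p\<in>{p. p permutes UNIV} - {id}. T p)"
    unfolding cp by (rule sum.remove) (auto simp: permutes_id finite_permutations)
  have "degree (\<Sum>p\<in>{p. p permutes UNIV} - {id}. T p) \<le> CARD('n) - 1"
    by (rule degree_sum_le) (use dT in \<open>fastforce simp: finite_permutations\<close>)+
  then have lt: "degree (\<Sum>p\<in>{p. p permutes UNIV} - {id}. T p) < degree (T id)"
    using monic(2) zero_less_card_finite[where 'a='n] by linarith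
  show "degree (charpoly A) = CARD('n)"
    unfolding split degree_add_eq_left[OF lt] by (rule monic)
  show "lead_coeff (charpoly A) = 1"
    unfolding split degree_add_eq_left[OF lt] using lt monic(1) by (simp add: coeff_eq_0)
qed

lemma charpoly_eigenvals:
  fixes A :: "real^'n^'n::finite"
  shows "charpoly A = (\<Prod>i\<in>UNIV. [:- eigenvals A i, 1:])"
proof -
  have "charpoly A \<noteq> 0" using degree_charpoly(2)[of A] by auto
  then obtain X where X: "size X = degree (charpoly A)"
      "charpoly A = smult (lead_coeff (charpoly A)) (\<Prod>x\<in>#X. [:- x, 1:])"
    using alg_closed_imp_factorization[OF \<open>charpoly A \<noteq> 0\<close>] by blast
  obtain xs where xs: "mset xs = X" using ex_mset by blast
  have len: "length xs = CARD('n)" using X(1) xs degree_charpoly(1)[of A] by (auto simp flip: size_mset)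
  obtain f :: "'n \<Rightarrow> nat" where f: "bij_betw f UNIV {0..<CARD('n)}"
    using ex_bij_betw_finite_nat[of "UNIV::'n set"] by auto
  have "(\<Prod>i\<in>UNIV. [:- (xs ! f i), 1:]) = (\<Prod>j\<in>{0..<CARD('n)}. [:- (xs ! j), 1:])"
    by (rule prod.reindex_bij_betw[OF f])
  also have "\<dots> = prod_list (map (\<lambda>x. [:- x, 1:]) xs)"
    by (simp add: prod.list_conv_set_nth len)
  also have "\<dots> = charpoly A"
    using X(2) degree_charpoly(2)[of A] by (simp flip: xs mset_map add: prod_mset_prod_list)
  finally have "\<exists>l::'n \<Rightarrow> complex. charpoly A = (\<Prod>i\<in>UNIV. [:- l i, 1:])"
    by (intro exI[of _ "\<lambda>i. xs ! f i"]) simp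
  then show ?thesis unfolding eigenvals_def
    by (rule someI_ex[where P = "\<lambda>l. charpoly A = (\<Prod>i\<in>UNIV. [:- l i, 1:])"])
qed

lemma S_op_coeff:
  fixes A :: "real^'n^'n::finite"
  assumes "k \<le> CARD('n)"
  shows "S_op k A = Re ((-1)^k * coeff (charpoly A) (CARD('n) - k))"
  unfolding S_op_def coeff_prod_linear[OF assms] charpoly_eigenvals[symmetric] ..

lemma differentiable_coeff_prod:
  fixes A :: "'a::real_normed_vector"
  assumes "\<And>i m. i \<in> I \<Longrightarrow> (\<lambda>A. coeff (q i A :: complex poly) m) differentiable (at A)"
  shows "(\<lambda>A. coeff (\<Prod>i\<in>I. q i A) m) differentiable (at A)"
  using assms
proof (induction I arbitrary: m rule: infinite_finite_induct)
  case (insert x F)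
  then show ?case by (auto simp: coeff_mult intro!: differentiable_sum differentiable_mult)
qed auto

lemma S_op_differentiable:
  fixes A :: "real^'n^'n::finite"
  assumes "k \<le> CARD('n)"
  shows "S_op k differentiable (at A)"
proof -
  have entry: "(\<lambda>A::real^'n^'n. coeff ((if i = j then [:0, 1:] else 0) - [:complex_of_real (A $ i $ j):]) m) differentiable (at A)" for i j m A
  proof -
    have bl: "bounded_linear (\<lambda>A::real^'n^'n. complex_of_real (A $ i $ j))"
      by (rule bounded_linear_compose[OF bounded_linear_of_real bounded_linear_compose[OF bounded_linear_vec_nth bounded_linear_vec_nth]])
    then have "(\<lambda>A::real^'n^'n. complex_of_real (A $ i $ j)) differentiable (at A)"
      using bounded_linear_imp_differentiable by blast
    then show ?thesis by (cases m) (auto intro!: differentiable_diff)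
  qed
  have "(\<lambda>A::real^'n^'n. coeff (charpoly A) m) differentiable (at A)" for m
  proof -
    have "coeff (charpoly A) m = (\<Sum>p | p permutes UNIV. of_int (sign p) *
        coeff (\<Prod>i\<in>UNIV. (if i = p i then [:0, 1:] else 0) - [:complex_of_real (A $ i $ p i):]) m)" for A :: "real^'n^'n"
      unfolding charpoly_def det_def by (simp add: coeff_sum of_int_poly[symmetric] del: of_int_poly) (simp add: of_int_poly)
    then show ?thesis
      by (simp only:, intro differentiable_sum ballI differentiable_mult differentiable_const differentiable_coeff_prod entry)
        (simp add: finite_permutations)
  qed
  then have "(\<lambda>A::real^'n^'n. Re ((-1)^k * coeff (charpoly A) (CARD('n) - k))) differentiable (at A)"
    using differentiable_compose[OF bounded_linear_imp_differentiable[OF bounded_linear_Re]]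
    by (intro differentiable_compose[OF bounded_linear_imp_differentiable[OF bounded_linear_Re]] differentiable_mult differentiable_const) auto
  moreover have "S_op k = (\<lambda>A::real^'n^'n. Re ((-1)^k * coeff (charpoly A) (CARD('n) - k)))"
    using S_op_coeff[OF assms] by (auto simp: fun_eq_iff)
  ultimately show ?thesis by simp
qed

text \<open>rank one\<close>
lemma det_rank_one:
  fixes e :: "real^'n::finite"
  assumes "norm e = 1"
  shows "det (\<chi> i j. (if i = j then p else 0) + q * e $ i * e $ j) = p ^ (CARD('n) - 1) * (p + q)"
proof -
  obtain i0 :: 'n where True by simp
  obtain R :: "real^'n^'n" where R: "orthogonal_matrix R" "R *v axis i0 1 = e"
    using orthogonal_matrix_exists_basis[OF assms] by metis
  define D :: "real^'n^'n" where "D = (\<chi> i j. if i = j then (if i = i0 then p + q else p) else 0)"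
  have Re: "R $ i $ i0 = e $ i" for i
    using R(2) by (simp add: matrix_vector_mult_basis column_def vec_eq_iff)
  have RR: "R ** transpose R = mat 1" using R(1) by (simp add: orthogonal_matrix_def)
  have RR': "(\<Sum>c\<in>UNIV. R $ i $ c * R $ j $ c) = (if i = j then 1 else 0)" for i j
    using arg_cong[OF RR, of "\<lambda>M. M $ i $ j"] by (simp add: matrix_matrix_mult_def transpose_def mat_def)
  have "(\<chi> i j. (if i = j then p else 0) + q * e $ i * e $ j) = R ** D ** transpose R"
  proof -
    have entry: "(R ** D ** transpose R) $ i $ j = (if i = j then p else 0) + q * e $ i * e $ j" for i j
    proof -
    have "(R ** D ** transpose R) $ i $ j = (\<Sum>c\<in>UNIV. (\<Sum>d\<in>UNIV. R $ i $ d * D $ d $ c) * R $ j $ c)"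
      by (simp add: matrix_matrix_mult_def transpose_def)
    also have "\<dots> = (\<Sum>c\<in>UNIV. p * (R $ i $ c * R $ j $ c) + (if c = i0 then q * R $ i $ i0 * R $ j $ i0 else 0))"
      by (rule sum.cong) (auto simp: D_def if_distrib[of "\<lambda>x. _ * x"] sum.delta algebra_simps cong: if_cong)
    also have "\<dots> = (if i = j then p else 0) + q * e $ i * e $ j"
      by (simp add: sum.distrib RR' Re flip: sum_distrib_left)
    finally show ?thesis .
    qed
    then show ?thesis by (simp add: vec_eq_iff)
  qed
  then have "det (\<chi> i j. (if i = j then p else 0) + q * e $ i * e $ j) = det D"
  proof -
    have "det R * det (transpose R) = 1" using arg_cong[OF RR, of det] by (simp only: det_mul det_I)
    then have "det R * det D * det (transpose R) = det D" by (simp add: mult.assoc mult.left_commute[of _ "det D"])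
    then show ?thesis by (simp only: \<open>_ = R ** D ** transpose R\<close> det_mul)
  qed
  also have "\<dots> = (\<Prod>i\<in>UNIV. if i = i0 then p + q else p)"
    by (subst det_diagonal) (auto simp: D_def)
  also have "\<dots> = (p + q) * (\<Prod>i\<in>UNIV - {i0}. if i = i0 then p + q else p)"
    by (subst prod.remove[of _ i0]) auto
  also have "(\<Prod>i\<in>UNIV - {i0}. if i = i0 then p + q else p) = (\<Prod>i\<in>UNIV - {i0}. p)"
    by (rule prod.cong) auto
  finally show ?thesis by (simp add: card_Diff_subset mult.commute)
qed

lemma poly_eq_if_eq_on_reals:
  fixes p q :: "complex poly"
  assumes "\<And>z. poly p (of_real z) = poly q (of_real z)"
  shows "p = q"
proof (rule ccontr)
  assume "p \<noteq> q"
  then have "finite {x. poly (p - q) x = 0}" by (intro poly_roots_finite) simp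
  moreover have "range complex_of_real \<subseteq> {x. poly (p - q) x = 0}" using assms by auto
  ultimately have "finite (range complex_of_real)" by (rule rev_finite_subset)
  then show False by (simp add: finite_image_iff inj_of_real infinite_UNIV_char_0)
qed

lemma charpoly_rank_one:
  fixes e :: "real^'n::finite"
  assumes "norm e = 1"
  shows "charpoly (\<chi> i j. (if i = j then p else 0) + q * e $ i * e $ j) = [:- of_real p, 1:] ^ (CARD('n) - 1) * [:- of_real (p + q), 1:]"
    (is "?L = ?R")
proof -
  have "poly ?L (of_real z) = poly ?R (of_real z)" for z
  proof -
    have pd: "poly (det M) x = det (\<chi> i j. poly (M $ i $ j) x)" for M :: "complex poly^'n^'n" and x
      by (simp add: det_def poly_sum poly_prod)
    have rd: "det (\<chi> i j. complex_of_real (M $ i $ j)) = of_real (det M)" for M :: "real^'n^'n"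
      by (simp add: det_def)
    have "poly ?L (of_real z) = det (\<chi> i j. complex_of_real ((\<chi> i j. (if i = j then z - p else 0) + (- q) * e $ i * e $ j) $ i $ j))"
    proof -
      have "(\<chi> i j. poly ((\<chi> i j. (if i = j then [:0, 1:] else 0) - [:complex_of_real ((\<chi> i j. (if i = j then p else 0) + q * e $ i * e $ j) $ i $ j):]) $ i $ j) (of_real z))
        = (\<chi> i j. complex_of_real ((\<chi> i j. (if i = j then z - p else 0) + (- q) * e $ i * e $ j) $ i $ j))"
        by (simp add: vec_eq_iff)
      then show ?thesis unfolding charpoly_def pd by (rule arg_cong[where f = det])
    qed
    also have "\<dots> = of_real ((z - p) ^ (CARD('n) - 1) * ((z - p) + (- q)))"
      unfolding rd det_rank_one[OF assms] ..
    also have "\<dots> = (of_real z - of_real p) ^ (CARD('n) - 1) * (of_real z - of_real (p + q))"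
      by (simp add: diff_diff_eq)
    also have "\<dots> = poly ?R (of_real z)" unfolding poly_mult poly_power by simp
    finally show ?thesis .
  qed
  then show ?thesis by (rule poly_eq_if_eq_on_reals)
qed

lemma S_op_rank_one:
  fixes e :: "real^'n::finite"
  assumes "norm e = 1" "1 \<le> k" "k \<le> CARD('n)"
  shows "S_op k (\<chi> i j. (if i = j then p else 0) + q * e $ i * e $ j)
     = real ((CARD('n) - 1) choose k) * p ^ k + real ((CARD('n) - 1) choose (k - 1)) * p ^ (k - 1) * (p + q)"
proof -
  let ?n = "CARD('n)"
  obtain j where k: "k = Suc j" using assms(2) by (cases k) auto
  have c: "coeff ([:- complex_of_real p, 1:] ^ (?n - 1)) m = of_nat ((?n - 1) choose m) * (- of_real p) ^ (?n - 1 - m)" if "m \<le> ?n - 1" for m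
    using that by (simp add: coeff_linear_poly_power)
  have c1: "coeff ([:- complex_of_real p, 1:] ^ (?n - 1)) (?n - k) = of_nat ((?n - 1) choose j) * (- of_real p) ^ j"
  proof -
    have "?n - 1 choose (?n - k) = ?n - 1 choose j"
      using assms k binomial_symmetric[of j "?n - 1"] by simp
    then show ?thesis using assms k by (subst c) auto
  qed
  have c2: "coeff ([:- complex_of_real p, 1:] ^ (?n - 1) * [:- of_real (p + q), 1:]) (?n - k)
      = of_nat ((?n - 1) choose j) * (- of_real p) ^ j * (- of_real (p + q)) + of_nat ((?n - 1) choose k) * (- of_real p) ^ k"
  proof (cases "k = ?n")
    case True
    then show ?thesis using c1 by (simp add: mult.commute)
  next
    case False
    then obtain m where m: "?n - k = Suc m" using assms by (metis Suc_diff_Suc le_neq_implies_less)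
    have mm': "m = ?n - 1 - k" "k \<le> ?n - 1" using m by linarith+
    have mm: "?n - 1 choose m = ?n - 1 choose k" "?n - 1 - m = k" "m \<le> ?n - 1"
      using binomial_symmetric[OF mm'(2)] mm' by simp_all
    have "coeff ([:- complex_of_real p, 1:] ^ (?n - 1) * [:- of_real (p + q), 1:]) (?n - k)
       = coeff ([:- complex_of_real p, 1:] ^ (?n - 1)) (?n - k) * (- of_real (p + q)) + coeff ([:- complex_of_real p, 1:] ^ (?n - 1)) m"
      unfolding m by (simp add: coeff_pCons algebra_simps)
    also have "\<dots> = of_nat ((?n - 1) choose j) * (- of_real p) ^ j * (- of_real (p + q)) + of_nat ((?n - 1) choose k) * (- of_real p) ^ k"
      unfolding c1 c[OF mm(3)] mm(1,2) ..
    finally show ?thesis .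
  qed
  have eq: "(-1)^k * (of_nat ((?n - 1) choose j) * (- of_real p) ^ j * (- of_real (p + q)) + of_nat ((?n - 1) choose k) * (- of_real p) ^ k)
    = complex_of_real (real ((?n - 1) choose k) * p ^ k + real ((?n - 1) choose (k - 1)) * p ^ (k - 1) * (p + q))"
  proof -
    define s where "s = (-1 :: complex) ^ j"
    have ss: "s * s = 1" unfolding s_def by (simp flip: power_mult_distrib)
    have "- s * (b * (s * x) * (- y) + a * (- P * (s * x))) = (s * s) * (a * (P * x) + b * x * y)" for a b x y P :: complex
      by (simp add: algebra_simps)
    from this[of "of_nat (?n - 1 choose j)" "of_real p ^ j" "of_real (p + q)" "of_nat (?n - 1 choose k)" "of_real p"]
    show ?thesis unfolding ss k power_Suc power_minus[of "complex_of_real p"] s_def[symmetric] by simp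
  qed
  then show ?thesis
    unfolding S_op_coeff[OF assms(3)] charpoly_rank_one[OF assms(1)] c2 eq by (simp only: Re_complex_of_real)
qed

lemma S_deriv_quadratic:
  fixes A :: "real^'n^'n::finite"
  assumes "k \<le> CARD('n)"
      and "((\<lambda>t. S_op k (\<chi> a b. A $ a $ b + t * (y $ a * y $ b))) has_real_derivative d) (at 0)"
  shows "(\<Sum>i\<in>UNIV. \<Sum>j\<in>UNIV. y $ i * y $ j * S_deriv k A i j) = d"
proof -
  obtain F where F: "(S_op k has_derivative F) (at A)"
    using S_op_differentiable[OF assms(1)] by (auto simp: differentiable_def)
  have lin: "linear F" using F has_derivative_linear by blast
  have curve: "((\<lambda>t. S_op k (\<chi> a b. A $ a $ b + t * B $ a $ b)) has_real_derivative F B) (at 0)" for B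
  proof -
    have "((\<lambda>t::real. A + t *\<^sub>R B) has_derivative (\<lambda>t. t *\<^sub>R B)) (at 0)"
      by (auto intro!: derivative_eq_intros)
    then have "((\<lambda>t. S_op k (A + t *\<^sub>R B)) has_derivative (\<lambda>t. F (t *\<^sub>R B))) (at 0)"
      using F diff_chain_at[of "\<lambda>t. A + t *\<^sub>R B" _ 0 "S_op k" F] by (simp add: o_def)
    moreover have "(\<lambda>t. F (t *\<^sub>R B)) = (\<lambda>t. F B * t)" using lin by (auto simp: linear_cmul)
    moreover have "A + t *\<^sub>R B = (\<chi> a b. A $ a $ b + t * B $ a $ b)" for t by (simp add: vec_eq_iff)
    ultimately show ?thesis by (simp add: has_field_derivative_def)
  qed
  define E where "E = (\<lambda>i j. (\<chi> a b. if a = i \<and> b = j then 1 else 0) :: real^'n^'n)"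
  have S: "S_deriv k A i j = F (E i j)" for i j
  proof -
    have "(\<chi> a b. A $ a $ b + (if a = i \<and> b = j then t else 0)) = (\<chi> a b. A $ a $ b + t * E i j $ a $ b)" for t
      by (auto simp: E_def vec_eq_iff)
    then show ?thesis unfolding S_deriv_def using DERIV_imp_deriv[OF curve[of "E i j"]] by simp
  qed
  have "(\<Sum>i\<in>UNIV. \<Sum>j\<in>UNIV. y $ i * y $ j * S_deriv k A i j) = F (\<Sum>i\<in>UNIV. \<Sum>j\<in>UNIV. (y $ i * y $ j) *\<^sub>R E i j)"
    by (simp add: S linear_sum[OF lin] linear_cmul[OF lin])
  also have "(\<Sum>i\<in>UNIV. \<Sum>j\<in>UNIV. (y $ i * y $ j) *\<^sub>R E i j) = (\<chi> a b. y $ a * y $ b)"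
  proof -
    have "(\<Sum>j\<in>UNIV. y $ i * y $ j * (if a = i \<and> b = j then 1 else 0)) = (if a = i then y $ a * y $ b else 0)" for a b i
      by (auto simp: if_distrib[of "\<lambda>x. _ * x"] cong: if_cong)
    then show ?thesis
      by (simp add: E_def vec_eq_iff)
  qed
  also have "F \<dots> = d"
    using curve[of "\<chi> a b. y $ a * y $ b"] assms(2) DERIV_unique by simp
  finally show ?thesis .
qed

lemma S_deriv_quadratic_rank_one:
  fixes e :: "real^'n::finite"
  assumes "norm e = 1" "1 \<le> k" "k \<le> CARD('n)" and y: "y = s *\<^sub>R e"
  shows "(\<Sum>i\<in>UNIV. \<Sum>j\<in>UNIV. y $ i * y $ j * S_deriv k (\<chi> i j. (if i = j then p else 0) + q * e $ i * e $ j) i j)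
     = real ((CARD('n) - 1) choose (k - 1)) * p ^ (k - 1) * s\<^sup>2"
proof (rule S_deriv_quadratic[OF assms(3)])
  have "(\<lambda>t. S_op k (\<chi> a b. (\<chi> i j. (if i = j then p else 0) + q * e $ i * e $ j) $ a $ b + t * (y $ a * y $ b)))
     = (\<lambda>t. S_op k (\<chi> a b. (if a = b then p else 0) + (q + t * s\<^sup>2) * e $ a * e $ b))"
    by (rule ext, rule arg_cong[of _ _ "S_op k"]) (simp add: vec_eq_iff y power2_eq_square algebra_simps)
  also have "\<dots> = (\<lambda>t. real ((CARD('n) - 1) choose k) * p ^ k + real ((CARD('n) - 1) choose (k - 1)) * p ^ (k - 1) * (p + (q + t * s\<^sup>2)))"
    by (subst S_op_rank_one[OF assms(1-3)]) simp
  finally show "((\<lambda>t. S_op k (\<chi> a b. (\<chi> i j. (if i = j then p else 0) + q * e $ i * e $ j) $ a $ b + t * (y $ a * y $ b)))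
      has_real_derivative real ((CARD('n) - 1) choose (k - 1)) * p ^ (k - 1) * s\<^sup>2) (at 0)"
    by (auto intro!: derivative_eq_intros)
qed

lemma partial_eq:
  fixes f :: "real^'n::finite \<Rightarrow> real"
  assumes "(f has_derivative f') (at x)"
  shows "partial i f x = f' (axis i 1)"
proof -
  have lin: "linear f'" using assms has_derivative_linear by blast
  have "((\<lambda>t::real. x + t *\<^sub>R axis i 1) has_derivative (\<lambda>t. t *\<^sub>R axis i 1)) (at 0)"
    by (auto intro!: derivative_eq_intros)
  then have "((\<lambda>t. f (x + t *\<^sub>R axis i 1)) has_derivative (\<lambda>t. f' (t *\<^sub>R axis i 1))) (at 0)"
    using assms diff_chain_at[of "\<lambda>t. x + t *\<^sub>R axis i 1" _ 0 f f'] by (simp add: o_def)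
  moreover have "(\<lambda>t. f' (t *\<^sub>R axis i 1)) = (\<lambda>t. f' (axis i 1) * t)" using lin by (auto simp: linear_cmul)
  ultimately have "((\<lambda>t. f (x + t *\<^sub>R axis i 1)) has_real_derivative f' (axis i 1)) (at 0)"
    by (simp add: has_field_derivative_def)
  then show ?thesis unfolding partial_def by (rule DERIV_imp_deriv)
qed

lemma has_derivative_partial:
  fixes f :: "real^'n::finite \<Rightarrow> real"
  assumes "f differentiable (at x)"
  shows "(f has_derivative (\<lambda>h. \<Sum>i\<in>UNIV. h $ i * partial i f x)) (at x)"
proof -
  obtain f' where f': "(f has_derivative f') (at x)" using assms by (auto simp: differentiable_def)
  then have lin: "linear f'" using has_derivative_linear by blast
  have "f' h = (\<Sum>i\<in>UNIV. h $ i * partial i f x)" for h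
  proof -
    have "f' h = f' (\<Sum>i\<in>UNIV. h $ i *\<^sub>R axis i 1)"
      using basis_expansion[of h] by (simp add: scalar_mult_eq_scaleR)
    then show ?thesis by (simp add: linear_sum[OF lin] linear_cmul[OF lin] partial_eq[OF f'])
  qed
  then have "f' = (\<lambda>h. \<Sum>i\<in>UNIV. h $ i * partial i f x)" by auto
  then show ?thesis using f' by simp
qed

lemma C1_onI:
  fixes f :: "real^'n::finite \<Rightarrow> real"
  assumes "\<And>x. x \<in> A \<Longrightarrow> (f has_derivative f' x) (at x)"
      and "\<And>i. continuous_on A (\<lambda>x. f' x (axis i 1))"
  shows "C1_on A f"
  unfolding C1_on_def
proof (intro conjI ballI allI)
  show "f differentiable (at x)" if "x \<in> A" for x using assms(1)[OF that] by (auto simp: differentiable_def)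
  show "continuous_on A (partial i f)" for i
    using assms(2)[of i] by (rule continuous_on_eq) (simp add: partial_eq[OF assms(1)])
qed

lemma C1_on_continuous: "C1_on A f \<Longrightarrow> continuous_on A f"
  unfolding C1_on_def
  by (auto intro!: continuous_at_imp_continuous_on simp: differentiable_imp_continuous_within)

lemma partial_mult:
  fixes f g :: "real^'n::finite \<Rightarrow> real"
  assumes "f differentiable (at x)" "g differentiable (at x)"
  shows "partial i (\<lambda>x. f x * g x) x = f x * partial i g x + partial i f x * g x"
  using partial_eq[OF has_derivative_mult[OF has_derivative_partial[OF assms(1)] has_derivative_partial[OF assms(2)]], of i]
  by (simp add: axis_def if_distrib[of "\<lambda>x. x * _"] cong: if_cong)

lemma C1_on_mult:
  fixes f g :: "real^'n::finite \<Rightarrow> real"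
  assumes "C1_on A f" "C1_on A g"
  shows "C1_on A (\<lambda>x. f x * g x)"
  unfolding C1_on_def
proof (intro conjI ballI allI)
  show "(\<lambda>x. f x * g x) differentiable (at x)" if "x \<in> A" for x
    using assms that by (auto simp: C1_on_def intro: differentiable_mult)
  have "continuous_on A (\<lambda>x. f x * partial i g x + partial i f x * g x)" for i
    using assms C1_on_continuous[OF assms(1)] C1_on_continuous[OF assms(2)] by (auto simp: C1_on_def intro!: continuous_intros)
  then show "continuous_on A (partial i (\<lambda>x. f x * g x))" for i
    by (rule continuous_on_eq) (use assms in \<open>auto simp: C1_on_def partial_mult\<close>)
qed

lemma Cc1_mult:
  assumes "C1_on UNIV f" "\<eta> \<in> Cc1 A"
  shows "(\<lambda>x. f x * \<eta> x) \<in> Cc1 A"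
proof -
  have "closure {x. f x * \<eta> x \<noteq> 0} \<subseteq> closure {x. \<eta> x \<noteq> 0}" by (rule closure_mono) auto
  moreover from this have "compact (closure {x. f x * \<eta> x \<noteq> 0})"
    using assms(2) closed_Int_compact[of "closure {x. f x * \<eta> x \<noteq> 0}" "closure {x. \<eta> x \<noteq> 0}"]
    by (simp add: Cc1_def inf.absorb1)
  ultimately show ?thesis using assms C1_on_mult[of UNIV f \<eta>] unfolding Cc1_def by blast
qed

lemma C1_on_coordinate: "C1_on A (\<lambda>x::real^'n::finite. x $ i)"
  by (rule C1_onI[where f' = "\<lambda>x h. h $ i"]) (auto intro!: derivative_eq_intros bounded_linear_imp_has_derivative bounded_linear_vec_nth)

lemma partial_coordinate: "partial i (\<lambda>x::real^'n::finite. x $ j) x = (if i = j then 1 else 0)"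
  by (subst partial_eq[where f' = "\<lambda>h. h $ j"]) (auto intro!: bounded_linear_imp_has_derivative bounded_linear_vec_nth simp: axis_def)

lemma Cc1_support: "\<eta> \<in> Cc1 A \<Longrightarrow> x \<notin> A \<Longrightarrow> \<eta> x = 0"
  unfolding Cc1_def using closure_subset[of "{x. \<eta> x \<noteq> 0}"] by auto

lemma partial_eq_0_outside:
  fixes \<eta> :: "real^'n::finite \<Rightarrow> real"
  assumes "x \<notin> closure {x. \<eta> x \<noteq> 0}"
  shows "partial i \<eta> x = 0"
proof -
  have op: "open (- closure {x. \<eta> x \<noteq> 0})" by auto
  have "(\<eta> has_derivative (\<lambda>h. 0)) (at x)"
  proof (rule has_derivative_transform_within_open[OF has_derivative_const[of 0 "at x"] op])
    show "0 = \<eta> y" if "y \<in> - closure {x. \<eta> x \<noteq> 0}" for y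
      using that subsetD[OF closure_subset, of y "{x. \<eta> x \<noteq> 0}"] by fastforce
  qed (use assms in simp)
  then show ?thesis by (simp add: partial_eq)
qed

section \<open>radial\<close>

lemma has_derivative_radial:
  fixes x :: "real^'n::finite"
  assumes "(v has_real_derivative w) (at (norm x))" "x \<noteq> 0"
  shows "((\<lambda>x. v (norm x)) has_derivative (\<lambda>h. w * (sgn x \<bullet> h))) (at x)"
proof -
  have "(norm has_derivative (\<lambda>h. sgn x \<bullet> h)) (at x)"
    using has_derivative_norm[OF assms(2)] by (simp add: inner_commute)
  then show ?thesis
    using diff_chain_at[of norm _ x v "\<lambda>h. w * h"] assms(1) by (simp add: has_field_derivative_def o_def)
qed

lemma partial_radial:
  fixes x :: "real^'n::finite"
  assumes "(v has_real_derivative w) (at (norm x))" "x \<noteq> 0"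
  shows "partial i (\<lambda>x. v (norm x)) x = w * (x $ i / norm x)"
  using partial_eq[OF has_derivative_radial[OF assms], of i] by (simp add: inner_axis sgn_div_norm divide_inverse mult.commute)

text \<open>test data\<close>
definition bump_fun :: "real \<Rightarrow> real \<Rightarrow> (real \<Rightarrow> real) \<Rightarrow> (real \<Rightarrow> real) \<Rightarrow> bool" where
  "bump_fun \<alpha> \<beta> \<psi> \<psi>' \<longleftrightarrow> (\<forall>r. (\<psi> has_real_derivative \<psi>' r) (at r)) \<and> continuous_on UNIV \<psi>' \<and> (\<forall>r. r \<notin> {\<alpha>..\<beta>} \<longrightarrow> \<psi> r = 0)"

lemma bump_fun_deriv_0:
  assumes "bump_fun \<alpha> \<beta> \<psi> \<psi>'" "r \<notin> {\<alpha>..\<beta>}"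
  shows "\<psi>' r = 0"
proof -
  have "(\<psi> has_real_derivative 0) (at r)"
    using has_field_derivative_transform_within_open[OF DERIV_const[of 0], of "- {\<alpha>..\<beta>}" r \<psi>] assms
    by (auto simp: bump_fun_def open_Compl)
  moreover have "(\<psi> has_real_derivative \<psi>' r) (at r)" using assms(1) by (simp add: bump_fun_def)
  ultimately show ?thesis by (rule DERIV_unique[symmetric])
qed

lemma continuous_vanish_boundary:
  fixes f :: "real \<Rightarrow> real"
  assumes c: "continuous_on UNIV f" and z: "\<And>r. r \<notin> {\<alpha>..\<beta>} \<Longrightarrow> f r = 0" and r: "r = \<alpha> \<or> r = \<beta>"
  shows "f r = 0"
proof -
  have "- {\<alpha>..\<beta>} = {..<\<alpha>} \<union> {\<beta><..}" by auto
  then have cl: "closure (- {\<alpha>..\<beta>}) = {..\<alpha>} \<union> {\<beta>..}" by simp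
  show ?thesis
    by (rule continuous_constant_on_closure[where S = "- {\<alpha>..\<beta>}" and f = f and a = 0])
       (use z r in \<open>auto simp: cl intro: continuous_on_subset[OF c]\<close>)
qed

lemma radial_test_derivative:
  fixes x :: "real^'n::finite"
  assumes b: "bump_fun \<alpha> \<beta> \<psi> \<psi>'" and "0 < \<alpha>"
  shows "((\<lambda>x. \<psi> (norm x)) has_derivative (\<lambda>h. \<psi>' (norm x) * (sgn x \<bullet> h))) (at x)"
proof (cases "x = 0")
  case True
  have "((\<lambda>x::real^'n. \<psi> (norm x)) has_derivative (\<lambda>h. 0)) (at x)"
    by (rule has_derivative_transform_within_open[OF has_derivative_const[of 0 "at x"], of "ball 0 \<alpha>"])
       (use assms True in \<open>auto simp: bump_fun_def\<close>)
  then show ?thesis using True by simp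
next
  case False
  then show ?thesis using assms by (intro has_derivative_radial) (auto simp: bump_fun_def)
qed

lemma partial_radial_test:
  fixes x :: "real^'n::finite"
  assumes "bump_fun \<alpha> \<beta> \<psi> \<psi>'" and "0 < \<alpha>"
  shows "partial i (\<lambda>x. \<psi> (norm x)) x = \<psi>' (norm x) * (x $ i / norm x)"
  using partial_eq[OF radial_test_derivative[OF assms], of i] by (simp add: inner_axis sgn_div_norm divide_inverse mult.commute)

lemma radial_test_Cc1:
  assumes b: "bump_fun \<alpha> \<beta> \<psi> \<psi>'" and ab: "0 < \<alpha>" "\<beta> < 1"
  shows "(\<lambda>x::real^'n::finite. \<psi> (norm x)) \<in> Cc1 (ball 0 1 - {0})"
proof -
  have "C1_on UNIV (\<lambda>x::real^'n. \<psi> (norm x))"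
  proof (rule C1_onI)
    fix i
    have "\<psi>' (norm x) * (sgn x \<bullet> axis i 1) = \<psi>' (norm x) * (x $ i / max \<alpha> (norm x))" for x :: "real^'n"
      using bump_fun_deriv_0[OF b, of "norm x"] by (auto simp: inner_axis sgn_div_norm max_def divide_inverse)
    moreover have "continuous_on UNIV (\<lambda>x::real^'n. \<psi>' (norm x) * (x $ i / max \<alpha> (norm x)))"
      using b ab by (intro continuous_intros continuous_on_compose2[of UNIV \<psi>' UNIV norm]) (auto simp: bump_fun_def)
    ultimately show "continuous_on UNIV (\<lambda>x::real^'n. \<psi>' (norm x) * (sgn x \<bullet> axis i 1))" by simp
  qed (rule radial_test_derivative[OF b ab(1)])
  moreover have sub: "closure {x::real^'n. \<psi> (norm x) \<noteq> 0} \<subseteq> cball 0 \<beta> - ball 0 \<alpha>"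
    by (rule closure_minimal) (use b in \<open>force simp: bump_fun_def\<close>)+
  moreover have "compact (closure {x::real^'n. \<psi> (norm x) \<noteq> 0})"
    using bounded_subset[OF bounded_cball subset_trans[OF sub Diff_subset]] by (simp add: compact_eq_bounded_closed)
  moreover have "cball 0 \<beta> - ball 0 \<alpha> \<subseteq> ball (0::real^'n) 1 - {0}" using ab by auto
  ultimately show ?thesis unfolding Cc1_def by blast
qed

lemma hessian_radial:
  fixes x :: "real^'n::finite"
  assumes v: "\<And>r. \<alpha> < r \<Longrightarrow> r < \<beta> \<Longrightarrow> (v has_real_derivative w r) (at r)"
    and x: "0 \<le> \<alpha>" "\<alpha> < norm x" "norm x < \<beta>"
    and w: "(w has_real_derivative w') (at (norm x))"
  shows "hessian (\<lambda>x. v (norm x)) x = (\<chi> i j. (if i = j then w (norm x) / norm x else 0) + (w' - w (norm x) / norm x) * sgn x $ i * sgn x $ j)"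
proof -
  have x0: "x \<noteq> 0" using x by auto
  have "partial j (partial i (\<lambda>x. v (norm x))) x = (if i = j then w (norm x) / norm x else 0) + (w' - w (norm x) / norm x) * sgn x $ i * sgn x $ j" for i j
  proof -
    let ?D = "\<lambda>h. w (norm x) * ((h $ i * norm x - x $ i * (sgn x \<bullet> h)) / (norm x * norm x)) + w' * (sgn x \<bullet> h) * (x $ i / norm x)"
    have n: "(norm has_derivative (\<lambda>h. sgn x \<bullet> h)) (at x)"
      using has_derivative_norm[OF x0] by (simp add: inner_commute)
    have c: "((\<lambda>x::real^'n. x $ i) has_derivative (\<lambda>h. h $ i)) (at x)"
      by (intro bounded_linear_imp_has_derivative bounded_linear_vec_nth)
    have "((\<lambda>y. y $ i / norm y) has_derivative (\<lambda>h. (h $ i * norm x - x $ i * (sgn x \<bullet> h)) / (norm x * norm x))) (at x)"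
      by (rule has_derivative_divide'[OF c n]) (use x0 in auto)
    from has_derivative_mult[OF has_derivative_radial[OF w x0] this]
    have "((\<lambda>y. w (norm y) * (y $ i / norm y)) has_derivative ?D) (at x)" .
    then have "(partial i (\<lambda>x. v (norm x)) has_derivative ?D) (at x)"
    proof (rule has_derivative_transform_within_open)
      show "open {y::real^'n. \<alpha> < norm y \<and> norm y < \<beta>}"
        by (intro open_Collect_conj open_Collect_less continuous_intros)
      show "w (norm y) * (y $ i / norm y) = partial i (\<lambda>x. v (norm x)) y" if "y \<in> {y::real^'n. \<alpha> < norm y \<and> norm y < \<beta>}" for y
        using that x(1) v by (subst partial_radial[where w = "w (norm y)"]) auto
    qed (use x in auto)
    have "sgn x \<bullet> axis j 1 = x $ j / norm x" by (simp add: inner_axis sgn_div_norm divide_inverse mult.commute)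
    with partial_eq[OF \<open>(partial i (\<lambda>x. v (norm x)) has_derivative ?D) (at x)\<close>, of j]
    have "partial j (partial i (\<lambda>x. v (norm x))) x = w (norm x) * (((if i = j then 1 else 0) * norm x - x $ i * (x $ j / norm x)) / (norm x * norm x)) + w' * (x $ j / norm x) * (x $ i / norm x)"
      by (simp add: axis_def)
    then show ?thesis using x0 by (simp add: sgn_div_norm field_simps)
  qed
  then show ?thesis by (simp add: hessian_def vec_eq_iff)
qed

definition radial_density :: "nat \<Rightarrow> real \<Rightarrow> real" where
  "radial_density n r = (if 0 < r then real n * unit_ball_vol (real n) * r ^ (n - 1) else 0)"

lemma radial_density_nonneg: "0 \<le> radial_density n r"
  by (simp add: radial_density_def)

lemma radial_density_measurable [measurable]: "radial_density n \<in> borel_measurable borel"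
  unfolding radial_density_def by measurable

lemma distr_norm:
  "distr lborel borel (norm :: real^'n::finite \<Rightarrow> real) = density lborel (\<lambda>r. ennreal (radial_density CARD('n) r))"
proof (rule measure_eqI_generator_eq[where E = "range (\<lambda>a::real. {..a})" and \<Omega> = UNIV and A = "\<lambda>i. {..real i}"])
  let ?n = "CARD('n)" and ?M = "distr lborel borel (norm :: real^'n \<Rightarrow> real)"
  let ?D = "density lborel (\<lambda>r. ennreal (radial_density CARD('n) r))"
  have em: "emeasure ?M {..a} = ennreal (if 0 \<le> a then unit_ball_vol (real ?n) * a ^ ?n else 0)" for a
  proof -
    have "emeasure ?M {..a} = emeasure lborel (norm -` {..a} \<inter> space lborel :: (real^'n) set)"
      by (subst emeasure_distr) auto
    also have "norm -` {..a} \<inter> space lborel = (if 0 \<le> a then cball (0::real^'n) a else {})"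
      by (auto simp: dist_norm) (metis norm_ge_zero order_trans)
    finally show ?thesis by (simp add: emeasure_cball)
  qed
  have ed: "emeasure ?D {..a} = ennreal (if 0 \<le> a then unit_ball_vol (real ?n) * a ^ ?n else 0)" for a
  proof (cases "0 \<le> a")
    case True
    have "emeasure ?D {..a} = (\<integral>\<^sup>+r. ennreal (radial_density ?n r) * indicator {..a} r \<partial>lborel)"
      by (subst emeasure_density) auto
    also have "\<dots> = (\<integral>\<^sup>+r. ennreal (real ?n * unit_ball_vol (real ?n) * r ^ (?n - 1)) * indicator {0..a} r \<partial>lborel)"
      using AE_lborel_singleton[of "0::real"]
      by (intro nn_integral_cong_AE) (auto simp: radial_density_def indicator_def elim!: eventually_mono)
    also have "\<dots> = unit_ball_vol (real ?n) * a ^ ?n - unit_ball_vol (real ?n) * 0 ^ ?n"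
      using True by (intro nn_integral_FTC_Icc) (auto intro!: derivative_eq_intros)
    finally show ?thesis using True by simp
  next
    case False
    have "emeasure ?D {..a} = (\<integral>\<^sup>+r. ennreal (radial_density ?n r) * indicator {..a} r \<partial>lborel)"
      by (subst emeasure_density) auto
    also have "\<dots> = (\<integral>\<^sup>+r. 0 \<partial>(lborel::real measure))"
      using False by (intro nn_integral_cong) (auto simp: radial_density_def indicator_def)
    finally show ?thesis using False by simp
  qed
  show "emeasure ?M X = emeasure ?D X" if "X \<in> range (\<lambda>a::real. {..a})" for X
    using that em ed by auto
  show "emeasure ?M {..real i} \<noteq> \<infinity>" for i by (simp add: em)
  show "sets ?M = sigma_sets UNIV (range (\<lambda>a::real. {..a}))"
    by (simp add: borel_eq_atMost)
  show "sets ?D = sigma_sets UNIV (range (\<lambda>a::real. {..a}))"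
    by (simp add: borel_eq_atMost)
  show "Int_stable (range (\<lambda>a::real. {..a}))"
    by (auto simp: Int_stable_def)
  show "(\<Union>i::nat. {..real i}) = UNIV"
    by (auto intro: real_arch_simple)
qed auto

lemma integrable_radial_iff:
  fixes f :: "real \<Rightarrow> real"
  assumes [measurable]: "f \<in> borel_measurable borel"
  shows "integrable lebesgue (\<lambda>x::real^'n::finite. f (norm x)) \<longleftrightarrow> integrable lborel (\<lambda>r. radial_density CARD('n) r * f r)"
proof -
  have "integrable lebesgue (\<lambda>x::real^'n. f (norm x)) \<longleftrightarrow> integrable (distr lborel borel (norm :: real^'n \<Rightarrow> real)) f"
    by (simp add: integrable_completion integrable_distr_eq)
  also have "\<dots> \<longleftrightarrow> integrable lborel (\<lambda>r. radial_density CARD('n) r * f r)"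
    unfolding distr_norm by (subst integrable_density) (auto simp: radial_density_nonneg)
  finally show ?thesis .
qed

lemma integral_radial:
  fixes f :: "real \<Rightarrow> real"
  assumes [measurable]: "f \<in> borel_measurable borel"
  shows "(LINT x|lebesgue. f (norm (x::real^'n::finite))) = (LINT r|lborel. radial_density CARD('n) r * f r)"
proof -
  have "(LINT x|lebesgue. f (norm (x::real^'n))) = integral\<^sup>L (distr lborel borel (norm :: real^'n \<Rightarrow> real)) f"
    by (simp add: integral_completion integral_distr)
  also have "\<dots> = (LINT r|lborel. radial_density CARD('n) r * f r)"
    unfolding distr_norm by (subst integral_density) (auto simp: radial_density_nonneg)
  finally show ?thesis .
qed

lemma null_radial:
  assumes "A \<in> null_sets (lborel :: real measure)"
  shows "{x. norm (x::real^'n::finite) \<in> A} \<in> null_sets lborel"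
proof -
  have [measurable]: "A \<in> sets borel" using assms by auto
  have "emeasure lborel {x. norm (x::real^'n) \<in> A} = emeasure (distr lborel borel (norm :: real^'n \<Rightarrow> real)) A"
    by (subst emeasure_distr) (auto intro!: arg_cong[where f = "emeasure lborel"])
  also have "\<dots> = (\<integral>\<^sup>+r. ennreal (radial_density CARD('n) r) * indicator A r \<partial>lborel)"
    unfolding distr_norm by (subst emeasure_density) auto
  also have "\<dots> = (\<integral>\<^sup>+r. 0 \<partial>(lborel :: real measure))"
    by (rule nn_integral_cong_AE, rule AE_I'[OF assms]) (auto simp: indicator_def)
  finally show ?thesis
    using measurable_sets[of norm borel borel A] by (intro null_setsI) (simp_all add: vimage_def)
qed

lemma AE_radial:
  assumes "AE r in lborel. P (r::real)"
  shows "AE x in lebesgue. P (norm (x::real^'n::finite))"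
proof -
  obtain A where A: "{r \<in> space lborel. \<not> P r} \<subseteq> A" "A \<in> null_sets lborel"
    using assms by (auto simp: eventually_ae_filter)
  have "AE x in lborel. P (norm (x::real^'n))"
    by (rule AE_I'[OF null_radial[OF A(2)]]) (use A in auto)
  then show ?thesis by (simp add: AE_completion_iff)
qed

lemma zero_ae_if_zero_on_boxes:
  fixes f :: "'a::euclidean_space \<Rightarrow> real"
  assumes U: "open U" and f: "f absolutely_integrable_on U"
    and z: "\<And>a b. cbox a b \<subseteq> U \<Longrightarrow> integral (cbox a b) f = 0"
  obtains N where "negligible N" "\<And>x. x \<in> U - N \<Longrightarrow> f x = 0"
proof -
  define g where "g = (\<lambda>x. if x \<in> U then f x else 0)"
  have "g absolutely_integrable_on UNIV"
    unfolding g_def using f by (subst absolutely_integrable_restrict_UNIV)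
  then have "g integrable_on UNIV" using set_lebesgue_integral_eq_integral(1) by blast
  then have gi: "g integrable_on cbox a b" for a b
    by (rule integrable_on_subcbox) simp
  obtain N where N: "negligible N" "\<And>x e. \<lbrakk>x \<notin> N; 0 < e\<rbrakk> \<Longrightarrow> \<exists>d>0. \<forall>h. 0 < h \<and> h < d \<longrightarrow>
       norm(integral (cbox x (x + h *\<^sub>R One)) g /\<^sub>R h ^ DIM('a) - g x) < e"
    using integrable_ccontinuous_explicit[OF gi] by metis
  have "f x = 0" if x: "x \<in> U - N" for x
  proof (rule ccontr)
    assume nz: "f x \<noteq> 0"
    obtain d where d: "d > 0" "\<And>h. 0 < h \<and> h < d \<Longrightarrow> norm(integral (cbox x (x + h *\<^sub>R One)) g /\<^sub>R h ^ DIM('a) - g x) < \<bar>f x\<bar>"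
      using N(2)[of x "\<bar>f x\<bar>"] nz x by auto
    obtain r where r: "r > 0" "cball x r \<subseteq> U" using U x open_contains_cball by blast
    define h where "h = min (d/2) (r / DIM('a))"
    have h: "0 < h" "h < d" "h * DIM('a) \<le> r" using d r by (auto simp: h_def min_def field_simps)
    have "cbox x (x + h *\<^sub>R One) \<subseteq> cball x r"
    proof
      fix y assume y: "y \<in> cbox x (x + h *\<^sub>R One)"
      have "norm (y - x) \<le> (\<Sum>b\<in>Basis. \<bar>(y - x) \<bullet> b\<bar>)" by (rule norm_le_l1)
      also have "\<dots> \<le> (\<Sum>b\<in>(Basis::'a set). h)"
        using y by (intro sum_mono) (auto simp: mem_box inner_diff_left inner_add_left abs_le_iff algebra_simps)
      also have "\<dots> \<le> r" using h by (simp add: mult.commute)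
      finally show "y \<in> cball x r" by (simp add: dist_norm norm_minus_commute)
    qed
    then have sub: "cbox x (x + h *\<^sub>R One) \<subseteq> U" using r by blast
    have "integral (cbox x (x + h *\<^sub>R One)) g = integral (cbox x (x + h *\<^sub>R One)) f"
      by (rule integral_cong) (use sub in \<open>auto simp: g_def\<close>)
    then have "norm (0 - g x) < \<bar>f x\<bar>" using d(2)[of h] h z[OF sub] by simp
    then show False using x by (simp add: g_def)
  qed
  then show ?thesis using N(1) that by blast
qed

lemma indefinite_integral_differentiable_ae:
  fixes f :: "real \<Rightarrow> real"
  assumes f: "\<And>c d. f integrable_on {c..d}"
  obtains N where "negligible N" "\<And>x. a < x \<Longrightarrow> x \<notin> N \<Longrightarrow> ((\<lambda>x. integral {a..x} f) has_real_derivative f x) (at x)"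
proof -
  obtain N1 where N1: "negligible N1" "\<And>x e. \<lbrakk>x \<notin> N1; 0 < e\<rbrakk> \<Longrightarrow> \<exists>d>0. \<forall>h. 0 < h \<and> h < d \<longrightarrow>
       norm(integral (cbox x (x + h *\<^sub>R One)) f /\<^sub>R h ^ DIM(real) - f x) < e"
    using integrable_ccontinuous_explicit[of f] f by (metis box_real(2))
  have "(\<lambda>x. f (-x)) integrable_on {c..d}" for c d
    using f[of "-d" "-c"] Henstock_Kurzweil_Integration.integrable_reflect_real[where f = f and a = "-d" and b = "-c"] by simp
  then obtain N2 where N2: "negligible N2" "\<And>x e. \<lbrakk>x \<notin> N2; 0 < e\<rbrakk> \<Longrightarrow> \<exists>d>0. \<forall>h. 0 < h \<and> h < d \<longrightarrow>
       norm(integral (cbox x (x + h *\<^sub>R One)) (\<lambda>x. f (-x)) /\<^sub>R h ^ DIM(real) - f (- x)) < e"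
    using integrable_ccontinuous_explicit[of "\<lambda>x. f (-x)"] by (metis box_real(2))
  have neg: "negligible (uminus ` N2)"
    using N2(1) by (rule negligible_locally_Lipschitz_image[rotated]) (auto intro!: exI[of _ "UNIV :: real set"] exI[of _ "1 :: real"] simp: abs_minus_commute)
  show ?thesis
  proof
    show "negligible (N1 \<union> uminus ` N2)" using N1(1) neg by (rule negligible_Un)
    fix x assume x: "a < x" "x \<notin> N1 \<union> uminus ` N2"
    have xN: "x \<notin> N1" "- x \<notin> N2" using x(2) by (auto simp: image_iff)
    define F where "F = (\<lambda>x. integral {a..x} f)"
    have comb: "F q - F p = integral {p..q} f" if "a \<le> p" "p \<le> q" for p q
      unfolding F_def using Henstock_Kurzweil_Integration.integral_combine[OF that f] by linarith
    have "(\<lambda>h. (F (x + h) - F x) / h) \<midarrow>0\<rightarrow> f x"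
    proof (rule LIM_I)
      fix e :: real assume e: "0 < e"
      obtain d1 where d1: "d1 > 0" "\<And>h. 0 < h \<Longrightarrow> h < d1 \<Longrightarrow> norm(integral {x..x+h} f / h - f x) < e"
        using N1(2)[OF xN(1) e] by (auto simp: divide_inverse mult.commute)
      obtain d2 where d2: "d2 > 0" "\<And>h. 0 < h \<Longrightarrow> h < d2 \<Longrightarrow> norm(integral {-x..-x+h} (\<lambda>x. f (-x)) / h - f x) < e"
        using N2(2)[OF xN(2) e] by (auto simp: divide_inverse mult.commute)
      show "\<exists>s>0. \<forall>h::real. h \<noteq> 0 \<and> norm (h - 0) < s \<longrightarrow> norm ((F (x + h) - F x) / h - f x) < e"
      proof (intro exI[of _ "min d1 (min d2 (x - a))"] conjI allI impI)
        fix h :: real assume h: "h \<noteq> 0 \<and> norm (h - 0) < min d1 (min d2 (x - a))"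
        show "norm ((F (x + h) - F x) / h - f x) < e"
        proof (cases "h > 0")
          case True
          then show ?thesis using d1(2)[of h] h x(1) comb[of x "x + h"] by simp
        next
          case False
          have "F (x + h) - F x = - integral {x + h..x} f" using comb[of "x + h" x] h False by simp
          also have "integral {x + h..x} f = integral {-x..-(x+h)} (\<lambda>x. f (-x))"
            using Henstock_Kurzweil_Integration.integral_reflect_real[of "x" "x + h" f] by simp
          finally have "(F (x + h) - F x) / h = integral {-x..-x + (-h)} (\<lambda>x. f (-x)) / (-h)" by simp
          moreover have "0 < -h" "-h < d2" using h False by auto
          ultimately show ?thesis using d2(2)[of "-h"] by (simp only:)
        qed
      qed (use d1 d2 x in auto)
    qed
    then show "((\<lambda>x. integral {a..x} f) has_real_derivative f x) (at x)"
      by (simp add: DERIV_def F_def)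
  qed
qed

lemma bi_Lipschitz_density:
  fixes F :: "real \<Rightarrow> real"
  assumes L: "0 < L"
    and lo: "\<And>x y. x \<le> y \<Longrightarrow> L * (y - x) \<le> F y - F x"
    and up: "\<And>x y. x \<le> y \<Longrightarrow> F y - F x \<le> M * (y - x)"
  obtains f where "\<And>a b. a \<le> b \<Longrightarrow> (f has_integral (F b - F a)) {a..b}"
proof -
  have mono: "F x < F y" if "x < y" for x y
    using lo[of x y] mult_pos_pos[OF L, of "y - x"] that by linarith
  then have inj: "inj F" by (metis injI linorder_neqE_linordered_idom order_less_irrefl)
  have M0: "0 \<le> M" using lo[of 0 1] up[of 0 1] L by simp
  have lipF: "\<bar>F x - F y\<bar> \<le> M * \<bar>x - y\<bar>" for x y
    using up[of x y] up[of y x] mono[of x y] mono[of y x] by (cases x y rule: linorder_cases) auto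
  have contF: "continuous_on UNIV F"
  proof -
    have "M-lipschitz_on UNIV F" using lipF M0 by (intro lipschitz_onI) (auto simp: dist_real_def)
    then show ?thesis by (rule lipschitz_on_continuous_on)
  qed
  have surj: "surj F"
  proof -
    have "\<exists>x. F x = y" for y
    proof -
      define t where "t = \<bar>y - F 0\<bar> / L"
      have t: "0 \<le> t" "L * t = \<bar>y - F 0\<bar>" using L by (auto simp: t_def)
      have "F (- t) \<le> y" "y \<le> F t" using lo[of 0 t] lo[of "-t" 0] t by auto
      then have "\<exists>x\<ge>-t. x \<le> t \<and> F x = y"
        by (rule IVT') (use t continuous_on_subset[OF contF] in auto)
      then show ?thesis by blast
    qed
    then show ?thesis unfolding surj_def by metis
  qed
  define H where "H = inv F"
  have HF: "H (F x) = x" for x by (simp add: H_def inj)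
  have FH: "F (H y) = y" for y by (simp add: H_def surj surj_f_inv_f)
  have monoH: "mono H"
  proof (rule monoI, rule ccontr)
    fix x y assume "x \<le> y" "\<not> H x \<le> H y"
    then show False using mono[of "H y" "H x"] FH by simp
  qed
  have [measurable]: "H \<in> borel_measurable borel" by (rule borel_measurable_mono[OF monoH])
  have vim: "H -` A = F ` A" for A
  proof safe
    show "x \<in> F ` A" if "H x \<in> A" for x using imageI[OF that, of F] by (simp add: FH)
  qed (simp add: HF)
  define D where "D = distr lborel borel H"
  have "absolutely_continuous lborel D"
    unfolding absolutely_continuous_def
  proof
    fix A assume A: "A \<in> null_sets (lborel :: real measure)"
    then have [measurable]: "A \<in> sets borel" by auto
    have "negligible A" using A by (simp add: negligible_iff_null_sets null_sets_completionI)
    then have "negligible (F ` A)"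
      by (rule negligible_locally_Lipschitz_image[rotated]) (auto intro!: exI[of _ "UNIV :: real set"] exI[of _ M] simp: lipF)
    moreover have "F ` A \<in> sets borel" unfolding vim[symmetric] using measurable_sets[of H borel borel A] by simp
    ultimately have "emeasure lborel (F ` A) = 0"
      by (simp add: negligible_iff_null_sets null_sets_def)
    then show "A \<in> null_sets D" unfolding D_def
      by (intro null_setsI) (simp_all add: emeasure_distr vim)
  qed
  then have dens: "density lborel (RN_deriv lborel D) = D"
    by (rule sigma_finite_measure.density_RN_deriv[OF lborel.sigma_finite_measure_axioms]) (simp add: D_def)
  define h where "h = RN_deriv lborel D"
  have D': "emeasure D A = emeasure (density lborel h) A" for A unfolding h_def dens ..
  have [measurable]: "h \<in> borel_measurable borel" by (simp add: h_def borel_measurable_RN_deriv[of lborel D, simplified])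
  have hint: "(\<integral>\<^sup>+x. h x * indicator {a..b} x \<partial>lborel) = ennreal (F b - F a)" if "a \<le> b" for a b
  proof -
    have "(\<integral>\<^sup>+x. h x * indicator {a..b} x \<partial>lborel) = emeasure D {a..b}"
      unfolding D' by (subst emeasure_density) auto
    also have "\<dots> = emeasure lborel (F ` {a..b})"
      unfolding D_def by (subst emeasure_distr) (simp_all add: vim)
    also have "F ` {a..b} = {F a..F b}"
    proof
      show "{F a..F b} \<subseteq> F ` {a..b}"
      proof
        fix y assume y: "y \<in> {F a..F b}"
        then have "H y \<in> {a..b}" using monoD[OF monoH, of "F a" y] monoD[OF monoH, of y "F b"] by (simp add: HF)
        then show "y \<in> F ` {a..b}" using imageI[of "H y" "{a..b}" F] by (simp add: FH)
      qed
      show "F ` {a..b} \<subseteq> {F a..F b}" using mono by (auto simp: le_less)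
    qed
    finally show ?thesis using mono[of a b] that by (cases "a = b") auto
  qed
  have "(enn2real \<circ> h has_integral (F b - F a)) {a..b}" if ab: "a \<le> b" for a b
  proof -
    have "AE x in lborel. h x * indicator {a..b} x \<noteq> \<infinity>"
      by (rule nn_integral_PInf_AE) (use hint[OF ab] in auto)
    then have ae: "AE x in lborel. h x * indicator {a..b} x = ennreal (indicator {a..b} x * enn2real (h x))"
      by eventually_elim (auto simp: indicator_def less_top[symmetric])
    have "has_bochner_integral lborel (\<lambda>x. indicator {a..b} x * enn2real (h x)) (F b - F a)"
    proof (rule has_bochner_integral_nn_integral)
      show "(\<integral>\<^sup>+x. ennreal (indicator {a..b} x * enn2real (h x)) \<partial>lborel) = ennreal (F b - F a)"
        using hint[OF ab] nn_integral_cong_AE[OF ae] by simp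
      show "0 \<le> F b - F a" using mono[of a b] ab by (cases "a = b") auto
    qed (auto simp: indicator_def)
    then have "((\<lambda>x. indicator {a..b} x * enn2real (h x)) has_integral (F b - F a)) UNIV"
      using has_integral_integral_lborel[of "\<lambda>x. indicator {a..b} x * enn2real (h x)"] by (simp add: has_bochner_integral_iff)
    moreover have "(\<lambda>x. indicator {a..b} x * enn2real (h x)) = (\<lambda>x. if x \<in> {a..b} then (enn2real \<circ> h) x else 0)"
      by (auto simp: indicator_def)
    ultimately show ?thesis by (simp only: has_integral_restrict_UNIV)
  qed
  then show ?thesis using that by blast
qed

text \<open>Rademacher\<close>
lemma lipschitz_ae_differentiable:
  fixes G :: "real \<Rightarrow> real"
  assumes G: "L-lipschitz_on {a..b} G" and ab: "a \<le> b"
  obtains N G' where "negligible N" "\<And>x. x \<in> {a<..<b} - N \<Longrightarrow> (G has_real_derivative G' x) (at x)"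
    "(G' has_integral (G b - G a)) {a..b}"
proof -
  have L0: "0 \<le> L" using G by (rule lipschitz_on_nonneg)
  define cl where "cl = (\<lambda>x. max a (min b x))"
  have cl: "cl x \<in> {a..b}" "\<bar>cl x - cl y\<bar> \<le> \<bar>x - y\<bar>" for x y using ab by (auto simp: cl_def)
  define F where "F = (\<lambda>x. G (cl x) + (L + 1) * x)"
  have bnd: "\<bar>G (cl x) - G (cl y)\<bar> \<le> L * \<bar>x - y\<bar>" for x y
    using lipschitz_onD[OF G cl(1) cl(1), of x y] mult_left_mono[OF cl(2)[of x y] L0] by (simp add: dist_real_def)
  have b2: "\<bar>G (cl y) - G (cl x)\<bar> \<le> L * (y - x)" if "x \<le> y" for x y using bnd[of y x] that by simp
  obtain f where f: "\<And>a b. a \<le> b \<Longrightarrow> (f has_integral (F b - F a)) {a..b}"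
  proof (rule bi_Lipschitz_density[of 1 F "2 * L + 1"])
    show "1 * (y - x) \<le> F y - F x" if "x \<le> y" for x y
      using b2[OF that] by (simp add: F_def algebra_simps abs_le_iff)
    show "F y - F x \<le> (2 * L + 1) * (y - x)" if "x \<le> y" for x y
      using b2[OF that] by (simp add: F_def algebra_simps abs_le_iff)
  qed auto
  have fi: "f integrable_on {c..d}" for c d
    using f[of c d] by (cases "c \<le> d") (auto simp: integrable_on_def intro: has_integral_empty)
  obtain N where N: "negligible N" "\<And>x. a < x \<Longrightarrow> x \<notin> N \<Longrightarrow> ((\<lambda>x. integral {a..x} f) has_real_derivative f x) (at x)"
    using indefinite_integral_differentiable_ae[OF fi, of a] by blast
  show ?thesis
  proof
    show "negligible N" by fact
    show "(G has_real_derivative f x - (L + 1)) (at x)" if x: "x \<in> {a<..<b} - N" for x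
    proof -
      have "((\<lambda>x. integral {a..x} f + F a - (L + 1) * x) has_real_derivative f x - (L + 1)) (at x)"
        using N(2)[of x] x by (auto intro!: derivative_eq_intros)
      then show ?thesis
      proof (rule has_field_derivative_transform_within_open)
        show "integral {a..y} f + F a - (L + 1) * y = G y" if "y \<in> {a<..<b}" for y
          using integral_unique[OF f[of a y]] that by (simp add: F_def cl_def)
      qed (use x in auto)
    qed
    have "((\<lambda>x. f x - (L + 1)) has_integral (F b - F a) - (L + 1) * (b - a)) {a..b}"
      using has_integral_diff[OF f[OF ab] has_integral_const_real[of "L + 1" a b]] ab by (simp add: mult.commute)
    then show "((\<lambda>x. f x - (L + 1)) has_integral G b - G a) {a..b}"
      using ab by (simp add: F_def cl_def algebra_simps)
  qed
qed

lemma lipschitz_by_parts: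
  fixes G \<psi> :: "real \<Rightarrow> real"
  assumes G: "L-lipschitz_on {a..b} G" and ab: "a < b"
    and \<psi>: "\<And>x. x \<in> {a..b} \<Longrightarrow> (\<psi> has_real_derivative \<psi>' x) (at x)" "continuous_on {a..b} \<psi>'"
    and z: "\<psi> a = 0" "\<psi> b = 0"
  obtains N G' where "negligible N" "\<And>x. x \<in> {a<..<b} - N \<Longrightarrow> (G has_real_derivative G' x) (at x)"
    "((\<lambda>x. G' x * \<psi> x + G x * \<psi>' x) has_integral 0) {a..b}"
proof -
  have L0: "0 \<le> L" using G by (rule lipschitz_on_nonneg)
  obtain B where "\<forall>y\<in>\<psi>' ` {a..b}. norm y \<le> B"
    using compact_imp_bounded[OF compact_continuous_image[OF \<psi>(2) compact_Icc]] unfolding bounded_iff by blast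
  then have B: "\<And>x. x \<in> {a..b} \<Longrightarrow> \<bar>\<psi>' x\<bar> \<le> B" by auto
  have lip\<psi>: "\<bar>\<psi> x - \<psi> y\<bar> \<le> B * \<bar>x - y\<bar>" if "x \<in> {a..b}" "y \<in> {a..b}" for x y
    using field_differentiable_bound[of "{a..b}" \<psi> \<psi>' B x y] \<psi>(1) B that by (auto intro: has_field_derivative_at_within)
  obtain C where "\<forall>y\<in>G ` {a..b}. norm y \<le> C"
    using compact_imp_bounded[OF compact_continuous_image[OF lipschitz_on_continuous_on[OF G] compact_Icc]] unfolding bounded_iff by blast
  then have C: "\<And>x. x \<in> {a..b} \<Longrightarrow> \<bar>G x\<bar> \<le> C" by auto
  have B0: "0 \<le> B" using B[of a] ab by auto
  have C0: "0 \<le> C" using C[of a] ab by auto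
  have \<psi>b: "\<bar>\<psi> x\<bar> \<le> B * (b - a)" if "x \<in> {a..b}" for x
    using lip\<psi>[of x a] that z ab mult_left_mono[of "x - a" "b - a" B] B0 by auto
  have lip: "(C * B + B * (b - a) * L)-lipschitz_on {a..b} (\<lambda>x. G x * \<psi> x)"
  proof (rule lipschitz_onI)
    fix x y assume xy: "x \<in> {a..b}" "y \<in> {a..b}"
    have "\<bar>G x * \<psi> x - G y * \<psi> y\<bar> = \<bar>G x * (\<psi> x - \<psi> y) + \<psi> y * (G x - G y)\<bar>" by (simp add: algebra_simps)
    also have "\<dots> \<le> \<bar>G x\<bar> * \<bar>\<psi> x - \<psi> y\<bar> + \<bar>\<psi> y\<bar> * \<bar>G x - G y\<bar>"
      by (simp add: abs_mult[symmetric])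
    also have "\<dots> \<le> C * (B * \<bar>x - y\<bar>) + (B * (b - a)) * (L * \<bar>x - y\<bar>)"
      using C[OF xy(1)] lip\<psi>[OF xy] \<psi>b[OF xy(2)] lipschitz_onD[OF G xy] B0 C0 L0 ab
      by (intro add_mono mult_mono) (auto simp: dist_real_def)
    finally show "dist (G x * \<psi> x) (G y * \<psi> y) \<le> (C * B + B * (b - a) * L) * dist x y"
      by (simp add: dist_real_def algebra_simps)
  qed (use B0 C0 L0 ab in auto)
  obtain N1 G1 where 1: "negligible N1" "\<And>x. x \<in> {a<..<b} - N1 \<Longrightarrow> ((\<lambda>x. G x * \<psi> x) has_real_derivative G1 x) (at x)"
    "(G1 has_integral (G b * \<psi> b - G a * \<psi> a)) {a..b}"
    by (rule lipschitz_ae_differentiable[OF lip less_imp_le[OF ab]]) blast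
  obtain N2 G2 where 2: "negligible N2" "\<And>x. x \<in> {a<..<b} - N2 \<Longrightarrow> (G has_real_derivative G2 x) (at x)"
    "(G2 has_integral (G b - G a)) {a..b}"
    by (rule lipschitz_ae_differentiable[OF G less_imp_le[OF ab]]) blast
  have "((\<lambda>x. G2 x * \<psi> x + G x * \<psi>' x) has_integral (G b * \<psi> b - G a * \<psi> a)) {a..b}"
  proof (rule has_integral_spike[OF _ _ 1(3)])
    show "negligible (N1 \<union> N2 \<union> {a, b})" using 1 2 by (intro negligible_Un) auto
    fix x assume x: "x \<in> {a..b} - (N1 \<union> N2 \<union> {a, b})"
    have "((\<lambda>x. G x * \<psi> x) has_real_derivative G2 x * \<psi> x + G x * \<psi>' x) (at x)"
      using DERIV_mult[OF 2(2)[of x] \<psi>(1)[of x]] x by (auto simp: algebra_simps)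
    moreover have "((\<lambda>x. G x * \<psi> x) has_real_derivative G1 x) (at x)" using 1(2)[of x] x by auto
    ultimately show "G2 x * \<psi> x + G x * \<psi>' x = G1 x" by (rule DERIV_unique)
  qed
  then show ?thesis using that[OF 2(1,2)] z by simp
qed

lemma DERIV_max_power:
  assumes "2 \<le> (j::nat)"
  shows "((\<lambda>t::real. (max 0 t) ^ j) has_real_derivative real j * (max 0 t) ^ (j - 1)) (at t)"
proof -
  consider "t < 0" | "t > 0" | "t = 0" by linarith
  then show ?thesis
  proof cases
    case 1
    have "((\<lambda>t. 0) has_real_derivative real j * (max 0 t) ^ (j - 1)) (at t)"
      using 1 assms by (simp add: max_def zero_power)
    then show ?thesis
      by (rule has_field_derivative_transform_within_open[of _ _ _ "{..<0}"]) (use 1 assms in \<open>auto simp: max_def\<close>)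
  next
    case 2
    have "((\<lambda>t. t ^ j) has_real_derivative real j * (max 0 t) ^ (j - 1)) (at t)"
      using 2 by (auto intro!: derivative_eq_intros simp: max_def)
    then show ?thesis
      by (rule has_field_derivative_transform_within_open[of _ _ _ "{0<..}"]) (use 2 in \<open>auto simp: max_def\<close>)
  next
    case 3
    have "((\<lambda>h::real. (max 0 h) ^ j / h) \<longlongrightarrow> 0) (at 0)"
    proof (rule Lim_null_comparison)
      have "norm ((max 0 h) ^ j / h) \<le> \<bar>h\<bar>" if "\<bar>h\<bar> < 1" for h :: real
      proof (cases "h > 0")
        case True
        have "h ^ j \<le> h ^ 2" using True that assms by (intro power_decreasing) auto
        then show ?thesis using True by (simp add: field_simps power2_eq_square)
      qed (use assms in \<open>simp add: max_def zero_power\<close>)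
      then show "\<forall>\<^sub>F h::real in at 0. norm ((max 0 h) ^ j / h) \<le> \<bar>h\<bar>"
        by (auto simp: eventually_at intro!: exI[of _ 1])
      show "((\<lambda>h::real. \<bar>h\<bar>) \<longlongrightarrow> 0) (at 0)" by (intro tendsto_rabs_zero tendsto_ident_at)
    qed
    then show ?thesis using 3 assms by (simp add: DERIV_def zero_power)
  qed
qed

definition smooth_step :: "real \<Rightarrow> real" where
  "smooth_step t = 3 * (max 0 t)^2 - 2 * (max 0 t)^3 + 3 * (max 0 (t - 1))^2 + 2 * (max 0 (t - 1))^3"

definition smooth_step' :: "real \<Rightarrow> real" where
  "smooth_step' t = 6 * max 0 t - 6 * (max 0 t)^2 + 6 * max 0 (t - 1) + 6 * (max 0 (t - 1))^2"

lemma smooth_step_DERIV: "(smooth_step has_real_derivative smooth_step' t) (at t)"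
proof -
  have m: "((\<lambda>t. (max 0 (t - 1)) ^ j) has_real_derivative real j * (max 0 (t - 1)) ^ (j - 1)) (at t)" if "2 \<le> j" for j
    using DERIV_chain2[OF DERIV_max_power[OF that] DERIV_diff[OF DERIV_ident DERIV_const[of 1]], of t UNIV] by simp
  show ?thesis unfolding smooth_step_def [abs_def]
    by (rule derivative_eq_intros DERIV_max_power m | simp)+ (simp add: smooth_step'_def power2_eq_square)
qed

lemma smooth_step'_continuous: "continuous_on A smooth_step'"
  unfolding smooth_step'_def by (intro continuous_intros)

lemma smooth_step_0: "t \<le> 0 \<Longrightarrow> smooth_step t = 0"
  by (simp add: smooth_step_def max_def)

lemma smooth_step_1: "1 \<le> t \<Longrightarrow> smooth_step t = 1"
  by (auto simp: smooth_step_def max_def power2_eq_square power3_eq_cube algebra_simps)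

lemma smooth_step'_0: "t \<le> 0 \<or> 1 \<le> t \<Longrightarrow> smooth_step' t = 0"
  by (auto simp: smooth_step'_def max_def power2_eq_square algebra_simps)

lemma smooth_step_mid: "0 \<le> t \<Longrightarrow> t \<le> 1 \<Longrightarrow> smooth_step t = t^2 * (3 - 2 * t) \<and> smooth_step' t = 6 * t * (1 - t)"
  by (auto simp: smooth_step_def smooth_step'_def max_def power2_eq_square power3_eq_cube algebra_simps)

lemma smooth_step_range: "0 \<le> smooth_step t" "smooth_step t \<le> 1"
proof -
  have "0 \<le> smooth_step t \<and> smooth_step t \<le> 1"
  proof -
    consider "t \<le> 0" | "1 \<le> t" | "0 \<le> t" "t \<le> 1" by linarith
    then show ?thesis
    proof cases
      case 3
      have "1 - t^2 * (3 - 2 * t) = (1 - t)^2 * (1 + 2 * t)" by (simp add: power2_eq_square algebra_simps)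
      also have "\<dots> \<ge> 0" using 3 by simp
      finally show ?thesis using smooth_step_mid[OF 3] 3 by auto
    qed (simp_all add: smooth_step_0 smooth_step_1)
  qed
  then show "0 \<le> smooth_step t" "smooth_step t \<le> 1" by auto
qed

lemma smooth_step'_range: "0 \<le> smooth_step' t" "smooth_step' t \<le> 2"
proof -
  have "0 \<le> smooth_step' t \<and> smooth_step' t \<le> 2"
  proof -
    consider "t \<le> 0 \<or> 1 \<le> t" | "0 \<le> t" "t \<le> 1" by linarith
    then show ?thesis
    proof cases
      case 2
      have "2 - 6 * t * (1 - t) = 6 * (t - 1/2)^2 + 1/2" by (simp add: power2_eq_square algebra_simps)
      also have "\<dots> \<ge> 0" by simp
      finally show ?thesis using smooth_step_mid[OF 2] 2 by auto
    qed (simp_all add: smooth_step'_0)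
  qed
  then show "0 \<le> smooth_step' t" "smooth_step' t \<le> 2" by auto
qed

text \<open>dyadic\<close>
lemma dyadic_summation:
  fixes v h F :: "real \<Rightarrow> real"
  assumes mono: "\<And>r s. 0 < r \<Longrightarrow> r \<le> s \<Longrightarrow> s \<le> 1/2 \<Longrightarrow> v r \<le> v s" and A: "0 \<le> A"
    and step: "\<And>r. 0 < r \<Longrightarrow> r \<le> 1/2 \<Longrightarrow> v r - v (r/2) \<le> A * h r"
    and F: "\<And>r. 0 < r \<Longrightarrow> r \<le> 1/4 \<Longrightarrow> F (2 * r) + h (2 * r) \<le> F r"
    and F0: "\<And>r. 1/4 \<le> r \<Longrightarrow> r \<le> 1/2 \<Longrightarrow> h (1/2) \<le> F r"
    and r: "0 < r" "r \<le> 1/2"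
  shows "v (1/2) - v r \<le> A * F r"
proof -
  have "\<forall>r. (1/2) ^ (m + 2) \<le> r \<and> r \<le> 1/2 \<longrightarrow> v (1/2) - v r \<le> A * F r" for m
  proof (induction m)
    case 0
    show ?case
    proof (intro allI impI)
      fix r :: real assume r: "(1/2) ^ (0 + 2) \<le> r \<and> r \<le> 1/2"
      then have r': "1/4 \<le> r" "r \<le> 1/2" by (auto simp: power2_eq_square)
      have "v (1/2) - v r \<le> v (1/2) - v (1/4)" using mono[of "1/4" r] r' by simp
      also have "\<dots> \<le> A * h (1/2)" using step[of "1/2"] by simp
      also have "\<dots> \<le> A * F r" using F0[OF r'] A by (rule mult_left_mono)
      finally show "v (1/2) - v r \<le> A * F r" .
    qed
  next
    case (Suc m)
    show ?case
    proof (intro allI impI)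
      fix r :: real assume r: "(1/2) ^ (Suc m + 2) \<le> r \<and> r \<le> 1/2"
      show "v (1/2) - v r \<le> A * F r"
      proof (cases "r \<le> 1/4")
        case True
        have r0: "0 < r" using r zero_less_power[of "1/2::real" "Suc m + 2"] by linarith
        have "v (1/2) - v (2 * r) \<le> A * F (2 * r)" using Suc.IH r True by (auto simp: power_Suc)
        moreover have "v (2 * r) - v r \<le> A * h (2 * r)" using step[of "2 * r"] r0 True by simp
        ultimately have "v (1/2) - v r \<le> A * (F (2 * r) + h (2 * r))" by (simp add: algebra_simps)
        also have "\<dots> \<le> A * F r" using F[OF r0 True] A by (rule mult_left_mono)
        finally show ?thesis .
      next
        case False
        have "v (1/2) - v r \<le> v (1/2) - v (1/4)" using mono[of "1/4" r] r False by simp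
        also have "\<dots> \<le> A * h (1/2)" using step[of "1/2"] by simp
        also have "\<dots> \<le> A * F r" using F0[of r] r False A by (intro mult_left_mono) auto
        finally show ?thesis .
      qed
    qed
  qed
  moreover obtain m where "(1/2::real) ^ m < r" using real_arch_pow_inv[of r "1/2"] r by auto
  moreover have "(1/2::real) ^ (m + 2) \<le> (1/2) ^ m" by (rule power_decreasing) auto
  ultimately show ?thesis using r by (meson less_eq_real_def order_trans)
qed

lemma dyadic_powr_pos:
  fixes e :: real assumes "0 < e"
  obtains K where "0 \<le> K"
    "\<And>v A r. (\<And>r s. 0 < r \<Longrightarrow> r \<le> s \<Longrightarrow> s \<le> 1/2 \<Longrightarrow> v r \<le> v s) \<Longrightarrow> 0 \<le> A \<Longrightarrow>
      (\<And>r. 0 < r \<Longrightarrow> r \<le> 1/2 \<Longrightarrow> v r - v (r/2) \<le> A * r powr e) \<Longrightarrow> 0 < r \<Longrightarrow> r \<le> 1/2 \<Longrightarrow>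
      v (1/2) - v r \<le> A * (K::real)"
proof -
  define q where "q = 1 / (2 powr e - 1)"
  have t: "2 powr e > 1" using assms by simp
  have q: "q > 0" "q * (2 powr e - 1) = 1" using t by (auto simp: q_def)
  define qq where "qq = q * 2 powr e"
  have qq: "qq \<ge> 0" "qq * 2 powr e = qq + 2 powr e" using q t by (auto simp: qq_def algebra_simps)
  define K where "K = (qq + 1) * (1/2) powr e"
  show ?thesis
  proof (rule that[of K])
    show "0 \<le> K" using qq by (simp add: K_def)
    fix v :: "real \<Rightarrow> real" and A r :: real
    assume mono: "\<And>r s. 0 < r \<Longrightarrow> r \<le> s \<Longrightarrow> s \<le> 1/2 \<Longrightarrow> v r \<le> v s" and A: "0 \<le> A"
      and step: "\<And>r. 0 < r \<Longrightarrow> r \<le> 1/2 \<Longrightarrow> v r - v (r/2) \<le> A * r powr e"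
      and r: "0 < r" "r \<le> 1/2"
    have "v (1/2) - v r \<le> A * (K - qq * r powr e)"
    proof (rule dyadic_summation[where h = "\<lambda>r. r powr e" and F = "\<lambda>r. K - qq * r powr e", OF mono A step _ _ r])
      show "K - qq * (2 * x) powr e + (2 * x) powr e \<le> K - qq * x powr e" if "0 < x" "x \<le> 1/4" for x
      proof -
        have "qq * (2 * x) powr e = (qq * 2 powr e) * x powr e" using that by (simp add: powr_mult)
        also have "\<dots> = qq * x powr e + (2 * x) powr e" using that by (simp add: qq(2) powr_mult algebra_simps)
        finally show ?thesis by simp
      qed
      show "(1/2) powr e \<le> K - qq * x powr e" if "1/4 \<le> x" "x \<le> 1/2" for x :: real
      proof -
        have "x powr e \<le> (1/2) powr e" using that assms by (intro powr_mono2) auto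
        then have "qq * x powr e \<le> qq * (1/2) powr e" using qq(1) by (intro mult_left_mono)
        then show ?thesis by (simp add: K_def algebra_simps)
      qed
    qed auto
    also have "\<dots> \<le> A * K" using A qq(1) by (intro mult_left_mono) auto
    finally show "v (1/2) - v r \<le> A * K" .
  qed
qed

lemma dyadic_zero:
  fixes v :: "real \<Rightarrow> real" and A r :: real
  assumes mono: "\<And>r s. 0 < r \<Longrightarrow> r \<le> s \<Longrightarrow> s \<le> 1/2 \<Longrightarrow> v r \<le> v s" and A: "0 \<le> A"
    and step: "\<And>r. 0 < r \<Longrightarrow> r \<le> 1/2 \<Longrightarrow> v r - v (r/2) \<le> A"
    and r: "0 < r" "r \<le> 1/2"
  shows "v (1/2) - v r \<le> A * (- ln r / ln 2)"
proof (rule dyadic_summation[where h = "\<lambda>r. 1" and F = "\<lambda>r. - ln r / ln 2", OF mono A _ _ _ r])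
  show "- ln (2 * x) / ln 2 + 1 \<le> - ln x / ln 2" if "0 < x" "x \<le> 1/4" for x :: real
    using that by (simp add: ln_mult field_simps)
  show "1 \<le> - ln x / ln 2" if "1/4 \<le> x" "x \<le> 1/2" for x :: real
  proof -
    have "ln x \<le> ln (1/2)" using that by (subst ln_le_cancel_iff) auto
    then show ?thesis by (simp add: ln_div field_simps)
  qed
qed (use step in auto)

lemma dyadic_powr_neg:
  fixes e :: real assumes "e < 0"
  obtains K where "0 \<le> K"
    "\<And>v A r. (\<And>r s. 0 < r \<Longrightarrow> r \<le> s \<Longrightarrow> s \<le> 1/2 \<Longrightarrow> v r \<le> v s) \<Longrightarrow> 0 \<le> A \<Longrightarrow>
      (\<And>r. 0 < r \<Longrightarrow> r \<le> 1/2 \<Longrightarrow> v r - v (r/2) \<le> A * r powr e) \<Longrightarrow> 0 < r \<Longrightarrow> r \<le> 1/2 \<Longrightarrow>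
      v (1/2) - v r \<le> A * ((K::real) * r powr e)"
proof -
  define T where "T = 2 powr (-e)"
  have T: "T > 1" "2 powr e = 1 / T" using powr_less_mono[of 0 "-e" 2] assms by (simp_all add: T_def powr_minus_divide)
  define K where "K = 1 / (T - 1) + 1"
  have K1: "K \<ge> 1" using T by (simp add: K_def)
  have "K * (T - 1) = T" using T by (simp add: K_def field_simps)
  then have K2: "K * T \<ge> K + 1" using T by (simp add: algebra_simps)
  show ?thesis
  proof (rule that[of K])
    show "0 \<le> K" using K1 by simp
    fix v :: "real \<Rightarrow> real" and A r :: real
    assume mono: "\<And>r s. 0 < r \<Longrightarrow> r \<le> s \<Longrightarrow> s \<le> 1/2 \<Longrightarrow> v r \<le> v s" and A: "0 \<le> A"
      and step: "\<And>r. 0 < r \<Longrightarrow> r \<le> 1/2 \<Longrightarrow> v r - v (r/2) \<le> A * r powr e"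
      and r: "0 < r" "r \<le> 1/2"
    show "v (1/2) - v r \<le> A * (K * r powr e)"
    proof (rule dyadic_summation[where h = "\<lambda>r. r powr e" and F = "\<lambda>r. K * r powr e", OF mono A step _ _ r])
      show "K * (2 * x) powr e + (2 * x) powr e \<le> K * x powr e" if "0 < x" "x \<le> 1/4" for x
      proof -
        have "(2 * x) powr e = x powr e / T" using that by (simp add: powr_mult T)
        then have "K * (2 * x) powr e + (2 * x) powr e = (K + 1) * (x powr e / T)" by (simp only: distrib_right mult_1_left)
        also have "\<dots> \<le> (K * T) * (x powr e / T)" using K2 T by (intro mult_right_mono) auto
        finally show ?thesis using T by simp
      qed
      show "(1/2) powr e \<le> K * x powr e" if "1/4 \<le> x" "x \<le> 1/2" for x :: real
      proof -
        have "(1/2) powr e \<le> x powr e" using that assms by (intro powr_mono2') auto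
        also have "\<dots> \<le> K * x powr e" using K1 mult_right_mono[of 1 K "x powr e"] by simp
        finally show ?thesis .
      qed
    qed auto
  qed
qed

lemma le_add_power:
  fixes x :: real assumes "0 \<le> x" "0 < l"
  shows "x \<le> l + x ^ (k + 1) / l ^ k"
proof (cases "x \<le> l")
  case True
  have "0 \<le> x ^ (k + 1) / l ^ k" using assms by simp
  then show ?thesis using True by linarith
next
  case False
  have "1 \<le> (x / l) ^ k" using False assms by (intro one_le_power) simp
  then have "x * 1 \<le> x * (x / l) ^ k" using assms by (intro mult_left_mono)
  also have "\<dots> = x ^ (k + 1) / l ^ k" by (simp add: power_divide)
  finally show ?thesis using assms by linarith
qed

lemma increment_bound:
  fixes v w :: "real \<Rightarrow> real"
  assumes l: "0 < l" and ab: "a \<le> b" and cv: "continuous_on {a..b} v"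
    and dv: "\<And>r. a < r \<Longrightarrow> r < b \<Longrightarrow> (v has_real_derivative w r) (at r)"
    and cw: "continuous_on {a..b} w" and w0: "\<And>r. r \<in> {a..b} \<Longrightarrow> 0 \<le> w r"
  shows "v b - v a \<le> l * (b - a) + integral {a..b} (\<lambda>r. w r ^ (k + 1)) / l ^ k"
proof -
  have 1: "(w has_integral (v b - v a)) {a..b}"
    by (rule fundamental_theorem_of_calculus_interior[OF ab cv])
       (use dv in \<open>auto simp: has_real_derivative_iff_has_vector_derivative[symmetric]\<close>)
  have "(\<lambda>r. w r ^ (k + 1)) integrable_on {a..b}"
    by (intro integrable_continuous_real continuous_intros cw)
  then have "((\<lambda>r. l + w r ^ (k + 1) / l ^ k) has_integral (l * (b - a) + integral {a..b} (\<lambda>r. w r ^ (k + 1)) / l ^ k)) {a..b}"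
    using has_integral_const_real[of l a b] ab
    by (intro has_integral_add has_integral_divide integrable_integral) (auto simp: mult.commute)
  then show ?thesis
    by (rule has_integral_le[OF 1]) (use le_add_power[OF w0 l] in auto)
qed

locale radial_profile =
  fixes n k :: nat and v w G :: "real \<Rightarrow> real"
  assumes k1: "1 \<le> k" and kn: "k \<le> n"
    and cv: "continuous_on {0<..1} v"
    and dv: "\<And>r. 0 < r \<Longrightarrow> r < 1 \<Longrightarrow> (v has_real_derivative w r) (at r)"
    and cw: "continuous_on {0<..<1} w"
    and w0: "\<And>r. 0 < r \<Longrightarrow> r < 1 \<Longrightarrow> 0 \<le> w r"
    and dP: "\<And>r. 0 < r \<Longrightarrow> r < 1 \<Longrightarrow> ((\<lambda>r. r ^ (n - k) * w r ^ k) has_real_derivative r ^ (n - 1) * G r) (at r)"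
    and cG: "continuous_on {0<..<1} G" and G0: "\<And>r. 0 < r \<Longrightarrow> r < 1 \<Longrightarrow> 0 \<le> G r"
begin

definition P :: "real \<Rightarrow> real" where "P r = r ^ (n - k) * w r ^ k"

definition W :: "real \<Rightarrow> real" where "W r = r ^ (n - k) * w r ^ (k + 1)"

lemma W_eq: "W r = P r * w r" by (simp add: W_def P_def)

lemma v_mono: "0 < r \<Longrightarrow> r \<le> s \<Longrightarrow> s \<le> 1 \<Longrightarrow> v r \<le> v s"
  by (rule DERIV_nonneg_imp_increasing_open) (auto intro!: continuous_on_subset[OF cv] exI dv w0)

lemma P_mono: "0 < r \<Longrightarrow> r \<le> s \<Longrightarrow> s < 1 \<Longrightarrow> P r \<le> P s"
  unfolding P_def
  by (rule DERIV_nonneg_imp_nondecreasing[where f = "\<lambda>r. r ^ (n - k) * w r ^ k"]) (auto intro!: exI dP mult_nonneg_nonneg G0)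

lemma P_pos_iff: "0 < r \<Longrightarrow> r < 1 \<Longrightarrow> 0 < P r \<longleftrightarrow> 0 < w r"
  using w0[of r] k1 by (cases "w r = 0") (auto simp: P_def zero_power intro!: mult_pos_pos)

lemma w_cont: "0 < a \<Longrightarrow> b < 1 \<Longrightarrow> continuous_on {a..b} w"
  by (rule continuous_on_subset[OF cw]) auto

lemma W_cont: "0 < a \<Longrightarrow> b < 1 \<Longrightarrow> continuous_on {a..b} W"
  unfolding W_def [abs_def] by (intro continuous_intros w_cont)

lemma W_nonneg: "0 < r \<Longrightarrow> r < 1 \<Longrightarrow> 0 \<le> W r"
  unfolding W_def using w0[of r] by simp

lemma increment_W:
  assumes l: "0 < l" and ab: "0 < a" "a \<le> b" "b < 1"
  shows "v b - v a \<le> l * (b - a) + (1 / a) ^ (n - k) * integral {a..b} W / l ^ k"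
proof -
  have "v b - v a \<le> l * (b - a) + integral {a..b} (\<lambda>r. w r ^ (k + 1)) / l ^ k"
    using ab by (intro increment_bound l continuous_on_subset[OF cv] w_cont) (auto intro!: dv w0)
  moreover have "integral {a..b} (\<lambda>r. w r ^ (k + 1)) \<le> integral {a..b} (\<lambda>r. (1 / a) ^ (n - k) * W r)"
  proof (rule integral_le)
    show "w r ^ (k + 1) \<le> (1 / a) ^ (n - k) * W r" if "r \<in> {a..b}" for r
    proof -
      have "1 \<le> (r / a) ^ (n - k)" using that ab by (intro one_le_power) simp
      then have "1 * w r ^ (k + 1) \<le> (r / a) ^ (n - k) * w r ^ (k + 1)"
        using w0[of r] that ab by (intro mult_right_mono) auto
      then show ?thesis by (simp add: W_def power_divide)
    qed
    show "(\<lambda>r. w r ^ (k + 1)) integrable_on {a..b}" "(\<lambda>r. (1 / a) ^ (n - k) * W r) integrable_on {a..b}"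
      using ab by (intro integrable_continuous_real continuous_intros w_cont W_cont; simp)+
  qed
  moreover have "integral {a..b} (\<lambda>r. (1 / a) ^ (n - k) * W r) = (1 / a) ^ (n - k) * integral {a..b} W"
    by simp
  moreover have "0 < l ^ k" using l by simp
  ultimately show ?thesis
    using divide_right_mono[of "integral {a..b} (\<lambda>r. w r ^ (k + 1))" "(1 / a) ^ (n - k) * integral {a..b} W" "l ^ k"] by linarith
qed

lemma low_dimension_step:
  assumes N: "0 \<le> N" and K: "integral {1/2..3/4} W \<le> N ^ (k + 1)" and r: "0 < r" "r \<le> 1/2"
  shows "v r - v (r / 2) \<le> (4 * N) * (1 / 2 powr (1 - real (n - k) / real k)) * r powr (1 - real (n - k) / real k)"
proof -
  define q where "q = real (n - k) / real k"
  define p where "p = root k (P (1/2))"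
  have P0: "0 \<le> P (1/2)" using w0[of "1/2"] by (simp add: P_def)
  have p0: "0 \<le> p" using P0 by (simp add: p_def real_root_ge_zero)
  have pk: "p ^ k = P (1/2)" unfolding p_def using k1 P0 by (intro real_root_pow_pos2) auto
  have "p ^ (k + 1) \<le> W x" if x: "x \<in> {1/2..3/4}" for x
  proof -
    have "p ^ k \<le> P x" unfolding pk using x by (intro P_mono) auto
    also have "P x \<le> w x ^ k"
    proof -
      have "x ^ (n - k) \<le> 1" using x by (intro power_le_one) auto
      then show ?thesis unfolding P_def using w0[of x] x by (intro mult_left_le_one_le) auto
    qed
    finally have "p \<le> w x" using k1 w0[of x] x by (simp add: power_mono_iff p0)
    with \<open>p ^ k \<le> P x\<close> have "p ^ k * p \<le> P x * w x" using p0 by (intro mult_mono) (auto simp: order_trans[OF zero_le_power])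
    then show ?thesis by (simp add: W_eq mult.commute)
  qed
  then have "integral {1/2..3/4} (\<lambda>x::real. p ^ (k + 1)) \<le> integral {1/2..3/4} W"
    by (intro integral_le integrable_continuous_real W_cont) auto
  then have "p ^ (k + 1) \<le> 4 * N ^ (k + 1)" using K by simp
  also have "\<dots> \<le> 4 ^ (k + 1) * N ^ (k + 1)" using N by (intro mult_right_mono) (auto simp: self_le_power)
  finally have "p ^ (k + 1) \<le> (4 * N) ^ (k + 1)" by (simp only: power_mult_distrib)
  then have "p ^ Suc k \<le> (4 * N) ^ Suc k" by (simp only: Suc_eq_plus1)
  then have p4: "p \<le> 4 * N" by (rule power_le_imp_le_base) (use N in simp)
  have wb: "w x \<le> p * x powr (- q)" if x: "0 < x" "x \<le> 1/2" for x
  proof -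
    have "x ^ (n - k) * w x ^ k \<le> p ^ k" unfolding pk using P_mono[of x "1/2"] x by (simp add: P_def)
    then have "w x ^ k \<le> p ^ k / x ^ (n - k)" using x by (simp add: field_simps)
    also have "\<dots> = (p * x powr (- q)) ^ k"
    proof -
      have "(x powr (- q)) ^ k = x powr (- real (n - k))"
        using k1 x by (simp add: powr_powr q_def flip: powr_realpow)
      then have "(p * x powr (- q)) ^ k = p ^ k * x powr (- real (n - k))" by (simp only: power_mult_distrib)
      also have "x powr (- real (n - k)) = inverse (x ^ (n - k))" by (simp only: powr_minus powr_realpow[OF x(1)])
      finally show ?thesis by (simp only: divide_inverse)
    qed
    finally show ?thesis using k1 w0[of x] x p0 by (simp add: power_mono_iff)
  qed
  obtain z where z: "r / 2 < z" "z < r" "v r - v (r / 2) = (r - r / 2) * w z"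
    using MVT2[of "r / 2" r v w] dv r by auto
  have "w z \<le> p * z powr (- q)" using wb z r by auto
  also have "\<dots> \<le> p * (r / 2) powr (- q)"
    using z r p0 by (intro mult_left_mono powr_mono2') (auto simp: q_def)
  finally have "v r - v (r / 2) \<le> (r / 2) * (p * (r / 2) powr (- q))"
    using z(3) r by (simp add: mult_left_mono)
  also have "\<dots> = p * (r / 2) powr (1 - q)" using r by (simp add: powr_diff powr_minus field_simps)
  also have "\<dots> \<le> (4 * N) * (r / 2) powr (1 - q)" using p4 by (intro mult_right_mono) auto
  also have "(r / 2) powr (1 - q) = 1 / 2 powr (1 - q) * r powr (1 - q)" using r by (simp add: powr_divide)
  finally show ?thesis by (simp add: q_def mult.assoc)
qed

lemma outer_bound:
  assumes N: "0 < N"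
    and K: "\<And>a b. 1/2 < a \<Longrightarrow> a \<le> b \<Longrightarrow> b < 1 \<Longrightarrow> integral {a..b} W \<le> N ^ (k + 1)"
    and V: "integral {5/8..3/4} (\<lambda>r. \<bar>v r\<bar> ^ (k + 1)) \<le> N ^ (k + 1)"
    and r: "1/2 \<le> r" "r \<le> 1"
  shows "\<bar>v r\<bar> \<le> (9 + 2 ^ (n - k)) * N"
proof -
  have diff: "v b - v a \<le> (1 + 2 ^ (n - k)) * N" if ab: "1/2 < a" "a \<le> b" "b < 1" for a b
  proof -
    have "v b - v a \<le> N * (b - a) + (1 / a) ^ (n - k) * integral {a..b} W / N ^ k"
      using ab by (intro increment_W N) auto
    also have "\<dots> \<le> N * 1 + 2 ^ (n - k) * N ^ (k + 1) / N ^ k"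
      using ab N K[OF ab] W_nonneg
      by (intro add_mono divide_right_mono mult_mono mult_left_mono power_mono integral_nonneg integrable_continuous_real W_cont)
         (auto simp: field_simps)
    also have "\<dots> = (1 + 2 ^ (n - k)) * N" using N by (simp add: field_simps)
    finally show ?thesis .
  qed
  have "\<exists>x\<in>{5/8..3/4}. \<bar>v x\<bar> \<le> 8 * N"
  proof (rule ccontr)
    assume "\<not> ?thesis"
    then have big: "8 * N \<le> \<bar>v x\<bar>" if "x \<in> {5/8..3/4}" for x using that by (auto simp: not_le intro: less_imp_le)
    have ci: "(\<lambda>r. \<bar>v r\<bar> ^ (k + 1)) integrable_on {5/8..3/4}"
      by (intro integrable_continuous_real continuous_intros continuous_on_subset[OF cv]) auto
    have "integral {5/8..3/4} (\<lambda>x::real. (8 * N) ^ (k + 1)) \<le> integral {5/8..3/4} (\<lambda>r. \<bar>v r\<bar> ^ (k + 1))"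
      by (intro integral_le ci power_mono big) (use N in auto)
    then have "(8 * N) ^ (k + 1) \<le> 8 * N ^ (k + 1)" using V by simp
    then have "(8::real) ^ (k + 1) * N ^ (k + 1) \<le> 8 * N ^ (k + 1)" by (simp only: power_mult_distrib)
    then have "(8::real) ^ (k + 1) \<le> 8" by (rule mult_right_le_imp_le) (use N in simp)
    moreover have "(8::real) ^ 2 \<le> 8 ^ (k + 1)" using k1 by (intro power_increasing) auto
    ultimately show False by simp
  qed
  then obtain x where x: "5/8 \<le> x" "x \<le> 3/4" "\<bar>v x\<bar> \<le> 8 * N" by auto
  have mid: "norm (v y) \<le> (9 + 2 ^ (n - k)) * N" if "y \<in> {1/2<..<1}" for y
  proof (cases "y \<le> x")
    case True
    then show ?thesis using diff[of y x] v_mono[of y x] x that N by (simp add: algebra_simps abs_le_iff)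
  next
    case False
    then show ?thesis using diff[of x y] v_mono[of x y] x that N by (simp add: algebra_simps abs_le_iff)
  qed
  have cl: "closure {1/2<..<1::real} = {1/2..1}" by simp
  have "norm (v r) \<le> (9 + 2 ^ (n - k)) * N"
  proof (rule continuous_on_closure_norm_le[where s = "{1/2<..<1}" and f = v and x = r])
    show "continuous_on (closure {1/2<..<1}) v" unfolding cl by (rule continuous_on_subset[OF cv]) auto
    show "\<forall>y\<in>{1/2<..<1}. norm (v y) \<le> (9 + 2 ^ (n - k)) * N" using mid by blast
    show "r \<in> closure {1/2<..<1}" unfolding cl using r by simp
  qed
  then show ?thesis by simp
qed

end

definition eta :: "real \<Rightarrow> real \<Rightarrow> real \<Rightarrow> real" where
  "eta r0 s r = r * (r\<^sup>2 + r0\<^sup>2) powr (- (s + 1) / 2)"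

definition eta_slope :: "real \<Rightarrow> real \<Rightarrow> real \<Rightarrow> real" where
  "eta_slope r0 s r = 1 - (s + 1) * (r\<^sup>2 / (r\<^sup>2 + r0\<^sup>2))"

definition eta' :: "real \<Rightarrow> real \<Rightarrow> real \<Rightarrow> real" where
  "eta' r0 s r = (r\<^sup>2 + r0\<^sup>2) powr (- (s + 1) / 2) * eta_slope r0 s r"

lemma eta_DERIV:
  assumes "0 < r0"
  shows "(eta r0 s has_real_derivative eta' r0 s r) (at r)"
proof -
  have pos: "0 < x\<^sup>2 + r0\<^sup>2" for x using assms by (simp add: add_nonneg_pos)
  have "((\<lambda>r. r\<^sup>2 + r0\<^sup>2) has_real_derivative 2 * r) (at r)" by (auto intro!: derivative_eq_intros)
  from DERIV_chain2[OF has_real_derivative_powr[OF pos] this, of "- (s + 1) / 2"]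
  have 1: "((\<lambda>r. (r\<^sup>2 + r0\<^sup>2) powr (- (s + 1) / 2)) has_real_derivative
      - (s + 1) / 2 * (r\<^sup>2 + r0\<^sup>2) powr (- (s + 1) / 2 - 1) * (2 * r)) (at r)" .
  have 2: "(r\<^sup>2 + r0\<^sup>2) powr (- (s + 1) / 2 - 1) = (r\<^sup>2 + r0\<^sup>2) powr (- (s + 1) / 2) / (r\<^sup>2 + r0\<^sup>2)"
    using pos[of r] by (simp add: powr_diff)
  define Y where "Y = r\<^sup>2 + r0\<^sup>2"
  have Y0: "Y \<noteq> 0" using pos[of r] unfolding Y_def by linarith
  define X where "X = Y powr (- (s + 1) / 2)"
  have "1 * (r\<^sup>2 + r0\<^sup>2) powr (- (s + 1) / 2) + - (s + 1) / 2 * (r\<^sup>2 + r0\<^sup>2) powr (- (s + 1) / 2 - 1) * (2 * r) * r = eta' r0 s r"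
    unfolding 2 unfolding eta'_def eta_slope_def Y_def[symmetric] X_def[symmetric] by (simp add: Y0 power2_eq_square field_simps)
  with DERIV_mult[OF DERIV_ident 1] show ?thesis unfolding eta_def [abs_def] by (rule DERIV_cong)
qed

lemma eta'_continuous: "0 < r0 \<Longrightarrow> continuous_on A (eta' r0 s)"
  unfolding eta'_def eta_slope_def by (intro continuous_intros) (auto simp: add_nonneg_eq_0_iff)

lemma eta'_eq: "0 < r \<Longrightarrow> eta' r0 s r = eta r0 s r * eta_slope r0 s r / r"
  by (simp add: eta_def eta'_def)

lemma eta_square: "0 < r0 \<Longrightarrow> (eta r0 s r)\<^sup>2 = r\<^sup>2 * (r\<^sup>2 + r0\<^sup>2) powr (- (s + 1))"
  by (simp add: eta_def power_mult_distrib flip: powr_realpow[of "(r\<^sup>2 + r0\<^sup>2) powr (- (s + 1) / 2)" 2])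
     (simp add: power2_eq_square flip: powr_add)

lemma slope_fraction:
  fixes r r0 :: real
  assumes "0 < r0" "0 < r"
  shows "0 < r\<^sup>2 / (r\<^sup>2 + r0\<^sup>2)" "r\<^sup>2 / (r\<^sup>2 + r0\<^sup>2) < 1"
proof -
  have "0 < r\<^sup>2" "0 < r0\<^sup>2" using zero_less_power[of r 2] zero_less_power[of r0 2] assms by auto
  moreover from this have d: "0 < r\<^sup>2 + r0\<^sup>2" by (rule add_pos_pos)
  ultimately show "0 < r\<^sup>2 / (r\<^sup>2 + r0\<^sup>2)" "r\<^sup>2 / (r\<^sup>2 + r0\<^sup>2) < 1"
    by (simp_all only: divide_pos_pos divide_less_eq_1_pos[OF d])
qed

lemma slope_bounds:
  assumes "0 < r0" "0 < r" "1 \<le> s" "0 \<le> b" "b < 1"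
  shows "\<bar>eta_slope r0 s r + b\<bar> \<le> s + 1"
proof -
  define y where "y = r\<^sup>2 / (r\<^sup>2 + r0\<^sup>2)"
  have y: "0 < y" "y < 1" using slope_fraction[OF assms(1,2)] by (auto simp: y_def)
  define t where "t = (s + 1) * y"
  have "t \<le> (s + 1) * 1" unfolding t_def using y assms by (intro mult_left_mono) linarith+
  moreover have "0 \<le> t" using y assms by (simp add: t_def)
  ultimately have "1 - t + b \<le> s + 1" "- (1 - t + b) \<le> s + 1" using assms by auto
  then show ?thesis unfolding eta_slope_def y_def[symmetric] t_def[symmetric] abs_le_iff by blast
qed

lemma slope_product:
  assumes "0 < r0" "0 < r" "1 \<le> s" "1 \<le> s - 2 * b"
  shows "0 \<le> (eta_slope r0 s r + s) * (s - 2 * b - eta_slope r0 s r)"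
    and "r0 / 2 \<le> r \<Longrightarrow> r \<le> r0 \<Longrightarrow> (s + 1)\<^sup>2 / 10 \<le> (eta_slope r0 s r + s) * (s - 2 * b - eta_slope r0 s r)"
proof -
  define y where "y = r\<^sup>2 / (r\<^sup>2 + r0\<^sup>2)"
  have y: "0 < y" "y < 1" using slope_fraction[OF assms(1,2)] by (auto simp: y_def)
  have p: "eta_slope r0 s r = 1 - (s + 1) * y" by (simp add: eta_slope_def y_def)
  have 1: "eta_slope r0 s r + s = (s + 1) * (1 - y)" by (simp add: p algebra_simps)
  have 2: "(s + 1) * y \<le> s - 2 * b - eta_slope r0 s r" using assms(4) by (simp add: p)
  have 3: "(s + 1) * (1 - y) * ((s + 1) * y) \<le> (eta_slope r0 s r + s) * (s - 2 * b - eta_slope r0 s r)"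
    unfolding 1 using 2 y assms by (intro mult_left_mono) auto
  have "0 \<le> (s + 1) * (1 - y) * ((s + 1) * y)" using y assms by simp
  with 3 show "0 \<le> (eta_slope r0 s r + s) * (s - 2 * b - eta_slope r0 s r)" by linarith
  assume r: "r0 / 2 \<le> r" "r \<le> r0"
  have den: "0 < r\<^sup>2 + r0\<^sup>2" using assms by (simp add: add_pos_pos)
  have "(r0/2)\<^sup>2 \<le> r\<^sup>2" "r\<^sup>2 \<le> r0\<^sup>2" using r assms by (auto intro!: power_mono)
  then have y2: "1/5 \<le> y" "y \<le> 1/2" using den by (auto simp: y_def field_simps power2_eq_square)
  have "1/10 \<le> (1 - y) * y"
    using mult_mono[of "1/2" "1 - y" "1/5" y] y2 by simp
  then have "(s + 1)\<^sup>2 * (1/10) \<le> (s + 1)\<^sup>2 * ((1 - y) * y)" by (intro mult_left_mono) auto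
  also have "\<dots> = (s + 1) * (1 - y) * ((s + 1) * y)" by (simp add: power2_eq_square)
  also note 3
  finally show "(s + 1)\<^sup>2 / 10 \<le> (eta_slope r0 s r + s) * (s - 2 * b - eta_slope r0 s r)" by simp
qed

context radial_profile
begin

lemma stable_core:
  fixes s b \<gamma> M a a' r0 :: real
  assumes s: "1 \<le> s" and b: "0 \<le> b" "b < 1" "1 \<le> s - 2 * b" and \<gamma>: "\<gamma> = s\<^sup>2 - 2 * b * s"
    and stab: "\<And>\<alpha> \<beta> \<zeta> \<zeta>'. 0 < \<alpha> \<Longrightarrow> \<alpha> < \<beta> \<Longrightarrow> \<beta> < 1 \<Longrightarrow> (\<And>r. \<alpha> \<le> r \<Longrightarrow> r \<le> \<beta> \<Longrightarrow> 0 < w r) \<Longrightarrow> bump_fun \<alpha> \<beta> \<zeta> \<zeta>' \<Longrightarrow>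
        0 \<le> integral {\<alpha>..\<beta>} (\<lambda>r. W r * ((\<zeta>' r)\<^sup>2 + 2 * b * \<zeta> r * \<zeta>' r / r - \<gamma> * (\<zeta> r)\<^sup>2 / r\<^sup>2))"
    and M: "integral {1/2..3/4} W \<le> M"
    and a: "0 \<le> a" "a < a'" "a' < r0" "r0 \<le> 1/2" "r0 / 2 \<le> a'"
    and pos: "\<And>r. a < r \<Longrightarrow> r < 1 \<Longrightarrow> 0 < w r"
    and inner: "\<And>\<delta> e0. 0 < \<delta> \<Longrightarrow> 0 < e0 \<Longrightarrow> \<exists>\<epsilon>. 0 < \<epsilon> \<and> \<epsilon> < e0 \<and> integral {a+\<epsilon>..a+2*\<epsilon>} (\<lambda>r. W r * (eta r0 s r)\<^sup>2) / \<epsilon>\<^sup>2 \<le> \<delta>"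
  shows "(s + 1)\<^sup>2 / 10 * (2 * r0\<^sup>2) powr (- (s + 1)) * integral {a'..r0} W \<le> 4 powr (s + 1) * (64 + 32 * (s + 1)) * M"
proof (rule field_le_epsilon)
  fix d :: real assume d: "0 < d"
  define c2 where "c2 = (s + 1)\<^sup>2 / 10 * (2 * r0\<^sup>2) powr (- (s + 1))"
  define C1 where "C1 = 4 powr (s + 1) * (64 + 32 * (s + 1))"
  have C10: "0 \<le> C1" using s by (simp add: C1_def)
  have r0: "0 < r0" using a by linarith
  obtain \<epsilon> where e: "0 < \<epsilon>" "\<epsilon> < (a' - a) / 2"
    and ie: "integral {a+\<epsilon>..a+2*\<epsilon>} (\<lambda>r. W r * (eta r0 s r)\<^sup>2) / \<epsilon>\<^sup>2 \<le> d / (8 + 4 * s)"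
    using inner[of "d / (8 + 4 * s)" "(a' - a) / 2"] d a s by auto
  define \<Phi>1 where "\<Phi>1 = (\<lambda>r. smooth_step ((r - a) / \<epsilon> - 1))"
  define \<Phi>1' where "\<Phi>1' = (\<lambda>r. smooth_step' ((r - a) / \<epsilon> - 1))"
  define \<Phi>2 where "\<Phi>2 = (\<lambda>r. smooth_step (4 * (r - 1/2)))"
  define \<Phi>2' where "\<Phi>2' = (\<lambda>r. smooth_step' (4 * (r - 1/2)))"
  define \<kappa> where "\<kappa> = (\<lambda>r. \<Phi>1 r * (1 - \<Phi>2 r))"
  define \<kappa>' where "\<kappa>' = (\<lambda>r. \<Phi>1' r / \<epsilon> * (1 - \<Phi>2 r) - \<Phi>1 r * (4 * \<Phi>2' r))"
  define \<zeta> where "\<zeta> = (\<lambda>r. eta r0 s r * \<kappa> r)"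
  define \<zeta>' where "\<zeta>' = (\<lambda>r. eta' r0 s r * \<kappa> r + eta r0 s r * \<kappa>' r)"
  have e0: "\<epsilon> \<noteq> 0" using e(1) by simp
  have D1: "(\<Phi>1 has_real_derivative \<Phi>1' r / \<epsilon>) (at r)" for r
  proof -
    have "((\<lambda>r. (r - a) / \<epsilon> - 1) has_real_derivative 1 / \<epsilon>) (at r)" using e0 by (auto intro!: derivative_eq_intros)
    from DERIV_chain2[OF smooth_step_DERIV this] show ?thesis by (simp add: \<Phi>1_def \<Phi>1'_def)
  qed
  have D2: "(\<Phi>2 has_real_derivative 4 * \<Phi>2' r) (at r)" for r
  proof -
    have "((\<lambda>r. 4 * (r - 1/2)) has_real_derivative 4) (at r)" by (auto intro!: derivative_eq_intros)
    from DERIV_chain2[OF smooth_step_DERIV this] show ?thesis by (simp add: \<Phi>2_def \<Phi>2'_def mult.commute)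
  qed
  have D\<kappa>: "(\<kappa> has_real_derivative \<kappa>' r) (at r)" for r
    unfolding \<kappa>_def \<kappa>'_def by (rule DERIV_cong[OF DERIV_mult[OF D1 DERIV_diff[OF DERIV_const D2]]]) (simp add: algebra_simps)
  have D\<zeta>: "(\<zeta> has_real_derivative \<zeta>' r) (at r)" for r
    unfolding \<zeta>_def \<zeta>'_def by (rule DERIV_cong[OF DERIV_mult[OF eta_DERIV[OF r0] D\<kappa>]]) (simp add: algebra_simps)
  have cont: "continuous_on A \<Phi>1" "continuous_on A \<Phi>2" "continuous_on A \<kappa>" "continuous_on A \<zeta>" "continuous_on A (eta r0 s)" for A
    by (meson D1 D2 D\<kappa> D\<zeta> eta_DERIV[OF r0] DERIV_isCont continuous_at_imp_continuous_on)+
  have c1': "continuous_on A \<Phi>1'" for A unfolding \<Phi>1'_def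
    by (rule continuous_on_compose2[OF smooth_step'_continuous[of UNIV]]) (auto intro!: continuous_intros simp: e0)
  have c2': "continuous_on A \<Phi>2'" for A unfolding \<Phi>2'_def
    by (rule continuous_on_compose2[OF smooth_step'_continuous[of UNIV]]) (auto intro!: continuous_intros)
  have c\<zeta>': "continuous_on A \<zeta>'" for A
    unfolding \<zeta>'_def \<kappa>'_def by (intro continuous_intros cont c1' c2' eta'_continuous r0) (simp_all add: e0)
  have le: "a + 2 * \<epsilon> < a'" using e by (simp add: field_simps)
  have bump: "bump_fun (a + \<epsilon>) (3/4) \<zeta> \<zeta>'"
    unfolding bump_fun_def
  proof (intro conjI allI impI D\<zeta> c\<zeta>')
    fix r assume "r \<notin> {a + \<epsilon>..3/4}"
    then consider "r < a + \<epsilon>" | "3/4 < r" by fastforce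
    then show "\<zeta> r = 0"
    proof cases
      case 1
      then have "\<Phi>1 r = 0" unfolding \<Phi>1_def using e by (intro smooth_step_0) (simp add: field_simps)
      then show ?thesis by (simp add: \<zeta>_def \<kappa>_def)
    next
      case 2
      then have "\<Phi>2 r = 1" unfolding \<Phi>2_def by (intro smooth_step_1) simp
      then show ?thesis by (simp add: \<zeta>_def \<kappa>_def)
    qed
  qed
  define p where "p = eta_slope r0 s"
  define Q where "Q = (\<lambda>r. (\<zeta>' r)\<^sup>2 + 2 * b * \<zeta> r * \<zeta>' r / r - \<gamma> * (\<zeta> r)\<^sup>2 / r\<^sup>2)"
  have Qeq: "Q r = (eta r0 s r)\<^sup>2 * ((\<kappa>' r)\<^sup>2 + 2 * \<kappa> r * \<kappa>' r * (p r + b) / r - (\<kappa> r)\<^sup>2 * ((p r + s) * (s - 2 * b - p r)) / r\<^sup>2)" if "0 < r" for r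
  proof -
    have z': "\<zeta>' r = eta r0 s r * (p r * \<kappa> r / r + \<kappa>' r)"
      using that by (simp add: \<zeta>'_def eta'_eq p_def algebra_simps)
    show ?thesis unfolding Q_def z' \<zeta>_def \<gamma> using that
      by (simp add: field_simps power2_eq_square)
  qed
  have B1: "Q r \<le> (eta r0 s r)\<^sup>2 * (c\<^sup>2 + 2 * c * (s + 1) / r)"
    if r: "0 < r" and k: "0 \<le> \<kappa> r" "\<kappa> r \<le> 1" and k': "\<bar>\<kappa>' r\<bar> \<le> c" for r c
  proof -
    have "(\<kappa>' r)\<^sup>2 \<le> c\<^sup>2" using k' by (metis abs_ge_zero power2_abs power_mono)
    moreover have "2 * \<kappa> r * \<kappa>' r * (p r + b) / r \<le> 2 * c * (s + 1) / r"
    proof -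
      have "\<kappa> r * \<kappa>' r * (p r + b) \<le> \<bar>\<kappa> r\<bar> * \<bar>\<kappa>' r\<bar> * \<bar>p r + b\<bar>" by (metis abs_ge_self abs_mult)
      also have "\<dots> \<le> 1 * c * (s + 1)"
        using k k' slope_bounds[OF r0 r s b(1,2)] by (intro mult_mono) (auto simp: p_def)
      finally show ?thesis using r by (intro divide_right_mono) auto
    qed
    moreover have "0 \<le> (\<kappa> r)\<^sup>2 * ((p r + s) * (s - 2 * b - p r)) / r\<^sup>2"
      using slope_product(1)[OF r0 r s b(3)] by (simp add: p_def)
    ultimately show ?thesis unfolding Qeq[OF r] by (intro mult_left_mono) auto
  qed
  have B2: "Q r = - (eta r0 s r)\<^sup>2 * ((p r + s) * (s - 2 * b - p r)) / r\<^sup>2" if "0 < r" "\<kappa> r = 1" "\<kappa>' r = 0" for r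
    unfolding Qeq[OF that(1)] that(2,3) by simp
  have m: "\<kappa> r = 1 \<and> \<kappa>' r = 0" if "a + 2 * \<epsilon> \<le> r" "r \<le> 1/2" for r
  proof -
    have "\<Phi>1 r = 1" "\<Phi>1' r = 0" "\<Phi>2 r = 0" "\<Phi>2' r = 0"
      unfolding \<Phi>1_def \<Phi>1'_def \<Phi>2_def \<Phi>2'_def using that e
      by (auto intro!: smooth_step_0 smooth_step_1 smooth_step'_0 simp: field_simps)
    then show ?thesis by (simp add: \<kappa>_def \<kappa>'_def)
  qed
  let ?I = "\<lambda>x y. integral {x..y} (\<lambda>r. W r * Q r)"
  have ci: "(\<lambda>r. W r * Q r) integrable_on {x..y}" if "0 < x" "y < 1" for x y
    unfolding Q_def using that
    by (intro integrable_continuous_real continuous_intros W_cont cont c\<zeta>') auto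
  have Wi: "W integrable_on {x..y}" if "0 < x" "y < 1" for x y
    using that by (intro integrable_continuous_real W_cont)
  have comb: "?I x z = ?I x y + ?I y z" if "0 < x" "x \<le> y" "y \<le> z" "z < 1" for x y z
    using Henstock_Kurzweil_Integration.integral_combine[of x y z "\<lambda>r. W r * Q r"] that ci by simp
  have I0: "0 \<le> ?I (a + \<epsilon>) (3/4)"
    unfolding Q_def using a e by (intro stab bump pos) auto
  have Isplit: "?I (a + \<epsilon>) (3/4) = ?I (a + \<epsilon>) (a + 2 * \<epsilon>) + ?I (a + 2 * \<epsilon>) a' + ?I a' r0 + ?I r0 (1/2) + ?I (1/2) (3/4)"
    using a e le r0 comb[of "a + \<epsilon>" "a + 2 * \<epsilon>" "3/4"] comb[of "a + 2 * \<epsilon>" a' "3/4"] comb[of a' r0 "3/4"] comb[of r0 "1/2" "3/4"]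
    by simp
  have I1: "?I (a + \<epsilon>) (a + 2 * \<epsilon>) \<le> d"
  proof -
    have "?I (a + \<epsilon>) (a + 2 * \<epsilon>) \<le> integral {a+\<epsilon>..a+2*\<epsilon>} (\<lambda>r. (8 + 4 * s) / \<epsilon>\<^sup>2 * (W r * (eta r0 s r)\<^sup>2))"
    proof (rule integral_le)
      show "(\<lambda>r. W r * Q r) integrable_on {a + \<epsilon>..a + 2 * \<epsilon>}" using a e le by (intro ci) auto
      show "(\<lambda>r. (8 + 4 * s) / \<epsilon>\<^sup>2 * (W r * (eta r0 s r)\<^sup>2)) integrable_on {a + \<epsilon>..a + 2 * \<epsilon>}"
        using a e le by (intro integrable_continuous_real continuous_intros W_cont cont) auto
      fix r assume r: "r \<in> {a + \<epsilon>..a + 2 * \<epsilon>}"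
      have r': "0 < r" "r < 1" "\<epsilon> \<le> r" "r \<le> 1/2" using r a e le by auto
      have "\<Phi>2 r = 0" "\<Phi>2' r = 0"
        unfolding \<Phi>2_def \<Phi>2'_def using r' by (auto intro!: smooth_step_0 smooth_step'_0)
      then have kk: "\<kappa> r = \<Phi>1 r" "\<kappa>' r = \<Phi>1' r / \<epsilon>" by (auto simp: \<kappa>_def \<kappa>'_def)
      have "\<bar>\<kappa>' r\<bar> \<le> 2 / \<epsilon>" unfolding kk \<Phi>1'_def using e smooth_step'_range by (simp add: divide_right_mono)
      then have "Q r \<le> (eta r0 s r)\<^sup>2 * ((2 / \<epsilon>)\<^sup>2 + 2 * (2 / \<epsilon>) * (s + 1) / r)"
        by (intro B1 r') (auto simp: kk \<Phi>1_def smooth_step_range)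
      also have "\<dots> \<le> (eta r0 s r)\<^sup>2 * ((2 / \<epsilon>)\<^sup>2 + 2 * (2 / \<epsilon>) * (s + 1) / \<epsilon>)"
        using r' e s by (intro mult_left_mono add_left_mono divide_left_mono) auto
      also have "\<dots> = (8 + 4 * s) / \<epsilon>\<^sup>2 * (eta r0 s r)\<^sup>2" using e by (simp add: field_simps power2_eq_square)
      finally have "W r * Q r \<le> W r * ((8 + 4 * s) / \<epsilon>\<^sup>2 * (eta r0 s r)\<^sup>2)"
        using W_nonneg[OF r'(1,2)] by (intro mult_left_mono)
      then show "W r * Q r \<le> (8 + 4 * s) / \<epsilon>\<^sup>2 * (W r * (eta r0 s r)\<^sup>2)" by (simp only: mult.left_commute)
    qed
    also have "\<dots> = (8 + 4 * s) * (integral {a+\<epsilon>..a+2*\<epsilon>} (\<lambda>r. W r * (eta r0 s r)\<^sup>2) / \<epsilon>\<^sup>2)"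
      by simp
    also have "\<dots> \<le> (8 + 4 * s) * (d / (8 + 4 * s))" using ie s by (intro mult_left_mono) auto
    also have "\<dots> = d" using s by simp
    finally show ?thesis .
  qed
  have neg: "?I x y \<le> 0" if "a + 2 * \<epsilon> \<le> x" "y \<le> 1/2" for x y
  proof -
    have "?I x y \<le> integral {x..y} (\<lambda>r. 0)"
    proof (rule integral_le)
      show "(\<lambda>r. W r * Q r) integrable_on {x..y}" using that a e by (intro ci) auto
      fix r assume r: "r \<in> {x..y}"
      then have r': "0 < r" "r < 1" using that a e by auto
      have "Q r \<le> 0" using B2[OF r'(1)] m[of r] slope_product(1)[OF r0 r'(1) s b(3)] r that by (simp add: p_def)
      then show "W r * Q r \<le> 0" using W_nonneg[OF r'] by (simp add: mult_nonneg_nonpos)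
    qed auto
    then show ?thesis by simp
  qed
  have I3: "?I a' r0 \<le> - c2 * integral {a'..r0} W"
  proof -
    have "?I a' r0 \<le> integral {a'..r0} (\<lambda>r. - c2 * W r)"
    proof (rule integral_le)
      show "(\<lambda>r. W r * Q r) integrable_on {a'..r0}" using a by (intro ci) auto
      show "(\<lambda>r. - c2 * W r) integrable_on {a'..r0}"
        using a by (intro integrable_continuous_real continuous_intros W_cont) auto
      fix r assume r: "r \<in> {a'..r0}"
      then have r': "0 < r" "r < 1" "r0 / 2 \<le> r" "r \<le> r0" using a by auto
      have "Q r = - ((r\<^sup>2 + r0\<^sup>2) powr (- (s + 1)) * ((p r + s) * (s - 2 * b - p r)))"
        using B2[OF r'(1)] m[of r] r a le r'(1) by (simp add: eta_square[OF r0])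
      moreover have "(2 * r0\<^sup>2) powr (- (s + 1)) * ((s + 1)\<^sup>2 / 10) \<le> (r\<^sup>2 + r0\<^sup>2) powr (- (s + 1)) * ((p r + s) * (s - 2 * b - p r))"
      proof (rule mult_mono)
        have "r\<^sup>2 \<le> r0\<^sup>2" using r' by (intro power_mono) auto
        then show "(2 * r0\<^sup>2) powr (- (s + 1)) \<le> (r\<^sup>2 + r0\<^sup>2) powr (- (s + 1))"
          using r' s by (intro powr_mono2') (auto simp: add_pos_nonneg)
        show "(s + 1)\<^sup>2 / 10 \<le> (p r + s) * (s - 2 * b - p r)"
          unfolding p_def by (rule slope_product(2)[OF r0 r'(1) s b(3) r'(3,4)])
      qed auto
      ultimately have "Q r \<le> - c2" by (simp add: c2_def mult.commute)
      then show "W r * Q r \<le> - c2 * W r" using mult_left_mono[of "Q r" "- c2" "W r"] W_nonneg[OF r'(1,2)] by (simp add: mult.commute)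
    qed
    then show ?thesis by simp
  qed
  have I5: "?I (1/2) (3/4) \<le> C1 * M"
  proof -
    have "?I (1/2) (3/4) \<le> integral {1/2..3/4} (\<lambda>r. C1 * W r)"
    proof (rule integral_le)
      show "(\<lambda>r. W r * Q r) integrable_on {1/2..3/4}" by (intro ci) auto
      show "(\<lambda>r. C1 * W r) integrable_on {1/2..3/4}"
        by (intro integrable_continuous_real continuous_intros W_cont) auto
      fix r :: real assume r: "r \<in> {1/2..3/4}"
      then have r': "0 < r" "r < 1" "1/2 \<le> r" by auto
      have "\<Phi>1 r = 1" "\<Phi>1' r = 0"
        unfolding \<Phi>1_def \<Phi>1'_def using r' e le a by (auto intro!: smooth_step_1 smooth_step'_0 simp: field_simps)
      then have kk: "\<kappa> r = 1 - \<Phi>2 r" "\<kappa>' r = - 4 * \<Phi>2' r" by (auto simp: \<kappa>_def \<kappa>'_def)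
      have "\<bar>\<kappa>' r\<bar> \<le> 8" unfolding kk \<Phi>2'_def using smooth_step'_range[of "4 * (r - 1/2)"] by simp
      then have "Q r \<le> (eta r0 s r)\<^sup>2 * (8\<^sup>2 + 2 * 8 * (s + 1) / r)"
        by (intro B1 r') (use smooth_step_range[of "4 * (r - 1/2)"] in \<open>auto simp: kk \<Phi>2_def\<close>)
      also have "\<dots> \<le> (4 powr (s + 1)) * (64 + 32 * (s + 1))"
      proof (rule mult_mono)
        have "(r\<^sup>2 + r0\<^sup>2) powr (- (s + 1)) \<le> (1/4) powr (- (s + 1))"
        proof (rule powr_mono2')
          have "(1/2)\<^sup>2 \<le> r\<^sup>2" using r' by (intro power_mono) auto
          then show "1/4 \<le> r\<^sup>2 + r0\<^sup>2" by (simp add: power2_eq_square add_increasing2)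
        qed (use s in auto)
        also have "(1/4::real) powr (- (s + 1)) = 4 powr (s + 1)"
        proof -
          have q: "(1/4::real) = 4 powr (-1)" by (simp add: powr_minus_divide)
          show ?thesis unfolding q powr_powr by (simp add: add.commute)
        qed
        finally have "r\<^sup>2 * (r\<^sup>2 + r0\<^sup>2) powr (- (s + 1)) \<le> 1 * 4 powr (s + 1)"
          using r' by (intro mult_mono) (auto intro: power_le_one)
        then show "(eta r0 s r)\<^sup>2 \<le> 4 powr (s + 1)" by (simp add: eta_square[OF r0])
        have "2 * 8 * (s + 1) / r \<le> 2 * 8 * (s + 1) / (1/2)"
          using r' s by (intro divide_left_mono) auto
        then show "8\<^sup>2 + 2 * 8 * (s + 1) / r \<le> 64 + 32 * (s + 1)" by simp
        show "0 \<le> 8\<^sup>2 + 2 * 8 * (s + 1) / r" using r' s by simp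
      qed simp
      finally have "W r * Q r \<le> W r * C1" unfolding C1_def using W_nonneg[OF r'(1,2)] by (intro mult_left_mono)
      then show "W r * Q r \<le> C1 * W r" by (simp add: mult.commute)
    qed
    also have "\<dots> \<le> C1 * M" using M C10 by (simp add: mult_left_mono)
    finally show ?thesis .
  qed
  have "0 \<le> d - c2 * integral {a'..r0} W + C1 * M"
    using I0 Isplit I1 I3 I5 neg[of "a + 2 * \<epsilon>" a'] neg[of r0 "1/2"] a le by linarith
  then show "(s + 1)\<^sup>2 / 10 * (2 * r0\<^sup>2) powr (- (s + 1)) * integral {a'..r0} W \<le> 4 powr (s + 1) * (64 + 32 * (s + 1)) * M + d"
    unfolding c2_def[symmetric] C1_def[symmetric] by simp
qed

end

context radial_profile
begin

lemma W_small_near_0: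
  assumes Wint: "W integrable_on {0..1/2}" and s: "0 \<le> s + 1" and r0: "0 < r0" and d: "0 < d" "0 < (e0::real)"
  shows "\<exists>\<epsilon>. 0 < \<epsilon> \<and> \<epsilon> < e0 \<and> integral {0+\<epsilon>..0+2*\<epsilon>} (\<lambda>r. W r * (eta r0 s r)\<^sup>2) / \<epsilon>\<^sup>2 \<le> d"
proof -
  define B where "B = (r0\<^sup>2) powr (- (s + 1))"
  have B: "0 < B" using r0 by (simp add: B_def)
  have eb: "(eta r0 s r)\<^sup>2 \<le> r\<^sup>2 * B" if r: "0 < r" "r \<le> 1" for r
  proof -
    have "(r\<^sup>2 + r0\<^sup>2) powr (- (s + 1)) \<le> B"
      unfolding B_def using s r0 by (intro powr_mono2') auto
    then show ?thesis by (simp add: eta_square[OF r0] mult_left_mono)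
  qed
  define F where "F = (\<lambda>x. integral {0..x} W)"
  have "continuous_on {0..1/2} F" unfolding F_def by (rule indefinite_integral_continuous_1[OF Wint])
  then have "\<forall>e>0. \<exists>t>0. \<forall>x\<in>{0..1/2}. dist x 0 < t \<longrightarrow> dist (F x) (F 0) < e"
    unfolding continuous_on_iff by (rule bspec) simp
  moreover have "0 < d / (4 * B)" using d B by simp
  ultimately have "\<exists>t>0. \<forall>x\<in>{0..1/2}. dist x 0 < t \<longrightarrow> dist (F x) (F 0) < d / (4 * B)" by blast
  then obtain t where t: "0 < t" "\<And>x. x \<in> {0..1/2} \<Longrightarrow> \<bar>x\<bar> < t \<Longrightarrow> \<bar>F x - F 0\<bar> < d / (4 * B)"
    by (auto simp: dist_real_def)
  define \<epsilon> where "\<epsilon> = min (e0/2) (min (t/4) (1/4))"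
  have e: "0 < \<epsilon>" "\<epsilon> < e0" "2 * \<epsilon> < t" "2 * \<epsilon> \<le> 1/2" using t d by (auto simp: \<epsilon>_def min_def)
  have Wsub: "W integrable_on {x..y}" if "0 \<le> x" "y \<le> 1/2" for x y
    using integrable_subinterval_real[OF Wint, of x y] that by auto
  have "integral {\<epsilon>..2*\<epsilon>} (\<lambda>r. W r * (eta r0 s r)\<^sup>2) \<le> integral {\<epsilon>..2*\<epsilon>} (\<lambda>r. 4 * \<epsilon>\<^sup>2 * B * W r)"
  proof (rule integral_le)
    have "continuous_on {\<epsilon>..2*\<epsilon>} (eta r0 s)"
      by (meson eta_DERIV[OF r0] DERIV_isCont continuous_at_imp_continuous_on)
    then show "(\<lambda>r. W r * (eta r0 s r)\<^sup>2) integrable_on {\<epsilon>..2*\<epsilon>}"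
      using e by (intro integrable_continuous_real continuous_intros W_cont) auto
    show "(\<lambda>r. 4 * \<epsilon>\<^sup>2 * B * W r) integrable_on {\<epsilon>..2*\<epsilon>}"
      using e by (intro integrable_continuous_real continuous_intros W_cont) auto
    fix r assume r: "r \<in> {\<epsilon>..2*\<epsilon>}"
    have "(eta r0 s r)\<^sup>2 \<le> r\<^sup>2 * B" using r e by (intro eb) auto
    also have "\<dots> \<le> (2 * \<epsilon>)\<^sup>2 * B" using r e B by (intro mult_right_mono power_mono) auto
    finally have "W r * (eta r0 s r)\<^sup>2 \<le> W r * ((2 * \<epsilon>)\<^sup>2 * B)" using W_nonneg[of r] r e by (intro mult_left_mono) auto
    then show "W r * (eta r0 s r)\<^sup>2 \<le> 4 * \<epsilon>\<^sup>2 * B * W r" by (simp add: power2_eq_square mult_ac)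
  qed
  also have "\<dots> = 4 * \<epsilon>\<^sup>2 * B * integral {\<epsilon>..2*\<epsilon>} W" by simp
  also have "integral {\<epsilon>..2*\<epsilon>} W \<le> d / (4 * B)"
  proof -
    have "F (2 * \<epsilon>) = F \<epsilon> + integral {\<epsilon>..2*\<epsilon>} W"
      unfolding F_def using e Wsub[of 0 "2 * \<epsilon>"] by (intro Henstock_Kurzweil_Integration.integral_combine[symmetric]) auto
    moreover have "0 \<le> F \<epsilon>"
    proof -
      have "integral {0..\<epsilon>} (\<lambda>x. if x = 0 then 0 else W x) = F \<epsilon>"
        unfolding F_def by (rule integral_spike[of "{0}"]) auto
      moreover have "0 \<le> integral {0..\<epsilon>} (\<lambda>x. if x = 0 then 0 else W x)"
        by (rule integral_nonneg[OF integrable_spike[OF Wsub[of 0 \<epsilon>], of "{0}"]]) (use e W_nonneg in auto)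
      ultimately show ?thesis by simp
    qed
    moreover have "F 0 = 0" by (simp add: F_def)
    ultimately show ?thesis using t(2)[of "2 * \<epsilon>"] e by auto
  qed
  then have "4 * \<epsilon>\<^sup>2 * B * integral {\<epsilon>..2*\<epsilon>} W \<le> 4 * \<epsilon>\<^sup>2 * B * (d / (4 * B))"
    using B by (intro mult_left_mono) auto
  also have "\<dots> = d * \<epsilon>\<^sup>2" using B by simp
  finally have "integral {\<epsilon>..2*\<epsilon>} (\<lambda>r. W r * (eta r0 s r)\<^sup>2) \<le> d * \<epsilon>\<^sup>2" .
  then have "integral {0+\<epsilon>..0+2*\<epsilon>} (\<lambda>r. W r * (eta r0 s r)\<^sup>2) / \<epsilon>\<^sup>2 \<le> d"
    using e by (simp add: divide_le_eq)
  then show ?thesis using e by blast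
qed

lemma W_small_near_zero_set:
  assumes a: "0 < a" "a < 1/2" and wa: "w a = 0" and r0: "0 < r0" and d: "0 < d" "0 < (e0::real)"
  shows "\<exists>\<epsilon>. 0 < \<epsilon> \<and> \<epsilon> < e0 \<and> integral {a+\<epsilon>..a+2*\<epsilon>} (\<lambda>r. W r * (eta r0 s r)\<^sup>2) / \<epsilon>\<^sup>2 \<le> d"
proof -
  have "compact (G ` {a..3/4})" using a by (intro compact_continuous_image continuous_on_subset[OF cG]) auto
  from compact_imp_bounded[OF this] obtain g where g: "\<forall>y\<in>G ` {a..3/4}. norm y \<le> g" unfolding bounded_iff by blast
  have "continuous_on {a..3/4} (eta r0 s)"
    by (meson eta_DERIV[OF r0] DERIV_isCont continuous_at_imp_continuous_on)
  then have ce: "continuous_on {a..3/4} (\<lambda>r. (eta r0 s r)\<^sup>2)" by (intro continuous_intros)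
  then have "compact ((\<lambda>r. (eta r0 s r)\<^sup>2) ` {a..3/4})" by (intro compact_continuous_image) auto
  from compact_imp_bounded[OF this] obtain h where h: "\<forall>y\<in>(\<lambda>r. (eta r0 s r)\<^sup>2) ` {a..3/4}. norm y \<le> h" unfolding bounded_iff by blast
  have g0: "0 \<le> g" using g a by (force intro: order_trans[OF norm_ge_zero])
  have "a \<in> {a..3/4}" using a by simp
  then have "norm ((eta r0 s a)\<^sup>2) \<le> h" using h by blast
  then have h0: "0 \<le> h" by (rule order_trans[OF norm_ge_zero])
  have Pb: "P r \<le> g * (r - a)" if r: "a \<le> r" "r \<le> 3/4" for r
  proof (cases "r = a")
    case False
    obtain z where z: "a < z" "z < r" "P r - P a = (r - a) * (z ^ (n - 1) * G z)"
      using MVT2[of a r P "\<lambda>z. z ^ (n - 1) * G z"] dP r a False unfolding P_def [abs_def] by force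
    have "G z \<le> g" using g z r a by (auto simp: abs_le_iff)
    moreover have "z ^ (n - 1) \<le> 1" using z r a by (intro power_le_one) auto
    ultimately have "z ^ (n - 1) * G z \<le> 1 * g" using z r a G0[of z] by (intro mult_mono) auto
    moreover have "P a = 0" using wa k1 by (simp add: P_def zero_power)
    ultimately show ?thesis using z(3) r mult_left_mono[of "z ^ (n - 1) * G z" g "r - a"] by (simp add: mult.commute)
  qed (use wa k1 in \<open>simp add: P_def zero_power\<close>)
  define m where "m = 2 * g * h + 1"
  have m: "0 < m" using g0 h0 by (simp add: m_def add_nonneg_pos)
  have "continuous_on {a..3/4} w" using a by (intro w_cont) auto
  then have "\<exists>t>0. \<forall>x\<in>{a..3/4}. dist x a < t \<longrightarrow> dist (w x) (w a) < d / m"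
    using a d m unfolding continuous_on_iff by auto
  then obtain t where t: "0 < t" "\<And>x. x \<in> {a..3/4} \<Longrightarrow> \<bar>x - a\<bar> < t \<Longrightarrow> \<bar>w x\<bar> < d / m"
    by (auto simp: dist_real_def wa)
  define \<epsilon> where "\<epsilon> = min (e0/2) (min (t/4) (1/8))"
  have e: "0 < \<epsilon>" "\<epsilon> < e0" "2 * \<epsilon> < t" "2 * \<epsilon> \<le> 1/4" using t d by (auto simp: \<epsilon>_def min_def)
  have "integral {a+\<epsilon>..a+2*\<epsilon>} (\<lambda>r. W r * (eta r0 s r)\<^sup>2) \<le> integral {a+\<epsilon>..a+2*\<epsilon>} (\<lambda>r. d * \<epsilon>)"
  proof (rule integral_le)
    show "(\<lambda>r. W r * (eta r0 s r)\<^sup>2) integrable_on {a+\<epsilon>..a+2*\<epsilon>}"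
      using a e by (intro integrable_continuous_real continuous_intros W_cont continuous_on_subset[OF ce]) auto
    fix r assume "r \<in> {a+\<epsilon>..a+2*\<epsilon>}"
    then have r: "a \<le> r" "r \<le> 3/4" "0 < r" "r < 1" "r - a \<le> 2 * \<epsilon>" using a e by auto
    have wr: "w r \<le> d / m" using t(2)[of r] r e by auto
    have "P r \<le> g * (2 * \<epsilon>)" using Pb[OF r(1,2)] mult_left_mono[OF r(5) g0] by linarith
    then have "W r \<le> (g * (2 * \<epsilon>)) * (d / m)"
      unfolding W_eq using wr w0[OF r(3,4)] g0 e by (intro mult_mono) auto
    moreover have "(eta r0 s r)\<^sup>2 \<le> h" using h r by auto
    ultimately have "W r * (eta r0 s r)\<^sup>2 \<le> ((g * (2 * \<epsilon>)) * (d / m)) * h"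
      using g0 e d m by (intro mult_mono) auto
    also have "\<dots> = (2 * g * h) / m * (d * \<epsilon>)" by simp
    also have "\<dots> \<le> 1 * (d * \<epsilon>)" using m d e by (intro mult_right_mono) (auto simp: m_def divide_le_eq_1)
    finally show "W r * (eta r0 s r)\<^sup>2 \<le> d * \<epsilon>" by simp
  qed auto
  also have "\<dots> = d * \<epsilon>\<^sup>2" using e by (simp add: power2_eq_square)
  finally have "integral {a+\<epsilon>..a+2*\<epsilon>} (\<lambda>r. W r * (eta r0 s r)\<^sup>2) / \<epsilon>\<^sup>2 \<le> d"
    using e by (simp add: divide_le_eq)
  then show ?thesis using e by blast
qed

lemma high_dimension_step:
  fixes s b \<gamma> N r0 :: real
  assumes s: "1 \<le> s" and b: "0 \<le> b" "b < 1" "1 \<le> s - 2 * b" and \<gamma>: "\<gamma> = s\<^sup>2 - 2 * b * s"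
    and stab: "\<And>\<alpha> \<beta> \<zeta> \<zeta>'. 0 < \<alpha> \<Longrightarrow> \<alpha> < \<beta> \<Longrightarrow> \<beta> < 1 \<Longrightarrow> (\<And>r. \<alpha> \<le> r \<Longrightarrow> r \<le> \<beta> \<Longrightarrow> 0 < w r) \<Longrightarrow> bump_fun \<alpha> \<beta> \<zeta> \<zeta>' \<Longrightarrow>
        0 \<le> integral {\<alpha>..\<beta>} (\<lambda>r. W r * ((\<zeta>' r)\<^sup>2 + 2 * b * \<zeta> r * \<zeta>' r / r - \<gamma> * (\<zeta> r)\<^sup>2 / r\<^sup>2))"
    and Wint: "W integrable_on {0..1/2}"
    and N: "0 < N" and M: "integral {1/2..3/4} W \<le> N ^ (k + 1)"
    and r0: "0 < r0" "r0 \<le> 1/2"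
    and e: "(real k + 1) * e = 2 * s + 2 * real k + 2 - real n"
  shows "v r0 - v (r0 / 2) \<le> (1 + 2 ^ (n - k) * (2 powr (s + 1) * (4 powr (s + 1) * (64 + 32 * (s + 1))) * 10 / (s + 1)\<^sup>2)) * N * r0 powr e"
    (is "_ \<le> (1 + ?C) * N * r0 powr e")
proof -
  have C0: "0 \<le> ?C" using s by simp
  have half: "v (r0 / 2) \<le> v r0" using r0 by (intro v_mono) auto
  show ?thesis
  proof (cases "w r0 = 0")
    case True
    have "w r = 0" if "0 < r" "r \<le> r0" for r
      using P_mono[OF that] that r0 True P_pos_iff[of r] P_pos_iff[of r0] w0[of r] by force
    then have z: "w r = 0" if "r0 / 2 < r" "r < r0" for r using that r0 by simp
    obtain z where "r0 / 2 < z" "z < r0" "v r0 - v (r0 / 2) = (r0 - r0 / 2) * w z"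
      using MVT2[of "r0 / 2" r0 v w] r0 dv by auto
    then have "v r0 - v (r0 / 2) = 0" using z[of z] by simp
    then show ?thesis using C0 N by simp
  next
    case False
    then have P0: "0 < P r0" using P_pos_iff[of r0] w0[of r0] r0 by auto
    define Z where "Z = {r. 0 \<le> r \<and> r < r0 \<and> (r = 0 \<or> w r = 0)}"
    define a where "a = Sup Z"
    have Z0: "0 \<in> Z" using r0 by (simp add: Z_def)
    have bdd: "bdd_above Z" by (rule bdd_aboveI[of _ r0]) (auto simp: Z_def)
    have a0: "0 \<le> a" unfolding a_def using Z0 bdd by (rule cSup_upper)
    have ar: "a \<le> r0" unfolding a_def using Z0 by (intro cSup_least) (auto simp: Z_def)
    have pos: "0 < w r" if "a < r" "r < 1" for r
    proof (cases "r < r0")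
      case True
      have "r \<notin> Z" using cSup_upper[OF _ bdd, of r] that by (auto simp: a_def)
      then show ?thesis using w0[of r] that a0 True by (auto simp: Z_def less_le)
    next
      case False
      then show ?thesis using P_mono[of r0 r] P0 P_pos_iff[of r] r0 that by auto
    qed
    have zero: "w r = 0" if "0 < r" "r < a" for r
    proof -
      have "Z \<noteq> {}" "r < Sup Z" using Z0 that(2) by (auto simp: a_def)
      from less_cSupD[OF this] obtain z where z: "z \<in> Z" "r < z" by blast
      then have "w z = 0" "0 < z" "z < r0" using that by (auto simp: Z_def)
      then show ?thesis using P_mono[of r z] P_pos_iff[of r] P_pos_iff[of z] w0[of r] z that r0 by force
    qed
    have wa: "w a = 0" if "0 < a"
    proof -
      have "continuous_on {a/2..a} w" using that ar r0 by (intro w_cont) auto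
      moreover have "closure {a/2<..<a} = {a/2..a}" using that by simp
      ultimately have "continuous_on (closure {a/2<..<a}) w" by simp
      moreover have "\<forall>y\<in>{a/2<..<a}. norm (w y) \<le> 0" using zero that by auto
      moreover have "a \<in> closure {a/2<..<a}" using that by simp
      ultimately have "norm (w a) \<le> 0" by (rule continuous_on_closure_norm_le)
      then show ?thesis by simp
    qed
    have ar': "a < r0" using ar wa False r0 by (cases "a = r0") auto
    define b0 where "b0 = max a (r0 / 2)"
    have b0: "0 < b0" "b0 < r0" "a \<le> b0" "r0 / 2 \<le> b0" using ar' r0 by (auto simp: b0_def)
    have main: "v r0 - v a' \<le> (1 + ?C) * N * r0 powr e" if a': "b0 < a'" "a' < r0" for a'
    proof -
      have inner: "\<exists>\<epsilon>. 0 < \<epsilon> \<and> \<epsilon> < e0 \<and> integral {a+\<epsilon>..a+2*\<epsilon>} (\<lambda>r. W r * (eta r0 s r)\<^sup>2) / \<epsilon>\<^sup>2 \<le> d"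
        if "0 < d" "0 < e0" for d e0
      proof (cases "a = 0")
        case True
        then show ?thesis using W_small_near_0[OF Wint _ r0(1) that, of s] s by simp
      next
        case False
        then show ?thesis using a0 ar' r0 that wa by (intro W_small_near_zero_set) auto
      qed
      have core: "(s + 1)\<^sup>2 / 10 * (2 * r0\<^sup>2) powr (- (s + 1)) * integral {a'..r0} W \<le> 4 powr (s + 1) * (64 + 32 * (s + 1)) * N ^ (k + 1)"
        by (rule stable_core[OF s b \<gamma> stab M a0 _ a'(2) r0(2) _ pos inner]) (use a' b0 in auto)
      define I where "I = integral {a'..r0} W"
      define T where "T = 2 powr (s + 1) * (4 powr (s + 1) * (64 + 32 * (s + 1))) * 10 / (s + 1)\<^sup>2"
      have Ib: "I \<le> T * r0 powr (2 * s + 2) * N ^ (k + 1)"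
      proof -
        have "(2 * r0\<^sup>2) powr (- (s + 1)) = 1 / (2 powr (s + 1) * r0 powr (2 * s + 2))"
        proof -
          have "(r0\<^sup>2) powr (s + 1) = r0 powr (2 * (s + 1))" using r0 by (simp add: powr_powr flip: powr_numeral)
          also have "2 * (s + 1) = 2 * s + 2" by simp
          finally have "(2 * r0\<^sup>2) powr (s + 1) = 2 powr (s + 1) * r0 powr (2 * s + 2)" by (simp only: powr_mult)
          then show ?thesis by (simp only: powr_minus_divide)
        qed
        then have "(s + 1)\<^sup>2 / 10 * (1 / (2 powr (s + 1) * r0 powr (2 * s + 2))) * I \<le> 4 powr (s + 1) * (64 + 32 * (s + 1)) * N ^ (k + 1)"
          using core by (simp only: I_def)
        moreover have "0 < 2 powr (s + 1) * r0 powr (2 * s + 2)" "0 < (s + 1)\<^sup>2" using r0 s by auto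
        moreover have "I \<le> R * 10 * q / x" if "x / 10 * (1 / q) * I \<le> R" "0 < q" "0 < x" for x q R :: real
          using that by (simp add: field_simps)
        ultimately have "I \<le> 4 powr (s + 1) * (64 + 32 * (s + 1)) * N ^ (k + 1) * 10 * (2 powr (s + 1) * r0 powr (2 * s + 2)) / (s + 1)\<^sup>2"
          by blast
        then show ?thesis unfolding T_def by (simp only: times_divide_eq_left times_divide_eq_right mult_ac)
      qed
      define l where "l = N * r0 powr (e - 1)"
      have l: "0 < l" using N r0 by (simp add: l_def)
      have "v r0 - v a' \<le> l * (r0 - a') + (1 / a') ^ (n - k) * I / l ^ k"
        unfolding I_def using a' b0 r0 by (intro increment_W l) auto
      also have "\<dots> \<le> l * r0 + (2 / r0) ^ (n - k) * (T * r0 powr (2 * s + 2) * N ^ (k + 1)) / l ^ k"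
      proof (intro add_mono mult_left_mono divide_right_mono mult_mono Ib power_mono)
        show "1 / a' \<le> 2 / r0" using a' b0 r0 by (simp add: field_simps)
        show "0 \<le> I" unfolding I_def using a' b0 r0 W_nonneg
          by (intro integral_nonneg integrable_continuous_real W_cont) auto
      qed (use a' b0 l r0 in auto)
      also have "l * r0 = N * r0 powr e" using r0 by (simp add: l_def powr_diff)
      also have "(2 / r0) ^ (n - k) * (T * r0 powr (2 * s + 2) * N ^ (k + 1)) / l ^ k = 2 ^ (n - k) * T * N * r0 powr e"
      proof -
        have lk: "l ^ k = N ^ k * r0 powr (real k * (e - 1))"
          using r0 by (simp add: l_def power_mult_distrib powr_power)
        have "(2 / r0) ^ (n - k) = 2 ^ (n - k) * r0 powr (- real (n - k))"
          unfolding power_divide powr_minus powr_realpow[OF r0(1)] by (simp only: divide_inverse)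
        moreover have "r0 powr (- real (n - k)) * r0 powr (2 * s + 2) / r0 powr (real k * (e - 1)) = r0 powr e"
        proof -
          have "- real (n - k) + (2 * s + 2) - real k * (e - 1) = e"
            using e kn by (simp add: of_nat_diff algebra_simps)
          then show ?thesis using r0 by (simp flip: powr_add powr_diff)
        qed
        moreover have "(c * X) * (T * Y * N ^ (k + 1)) / (N ^ k * Z) = c * T * N * (X * Y / Z)" for c X Y Z
          using N by simp
        ultimately show ?thesis unfolding lk by (simp only:)
      qed
      finally show ?thesis by (simp add: T_def algebra_simps)
    qed
    have "v r0 - (1 + ?C) * N * r0 powr e \<le> v b0"
    proof (rule continuous_ge_on_closure[where f = v and x = b0 and S = "{b0<..<r0}"])
      have cl: "closure {b0<..<r0} = {b0..r0}" using b0 by simp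
      show "continuous_on (closure {b0<..<r0}) v" unfolding cl using b0 r0 by (intro continuous_on_subset[OF cv]) auto
      show "b0 \<in> closure {b0<..<r0}" unfolding cl using b0 by simp
      show "v r0 - (1 + ?C) * N * r0 powr e \<le> v x" if "x \<in> {b0<..<r0}" for x using main[of x] that by auto
    qed
    moreover have "v b0 = v (r0 / 2)"
    proof (cases "a \<le> r0 / 2")
      case True
      then show ?thesis by (simp add: b0_def)
    next
      case False
      obtain z where "r0 / 2 < z" "z < a" "v a - v (r0 / 2) = (a - r0 / 2) * w z"
        using MVT2[of "r0 / 2" a v w] False r0 ar' dv by auto
      then show ?thesis using zero[of z] False r0 by (simp add: b0_def)
    qed
    ultimately show ?thesis by simp
  qed
qed

end

lemma C1_on_UNIV_measurable:
  fixes \<eta> :: "real^'n::finite \<Rightarrow> real"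
  assumes "C1_on UNIV \<eta>"
  shows "\<eta> \<in> borel_measurable borel" "partial i \<eta> \<in> borel_measurable borel"
  using assms C1_on_continuous[OF assms] by (auto simp: C1_on_def intro!: borel_measurable_continuous_onI)

lemma integrable_mult_compact_support:
  fixes f \<phi> :: "real^'n::finite \<Rightarrow> real"
  assumes f: "f absolutely_integrable_on K" and K: "compact K" and \<phi>: "continuous_on UNIV \<phi>" "\<And>x. x \<notin> K \<Longrightarrow> \<phi> x = 0"
  shows "integrable lebesgue (\<lambda>x. f x * \<phi> x)"
proof -
  have "compact (\<phi> ` K)" using \<phi>(1) K by (intro compact_continuous_image continuous_on_subset[OF \<phi>(1)]) auto
  from compact_imp_bounded[OF this] obtain B where B: "\<forall>y\<in>\<phi> ` K. norm y \<le> B" unfolding bounded_iff by blast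
  have i: "integrable lebesgue (\<lambda>x. indicator K x *\<^sub>R f x)" using f by (simp add: set_integrable_def)
  have [measurable]: "\<phi> \<in> borel_measurable lebesgue"
    using \<phi>(1) by (intro measurable_completion) (simp add: borel_measurable_continuous_onI)
  have eq: "(\<lambda>x. f x * \<phi> x) = (\<lambda>x. (indicator K x *\<^sub>R f x) * \<phi> x)"
  proof
    fix x show "f x * \<phi> x = (indicator K x *\<^sub>R f x) * \<phi> x" using \<phi>(2)[of x] by (cases "x \<in> K") auto
  qed
  show ?thesis unfolding eq
  proof (rule Bochner_Integration.integrable_bound[OF integrable_mult_right[OF integrable_abs[OF i], of "\<bar>B\<bar>"]])
    show "(\<lambda>x. indicat_real K x *\<^sub>R f x * \<phi> x) \<in> borel_measurable lebesgue"
      using borel_measurable_integrable[OF i] by measurable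
    show "AE x in lebesgue. norm (indicat_real K x *\<^sub>R f x * \<phi> x) \<le> norm (\<bar>B\<bar> * \<bar>indicat_real K x *\<^sub>R f x\<bar>)"
    proof (rule AE_I2)
      fix x :: "real^'n"
      show "norm (indicat_real K x *\<^sub>R f x * \<phi> x) \<le> norm (\<bar>B\<bar> * \<bar>indicat_real K x *\<^sub>R f x\<bar>)"
      proof (cases "x \<in> K")
        case True
        then have "\<bar>\<phi> x\<bar> \<le> \<bar>B\<bar>" using B by fastforce
        then show ?thesis using True by (simp add: abs_mult mult.commute[of "\<bar>f x\<bar>"] mult_right_mono)
      qed simp
    qed
  qed
qed

lemma weak_gradient_dilation:
  fixes u :: "real^'n::finite \<Rightarrow> real"
  assumes W: "has_weak_gradient A u Du" and \<eta>: "\<eta> \<in> Cc1 A"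
  shows "(LINT x|lebesgue. u x * (real CARD('n) * \<eta> x + (\<Sum>i\<in>UNIV. x $ i * partial i \<eta> x))) = - (LINT x|lebesgue. (Du x \<bullet> x) * \<eta> x)"
    and "integrable lebesgue (\<lambda>x. u x * (real CARD('n) * \<eta> x + (\<Sum>i\<in>UNIV. x $ i * partial i \<eta> x)))"
    and "integrable lebesgue (\<lambda>x. (Du x \<bullet> x) * \<eta> x)"
proof -
  define K where "K = closure {x. \<eta> x \<noteq> 0}"
  have K: "compact K" "K \<subseteq> A" and C1: "C1_on UNIV \<eta>" using \<eta> by (auto simp: Cc1_def K_def)
  have ui: "u absolutely_integrable_on K" and Di: "Du absolutely_integrable_on K"
    using W K by (auto simp: has_weak_gradient_def)
  have Dui: "(\<lambda>x. Du x $ i) absolutely_integrable_on K" for i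
    using absolutely_integrable_component[OF Di, of "axis i 1"] by (simp add: inner_axis)
  have out: "\<eta> x = 0" "partial i \<eta> x = 0" if "x \<notin> K" for x i
    using that partial_eq_0_outside[of x \<eta> i] closure_subset[of "{x. \<eta> x \<noteq> 0}"] by (auto simp: K_def)
  define e where "e = (\<lambda>i (x::real^'n). x $ i * \<eta> x)"
  have e: "e i \<in> Cc1 A" for i unfolding e_def by (rule Cc1_mult[OF C1_on_coordinate \<eta>])
  have pe: "partial i (e i) x = x $ i * partial i \<eta> x + \<eta> x" for i x
    unfolding e_def using C1 C1_on_coordinate[of UNIV i]
    by (subst partial_mult) (auto simp: C1_on_def partial_coordinate)
  have c\<eta>: "continuous_on UNIV \<eta>" "continuous_on UNIV (partial i \<eta>)" for i
    using C1 C1_on_continuous[OF C1] by (auto simp: C1_on_def)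
  have ci: "continuous_on UNIV (\<lambda>x::real^'n. x $ i)" for i by (intro continuous_intros)
  have i1: "integrable lebesgue (\<lambda>x. u x * partial i (e i) x)" for i
    by (rule integrable_mult_compact_support[OF ui K(1)]) (auto simp: pe out intro!: continuous_intros c\<eta> ci)
  have i2: "integrable lebesgue (\<lambda>x. Du x $ i * e i x)" for i
    by (rule integrable_mult_compact_support[OF Dui K(1)]) (auto simp: e_def out intro!: continuous_intros c\<eta> ci)
  have restr: "(LINT x:A|lebesgue. f x) = (LINT x|lebesgue. f x)" if "\<And>x. x \<notin> K \<Longrightarrow> f x = 0" for f :: "real^'n \<Rightarrow> real"
    unfolding set_lebesgue_integral_def using that K(2)
    by (intro Bochner_Integration.integral_cong) (auto simp: indicator_def)
  have eq: "(LINT x|lebesgue. u x * partial i (e i) x) = - (LINT x|lebesgue. Du x $ i * e i x)" for i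
  proof -
    have "(LINT x:A|lebesgue. u x * partial i (e i) x) = - (LINT x:A|lebesgue. Du x $ i * e i x)"
      using W e[of i] by (auto simp: has_weak_gradient_def)
    moreover have "u x * partial i (e i) x = 0" "Du x $ i * e i x = 0" if "x \<notin> K" for x
      using that by (simp add: pe out, simp add: e_def out)
    ultimately show ?thesis using restr[of "\<lambda>x. u x * partial i (e i) x"] restr[of "\<lambda>x. Du x $ i * e i x"] by simp
  qed
  have s1: "u x * (real CARD('n) * \<eta> x + (\<Sum>i\<in>UNIV. x $ i * partial i \<eta> x)) = (\<Sum>i\<in>UNIV. u x * partial i (e i) x)" for x
    by (simp add: pe sum.distrib algebra_simps flip: sum_distrib_left)
  have s2: "(Du x \<bullet> x) * \<eta> x = (\<Sum>i\<in>UNIV. Du x $ i * e i x)" for x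
    by (simp add: e_def inner_vec_def sum_distrib_left mult_ac)
  show "integrable lebesgue (\<lambda>x. u x * (real CARD('n) * \<eta> x + (\<Sum>i\<in>UNIV. x $ i * partial i \<eta> x)))"
    unfolding s1 using i1 by (intro Bochner_Integration.integrable_sum)
  show "integrable lebesgue (\<lambda>x. (Du x \<bullet> x) * \<eta> x)"
    unfolding s2 using i2 by (intro Bochner_Integration.integrable_sum)
  show "(LINT x|lebesgue. u x * (real CARD('n) * \<eta> x + (\<Sum>i\<in>UNIV. x $ i * partial i \<eta> x))) = - (LINT x|lebesgue. (Du x \<bullet> x) * \<eta> x)"
    unfolding s1 s2 using i1 i2 eq by (simp add: Bochner_Integration.integral_sum sum_negf)
qed

lemma smooth_step_kernel:
  assumes "0 < d"
  shows "((\<lambda>r. smooth_step' ((r - a) / d) / d) has_integral 1) {a..a + d}"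
proof -
  have D: "((\<lambda>r. smooth_step ((r - a) / d)) has_real_derivative smooth_step' ((r - a) / d) / d) (at r)" for r
  proof -
    have "((\<lambda>r. (r - a) / d) has_real_derivative 1 / d) (at r)" using assms by (auto intro!: derivative_eq_intros)
    from DERIV_chain2[OF smooth_step_DERIV this] show ?thesis by simp
  qed
  have "((\<lambda>r. smooth_step' ((r - a) / d) / d) has_integral (smooth_step ((a + d - a) / d) - smooth_step ((a - a) / d))) {a..a + d}"
    using assms D by (intro fundamental_theorem_of_calculus)
      (auto simp: has_real_derivative_iff_has_vector_derivative[symmetric] intro: has_field_derivative_at_within)
  then show ?thesis using assms by (simp add: smooth_step_0 smooth_step_1)
qed

text \<open>pushforward\<close>
lemma radial_pushforward_density:
  fixes F :: "real^'n::finite \<Rightarrow> real"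
  assumes F: "integrable lebesgue F" and F0: "\<And>x. 0 \<le> F x"
  obtains h where "integrable lborel h" "\<And>r. 0 \<le> h r"
    "\<And>\<psi>. \<psi> \<in> borel_measurable borel \<Longrightarrow> (LINT x|lebesgue. F x * \<psi> (norm x)) = (LINT r|lborel. h r * \<psi> r)"
proof -
  have [measurable]: "F \<in> borel_measurable lebesgue" using F by auto
  have nm [measurable]: "(norm :: real^'n \<Rightarrow> real) \<in> borel_measurable lebesgue" by (intro measurable_completion) simp
  define N where "N = distr (density lebesgue (\<lambda>x. ennreal (F x))) borel (norm :: real^'n \<Rightarrow> real)"
  have sN: "sets N = sets lborel" by (simp add: N_def)
  have eN: "emeasure N A = (\<integral>\<^sup>+x. ennreal (F x) * indicator {x. norm x \<in> A} x \<partial>lebesgue)" if [measurable]: "A \<in> sets borel" for A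
  proof -
    have s: "norm -` A \<inter> space lebesgue \<in> sets (lebesgue :: (real^'n) measure)" by (rule measurable_sets[OF nm that])
    have "emeasure N A = emeasure (density lebesgue (\<lambda>x. ennreal (F x))) (norm -` A \<inter> space lebesgue)"
      unfolding N_def by (subst emeasure_distr) auto
    also have "\<dots> = (\<integral>\<^sup>+x. ennreal (F x) * indicator (norm -` A \<inter> space lebesgue) x \<partial>lebesgue)"
      using s by (subst emeasure_density) auto
    also have "norm -` A \<inter> space lebesgue = {x::real^'n. norm x \<in> A}" by auto
    finally show ?thesis .
  qed
  have "absolutely_continuous lborel N"
    unfolding absolutely_continuous_def
  proof
    fix A assume A: "A \<in> null_sets (lborel :: real measure)"
    then have [measurable]: "A \<in> sets borel" by auto
    have "{x::real^'n. norm x \<in> A} \<in> null_sets lebesgue" by (intro null_sets_completionI null_radial A)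
    then have "(\<integral>\<^sup>+x. ennreal (F x) * indicator {x. norm x \<in> A} x \<partial>lebesgue) = (\<integral>\<^sup>+x. 0 \<partial>(lebesgue :: (real^'n) measure))"
      by (intro nn_integral_cong_AE AE_I'[of "{x. norm x \<in> A}"]) (auto simp: indicator_def)
    then show "A \<in> null_sets N" by (intro null_setsI) (simp_all add: eN sN)
  qed
  then have dens: "density lborel (RN_deriv lborel N) = N"
    by (rule sigma_finite_measure.density_RN_deriv[OF lborel.sigma_finite_measure_axioms]) (rule sN)
  define g where "g = RN_deriv lborel N"
  have [measurable]: "g \<in> borel_measurable borel" by (simp add: g_def borel_measurable_RN_deriv[of lborel N, simplified])
  have Ng: "N = density lborel g" unfolding g_def by (rule dens[symmetric])
  have fin: "(\<integral>\<^sup>+r. g r \<partial>lborel) = ennreal (LINT x|lebesgue. F x)"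
  proof -
    have "(\<integral>\<^sup>+r. g r \<partial>lborel) = emeasure (density lborel g) UNIV" by (subst emeasure_density) auto
    also have "\<dots> = emeasure N UNIV" unfolding Ng ..
    also have "\<dots> = (\<integral>\<^sup>+x. ennreal (F x) \<partial>lebesgue)" by (subst eN) auto
    also have "\<dots> = ennreal (LINT x|lebesgue. F x)" using F F0 by (intro nn_integral_eq_integral) auto
    finally show ?thesis .
  qed
  then have "AE r in lborel. g r \<noteq> \<infinity>" by (intro nn_integral_PInf_AE) auto
  then have ae: "AE r in lborel. g r = ennreal (enn2real (g r))" by eventually_elim (simp add: less_top)
  define h where "h = (\<lambda>r. enn2real (g r))"
  have [measurable]: "h \<in> borel_measurable borel" unfolding h_def by measurable
  have Nh: "N = density lborel (\<lambda>r. ennreal (h r))"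
    unfolding Ng h_def using ae by (intro density_cong) auto
  show ?thesis
  proof (rule that)
    show "0 \<le> h r" for r by (simp add: h_def)
    have "(\<integral>\<^sup>+r. ennreal (h r) \<partial>lborel) = (\<integral>\<^sup>+r. g r \<partial>lborel)"
      using ae by (intro nn_integral_cong_AE) (auto simp: h_def)
    then show "integrable lborel h" using fin by (intro integrableI_nonneg) (auto simp: h_def)
    fix \<psi> :: "real \<Rightarrow> real" assume [measurable]: "\<psi> \<in> borel_measurable borel"
    have [measurable]: "(\<lambda>x::real^'n. \<psi> (norm x)) \<in> borel_measurable lebesgue"
      by (rule measurable_compose[OF nm]) simp
    have "(LINT x|lebesgue. F x * \<psi> (norm x)) = (LINT x|density lebesgue (\<lambda>x. ennreal (F x)). \<psi> (norm x))"
      by (subst integral_density) (auto simp: F0)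
    also have "\<dots> = (LINT r|N. \<psi> r)" unfolding N_def by (subst integral_distr) auto
    also have "\<dots> = (LINT r|lborel. h r * \<psi> r)" unfolding Nh by (subst integral_density) (auto simp: h_def)
    finally show "(LINT x|lebesgue. F x * \<psi> (norm x)) = (LINT r|lborel. h r * \<psi> r)" .
  qed
qed

lemma kernel_limit:
  assumes v: "continuous_on {a..a + d0} v" and d0: "0 < d0" and e: "0 < (e::real)"
  obtains d1 where "0 < d1" "\<And>d. 0 < d \<Longrightarrow> d < d1 \<Longrightarrow> d \<le> d0 \<Longrightarrow> \<bar>integral {a..a + d} (\<lambda>r. v r * (smooth_step' ((r - a) / d) / d)) - v a\<bar> \<le> e"
proof -
  have "\<forall>e>0. \<exists>t>0. \<forall>x\<in>{a..a + d0}. dist x a < t \<longrightarrow> dist (v x) (v a) < e"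
    using v unfolding continuous_on_iff by (rule bspec) (use d0 in simp)
  then obtain t where t: "0 < t" "\<And>x. x \<in> {a..a + d0} \<Longrightarrow> \<bar>x - a\<bar> < t \<Longrightarrow> \<bar>v x - v a\<bar> < e"
    using e by (auto simp: dist_real_def)
  show ?thesis
  proof (rule that[OF t(1)])
    fix d assume d: "0 < d" "d < t" "d \<le> d0"
    let ?K = "\<lambda>r. smooth_step' ((r - a) / d) / d"
    have K: "(?K has_integral 1) {a..a + d}" by (rule smooth_step_kernel[OF d(1)])
    have cK: "continuous_on A ?K" for A
      by (intro continuous_intros continuous_on_compose2[OF smooth_step'_continuous[of UNIV]]) (use d in auto)
    have "(\<lambda>r. v r * ?K r) integrable_on {a..a + d}"
      by (intro integrable_continuous_real continuous_on_mult cK continuous_on_subset[OF v]) (use d in auto)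
    then have i: "((\<lambda>r. v r * ?K r - v a * ?K r) has_integral (integral {a..a + d} (\<lambda>r. v r * ?K r) - v a * 1)) {a..a + d}"
      using K by (intro has_integral_diff has_integral_mult_right integrable_integral)
    have b: "\<bar>v r * ?K r - v a * ?K r\<bar> \<le> e * ?K r" if "r \<in> {a..a + d}" for r
    proof -
      have "\<bar>v r - v a\<bar> \<le> e" using t(2)[of r] that d by auto
      moreover have "0 \<le> ?K r" using d smooth_step'_range(1) by simp
      ultimately have "\<bar>v r - v a\<bar> * ?K r \<le> e * ?K r" by (rule mult_right_mono)
      moreover have "\<bar>v r * ?K r - v a * ?K r\<bar> = \<bar>v r - v a\<bar> * ?K r"
        using \<open>0 \<le> ?K r\<close> by (simp only: left_diff_distrib[symmetric] abs_mult abs_of_nonneg)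
      ultimately show ?thesis by linarith
    qed
    have "integral {a..a + d} (\<lambda>r. v r * ?K r) - v a * 1 \<le> e * 1"
      by (rule has_integral_le[OF i has_integral_mult_right[OF K]]) (use b in \<open>auto simp: abs_le_iff\<close>)
    moreover have "e * - 1 \<le> integral {a..a + d} (\<lambda>r. v r * ?K r) - v a * 1"
      by (rule has_integral_le[OF has_integral_mult_right[OF has_integral_neg[OF K]] i]) (use b in \<open>force simp: abs_le_iff\<close>)
    ultimately show "\<bar>integral {a..a + d} (\<lambda>r. v r * ?K r) - v a\<bar> \<le> e" by (simp add: abs_le_iff)
  qed
qed

locale radial_sobolev =
  fixes u :: "real^'n::finite \<Rightarrow> real" and Du :: "real^'n \<Rightarrow> real^'n" and v :: "real \<Rightarrow> real" and k :: nat
  assumes radial: "\<And>x. u x = v (norm x)" and cv: "continuous_on {0<..1} v"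
    and W: "in_W k (ball 0 1) u Du"
    and rd0: "AE x in lebesgue. x \<in> ball 0 1 \<longrightarrow> radial_deriv Du x \<ge> 0"
begin

abbreviation "B1 \<equiv> ball (0::real^'n) 1"

lemma wg: "has_weak_gradient B1 u Du" using W by (simp add: in_W_def)

lemma Du_measurable: "(\<lambda>x. indicator B1 x *\<^sub>R Du x) \<in> borel_measurable lebesgue"
proof (rule borel_measurable_LIMSEQ_metric)
  fix j :: nat
  have "Du absolutely_integrable_on cball 0 (1 - 1 / real (j + 2))"
  proof -
    have "cball 0 q \<subseteq> B1" if "q < 1" for q using that by auto
    then have "cball 0 (1 - 1 / real (j + 2)) \<subseteq> B1" by simp
    moreover have "Du absolutely_integrable_on K" if "compact K" "K \<subseteq> B1" for K
      using wg that by (simp add: has_weak_gradient_def)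
    ultimately show ?thesis using compact_cball by metis
  qed
  then show "(\<lambda>x. indicator (cball 0 (1 - 1 / real (j + 2))) x *\<^sub>R Du x) \<in> borel_measurable lebesgue"
    by (auto simp: set_integrable_def)
next
  fix x :: "real^'n"
  show "(\<lambda>j. indicator (cball 0 (1 - 1 / real (j + 2))) x *\<^sub>R Du x) \<longlonglongrightarrow> indicator B1 x *\<^sub>R Du x"
  proof (cases "x \<in> B1")
    case True
    then have "0 < 1 - norm x" by simp
    then obtain J :: nat where J: "1 / real (Suc J) < 1 - norm x" using nat_approx_posE by blast
    have "indicator (cball 0 (1 - 1 / real (j + 2))) x *\<^sub>R Du x = indicator B1 x *\<^sub>R Du x" if "J \<le> j" for j
    proof -
      have "1 / real (j + 2) \<le> 1 / real (Suc J)" using that by (intro divide_left_mono) auto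
      then show ?thesis using J True by simp
    qed
    then show ?thesis by (intro tendsto_eventually) (auto simp: eventually_sequentially)
  next
    case False
    have "x \<notin> cball 0 (1 - 1 / real (j + 2))" for j :: nat
    proof -
      have "0 < 1 / real (j + 2)" by simp
      moreover have "1 \<le> norm x" using False by simp
      ultimately show ?thesis unfolding mem_cball_0 by linarith
    qed
    then show ?thesis using False by simp
  qed
qed

definition F :: "real^'n \<Rightarrow> real" where "F x = indicator B1 x * max 0 (Du x \<bullet> x)"

lemma F_nonneg: "0 \<le> F x" by (simp add: F_def)

lemma F_eq: "AE x in lebesgue. x \<in> B1 \<longrightarrow> F x = Du x \<bullet> x"
  using rd0
proof eventually_elim
  case (elim x)
  show ?case
  proof
    assume x: "x \<in> B1"
    then have "0 \<le> (Du x \<bullet> x) / norm x" using elim by (simp add: radial_deriv_def)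
    then have "0 \<le> Du x \<bullet> x" by (cases "x = 0") (auto simp: zero_le_divide_iff)
    then show "F x = Du x \<bullet> x" using x by (simp add: F_def)
  qed
qed

lemma F_measurable: "F \<in> borel_measurable lebesgue"
proof -
  have "F = (\<lambda>x. max 0 ((indicator B1 x *\<^sub>R Du x) \<bullet> x))" by (auto simp: F_def indicator_def)
  moreover have idm: "(\<lambda>x::real^'n. x) \<in> borel_measurable lebesgue" by (intro measurable_completion) simp
  moreover have "(\<lambda>x. max 0 ((indicator B1 x *\<^sub>R Du x) \<bullet> x)) \<in> borel_measurable lebesgue"
    by (intro borel_measurable_max borel_measurable_const borel_measurable_inner Du_measurable idm)
  ultimately show ?thesis by (simp only:)
qed

lemma F_integrable: "integrable lebesgue F"
proof (rule Bochner_Integration.integrable_bound[OF _ F_measurable])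
  have "integrable lebesgue (indicator B1 :: real^'n \<Rightarrow> real)"
    using lmeasurable_ball[of "0::real^'n" 1] by (simp add: fmeasurable_def)
  moreover have "integrable lebesgue (\<lambda>x. indicator B1 x *\<^sub>R (norm x powr (1 - real k) * norm (Du x) ^ (k + 1)))"
    using W by (simp add: in_W_def set_integrable_def)
  ultimately show "integrable lebesgue (\<lambda>x. indicator B1 x + indicator B1 x *\<^sub>R (norm x powr (1 - real k) * norm (Du x) ^ (k + 1)))"
    by (rule Bochner_Integration.integrable_add)
  show "AE x in lebesgue. norm (F x) \<le> norm (indicator B1 x + indicator B1 x *\<^sub>R (norm x powr (1 - real k) * norm (Du x) ^ (k + 1)))"
  proof (rule AE_I2)
    fix x :: "real^'n"
    show "norm (F x) \<le> norm (indicator B1 x + indicator B1 x *\<^sub>R (norm x powr (1 - real k) * norm (Du x) ^ (k + 1)))"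
    proof (cases "x \<in> B1 \<and> x \<noteq> 0")
      case True
      then have x: "0 < norm x" "norm x < 1" by auto
      have "\<bar>Du x \<bullet> x\<bar> \<le> norm (Du x) * norm x" by (rule Cauchy_Schwarz_ineq2)
      also have "\<dots> \<le> norm (Du x)" using x by (simp add: mult_left_le)
      finally have 1: "\<bar>Du x \<bullet> x\<bar> \<le> norm (Du x)" .
      show ?thesis
      proof (cases "k = 0")
        case k0: True
        show ?thesis using True 1 x
        proof -
          have "(Du x \<bullet> x) \<le> norm (Du x) * norm x" by (rule norm_cauchy_schwarz)
          then have "max 0 (Du x \<bullet> x) \<le> norm x * norm (Du x)" using x by (simp add: mult.commute)
          then show ?thesis using True x k0 by (simp add: F_def)
        qed
      next
        case False
        have "norm (Du x) \<le> 1 + norm (Du x) ^ (k + 1)"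
        proof (cases "norm (Du x) \<le> 1")
          case False
          then have "norm (Du x) \<le> norm (Du x) ^ (k + 1)" by (intro self_le_power) auto
          then show ?thesis by simp
        qed (simp add: add_increasing2)
        also have "norm (Du x) ^ (k + 1) \<le> norm x powr (1 - real k) * norm (Du x) ^ (k + 1)"
        proof -
          have "norm x powr 0 \<le> norm x powr (1 - real k)" using x False by (intro powr_mono') auto
          then show ?thesis using x mult_right_mono[of 1 "norm x powr (1 - real k)" "norm (Du x) ^ (k + 1)"] by simp
        qed
        finally have "\<bar>Du x \<bullet> x\<bar> \<le> 1 + norm x powr (1 - real k) * norm (Du x) ^ (k + 1)" using 1 by linarith
        then show ?thesis using True by (simp add: F_def)
      qed
    qed (auto simp: F_def)
  qed
qed

definition h :: "real \<Rightarrow> real" where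
  "h = (SOME h. integrable lborel h \<and> (\<forall>r. 0 \<le> h r) \<and>
     (\<forall>\<psi>\<in>borel_measurable borel. (LINT x|lebesgue. F x * \<psi> (norm x)) = (LINT r|lborel. h r * \<psi> r)))"

lemma h: "integrable lborel h" "\<And>r. 0 \<le> h r"
    "\<And>\<psi>. \<psi> \<in> borel_measurable borel \<Longrightarrow> (LINT x|lebesgue. F x * \<psi> (norm x)) = (LINT r|lborel. h r * \<psi> r)"
proof -
  have "\<exists>h. integrable lborel h \<and> (\<forall>r. 0 \<le> h r) \<and>
     (\<forall>\<psi>\<in>borel_measurable borel. (LINT x|lebesgue. F x * \<psi> (norm x)) = (LINT r|lborel. h r * \<psi> r))"
    using radial_pushforward_density[OF F_integrable F_nonneg] by metis
  from someI_ex[OF this]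
  have H: "integrable lborel h \<and> (\<forall>r. 0 \<le> h r) \<and>
     (\<forall>\<psi>\<in>borel_measurable borel. (LINT x|lebesgue. F x * \<psi> (norm x)) = (LINT r|lborel. h r * \<psi> r))"
    unfolding h_def .
  show "integrable lborel h" "\<And>r. 0 \<le> h r"
    "\<And>\<psi>. \<psi> \<in> borel_measurable borel \<Longrightarrow> (LINT x|lebesgue. F x * \<psi> (norm x)) = (LINT r|lborel. h r * \<psi> r)"
    using H by blast+
qed

lemma h_measurable [measurable]: "h \<in> borel_measurable borel" using h(1) by auto

definition \<kappa> :: real where "\<kappa> = real CARD('n) * unit_ball_vol (real CARD('n))"

lemma \<kappa>_pos: "0 < \<kappa>" by (simp add: \<kappa>_def)

definition m :: "real \<Rightarrow> real" where "m r = (if 0 < r \<and> r < 1 then h r / (\<kappa> * r ^ CARD('n)) else 0)"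

lemma m_measurable [measurable]: "m \<in> borel_measurable borel" unfolding m_def by measurable

lemma m_nonneg: "0 \<le> m r" using h(2)[of r] \<kappa>_pos by (simp add: m_def)

lemma h_eq: "0 < r \<Longrightarrow> r < 1 \<Longrightarrow> h r = \<kappa> * r ^ CARD('n) * m r"
  using \<kappa>_pos by (simp add: m_def)

lemma m_integrable: "0 < a \<Longrightarrow> b < 1 \<Longrightarrow> integrable lborel (\<lambda>r. indicator {a..b} r * m r)"
proof (rule Bochner_Integration.integrable_bound[OF integrable_mult_right[OF h(1), of "1 / (\<kappa> * a ^ CARD('n))"]])
  assume ab: "0 < a" "b < 1"
  show "AE r in lborel. norm (indicator {a..b} r * m r) \<le> norm (1 / (\<kappa> * a ^ CARD('n)) * h r)"
  proof (rule AE_I2)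
    fix r
    show "norm (indicator {a..b} r * m r) \<le> norm (1 / (\<kappa> * a ^ CARD('n)) * h r)"
    proof (cases "r \<in> {a..b}")
      case True
      have "a ^ CARD('n) \<le> r ^ CARD('n)" using True ab by (intro power_mono) auto
      then have "h r / (\<kappa> * r ^ CARD('n)) \<le> h r / (\<kappa> * a ^ CARD('n))"
        using True ab \<kappa>_pos h(2)[of r] by (intro divide_left_mono mult_left_mono) auto
      then show ?thesis using True ab \<kappa>_pos h(2)[of r] by (simp add: m_def)
    qed simp
  qed
qed measurable

lemma weak_derivative_1D:
  assumes b: "bump_fun \<alpha> \<beta> \<xi> \<xi>'" and ab: "0 < \<alpha>" "\<beta> < 1"
  shows "(LINT r|lborel. v r * \<xi>' r) = - (LINT r|lborel. m r * \<xi> r)"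
proof -
  let ?n = "CARD('n)"
  define \<psi> where "\<psi> = (\<lambda>r. \<xi> r / r ^ ?n)"
  define \<psi>' where "\<psi>' = (\<lambda>r. \<xi>' r / (max \<alpha> r) ^ ?n - real ?n * \<xi> r / (max \<alpha> r) ^ (?n + 1))"
  have \<xi>0: "\<xi> r = 0" "\<xi>' r = 0" if "r \<notin> {\<alpha>..\<beta>}" for r
    using b bump_fun_deriv_0[OF b] that by (auto simp: bump_fun_def)
  have c: "continuous_on UNIV \<xi>" "continuous_on UNIV \<xi>'"
    using b by (auto simp: bump_fun_def intro: DERIV_isCont intro!: continuous_at_imp_continuous_on)
  have bp: "bump_fun \<alpha> \<beta> \<psi> \<psi>'"
    unfolding bump_fun_def
  proof (intro conjI allI impI)
    show "\<psi> r = 0" if "r \<notin> {\<alpha>..\<beta>}" for r using \<xi>0[OF that] by (simp add: \<psi>_def)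
    show "continuous_on UNIV \<psi>'" unfolding \<psi>'_def using ab by (intro continuous_intros c) auto
    fix r
    show "(\<psi> has_real_derivative \<psi>' r) (at r)"
    proof (cases "r < \<alpha>")
      case True
      have "(\<psi> has_real_derivative 0) (at r)"
        by (rule has_field_derivative_transform_within_open[OF DERIV_const[of 0], of "{..<\<alpha>}"])
           (use True \<xi>0 in \<open>auto simp: \<psi>_def\<close>)
      then show ?thesis using True \<xi>0[of r] by (simp add: \<psi>'_def)
    next
      case False
      then have r: "0 < r" using ab by simp
      have "(\<xi> has_real_derivative \<xi>' r) (at r)" using b by (simp add: bump_fun_def)
      then have "(\<psi> has_real_derivative (\<xi>' r * r ^ ?n - \<xi> r * (real ?n * r ^ (?n - 1))) / (r ^ ?n * r ^ ?n)) (at r)"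
        unfolding \<psi>_def using r by (auto intro!: derivative_eq_intros)
      moreover have "(\<xi>' r * r ^ ?n - \<xi> r * (real ?n * r ^ (?n - 1))) / (r ^ ?n * r ^ ?n) = \<psi>' r"
      proof -
        have "r ^ ?n = r ^ (?n - 1) * r" by (metis power_minus_mult zero_less_card_finite)
        then show ?thesis using False r by (simp add: \<psi>'_def max_def divide_simps) (simp add: algebra_simps)
      qed
      ultimately show ?thesis by simp
    qed
  qed
  define \<eta> where "\<eta> = (\<lambda>x::real^'n. \<psi> (norm x))"
  have \<eta>: "\<eta> \<in> Cc1 B1"
    using radial_test_Cc1[OF bp ab, where 'n = 'n] by (auto simp: Cc1_def \<eta>_def)
  define f where "f = (\<lambda>r. (if r \<in> {\<alpha>..\<beta>} then v r else 0) * (real ?n * \<psi> r + r * \<psi>' r))"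
  have cp: "continuous_on UNIV \<psi>" "continuous_on UNIV \<psi>'"
    using bp by (auto simp: bump_fun_def intro: DERIV_isCont intro!: continuous_at_imp_continuous_on)
  have vm [measurable]: "(\<lambda>r. if r \<in> {\<alpha>..\<beta>} then v r else 0) \<in> borel_measurable borel"
    using ab by (intro borel_measurable_continuous_on_if continuous_on_subset[OF cv]) auto
  have [measurable]: "\<psi> \<in> borel_measurable borel" "\<psi>' \<in> borel_measurable borel"
    using cp by (auto intro: borel_measurable_continuous_onI)
  have [measurable]: "f \<in> borel_measurable borel"
    unfolding f_def using cp by (intro borel_measurable_times vm borel_measurable_continuous_onI continuous_intros)
  have "u x * (real ?n * \<eta> x + (\<Sum>i\<in>UNIV. x $ i * partial i \<eta> x)) = f (norm x)" for x
  proof (cases "norm x \<in> {\<alpha>..\<beta>}")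
    case True
    then have x: "x \<noteq> 0" using ab by auto
    have "(\<Sum>i\<in>UNIV. x $ i * partial i \<eta> x) = \<psi>' (norm x) / norm x * (\<Sum>i\<in>UNIV. x $ i * x $ i)"
      unfolding \<eta>_def partial_radial_test[OF bp ab(1)] by (simp add: sum_distrib_left algebra_simps)
    also have "(\<Sum>i\<in>UNIV. x $ i * x $ i) = (norm x)\<^sup>2"
      by (simp add: power2_norm_eq_inner inner_vec_def)
    finally show ?thesis using True x by (simp add: f_def radial \<eta>_def power2_eq_square algebra_simps)
  next
    case False
    then have "\<psi> (norm x) = 0" "\<psi>' (norm x) = 0" using bp bump_fun_deriv_0[OF bp] by (auto simp: bump_fun_def)
    then show ?thesis unfolding \<eta>_def partial_radial_test[OF bp ab(1)] by (simp add: f_def)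
  qed
  then have "(LINT x|lebesgue. f (norm (x::real^'n))) = - (LINT x|lebesgue. (Du x \<bullet> x) * \<eta> x)"
    using weak_gradient_dilation(1)[OF wg \<eta>] by simp
  also have "(LINT x|lebesgue. (Du x \<bullet> x) * \<eta> x) = (LINT x|lebesgue. F x * \<psi> (norm x))"
  proof (rule integral_cong_AE)
    show "(\<lambda>x. (Du x \<bullet> x) * \<eta> x) \<in> borel_measurable lebesgue"
      using weak_gradient_dilation(3)[OF wg \<eta>] by auto
    have "(\<lambda>x::real^'n. \<psi> (norm x)) \<in> borel_measurable lebesgue" by (intro measurable_completion) simp
    then show "(\<lambda>x. F x * \<psi> (norm x)) \<in> borel_measurable lebesgue" using F_measurable by simp
    show "AE x in lebesgue. Du x \<bullet> x * \<eta> x = F x * \<psi> (norm x)"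
      using F_eq
    proof eventually_elim
      case (elim x)
      then show ?case using bp ab by (cases "x \<in> B1") (auto simp: \<eta>_def bump_fun_def)
    qed
  qed
  also have "\<dots> = (LINT r|lborel. h r * \<psi> r)" by (rule h(3)) measurable
  also have "\<dots> = (LINT r|lborel. \<kappa> * (m r * \<xi> r))"
  proof (rule Bochner_Integration.integral_cong[OF refl])
    fix r
    show "h r * \<psi> r = \<kappa> * (m r * \<xi> r)"
      using \<xi>0[of r] ab h_eq[of r] by (cases "r \<in> {\<alpha>..\<beta>}") (auto simp: \<psi>_def)
  qed
  also have "(LINT x|lebesgue. f (norm (x::real^'n))) = (LINT r|lborel. radial_density ?n r * f r)"
    by (rule integral_radial) measurable
  also have "\<dots> = (LINT r|lborel. \<kappa> * (v r * \<xi>' r))"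
  proof (rule Bochner_Integration.integral_cong[OF refl])
    fix r
    show "radial_density ?n r * f r = \<kappa> * (v r * \<xi>' r)"
    proof (cases "r \<in> {\<alpha>..\<beta>}")
      case True
      then have r: "0 < r" using ab by simp
      have "real ?n * \<psi> r + r * \<psi>' r = \<xi>' r / r ^ (?n - 1)"
      proof -
        have "r ^ ?n = r ^ (?n - 1) * r" by (metis power_minus_mult zero_less_card_finite)
        then show ?thesis using True r by (simp add: \<psi>_def \<psi>'_def max_def divide_simps)
      qed
      then show ?thesis using True r by (simp add: f_def radial_density_def \<kappa>_def)
    qed (use \<xi>0 in \<open>auto simp: f_def\<close>)
  qed
  finally have "\<kappa> * (LINT r|lborel. v r * \<xi>' r) = \<kappa> * (- (LINT r|lborel. m r * \<xi> r))" by simp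
  then show ?thesis using \<kappa>_pos unfolding mult_cancel_left by linarith
qed

end

lemma lint_eq_integral:
  fixes f :: "real \<Rightarrow> real"
  assumes "continuous_on {a..b} f" "\<And>x. x \<notin> {a..b} \<Longrightarrow> f x = 0"
  shows "integrable lborel f" "(LINT x|lborel. f x) = integral {a..b} f"
proof -
  have eq: "(\<lambda>x. indicator {a..b} x *\<^sub>R f x) = f"
  proof
    fix x show "indicator {a..b} x *\<^sub>R f x = f x" using assms(2)[of x] by (cases "x \<in> {a..b}") auto
  qed
  have s: "set_integrable lborel {a..b} f" by (rule borel_integrable_atLeastAtMost'[OF assms(1)])
  show "integrable lborel f" using s unfolding set_integrable_def eq .
  show "(LINT x|lborel. f x) = integral {a..b} f"
    using set_borel_integral_eq_integral(2)[OF s] unfolding set_lebesgue_integral_def eq .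
qed

context radial_sobolev
begin

lemma v_increment:
  assumes ab: "0 < a" "a \<le> b" "b < 1"
  shows "(m has_integral (v b - v a)) {a..b}"
proof -
  define d0 where "d0 = (1 - b) / 2"
  have d0: "0 < d0" "b + d0 < 1" using ab by (auto simp: d0_def field_simps)
  define d where "d = (\<lambda>j. d0 / real (Suc j))"
  have d: "0 < d j" "d j \<le> d0" for j using d0 by (auto simp: d_def field_simps)
  have dlim: "d \<longlonglongrightarrow> 0" unfolding d_def by real_asymp
  define K where "K = (\<lambda>c j r. smooth_step' ((r - c) / d j) / d j)"
  define \<xi> where "\<xi> = (\<lambda>j r. smooth_step ((r - a) / d j) - smooth_step ((r - b) / d j))"
  define \<xi>' where "\<xi>' = (\<lambda>j r. K a j r - K b j r)"
  have DS: "((\<lambda>r. smooth_step ((r - c) / d j)) has_real_derivative K c j r) (at r)" for c j r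
  proof -
    have "((\<lambda>r. (r - c) / d j) has_real_derivative 1 / d j) (at r)" using d[of j] by (auto intro!: derivative_eq_intros)
    from DERIV_chain2[OF smooth_step_DERIV this] show ?thesis by (simp add: K_def)
  qed
  have cK: "continuous_on A (K c j)" for A c j
    unfolding K_def by (intro continuous_intros continuous_on_compose2[OF smooth_step'_continuous[of UNIV]]) (use d[of j] in auto)
  have K0: "K c j r = 0" if "r \<notin> {c..c + d j}" for c j r
    using that d[of j] smooth_step'_0[of "(r - c) / d j"] by (auto simp: K_def field_simps)
  have \<xi>out: "\<xi> j r = 0" if out: "r \<notin> {a..b + d0}" for j r
  proof -
    consider "r < a" | "b + d0 < r" using out by fastforce
    then show ?thesis
    proof cases
      case 1
      then show ?thesis using d[of j] ab by (simp add: \<xi>_def smooth_step_0 field_simps)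
    next
      case 2
      then show ?thesis using d[of j] ab by (simp add: \<xi>_def smooth_step_1 field_simps)
    qed
  qed
  have bump: "bump_fun a (b + d0) (\<xi> j) (\<xi>' j)" for j
    unfolding bump_fun_def
  proof (intro conjI allI impI)
    show "continuous_on UNIV (\<xi>' j)" unfolding \<xi>'_def by (intro continuous_intros cK)
    show "(\<xi> j has_real_derivative \<xi>' j r) (at r)" for r unfolding \<xi>_def \<xi>'_def by (intro DERIV_diff DS)
  qed (rule \<xi>out)
  have cvK: "continuous_on {c..c + d j} (\<lambda>r. v r * K c j r)" if "0 < c" "c + d0 < 1" for c j
    using that d[of j] by (intro continuous_on_mult cK continuous_on_subset[OF cv]) auto
  have lv: "(\<lambda>j. LINT r|lborel. v r * K c j r) \<longlonglongrightarrow> v c" if c: "0 < c" "c + d0 < 1" for c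
  proof (rule LIMSEQ_I)
    fix e :: real assume e: "0 < e"
    have "continuous_on {c..c + d0} v" using c by (intro continuous_on_subset[OF cv]) auto
    from kernel_limit[OF this d0(1) half_gt_zero[OF e]]
    obtain d1 where d1: "0 < d1" "\<And>d. 0 < d \<Longrightarrow> d < d1 \<Longrightarrow> d \<le> d0 \<Longrightarrow> \<bar>integral {c..c + d} (\<lambda>r. v r * (smooth_step' ((r - c) / d) / d)) - v c\<bar> \<le> e / 2"
      by blast
    obtain J where J: "\<And>j. J \<le> j \<Longrightarrow> norm (d j - 0) < d1" using LIMSEQ_D[OF dlim d1(1)] by blast
    have "norm ((LINT r|lborel. v r * K c j r) - v c) < e" if "J \<le> j" for j
    proof -
      have "(LINT r|lborel. v r * K c j r) = integral {c..c + d j} (\<lambda>r. v r * K c j r)"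
        by (rule lint_eq_integral(2)[OF cvK[OF c]]) (simp add: K0)
      then show ?thesis using d1(2)[of "d j"] d[of j] J[OF that] e by (simp add: K_def)
    qed
    then show "\<exists>J. \<forall>j\<ge>J. norm ((LINT r|lborel. v r * K c j r) - v c) < e" by blast
  qed
  have L: "(\<lambda>j. LINT r|lborel. v r * \<xi>' j r) \<longlonglongrightarrow> v a - v b"
  proof -
    have "(LINT r|lborel. v r * \<xi>' j r) = (LINT r|lborel. v r * K a j r) - (LINT r|lborel. v r * K b j r)" for j
      unfolding \<xi>'_def right_diff_distrib using ab d0
      by (intro Bochner_Integration.integral_diff lint_eq_integral(1)[OF cvK]) (auto simp: K0)
    moreover have "(\<lambda>j. (LINT r|lborel. v r * K a j r) - (LINT r|lborel. v r * K b j r)) \<longlonglongrightarrow> v a - v b"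
      using ab d0 by (intro tendsto_diff lv) auto
    ultimately show ?thesis by simp
  qed
  have R: "(\<lambda>j. LINT r|lborel. m r * \<xi> j r) \<longlonglongrightarrow> (LINT r|lborel. m r * indicator {a<..b} r)"
  proof (rule integral_dominated_convergence)
    have "continuous_on UNIV (\<xi> j)" for j
      using bump[of j] by (auto simp: bump_fun_def intro: DERIV_isCont intro!: continuous_at_imp_continuous_on)
    then have [measurable]: "\<xi> j \<in> borel_measurable borel" for j by (rule borel_measurable_continuous_onI)
    show "(\<lambda>r. m r * \<xi> j r) \<in> borel_measurable lborel" for j by measurable
    show "(\<lambda>r. m r * indicator {a<..b} r) \<in> borel_measurable lborel" by measurable
    show "integrable lborel (\<lambda>r. indicator {a..b + d0} r * m r)" using ab d0 by (intro m_integrable)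
    show "AE r in lborel. norm (m r * \<xi> j r) \<le> indicator {a..b + d0} r * m r" for j
    proof (rule AE_I2)
      fix r
      have "\<bar>\<xi> j r\<bar> \<le> 1" unfolding \<xi>_def using smooth_step_range[of "(r - a) / d j"] smooth_step_range[of "(r - b) / d j"] by auto
      then have "m r * \<bar>\<xi> j r\<bar> \<le> m r" using m_nonneg[of r] by (simp add: mult_left_le)
      then show "norm (m r * \<xi> j r) \<le> indicator {a..b + d0} r * m r"
        using \<xi>out[of r j] m_nonneg[of r] by (cases "r \<in> {a..b + d0}") (auto simp: abs_mult)
    qed
    show "AE r in lborel. (\<lambda>j. m r * \<xi> j r) \<longlonglongrightarrow> m r * indicator {a<..b} r"
    proof (rule AE_I2, rule tendsto_mult[OF tendsto_const])
      fix r
      have S: "(\<lambda>j. smooth_step ((r - c) / d j)) \<longlonglongrightarrow> indicator {c<..} r" for c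
      proof (cases "c < r")
        case True
        obtain J where J: "\<And>j. J \<le> j \<Longrightarrow> norm (d j - 0) < r - c" using LIMSEQ_D[OF dlim, of "r - c"] True by auto
        have "smooth_step ((r - c) / d j) = 1" if "J \<le> j" for j
          using J[OF that] d[of j] by (intro smooth_step_1) (simp add: field_simps)
        then show ?thesis using True by (intro tendsto_eventually) (auto simp: eventually_sequentially)
      next
        case False
        then have "smooth_step ((r - c) / d j) = 0" for j using d[of j] by (intro smooth_step_0) (simp add: field_simps)
        then show ?thesis using False by simp
      qed
      have "(\<lambda>j. \<xi> j r) \<longlonglongrightarrow> indicator {a<..} r - indicator {b<..} r" unfolding \<xi>_def by (intro tendsto_diff S)
      moreover have "indicator {a<..} r - indicator {b<..} r = (indicator {a<..b} r :: real)" using ab by (auto simp: indicator_def)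
      ultimately show "(\<lambda>j. \<xi> j r) \<longlonglongrightarrow> indicator {a<..b} r" by simp
    qed
  qed
  have "(LINT r|lborel. v r * \<xi>' j r) = - (LINT r|lborel. m r * \<xi> j r)" for j
    by (rule weak_derivative_1D[OF bump ab(1) d0(2)])
  with L have "(\<lambda>j. - (LINT r|lborel. m r * \<xi> j r)) \<longlonglongrightarrow> v a - v b" by simp
  with tendsto_minus[OF R] have "- (LINT r|lborel. m r * indicator {a<..b} r) = v a - v b" by (rule LIMSEQ_unique)
  moreover have "(LINT r|lborel. m r * indicator {a<..b} r) = (LINT r|lborel. indicator {a..b} r * m r)"
    by (rule integral_cong_AE) (use AE_lborel_singleton[of a] in \<open>auto simp: indicator_def elim!: eventually_mono\<close>)
  ultimately have "(LINT r|lborel. indicator {a..b} r * m r) = v b - v a" by simp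
  then have "((\<lambda>r. indicator {a..b} r * m r) has_integral (v b - v a)) UNIV"
    using has_integral_integral_lborel[OF m_integrable[OF ab(1,3)]] by simp
  moreover have "(\<lambda>r. indicator {a..b} r * m r) = (\<lambda>r. if r \<in> {a..b} then m r else 0)" by (auto simp: indicator_def)
  ultimately show ?thesis by (simp only: has_integral_restrict_UNIV)
qed

lemma v_le: "0 < a \<Longrightarrow> a \<le> b \<Longrightarrow> b < 1 \<Longrightarrow> v a \<le> v b"
  using has_integral_nonneg[OF v_increment[of a b]] m_nonneg by simp

lemma v_differentiable_ae:
  assumes "0 < \<alpha>" "\<beta> < 1"
  obtains N where "negligible N" "\<And>r. r \<in> {\<alpha><..<\<beta>} - N \<Longrightarrow> (v has_real_derivative m r) (at r)"
proof -
  define f where "f = (\<lambda>r. indicator {\<alpha>..\<beta>} r * m r)"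
  have "f integrable_on UNIV" unfolding f_def by (rule integrable_on_lborel[OF m_integrable[OF assms]])
  then have "f integrable_on {c..d}" for c d by (rule integrable_on_subinterval) simp
  then obtain N where N: "negligible N" "\<And>x. \<alpha> < x \<Longrightarrow> x \<notin> N \<Longrightarrow> ((\<lambda>x. integral {\<alpha>..x} f) has_real_derivative f x) (at x)"
    using indefinite_integral_differentiable_ae[of f \<alpha>] by metis
  show ?thesis
  proof (rule that[OF N(1)])
    fix r assume r: "r \<in> {\<alpha><..<\<beta>} - N"
    have "((\<lambda>x. integral {\<alpha>..x} f + v \<alpha>) has_real_derivative f r + 0) (at r)"
      using N(2)[of r] r by (intro DERIV_add DERIV_const) auto
    then have "(v has_real_derivative f r + 0) (at r)"
    proof (rule has_field_derivative_transform_within_open)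
      fix y assume y: "y \<in> {\<alpha><..<\<beta>}"
      have "integral {\<alpha>..y} f = integral {\<alpha>..y} m" using y by (intro integral_cong) (auto simp: f_def)
      also have "\<dots> = v y - v \<alpha>" using y assms by (intro integral_unique v_increment) auto
      finally show "integral {\<alpha>..y} f + v \<alpha> = v y" by simp
    qed (use r in auto)
    then show "(v has_real_derivative m r) (at r)" using r by (simp add: f_def)
  qed
qed

end

lemma lint_scale:
  fixes g :: "real^'n::finite \<Rightarrow> real"
  assumes [measurable]: "g \<in> borel_measurable borel" and c: "0 < c"
  shows "(LINT x|lborel. g (c *\<^sub>R x)) = (1 / c ^ CARD('n)) * (LINT x|lborel. g x)"
proof -
  have "(LINT x|lborel. g x) = (LINT x|density (distr lborel borel (\<lambda>x::real^'n. 0 + c *\<^sub>R x)) (\<lambda>_. ennreal (\<bar>c\<bar> ^ DIM(real^'n))). g x)"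
    using lborel_affine[of c "0 :: real^'n"] c by simp
  also have "\<dots> = (LINT x|lborel. c ^ CARD('n) * g (c *\<^sub>R x))"
    using c by (subst integral_density) (simp_all add: integral_distr)
  finally show ?thesis using c by simp
qed

lemma C1_on_scaled_add:
  fixes f g :: "real^'n::finite \<Rightarrow> real"
  assumes "C1_on UNIV f" "C1_on UNIV g"
  shows "C1_on UNIV (\<lambda>x. c * f x + g x)"
proof (rule C1_onI)
  show "((\<lambda>x. c * f x + g x) has_derivative (\<lambda>h. c * (\<Sum>i\<in>UNIV. h $ i * partial i f x) + (\<Sum>i\<in>UNIV. h $ i * partial i g x))) (at x)" for x
    using assms by (intro has_derivative_add has_derivative_mult_right has_derivative_partial) (auto simp: C1_on_def)
  show "continuous_on UNIV (\<lambda>x. c * (\<Sum>j\<in>UNIV. axis i 1 $ j * partial j f x) + (\<Sum>j\<in>UNIV. axis i 1 $ j * partial j g x))" for i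
    using assms by (intro continuous_intros) (auto simp: C1_on_def)
qed

lemma Cc1_scaled_add:
  fixes f g :: "real^'n::finite \<Rightarrow> real"
  assumes "f \<in> Cc1 A" "g \<in> Cc1 A"
  shows "(\<lambda>x. c * f x + g x) \<in> Cc1 A"
proof -
  have sub: "closure {x. c * f x + g x \<noteq> 0} \<subseteq> closure {x. f x \<noteq> 0} \<union> closure {x. g x \<noteq> 0}"
    unfolding closure_Un[symmetric] by (rule closure_mono) auto
  have "compact (closure {x. f x \<noteq> 0} \<union> closure {x. g x \<noteq> 0})" using assms by (auto simp: Cc1_def)
  then have "compact (closure {x. c * f x + g x \<noteq> 0})"
    using closed_Int_compact[OF closed_closure[of "{x. c * f x + g x \<noteq> 0}"], of "closure {x. f x \<noteq> 0} \<union> closure {x. g x \<noteq> 0}"] inf.absorb1[OF sub] by simp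
  moreover have "closure {x. c * f x + g x \<noteq> 0} \<subseteq> A" using sub assms by (auto simp: Cc1_def)
  ultimately show ?thesis using assms C1_on_scaled_add[of f g c] by (simp add: Cc1_def)
qed

lemma dilation_DERIV:
  fixes \<eta> :: "real^'n::finite \<Rightarrow> real"
  assumes \<eta>: "C1_on UNIV \<eta>" and s: "-1 < s"
  shows "((\<lambda>s. \<eta> ((1 / (1 + s)) *\<^sub>R y) / (1 + s) ^ CARD('n)) has_real_derivative
     - (1 / (1 + s) ^ (CARD('n) + 1)) * (real CARD('n) * \<eta> ((1 / (1 + s)) *\<^sub>R y) + (\<Sum>i\<in>UNIV. ((1 / (1 + s)) *\<^sub>R y) $ i * partial i \<eta> ((1 / (1 + s)) *\<^sub>R y)))) (at s)"
proof -
  let ?n = "CARD('n)"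
  define z where "z = (1 / (1 + s)) *\<^sub>R y"
  have s1: "1 + s \<noteq> 0" using s by simp
  have "((\<lambda>s. 1 / (1 + s)) has_real_derivative - (1 / (1 + s)\<^sup>2)) (at s)"
    using s1 by (auto intro!: derivative_eq_intros simp: power2_eq_square)
  then have "((\<lambda>s. 1 / (1 + s)) has_derivative (\<lambda>h. h * - (1 / (1 + s)\<^sup>2))) (at s)"
    unfolding has_field_derivative_def by (rule has_derivative_eq_rhs) (simp add: fun_eq_iff)
  then have "((\<lambda>s. (1 / (1 + s)) *\<^sub>R y) has_derivative (\<lambda>h. (h * - (1 / (1 + s)\<^sup>2)) *\<^sub>R y)) (at s)"
    by (rule has_derivative_scaleR_left)
  moreover have "(\<eta> has_derivative (\<lambda>h. \<Sum>i\<in>UNIV. h $ i * partial i \<eta> z)) (at ((1 / (1 + s)) *\<^sub>R y))"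
    using has_derivative_partial[of \<eta> z] \<eta> by (simp add: C1_on_def z_def)
  ultimately have "(\<eta> \<circ> (\<lambda>s. (1 / (1 + s)) *\<^sub>R y) has_derivative (\<lambda>h. \<Sum>i\<in>UNIV. h $ i * partial i \<eta> z) \<circ> (\<lambda>h. (h * - (1 / (1 + s)\<^sup>2)) *\<^sub>R y)) (at s)"
    by (rule diff_chain_at)
  then have "((\<lambda>s. \<eta> ((1 / (1 + s)) *\<^sub>R y)) has_derivative (\<lambda>h. \<Sum>i\<in>UNIV. ((h * - (1 / (1 + s)\<^sup>2)) *\<^sub>R y) $ i * partial i \<eta> z)) (at s)"
    by (simp only: o_def)
  moreover have H2: "(\<lambda>h. \<Sum>i\<in>UNIV. ((h * - (1 / (1 + s)\<^sup>2)) *\<^sub>R y) $ i * partial i \<eta> z) = (\<lambda>h. (- (1 / (1 + s)) * (\<Sum>i\<in>UNIV. z $ i * partial i \<eta> z)) * h)"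
    using s1 by (auto simp: z_def sum_distrib_left sum_distrib_right power2_eq_square fun_eq_iff mult_ac intro!: sum.cong)
  ultimately have D: "((\<lambda>s. \<eta> ((1 / (1 + s)) *\<^sub>R y)) has_real_derivative - (1 / (1 + s)) * (\<Sum>i\<in>UNIV. z $ i * partial i \<eta> z)) (at s)"
    unfolding has_field_derivative_def H2 by blast
  have "((\<lambda>s. (1 + s) ^ ?n) has_real_derivative real ?n * (1 + s) ^ (?n - 1)) (at s)"
    by (auto intro!: derivative_eq_intros)
  from DERIV_divide[OF D this] s1
  have "((\<lambda>s. \<eta> ((1 / (1 + s)) *\<^sub>R y) / (1 + s) ^ ?n) has_real_derivative
     (- (1 / (1 + s)) * (\<Sum>i\<in>UNIV. z $ i * partial i \<eta> z) * (1 + s) ^ ?n - \<eta> z * (real ?n * (1 + s) ^ (?n - 1))) / ((1 + s) ^ ?n * (1 + s) ^ ?n)) (at s)"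
    by (simp add: z_def)
  moreover have "(- (1 / (1 + s)) * S * (1 + s) ^ ?n - E * (real ?n * (1 + s) ^ (?n - 1))) / ((1 + s) ^ ?n * (1 + s) ^ ?n)
     = - (1 / (1 + s) ^ (?n + 1)) * (real ?n * E + S)" for S E
  proof -
    obtain l where l: "?n = Suc l" using zero_less_card_finite[where 'a='n] gr0_implies_Suc by blast
    have "(- (1 / c) * S * c ^ Suc l - E * (real (Suc l) * c ^ l)) / (c ^ Suc l * c ^ Suc l)
      = - (1 / c ^ (Suc l + 1)) * (real (Suc l) * E + S)" if "c \<noteq> 0" for c :: real
      using that by (simp add: field_simps)
    from this[OF s1] show ?thesis unfolding l by simp
  qed
  ultimately show ?thesis by (simp add: z_def)
qed

lemma compact_in_punctured_ball:
  fixes K :: "(real^'n::finite) set"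
  assumes K: "compact K" "K \<subseteq> ball 0 1 - {0}"
  obtains \<alpha> \<beta> where "0 < \<alpha>" "\<alpha> < \<beta>" "\<beta> < 1" "\<And>x. x \<in> K \<Longrightarrow> \<alpha> \<le> norm x \<and> norm x \<le> \<beta>"
proof (cases "K = {}")
  case True
  show ?thesis by (rule that[of "1/3" "1/2"]) (use True in auto)
next
  case False
  have c: "continuous_on K norm" by (intro continuous_intros)
  obtain a where a: "a \<in> K" "\<And>x. x \<in> K \<Longrightarrow> norm a \<le> norm x"
    using continuous_attains_inf[OF K(1) False c] by blast
  obtain b where b: "b \<in> K" "\<And>x. x \<in> K \<Longrightarrow> norm x \<le> norm b"
    using continuous_attains_sup[OF K(1) False c] by blast
  have "a \<noteq> 0" "norm b < 1" using a(1) b(1) K(2) by auto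
  moreover have "norm a \<le> norm b" using a(2)[OF b(1)] .
  moreover have "norm a / 2 \<le> norm x" if "x \<in> K" for x using a(2)[OF that] norm_ge_zero[of a] by linarith
  moreover have "norm a / 2 < norm b" using \<open>norm a \<le> norm b\<close> \<open>a \<noteq> 0\<close> zero_less_norm_iff[of a] by linarith
  ultimately show ?thesis
    using b(2) by (intro that[of "norm a / 2" "norm b"]) simp_all
qed

context radial_sobolev
begin

definition M :: "real^'n \<Rightarrow> real" where "M x = norm x * m (norm x)"

lemma M_nonneg: "0 \<le> M x" using m_nonneg by (simp add: M_def)

lemma M_measurable: "M \<in> borel_measurable lebesgue"
  unfolding M_def by (intro measurable_completion) simp

lemma M_integrable: "integrable lebesgue M"
proof -
  have "M = (\<lambda>x. (\<lambda>r. r * m r) (norm x))" by (simp add: M_def fun_eq_iff)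
  moreover have "integrable lebesgue (\<lambda>x::real^'n. (\<lambda>r. r * m r) (norm x)) \<longleftrightarrow> integrable lborel (\<lambda>r. radial_density CARD('n) r * (r * m r))"
    by (rule integrable_radial_iff) measurable
  moreover have "integrable lborel (\<lambda>r. radial_density CARD('n) r * (r * m r))"
  proof (rule Bochner_Integration.integrable_bound[OF h(1)])
    show "AE r in lborel. norm (radial_density CARD('n) r * (r * m r)) \<le> norm (h r)"
    proof (rule AE_I2)
      fix r
      show "norm (radial_density CARD('n) r * (r * m r)) \<le> norm (h r)"
      proof (cases "0 < r \<and> r < 1")
        case True
        have "r ^ CARD('n) = r ^ (CARD('n) - 1) * r" by (metis power_minus_mult zero_less_card_finite)
        then have "radial_density CARD('n) r * (r * m r) = h r" using True h_eq[of r] by (simp add: radial_density_def \<kappa>_def)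
        then show ?thesis by simp
      qed (auto simp: m_def)
    qed
  qed measurable
  ultimately show ?thesis by simp
qed

lemma M_F_radial:
  assumes b: "bump_fun \<alpha> \<beta> \<psi> \<psi>'" and ab: "0 < \<alpha>" "\<beta> < 1"
  shows "(LINT x|lebesgue. M x * \<psi> (norm x)) = (LINT x|lebesgue. F x * \<psi> (norm x))"
proof -
  have "continuous_on UNIV \<psi>"
    using b by (auto simp: bump_fun_def intro: DERIV_isCont intro!: continuous_at_imp_continuous_on)
  then have [measurable]: "\<psi> \<in> borel_measurable borel" by (rule borel_measurable_continuous_onI)
  have "(LINT x|lebesgue. M x * \<psi> (norm x)) = (LINT x|lebesgue. (\<lambda>r. r * m r * \<psi> r) (norm (x :: real^'n)))"
    by (simp add: M_def)
  also have "\<dots> = (LINT r|lborel. radial_density CARD('n) r * (r * m r * \<psi> r))"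
    by (rule integral_radial) measurable
  also have "\<dots> = (LINT r|lborel. h r * \<psi> r)"
  proof (rule Bochner_Integration.integral_cong[OF refl])
    fix r
    show "radial_density CARD('n) r * (r * m r * \<psi> r) = h r * \<psi> r"
    proof (cases "r \<in> {\<alpha>..\<beta>}")
      case True
      have "r ^ CARD('n) = r ^ (CARD('n) - 1) * r" by (metis power_minus_mult zero_less_card_finite)
      then show ?thesis using True ab h_eq[of r] by (simp add: radial_density_def \<kappa>_def)
    qed (use b in \<open>auto simp: bump_fun_def\<close>)
  qed
  also have "\<dots> = (LINT x|lebesgue. F x * \<psi> (norm x))" by (rule h(3)[symmetric]) measurable
  finally show ?thesis .
qed

lemma F_times_test:
  assumes \<eta>: "\<eta> \<in> Cc1 B1"
  shows "(LINT x|lebesgue. F x * \<eta> x) = (LINT x|lebesgue. (Du x \<bullet> x) * \<eta> x)"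
proof (rule integral_cong_AE)
  show "(\<lambda>x. (Du x \<bullet> x) * \<eta> x) \<in> borel_measurable lebesgue"
    using weak_gradient_dilation(3)[OF wg \<eta>] by auto
  have "\<eta> \<in> borel_measurable lebesgue"
    using \<eta> by (intro measurable_completion) (simp add: Cc1_def C1_on_UNIV_measurable)
  then show "(\<lambda>x. F x * \<eta> x) \<in> borel_measurable lebesgue" using F_measurable by simp
  show "AE x in lebesgue. F x * \<eta> x = Du x \<bullet> x * \<eta> x"
    using F_eq
  proof eventually_elim
    case (elim x)
    then show ?case using Cc1_support[OF \<eta>, of x] by (cases "x \<in> B1") auto
  qed
qed

lemma M_le_F:
  assumes \<eta>: "\<eta> \<in> Cc1 (B1 - {0})" and pos: "\<And>x. 0 \<le> \<eta> x"
  shows "(LINT x|lebesgue. M x * \<eta> x) \<le> (LINT x|lebesgue. F x * \<eta> x)"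
proof -
  let ?n = "CARD('n)"
  have C1: "C1_on UNIV \<eta>" and \<eta>1: "\<eta> \<in> Cc1 B1" using \<eta> by (auto simp: Cc1_def)
  define K where "K = closure {x. \<eta> x \<noteq> 0}"
  have K: "compact K" "K \<subseteq> B1 - {0}" using \<eta> by (auto simp: Cc1_def K_def)
  obtain \<alpha> \<beta> where ab: "0 < \<alpha>" "\<alpha> < \<beta>" "\<beta> < 1" "\<And>x. x \<in> K \<Longrightarrow> \<alpha> \<le> norm x \<and> norm x \<le> \<beta>"
    using compact_in_punctured_ball[OF K] by blast
  have out: "\<eta> x = 0" "partial i \<eta> x = 0" if "x \<notin> K" for x i
    using that partial_eq_0_outside[of x \<eta> i] closure_subset[of "{x. \<eta> x \<noteq> 0}"] by (auto simp: K_def)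
  define \<tau> where "\<tau> = (1 - \<beta>) / 2"
  have \<tau>: "0 < \<tau>" "\<beta> * (1 + \<tau>) < 1"
  proof -
    show "0 < \<tau>" using ab by (simp add: \<tau>_def)
    have "\<beta> * \<tau> \<le> 1 * \<tau>" using ab \<open>0 < \<tau>\<close> by (intro mult_right_mono) auto
    moreover have "\<beta> + \<tau> < 1" using ab by (simp add: \<tau>_def field_simps)
    ultimately show "\<beta> * (1 + \<tau>) < 1" unfolding distrib_left by simp
  qed
  define t where "t = (\<lambda>j. \<tau> / real (Suc j))"
  have t: "0 < t j" "t j \<le> \<tau>" for j using \<tau> by (auto simp: t_def field_simps)
  have tlim: "t \<longlonglongrightarrow> 0" unfolding t_def by real_asymp
  define \<beta>1 where "\<beta>1 = \<beta> * (1 + \<tau>)"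
  have \<beta>1: "\<beta> < \<beta>1" "\<beta>1 < 1" using \<tau> ab by (auto simp: \<beta>1_def)
  define V where "V = (\<lambda>r. if r \<in> {\<alpha>..\<beta>1} then v r else 0)"
  have cvV: "continuous_on {\<alpha>..\<beta>1} v" using ab \<beta>1 by (intro continuous_on_subset[OF cv]) auto
  have Vm [measurable]: "V \<in> borel_measurable borel"
    unfolding V_def by (intro borel_measurable_continuous_on_if cvV) auto
  have "compact (v ` {\<alpha>..\<beta>1})" using cvV by (intro compact_continuous_image) auto
  from compact_imp_bounded[OF this] obtain B where B: "\<forall>y\<in>v ` {\<alpha>..\<beta>1}. norm y \<le> B" unfolding bounded_iff by blast
  have VB: "\<bar>V r\<bar> \<le> \<bar>B\<bar> * indicator {..1} r" for r
  proof (cases "r \<in> {\<alpha>..\<beta>1}")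
    case True
    then have "norm (v r) \<le> B" using B by blast
    then show ?thesis using True \<beta>1 by (simp add: V_def)
  qed (auto simp: V_def)
  define E where "E = (\<lambda>x. real ?n * \<eta> x + (\<Sum>i\<in>UNIV. x $ i * partial i \<eta> x))"
  have cE: "continuous_on UNIV E"
    using C1 C1_on_continuous[OF C1] unfolding E_def by (intro continuous_intros) (auto simp: C1_on_def)
  have E0: "E x = 0" if "x \<notin> K" for x using out[OF that] by (simp add: E_def)
  have "compact (E ` K)" by (intro compact_continuous_image continuous_on_subset[OF cE] K(1)) auto
  from compact_imp_bounded[OF this] obtain C where "\<forall>y\<in>E ` K. norm y \<le> C" unfolding bounded_iff by blast
  then have EC: "\<bar>E x\<bar> \<le> \<bar>C\<bar>" for x using E0[of x] by (cases "x \<in> K") force+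
  define \<phi> where "\<phi> = (\<lambda>y s. \<eta> ((1 / (1 + s)) *\<^sub>R y) / (1 + s) ^ ?n)"
  have D\<phi>: "(\<phi> y has_real_derivative - (1 / (1 + s) ^ (?n + 1)) * E ((1 / (1 + s)) *\<^sub>R y)) (at s)" if "-1 < s" for y s
    unfolding \<phi>_def E_def by (rule dilation_DERIV[OF C1 that])
  define q where "q = (\<lambda>j y. (\<phi> y (t j) - \<phi> y 0) / t j)"
  have qb: "\<bar>q j y\<bar> \<le> \<bar>C\<bar>" for j y
  proof -
    obtain s where s: "0 < s" "s < t j" "\<phi> y (t j) - \<phi> y 0 = (t j - 0) * (- (1 / (1 + s) ^ (?n + 1)) * E ((1 / (1 + s)) *\<^sub>R y))"
      using MVT2[of 0 "t j" "\<phi> y" "\<lambda>s. - (1 / (1 + s) ^ (?n + 1)) * E ((1 / (1 + s)) *\<^sub>R y)"] t[of j] D\<phi> by force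
    have "q j y = - (1 / (1 + s) ^ (?n + 1)) * E ((1 / (1 + s)) *\<^sub>R y)"
      unfolding q_def s(3) using t(1)[of j] by simp
    then have "\<bar>q j y\<bar> = (1 / (1 + s) ^ (?n + 1)) * \<bar>E ((1 / (1 + s)) *\<^sub>R y)\<bar>" using s(1) by (simp add: abs_mult)
    also have "\<dots> \<le> 1 * \<bar>C\<bar>"
      by (rule mult_mono) (use s(1) EC one_le_power[of "1 + s" "?n + 1"] in \<open>auto simp: divide_le_eq_1\<close>)
    finally show ?thesis by simp
  qed
  have ql: "(\<lambda>j. q j y) \<longlonglongrightarrow> - E y" for y
  proof -
    have "(\<lambda>h. (\<phi> y (0 + h) - \<phi> y 0) / h) \<midarrow>0\<rightarrow> - (1 / (1 + 0) ^ (?n + 1)) * E ((1 / (1 + 0)) *\<^sub>R y)"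
      using D\<phi>[of 0 y] by (simp only: DERIV_def)
    then have "(\<lambda>h. (\<phi> y h - \<phi> y 0) / h) \<midarrow>0\<rightarrow> - E y" by simp
    then have "((\<lambda>h. (\<phi> y h - \<phi> y 0) / h) \<circ> t) \<longlonglongrightarrow> - E y"
      using t(1) tlim by (intro tendsto_at_iff_sequentially[THEN iffD1, rule_format]) (auto simp: less_imp_neq[symmetric])
    then show ?thesis by (simp add: q_def o_def)
  qed
  define f where "f = (\<lambda>j x. (V ((1 + t j) * norm x) - V (norm x)) / t j * \<eta> x)"
  have \<eta>m [measurable]: "\<eta> \<in> borel_measurable borel" by (rule C1_on_UNIV_measurable(1)[OF C1])
  have Em [measurable]: "E \<in> borel_measurable borel" using cE by (rule borel_measurable_continuous_onI)
  have fm [measurable]: "f j \<in> borel_measurable borel" for j unfolding f_def by measurable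
  have \<phi>m [measurable]: "(\<lambda>y. \<phi> y s) \<in> borel_measurable borel" for s unfolding \<phi>_def by measurable
  have qm [measurable]: "(\<lambda>y. q j y) \<in> borel_measurable borel" for j unfolding q_def by measurable
  have "integrable lborel (indicator (cball 0 1) :: real^'n \<Rightarrow> real)"
    using emeasure_bounded_finite[of "cball (0::real^'n) 1"] by (simp add: less_top)
  then have Bint: "integrable lborel (\<lambda>x::real^'n. c * indicator (cball 0 1) x)" for c :: real
    by (rule integrable_mult_right)
  have VnB: "\<bar>V (norm x)\<bar> \<le> \<bar>B\<bar> * indicator (cball 0 1) x" for x :: "real^'n"
    using VB[of "norm x"] by (simp add: indicator_def)
  have Vint: "integrable lborel (\<lambda>x::real^'n. V (norm x) * g x)" if [measurable]: "g \<in> borel_measurable borel" and g: "\<And>x. \<bar>g x\<bar> \<le> c" for g c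
  proof (rule Bochner_Integration.integrable_bound[OF Bint[of "\<bar>B\<bar> * c"]])
    show "AE x in lborel. norm (V (norm x) * g x) \<le> norm (\<bar>B\<bar> * c * indicator (cball 0 1) x)"
    proof (rule AE_I2)
      fix x :: "real^'n"
      have c0: "0 \<le> c" using g[of x] by linarith
      have "\<bar>V (norm x)\<bar> * \<bar>g x\<bar> \<le> (\<bar>B\<bar> * indicator (cball 0 1) x) * c"
        using VnB[of x] g[of x] by (intro mult_mono) auto
      then show "norm (V (norm x) * g x) \<le> norm (\<bar>B\<bar> * c * indicator (cball 0 1) x)"
        using c0 by (simp add: abs_mult mult_ac)
    qed
  qed measurable
  have "compact (\<eta> ` K)" by (intro compact_continuous_image continuous_on_subset[OF C1_on_continuous[OF C1]] K(1)) auto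
  from compact_imp_bounded[OF this] obtain H where "\<forall>y\<in>\<eta> ` K. norm y \<le> H" unfolding bounded_iff by blast
  then have \<eta>H: "\<bar>\<eta> x\<bar> \<le> \<bar>H\<bar>" for x using out(1)[of x] by (cases "x \<in> K") force+
  have i0: "integrable lborel (\<lambda>x::real^'n. V (norm x) * \<eta> x)" by (rule Vint[OF _ \<eta>H]) measurable
  have i1: "integrable lborel (\<lambda>x::real^'n. V (c * norm x) * \<eta> x)" if "1 \<le> c" for c
  proof (rule Bochner_Integration.integrable_bound[OF Bint[of "\<bar>B\<bar> * \<bar>H\<bar>"]])
    show "AE x in lborel. norm (V (c * norm x) * \<eta> x) \<le> norm (\<bar>B\<bar> * \<bar>H\<bar> * indicator (cball 0 1) x)"
    proof (rule AE_I2)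
      fix x :: "real^'n"
      have "norm x \<le> c * norm x" using that mult_right_mono[of 1 c "norm x"] by simp
      then have "\<bar>V (c * norm x)\<bar> \<le> \<bar>B\<bar> * indicator (cball 0 1) x"
        using VB[of "c * norm x"] by (cases "c * norm x \<le> 1") (auto simp: indicator_def)
      then have "\<bar>V (c * norm x)\<bar> * \<bar>\<eta> x\<bar> \<le> (\<bar>B\<bar> * indicator (cball 0 1) x) * \<bar>H\<bar>"
        using \<eta>H[of x] by (intro mult_mono) auto
      then show "norm (V (c * norm x) * \<eta> x) \<le> norm (\<bar>B\<bar> * \<bar>H\<bar> * indicator (cball 0 1) x)"
        by (simp add: abs_mult mult_ac)
    qed
  qed measurable
  have i\<phi>: "integrable lborel (\<lambda>x::real^'n. V (norm x) * \<phi> x s)" if s: "0 \<le> s" for s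
  proof (rule Vint)
    show "\<bar>\<phi> x s\<bar> \<le> \<bar>H\<bar>" for x
    proof -
      have "1 \<le> (1 + s) ^ ?n" using s by (intro one_le_power) auto
      then have "\<bar>\<eta> ((1 / (1 + s)) *\<^sub>R x)\<bar> / (1 + s) ^ ?n \<le> \<bar>\<eta> ((1 / (1 + s)) *\<^sub>R x)\<bar>"
        by (simp add: divide_le_eq mult_le_cancel_left1)
      then show ?thesis using \<eta>H[of "(1 / (1 + s)) *\<^sub>R x"] s by (simp add: \<phi>_def)
    qed
  qed measurable
  have f_int: "integrable lborel (f j)" for j
  proof -
    have "f j = (\<lambda>x. (V ((1 + t j) * norm x) * \<eta> x - V (norm x) * \<eta> x) / t j)"
      by (auto simp: f_def left_diff_distrib divide_inverse fun_eq_iff)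
    then show ?thesis using i0 i1[of "1 + t j"] t(1)[of j] by (simp add: less_imp_le)
  qed
  have f_q: "(LINT x|lborel. f j x) = (LINT x|lborel. V (norm x) * q j x)" for j
  proof -
    have tj: "0 < 1 + t j" "1 \<le> 1 + t j" using t(1)[of j] by auto
    have "(LINT x|lborel. V ((1 + t j) * norm x) * \<eta> x) = (LINT x|lborel. (\<lambda>y. V (norm y) * \<eta> ((1 / (1 + t j)) *\<^sub>R y)) ((1 + t j) *\<^sub>R x))"
      using tj by (intro Bochner_Integration.integral_cong) auto
    also have "\<dots> = (1 / (1 + t j) ^ ?n) * (LINT y|lborel. V (norm y) * \<eta> ((1 / (1 + t j)) *\<^sub>R y))"
      by (rule lint_scale[OF _ tj(1)]) measurable
    also have "\<dots> = (LINT y|lborel. (1 / (1 + t j) ^ ?n) * (V (norm y) * \<eta> ((1 / (1 + t j)) *\<^sub>R y)))"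
      by simp
    also have "\<dots> = (LINT y|lborel. V (norm y) * \<phi> y (t j))"
      by (intro Bochner_Integration.integral_cong) (auto simp: \<phi>_def)
    finally have 1: "(LINT x|lborel. V ((1 + t j) * norm x) * \<eta> x) = (LINT y|lborel. V (norm y) * \<phi> y (t j))" .
    have "(LINT x|lborel. f j x) = (LINT x|lborel. (V ((1 + t j) * norm x) * \<eta> x - V (norm x) * \<eta> x) / t j)"
      by (auto simp: f_def left_diff_distrib divide_inverse intro!: Bochner_Integration.integral_cong)
    also have "\<dots> = ((LINT x|lborel. V ((1 + t j) * norm x) * \<eta> x) - (LINT x|lborel. V (norm x) * \<eta> x)) / t j"
      using i0 i1[OF tj(2)] by simp
    also have "(LINT x|lborel. V (norm x) * \<eta> x) = (LINT x|lborel. V (norm x) * \<phi> x 0)" by (simp add: \<phi>_def)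
    also have "((LINT x|lborel. V ((1 + t j) * norm x) * \<eta> x) - (LINT x|lborel. V (norm x) * \<phi> x 0)) / t j
       = (LINT x|lborel. (V (norm x) * \<phi> x (t j) - V (norm x) * \<phi> x 0) / t j)"
      unfolding 1 using i\<phi>[of "t j"] i\<phi>[of 0] t(1)[of j] by simp
    also have "\<dots> = (LINT x|lborel. V (norm x) * q j x)"
      by (intro Bochner_Integration.integral_cong) (auto simp: q_def right_diff_distrib diff_divide_distrib)
    finally show ?thesis .
  qed
  have "(\<lambda>j. LINT x|lborel. V (norm x) * q j x) \<longlonglongrightarrow> (LINT x|lborel. V (norm x) * - E x)"
  proof (rule integral_dominated_convergence[where w = "\<lambda>x. \<bar>B\<bar> * \<bar>C\<bar> * indicator (cball 0 1) x"])
    show "integrable lborel (\<lambda>x::real^'n. \<bar>B\<bar> * \<bar>C\<bar> * indicator (cball 0 1) x)" by (rule Bint)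
    show "AE x in lborel. norm (V (norm x) * q j x) \<le> \<bar>B\<bar> * \<bar>C\<bar> * indicator (cball 0 1) x" for j
    proof (rule AE_I2)
      fix x :: "real^'n"
      have "\<bar>V (norm x)\<bar> * \<bar>q j x\<bar> \<le> (\<bar>B\<bar> * indicator (cball 0 1) x) * \<bar>C\<bar>"
        using VnB[of x] qb[of j x] by (intro mult_mono) auto
      then show "norm (V (norm x) * q j x) \<le> \<bar>B\<bar> * \<bar>C\<bar> * indicator (cball 0 1) x" by (simp add: abs_mult mult_ac)
    qed
    show "AE x in lborel. (\<lambda>j. V (norm x) * q j x) \<longlonglongrightarrow> V (norm x) * - E x"
      by (intro AE_I2 tendsto_mult tendsto_const ql)
  qed measurable
  moreover have "(LINT x|lborel. V (norm x) * - E x) = (LINT x|lebesgue. F x * \<eta> x)"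
  proof -
    have "u x * E x = V (norm x) * E x" for x
      using ab(4)[of x] E0[of x] \<beta>1 by (cases "x \<in> K") (auto simp: radial V_def)
    then have "(LINT x|lebesgue. V (norm x) * E x) = (LINT x|lebesgue. u x * E x)" by (simp only:)
    also have "\<dots> = - (LINT x|lebesgue. (Du x \<bullet> x) * \<eta> x)"
      unfolding E_def by (rule weak_gradient_dilation(1)[OF wg \<eta>1])
    finally have "(LINT x|lebesgue. V (norm x) * E x) = - (LINT x|lebesgue. F x * \<eta> x)"
      using F_times_test[OF \<eta>1] by (simp only:)
    then show ?thesis by (simp add: integral_completion)
  qed
  ultimately have flim: "(\<lambda>j. LINT x|lborel. f j x) \<longlonglongrightarrow> (LINT x|lebesgue. F x * \<eta> x)" by (simp add: f_q)
  have f0: "0 \<le> f j x" for j x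
  proof (cases "x \<in> K")
    case True
    have x: "\<alpha> \<le> norm x" "norm x \<le> \<beta>" using ab(4)[OF True] by auto
    have up: "(1 + t j) * norm x \<le> \<beta>1"
      unfolding \<beta>1_def mult.commute[of \<beta>] using x t[of j] ab by (intro mult_mono) auto
    have lo: "norm x \<le> (1 + t j) * norm x" using t(1)[of j] mult_right_mono[of 1 "1 + t j" "norm x"] by simp
    have "v (norm x) \<le> v ((1 + t j) * norm x)" using x up lo ab \<beta>1 by (intro v_le) auto
    then show ?thesis using x up lo pos[of x] t(1)[of j] \<beta>1 by (simp add: f_def V_def)
  qed (simp add: f_def out)
  obtain N where N: "negligible N" "\<And>r. r \<in> {\<alpha>/2<..<\<beta>1} - N \<Longrightarrow> (v has_real_derivative m r) (at r)"
    using v_differentiable_ae[of "\<alpha>/2" \<beta>1] ab \<beta>1 by auto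
  have "N \<in> null_sets lebesgue" using N(1) by (simp add: negligible_iff_null_sets)
  then have "AE r in lebesgue. r \<notin> N" by (rule AE_not_in)
  then have "AE r in lborel. r \<notin> N" by (simp add: AE_completion_iff)
  then have "AE x in lebesgue. norm (x::real^'n) \<notin> N" by (rule AE_radial)
  then have aeN: "AE x in lborel. norm (x::real^'n) \<notin> N" by (simp add: AE_completion_iff)
  have flimae: "AE x in lborel. (\<lambda>j. f j x) \<longlonglongrightarrow> M x * \<eta> x"
    using aeN
  proof eventually_elim
    case (elim x)
    show ?case
    proof (cases "x \<in> K")
      case False
      then show ?thesis by (simp add: f_def out)
    next
      case True
      have x: "\<alpha> \<le> norm x" "norm x \<le> \<beta>" using ab(4)[OF True] by auto
      let ?r = "norm x"
      have D: "(v has_real_derivative m ?r) (at ?r)" using N(2)[of ?r] elim x ab \<beta>1 by auto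
      have "(\<lambda>h. (v (?r + h) - v ?r) / h) \<midarrow>0\<rightarrow> m ?r" using D by (simp add: DERIV_def)
      moreover have "(\<lambda>j. t j * ?r) \<longlonglongrightarrow> 0" using tendsto_mult_right[OF tlim, of ?r] by simp
      moreover have "t j * ?r \<noteq> 0" for j using t(1)[of j] x ab by auto
      ultimately have "((\<lambda>h. (v (?r + h) - v ?r) / h) \<circ> (\<lambda>j. t j * ?r)) \<longlonglongrightarrow> m ?r"
        by (intro tendsto_at_iff_sequentially[THEN iffD1, rule_format]) auto
      then have "(\<lambda>j. (v (?r + t j * ?r) - v ?r) / (t j * ?r) * ?r * \<eta> x) \<longlonglongrightarrow> m ?r * ?r * \<eta> x"
        unfolding o_def by (intro tendsto_mult tendsto_const)
      moreover have "(v (?r + t j * ?r) - v ?r) / (t j * ?r) * ?r * \<eta> x = f j x" for j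
      proof -
        have up: "(1 + t j) * norm x \<le> \<beta>1"
          unfolding \<beta>1_def mult.commute[of \<beta>] using x t[of j] ab by (intro mult_mono) auto
        have lo: "norm x \<le> (1 + t j) * norm x" using t(1)[of j] mult_right_mono[of 1 "1 + t j" "norm x"] by simp
        have "V ((1 + t j) * ?r) = v (?r + t j * ?r)" "V ?r = v ?r"
          using x up lo \<beta>1 by (auto simp: V_def algebra_simps)
        then show ?thesis using x ab by (simp add: f_def)
      qed
      ultimately show ?thesis by (simp add: M_def mult_ac)
    qed
  qed
  have Mm [measurable]: "M \<in> borel_measurable borel" unfolding M_def by measurable
  have "ennreal (LINT x|lebesgue. M x * \<eta> x) = ennreal (LINT x|lborel. M x * \<eta> x)" by (simp add: integral_completion)
  also have "\<dots> \<le> (\<integral>\<^sup>+x. ennreal (M x * \<eta> x) \<partial>lborel)"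
  proof (cases "integrable lborel (\<lambda>x. M x * \<eta> x)")
    case True
    then show ?thesis using nn_integral_eq_integral[OF True] M_nonneg pos by simp
  next
    case False
    then show ?thesis by (simp add: not_integrable_integral_eq)
  qed
  also have "\<dots> = (\<integral>\<^sup>+x. liminf (\<lambda>j. ennreal (f j x)) \<partial>lborel)"
  proof (rule nn_integral_cong_AE)
    show "AE x in lborel. ennreal (M x * \<eta> x) = liminf (\<lambda>j. ennreal (f j x))"
      using flimae
    proof eventually_elim
      case (elim x)
      then have "(\<lambda>j. ennreal (f j x)) \<longlonglongrightarrow> ennreal (M x * \<eta> x)" by (rule tendsto_ennrealI)
      then show ?case by (simp add: lim_imp_Liminf)
    qed
  qed
  also have "\<dots> \<le> liminf (\<lambda>j. \<integral>\<^sup>+x. ennreal (f j x) \<partial>lborel)" by (rule nn_integral_liminf) measurable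
  also have "(\<lambda>j. \<integral>\<^sup>+x. ennreal (f j x) \<partial>lborel) = (\<lambda>j. ennreal (LINT x|lborel. f j x))"
    using nn_integral_eq_integral[OF f_int] f0 by simp
  also have "liminf (\<lambda>j. ennreal (LINT x|lborel. f j x)) = ennreal (LINT x|lebesgue. F x * \<eta> x)"
    using tendsto_ennrealI[OF flim] by (simp add: lim_imp_Liminf)
  finally have "ennreal (LINT x|lebesgue. M x * \<eta> x) \<le> ennreal (LINT x|lebesgue. F x * \<eta> x)" .
  moreover have "0 \<le> (LINT x|lebesgue. F x * \<eta> x)" using F_nonneg pos by (intro Bochner_Integration.integral_nonneg) auto
  ultimately show ?thesis by (simp add: ennreal_le_iff)
qed

end

lemma plateau_bump:
  assumes "0 < \<alpha>" "\<alpha> \<le> \<beta>" "\<beta> < 1"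
  obtains \<alpha>' \<beta>' \<psi> \<psi>' where "0 < \<alpha>'" "\<beta>' < 1" "bump_fun \<alpha>' \<beta>' \<psi> \<psi>'" "\<And>r. r \<in> {\<alpha>..\<beta>} \<Longrightarrow> \<psi> r = 1" "\<And>r. 0 \<le> \<psi> r"
proof -
  define d where "d = (1 - \<beta>) / 2"
  have d: "0 < d" "\<beta> + d < 1" using assms by (auto simp: d_def field_simps)
  have DS: "((\<lambda>r. smooth_step ((r - c) / e)) has_real_derivative smooth_step' ((r - c) / e) / e) (at r)" if "e \<noteq> 0" for c e r
  proof -
    have "((\<lambda>r. (r - c) / e) has_real_derivative 1 / e) (at r)" using that by (auto intro!: derivative_eq_intros)
    from DERIV_chain2[OF smooth_step_DERIV this] show ?thesis by simp
  qed
  define \<psi> where "\<psi> = (\<lambda>r. smooth_step ((r - \<alpha>/2) / (\<alpha>/2)) * (1 - smooth_step ((r - \<beta>) / d)))"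
  define \<psi>' where "\<psi>' = (\<lambda>r. smooth_step' ((r - \<alpha>/2) / (\<alpha>/2)) / (\<alpha>/2) * (1 - smooth_step ((r - \<beta>) / d)) - smooth_step' ((r - \<beta>) / d) / d * smooth_step ((r - \<alpha>/2) / (\<alpha>/2)))"
  have a: "\<alpha>/2 \<noteq> 0" "d \<noteq> 0" using assms d by auto
  have "bump_fun (\<alpha>/2) (\<beta> + d) \<psi> \<psi>'"
    unfolding bump_fun_def
  proof (intro conjI allI impI)
    show "(\<psi> has_real_derivative \<psi>' r) (at r)" for r
      unfolding \<psi>_def \<psi>'_def
      by (rule DERIV_cong[OF DERIV_mult[OF DS[OF a(1)] DERIV_diff[OF DERIV_const[of 1] DS[OF a(2)]]]]) simp
    have cs: "continuous_on UNIV smooth_step" by (meson smooth_step_DERIV DERIV_isCont continuous_at_imp_continuous_on)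
    show "continuous_on UNIV \<psi>'"
      unfolding \<psi>'_def
      by (intro continuous_intros continuous_on_compose2[OF smooth_step'_continuous[of UNIV]] continuous_on_compose2[OF cs]) (use a in auto)
    show "\<psi> r = 0" if "r \<notin> {\<alpha>/2..\<beta> + d}" for r
    proof (cases "r < \<alpha>/2")
      case True
      then show ?thesis using assms by (simp add: \<psi>_def smooth_step_0 divide_le_0_iff)
    next
      case False
      then have "\<beta> + d < r" using that by auto
      then have "smooth_step ((r - \<beta>) / d) = 1" using d by (intro smooth_step_1) (simp add: field_simps)
      then show ?thesis by (simp add: \<psi>_def)
    qed
  qed
  moreover have "\<psi> r = 1" if "r \<in> {\<alpha>..\<beta>}" for r
  proof -
    have "smooth_step ((r - \<alpha>/2) / (\<alpha>/2)) = 1" using that assms by (intro smooth_step_1) (simp add: field_simps)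
    moreover have "smooth_step ((r - \<beta>) / d) = 0" using that d by (intro smooth_step_0) (simp add: divide_le_0_iff)
    ultimately show ?thesis by (simp add: \<psi>_def)
  qed
  moreover have "0 \<le> \<psi> r" for r unfolding \<psi>_def using smooth_step_range by simp
  ultimately show ?thesis using that[of "\<alpha>/2" "\<beta> + d" \<psi> \<psi>'] assms d by auto
qed

lemma integrable_times_test:
  fixes g \<eta> :: "real^'n::finite \<Rightarrow> real"
  assumes g: "integrable lebesgue g" and \<eta>: "\<eta> \<in> Cc1 A"
  shows "integrable lebesgue (\<lambda>x. g x * \<eta> x)"
proof (rule integrable_mult_compact_support[where f = g and K = "closure {x. \<eta> x \<noteq> 0}"])
  show "g absolutely_integrable_on closure {x. \<eta> x \<noteq> 0}"
    unfolding set_integrable_def by (rule integrable_mult_indicator[OF _ g]) (simp add: lebesgue_closedin)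
  show "\<eta> x = 0" if "x \<notin> closure {x. \<eta> x \<noteq> 0}" for x using that closure_subset[of "{x. \<eta> x \<noteq> 0}"] by auto
qed (use \<eta> C1_on_continuous in \<open>auto simp: Cc1_def\<close>)

lemma C1_on_prod:
  fixes f :: "'i \<Rightarrow> real^'n::finite \<Rightarrow> real"
  assumes "finite S" "\<And>i. i \<in> S \<Longrightarrow> C1_on UNIV (f i)"
  shows "C1_on UNIV (\<lambda>x. \<Prod>i\<in>S. f i x)"
  using assms
proof (induction S rule: finite_induct)
  case empty
  show ?case by (rule C1_onI[where f' = "\<lambda>x h. 0"]) (auto intro: continuous_on_const)
next
  case (insert x F)
  then show ?case using C1_on_mult[of UNIV "f x" "\<lambda>y. \<Prod>i\<in>F. f i y"] by simp
qed

lemma C1_on_coordinate_compose: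
  fixes i :: "'n::finite"
  assumes "\<And>t. (\<sigma> has_real_derivative \<sigma>' t) (at t)" "continuous_on UNIV \<sigma>'"
  shows "C1_on UNIV (\<lambda>x::real^'n. \<sigma> (x $ i))"
proof (rule C1_onI[where f' = "\<lambda>x h. \<sigma>' (x $ i) * (h $ i)"])
  fix x :: "real^'n"
  have "((\<lambda>x::real^'n. x $ i) has_derivative (\<lambda>h. h $ i)) (at x)"
    by (intro bounded_linear_imp_has_derivative bounded_linear_vec_nth)
  from diff_chain_at[OF this] assms(1)[of "x $ i"]
  show "((\<lambda>x. \<sigma> (x $ i)) has_derivative (\<lambda>h. \<sigma>' (x $ i) * (h $ i))) (at x)"
    by (simp add: has_field_derivative_def o_def)
next
  fix j :: 'n
  show "continuous_on UNIV (\<lambda>x::real^'n. \<sigma>' (x $ i) * axis j 1 $ i)"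
    by (intro continuous_intros continuous_on_compose2[OF assms(2)]) auto
qed

lemma box_test_functions:
  fixes a b :: "real^'n::finite"
  assumes "cbox a b \<subseteq> U"
  obtains \<eta> where "\<And>j::nat. \<eta> j \<in> Cc1 U" "\<And>j x. 0 \<le> \<eta> j x" "\<And>j x. \<eta> j x \<le> 1"
    "\<And>x. (\<lambda>j. \<eta> j x) \<longlonglongrightarrow> indicator (box a b) x"
proof -
  define \<sigma> where "\<sigma> = (\<lambda>j i t. smooth_step (real (Suc j) * (t - a $ i)) * smooth_step (real (Suc j) * (b $ i - t)))"
  define \<eta> where "\<eta> = (\<lambda>j x. \<Prod>i\<in>UNIV. \<sigma> j i (x $ i))"
  have r: "0 \<le> \<sigma> j i t \<and> \<sigma> j i t \<le> 1" for j i t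
    unfolding \<sigma>_def using smooth_step_range by (auto intro: mult_le_one)
  have z: "\<sigma> j i t = 0" if "t \<le> a $ i \<or> b $ i \<le> t" for j i t
    using that unfolding \<sigma>_def
    by (auto simp: smooth_step_0 mult_le_0_iff)
  have C1: "C1_on UNIV (\<lambda>x::real^'n. \<sigma> j i (x $ i))" for j i
  proof -
    have D1: "((\<lambda>t. smooth_step (c * (t - p))) has_real_derivative smooth_step' (c * (t - p)) * c) (at t)" for c p t
      by (rule DERIV_chain2[OF smooth_step_DERIV]) (auto intro!: derivative_eq_intros)
    have D2: "((\<lambda>t. smooth_step (c * (p - t))) has_real_derivative smooth_step' (c * (p - t)) * - c) (at t)" for c p t
      by (rule DERIV_chain2[OF smooth_step_DERIV]) (auto intro!: derivative_eq_intros)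
    have cs: "continuous_on UNIV smooth_step" by (meson smooth_step_DERIV DERIV_isCont continuous_at_imp_continuous_on)
    show ?thesis unfolding \<sigma>_def
      by (rule C1_on_coordinate_compose[OF DERIV_mult[OF D1 D2]])
         (intro continuous_intros continuous_on_compose2[OF smooth_step'_continuous[of UNIV]] continuous_on_compose2[OF cs]; simp)
  qed
  have "closure {x. \<eta> j x \<noteq> 0} \<subseteq> cbox a b" for j
  proof (rule closure_minimal)
    show "{x. \<eta> j x \<noteq> 0} \<subseteq> cbox a b"
    proof
      fix x assume "x \<in> {x. \<eta> j x \<noteq> 0}"
      then have "\<sigma> j i (x $ i) \<noteq> 0" for i by (auto simp: \<eta>_def)
      then have "a $ i \<le> x $ i \<and> x $ i \<le> b $ i" for i using z[of "x $ i" i j] by force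
      then show "x \<in> cbox a b" by (simp add: mem_box_cart)
    qed
  qed (rule closed_cbox)
  moreover from this have "compact (closure {x. \<eta> j x \<noteq> 0})" for j
    by (metis closed_closure closed_Int_compact compact_cbox inf.absorb1)
  ultimately have "\<eta> j \<in> Cc1 U" for j
    using assms C1_on_prod[of UNIV "\<lambda>i x. \<sigma> j i (x $ i)"] C1 by (auto simp: Cc1_def \<eta>_def)
  moreover have "0 \<le> \<eta> j x" for j x unfolding \<eta>_def using r by (intro prod_nonneg) auto
  moreover have "\<eta> j x \<le> 1" for j x unfolding \<eta>_def using r by (intro prod_le_1) auto
  moreover have "(\<lambda>j. \<eta> j x) \<longlonglongrightarrow> indicator (box a b) x" for x
  proof (cases "x \<in> box a b")
    case False
    then obtain i where "x $ i \<le> a $ i \<or> b $ i \<le> x $ i" by (auto simp: mem_box_cart not_less)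
    then have "\<eta> j x = 0" for j unfolding \<eta>_def using z[of "x $ i" i j] by (intro prod_zero) auto
    then show ?thesis using False by simp
  next
    case True
    have S: "(\<lambda>j. smooth_step (real (Suc j) * y)) \<longlonglongrightarrow> 1" if y: "0 < y" for y
    proof -
      obtain J where J: "1 < real J * y" using reals_Archimedean3[OF y] by blast
      have "smooth_step (real (Suc j) * y) = 1" if "J \<le> j" for j
      proof (rule smooth_step_1)
        have "real J * y \<le> real (Suc j) * y" using that y by (intro mult_right_mono) auto
        then show "1 \<le> real (Suc j) * y" using J by linarith
      qed
      then show ?thesis by (intro tendsto_eventually) (auto simp: eventually_sequentially)
    qed
    have "(\<lambda>j. \<sigma> j i (x $ i)) \<longlonglongrightarrow> 1 * 1" for i
      unfolding \<sigma>_def using True by (intro tendsto_mult S) (auto simp: mem_box_cart)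
    then have "(\<lambda>j. \<Prod>i\<in>UNIV. \<sigma> j i (x $ i)) \<longlonglongrightarrow> (\<Prod>i\<in>(UNIV::'n set). 1 * 1)"
      by (intro tendsto_prod) auto
    then show ?thesis using True by (simp add: \<eta>_def)
  qed
  ultimately show ?thesis by (rule that)
qed

context radial_sobolev
begin

lemma M_eq_F_test:
  assumes \<eta>: "\<eta> \<in> Cc1 (B1 - {0})"
  shows "(LINT x|lebesgue. M x * \<eta> x) = (LINT x|lebesgue. F x * \<eta> x)"
proof -
  define K where "K = closure {x. \<eta> x \<noteq> 0}"
  have K: "compact K" "K \<subseteq> B1 - {0}" and C1: "C1_on UNIV \<eta>" using \<eta> by (auto simp: Cc1_def K_def)
  have out: "\<eta> x = 0" if "x \<notin> K" for x
    using that closure_subset[of "{x. \<eta> x \<noteq> 0}"] by (auto simp: K_def)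
  obtain \<alpha> \<beta> where ab: "0 < \<alpha>" "\<alpha> < \<beta>" "\<beta> < 1" "\<And>x. x \<in> K \<Longrightarrow> \<alpha> \<le> norm x \<and> norm x \<le> \<beta>"
    using compact_in_punctured_ball[OF K] by blast
  obtain \<alpha>' \<beta>' \<psi> \<psi>' where \<psi>: "0 < \<alpha>'" "\<beta>' < 1" "bump_fun \<alpha>' \<beta>' \<psi> \<psi>'" "\<And>r. r \<in> {\<alpha>..\<beta>} \<Longrightarrow> \<psi> r = 1" "\<And>r. 0 \<le> \<psi> r"
    by (rule plateau_bump[OF ab(1) less_imp_le[OF ab(2)] ab(3)]) blast
  have "compact (\<eta> ` K)" by (intro compact_continuous_image continuous_on_subset[OF C1_on_continuous[OF C1]] K(1)) auto
  from compact_imp_bounded[OF this] obtain H where H: "\<forall>y\<in>\<eta> ` K. norm y \<le> H" unfolding bounded_iff by blast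
  define C where "C = \<bar>H\<bar>"
  define p where "p = (\<lambda>x::real^'n. \<psi> (norm x))"
  have p: "p \<in> Cc1 (B1 - {0})" unfolding p_def by (rule radial_test_Cc1[OF \<psi>(3,1,2)])
  have dom: "\<bar>\<eta> x\<bar> \<le> C * p x" for x
  proof (cases "x \<in> K")
    case True
    then have "\<bar>\<eta> x\<bar> \<le> C" using H by (auto simp: C_def)
    then show ?thesis using ab(4)[OF True] \<psi>(4)[of "norm x"] by (simp add: p_def)
  qed (use \<psi>(5) in \<open>simp add: out p_def C_def\<close>)
  have iM: "integrable lebesgue (\<lambda>x. M x * e x)" and iF: "integrable lebesgue (\<lambda>x. F x * e x)" if "e \<in> Cc1 (B1 - {0})" for e
    using that by (auto intro: integrable_times_test M_integrable F_integrable)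
  have pp: "(LINT x|lebesgue. M x * p x) = (LINT x|lebesgue. F x * p x)"
    unfolding p_def by (rule M_F_radial[OF \<psi>(3,1,2)])
  have add: "(LINT x|lebesgue. M x * (c * e x + f x)) = c * (LINT x|lebesgue. M x * e x) + (LINT x|lebesgue. M x * f x)"
      "(LINT x|lebesgue. F x * (c * e x + f x)) = c * (LINT x|lebesgue. F x * e x) + (LINT x|lebesgue. F x * f x)"
    if "e \<in> Cc1 (B1 - {0})" "f \<in> Cc1 (B1 - {0})" for c e f
    using iM[OF that(1)] iM[OF that(2)] iF[OF that(1)] iF[OF that(2)] by (simp_all add: distrib_left mult.left_commute[of _ c])
  have "(LINT x|lebesgue. M x * (C * p x + \<eta> x)) \<le> (LINT x|lebesgue. F x * (C * p x + \<eta> x))"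
    using dom by (intro M_le_F Cc1_scaled_add p \<eta>) (simp add: abs_le_iff, metis add.commute minus_le_iff le_add_same_cancel1 diff_ge_0_iff_ge diff_minus_eq_add)
  then have 1: "(LINT x|lebesgue. M x * \<eta> x) \<le> (LINT x|lebesgue. F x * \<eta> x)"
    using add[OF p \<eta>, of C] pp by simp
  have q: "(\<lambda>x. (C - 1) * p x + p x) \<in> Cc1 (B1 - {0})" by (intro Cc1_scaled_add p)
  have "(LINT x|lebesgue. M x * (- 1 * \<eta> x + ((C - 1) * p x + p x))) \<le> (LINT x|lebesgue. F x * (- 1 * \<eta> x + ((C - 1) * p x + p x)))"
  proof (intro M_le_F Cc1_scaled_add p \<eta>)
    show "0 \<le> - 1 * \<eta> x + ((C - 1) * p x + p x)" for x using dom[of x] by (simp add: algebra_simps abs_le_iff)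
  qed
  then have "(LINT x|lebesgue. F x * \<eta> x) \<le> (LINT x|lebesgue. M x * \<eta> x)"
    unfolding add[OF \<eta> q, of "-1"] add[OF p p] pp by simp
  with 1 show ?thesis by simp
qed

lemma F_eq_M: "AE x in lebesgue. x \<in> B1 - {0} \<longrightarrow> F x = M x"
proof -
  define g where "g = (\<lambda>x. F x - M x)"
  have gi: "integrable lebesgue g" unfolding g_def using F_integrable M_integrable by simp
  have op: "open (B1 - {0})" by (intro open_Diff) auto
  have zero: "integral (cbox a b) g = 0" if sub: "cbox a b \<subseteq> B1 - {0}" for a b
  proof -
    obtain \<eta> where \<eta>: "\<And>j::nat. \<eta> j \<in> Cc1 (B1 - {0})" "\<And>j x. 0 \<le> \<eta> j x" "\<And>j x. \<eta> j x \<le> 1"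
        "\<And>x. (\<lambda>j. \<eta> j x) \<longlonglongrightarrow> indicator (box a b) x"
      by (rule box_test_functions[OF sub]) blast
    have "(LINT x|lebesgue. g x * \<eta> j x) = 0" for j
      unfolding g_def left_diff_distrib
      using M_eq_F_test[OF \<eta>(1)[of j]] integrable_times_test[OF F_integrable \<eta>(1)[of j]] integrable_times_test[OF M_integrable \<eta>(1)[of j]]
      by simp
    moreover have "(\<lambda>j. LINT x|lebesgue. g x * \<eta> j x) \<longlonglongrightarrow> (LINT x|lebesgue. g x * indicator (box a b) x)"
    proof (rule integral_dominated_convergence[where w = "\<lambda>x. \<bar>g x\<bar>"])
      show "integrable lebesgue (\<lambda>x. \<bar>g x\<bar>)" using gi by simp
      show "(\<lambda>x. g x * indicator (box a b) x) \<in> borel_measurable lebesgue"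
        using gi by (intro borel_measurable_times borel_measurable_indicator) auto
      show "(\<lambda>x. g x * \<eta> j x) \<in> borel_measurable lebesgue" for j
        using integrable_times_test[OF gi \<eta>(1)[of j]] by auto
      show "AE x in lebesgue. norm (g x * \<eta> j x) \<le> \<bar>g x\<bar>" for j
        using \<eta>(2,3) by (intro AE_I2) (simp add: abs_mult mult_left_le)
      show "AE x in lebesgue. (\<lambda>j. g x * \<eta> j x) \<longlonglongrightarrow> g x * indicator (box a b) x"
        by (intro AE_I2 tendsto_mult tendsto_const \<eta>(4))
    qed
    ultimately have "(LINT x|lebesgue. g x * indicator (box a b) x) = 0" by (simp add: LIMSEQ_const_iff)
    moreover have si: "set_integrable lebesgue (box a b) g"
      unfolding set_integrable_def by (rule integrable_mult_indicator[OF _ gi]) simp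
    ultimately have "integral (box a b) g = 0"
      using set_lebesgue_integral_eq_integral(2)[OF si] by (simp add: set_lebesgue_integral_def mult.commute)
    moreover have "integral (cbox a b) g = integral (box a b) g"
      by (rule integral_open_interval[symmetric])
    ultimately show ?thesis by simp
  qed
  have ga: "g absolutely_integrable_on B1 - {0}"
    unfolding set_integrable_def by (rule integrable_mult_indicator[OF _ gi]) (simp add: op borel_open)
  obtain N where N: "negligible N" "\<And>x. x \<in> (B1 - {0}) - N \<Longrightarrow> g x = 0"
    using zero_ae_if_zero_on_boxes[OF op ga zero] by metis
  have "N \<in> null_sets lebesgue" using N(1) by (simp add: negligible_iff_null_sets)
  then have "AE x in lebesgue. x \<notin> N" by (rule AE_not_in)
  then show ?thesis
  proof eventually_elim
    case (elim x)
    then show ?case using N(2)[of x] by (auto simp: g_def)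
  qed
qed

lemma radial_deriv_eq: "AE x in lebesgue. x \<in> B1 - {0} \<longrightarrow> radial_deriv Du x = m (norm x)"
  using F_eq_M F_eq
proof eventually_elim
  case (elim x)
  show ?case
  proof
    assume x: "x \<in> B1 - {0}"
    then have "Du x \<bullet> x = norm x * m (norm x)" using elim by (simp add: M_def)
    then show "radial_deriv Du x = m (norm x)" using x by (simp add: radial_deriv_def)
  qed
qed

lemma energy_comparison:
  assumes A [measurable]: "A \<in> sets borel" and sub: "A \<subseteq> {0<..<1}" and k: "1 \<le> k" "k \<le> CARD('n)"
  shows "integrable lborel (\<lambda>r. indicator A r * (r ^ (CARD('n) - k) * m r ^ (k + 1)))"
    and "\<kappa> * (LINT r|lborel. indicator A r * (r ^ (CARD('n) - k) * m r ^ (k + 1)))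
      \<le> (LINT x:{x. norm x \<in> A}|lebesgue. norm x powr (1 - real k) * norm (Du x) ^ (k + 1))"
proof -
  define S where "S = {x::real^'n. norm x \<in> A}"
  have S: "S \<subseteq> B1 - {0}" using sub by (auto simp: S_def subset_eq)
  have "S = norm -` A" by (auto simp: S_def)
  then have Sm: "S \<in> sets borel" using measurable_sets[of norm borel borel A] by simp
  define e where "e = (\<lambda>x. norm x powr (1 - real k) * norm (Du x) ^ (k + 1))"
  have "integrable lebesgue (\<lambda>x. indicator B1 x *\<^sub>R e x)"
    using W by (simp add: in_W_def set_integrable_def e_def)
  from integrable_mult_indicator[OF _ this, of S]
  have "integrable lebesgue (\<lambda>x. indicator S x *\<^sub>R (indicator B1 x *\<^sub>R e x))"
    using Sm by simp
  moreover have "(\<lambda>x. indicator S x *\<^sub>R (indicator B1 x *\<^sub>R e x)) = (\<lambda>x. indicator S x *\<^sub>R e x)"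
    using S by (auto simp: indicator_def fun_eq_iff)
  ultimately have ei: "integrable lebesgue (\<lambda>x. indicator S x *\<^sub>R e x)" by simp
  define f where "f = (\<lambda>r. indicator A r * (r powr (1 - real k) * m r ^ (k + 1)))"
  have [measurable]: "f \<in> borel_measurable borel" unfolding f_def by measurable
  have le: "AE x in lebesgue. f (norm x) \<le> indicator S x *\<^sub>R e x"
    using radial_deriv_eq
  proof eventually_elim
    case (elim x)
    show ?case
    proof (cases "x \<in> S")
      case True
      then have x: "x \<noteq> 0" "radial_deriv Du x = m (norm x)" using S elim by auto
      have "m (norm x) * norm x \<le> norm (Du x) * norm x"
        using norm_cauchy_schwarz[of "Du x" x] x by (simp add: radial_deriv_def field_simps)
      then have "m (norm x) \<le> norm (Du x)" using x by simp
      then have "m (norm x) ^ (k + 1) \<le> norm (Du x) ^ (k + 1)" using m_nonneg by (intro power_mono) auto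
      then show ?thesis using True by (simp add: f_def e_def S_def mult_left_mono)
    qed (simp add: f_def S_def)
  qed
  have f0: "0 \<le> f r" for r using m_nonneg[of r] by (simp add: f_def)
  have fi: "integrable lebesgue (\<lambda>x::real^'n. f (norm x))"
  proof (rule Bochner_Integration.integrable_bound[OF ei])
    show "(\<lambda>x::real^'n. f (norm x)) \<in> borel_measurable lebesgue" by (intro measurable_completion) simp
    show "AE x in lebesgue. norm (f (norm x)) \<le> norm (indicator S x *\<^sub>R e x)"
      using le by eventually_elim (use f0 in \<open>auto intro: order_trans[OF _ abs_ge_self]\<close>)
  qed
  have eq: "radial_density CARD('n) r * f r = \<kappa> * (indicator A r * (r ^ (CARD('n) - k) * m r ^ (k + 1)))" for r
  proof (cases "r \<in> A")
    case True
    then have r: "0 < r" using sub by auto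
    have "r ^ (CARD('n) - 1) * r powr (1 - real k) = r ^ (CARD('n) - k)"
    proof -
      have "r ^ (CARD('n) - 1) * r powr (1 - real k) = r powr (real (CARD('n) - 1) + (1 - real k))"
        by (simp only: powr_add powr_realpow[OF r])
      also have "real (CARD('n) - 1) + (1 - real k) = real (CARD('n) - k)" using k by (simp add: of_nat_diff)
      finally show ?thesis using r by (simp add: powr_realpow)
    qed
    then show ?thesis using True r by (simp add: f_def radial_density_def \<kappa>_def mult.assoc[symmetric])
  qed (simp add: f_def)
  have "integrable lborel (\<lambda>r. \<kappa> * (indicator A r * (r ^ (CARD('n) - k) * m r ^ (k + 1))))"
    using fi integrable_radial_iff[of f, where 'n = 'n] by (simp add: eq)
  then show "integrable lborel (\<lambda>r. indicator A r * (r ^ (CARD('n) - k) * m r ^ (k + 1)))"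
    using \<kappa>_pos by simp
  have "\<kappa> * (LINT r|lborel. indicator A r * (r ^ (CARD('n) - k) * m r ^ (k + 1))) = (LINT x|lebesgue. f (norm (x::real^'n)))"
    using integral_radial[of f, where 'n = 'n] by (simp add: eq)
  also have "\<dots> \<le> (LINT x|lebesgue. indicator S x *\<^sub>R e x)" by (rule integral_mono_AE[OF fi ei le])
  finally show "\<kappa> * (LINT r|lborel. indicator A r * (r ^ (CARD('n) - k) * m r ^ (k + 1)))
      \<le> (LINT x:{x. norm x \<in> A}|lebesgue. norm x powr (1 - real k) * norm (Du x) ^ (k + 1))"
    by (simp add: set_lebesgue_integral_def S_def e_def)
qed

end

lemma bump_fun_continuous: "bump_fun \<alpha> \<beta> \<psi> \<psi>' \<Longrightarrow> continuous_on A \<psi> \<and> continuous_on A \<psi>'"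
  unfolding bump_fun_def by (meson DERIV_isCont continuous_at_imp_continuous_on continuous_on_subset subset_UNIV)

lemma AE_exhaust_unit_interval:
  assumes loc: "\<And>a b. 0 < a \<Longrightarrow> a < 1/4 \<Longrightarrow> 1/2 < b \<Longrightarrow> b < 1 \<Longrightarrow> AE r in lborel. r \<in> {a<..<b} \<longrightarrow> Q r"
  shows "AE r in lborel. r \<in> {0<..<1::real} \<longrightarrow> Q r"
proof -
  define d where "d j = 1 / real (j + 5)" for j :: nat
  have d: "0 < d j" "d j \<le> 1 / 5" for j by (auto simp: d_def field_simps)
  have "AE r in lborel. \<forall>j. r \<in> {d j<..<1 - d j} \<longrightarrow> Q r"
    unfolding AE_all_countable
  proof
    fix j
    show "AE r in lborel. r \<in> {d j<..<1 - d j} \<longrightarrow> Q r"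
      by (rule loc) (use d[of j] in linarith)+
  qed
  then show ?thesis
  proof eventually_elim
    case (elim r)
    show ?case
    proof
      assume "r \<in> {0<..<1}"
      then have "0 < min r (1 - r)" by auto
      then obtain j where j: "1 / real (Suc j) < min r (1 - r)" using nat_approx_posE by blast
      have "d j \<le> 1 / real (Suc j)" unfolding d_def by (intro divide_left_mono) auto
      then have "r \<in> {d j<..<1 - d j}" using j by auto
      then show "Q r" using elim by blast
    qed
  qed
qed

lemma integrable_indicator_Icc: "integrable lborel (indicator {a..b} :: real \<Rightarrow> real)"
  by (rule integrable_real_indicator) (auto simp: emeasure_lborel_Icc_eq)

lemma integrable_mult_continuous_support:
  fixes D \<theta> :: "real \<Rightarrow> real"
  assumes D: "integrable lborel D" and c: "continuous_on UNIV \<theta>" and z: "\<And>r. r \<notin> {\<alpha>..\<beta>} \<Longrightarrow> \<theta> r = 0"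
  shows "integrable lborel (\<lambda>r. D r * \<theta> r)"
proof -
  have "compact (\<theta> ` {\<alpha>..\<beta>})" by (intro compact_continuous_image continuous_on_subset[OF c]) auto
  from compact_imp_bounded[OF this] obtain B where B: "\<forall>y\<in>\<theta> ` {\<alpha>..\<beta>}. norm y \<le> B" unfolding bounded_iff by blast
  have b: "\<bar>\<theta> r\<bar> \<le> \<bar>B\<bar>" for r using B z[of r] by (cases "r \<in> {\<alpha>..\<beta>}") force+
  have [measurable]: "\<theta> \<in> borel_measurable borel" using c by (rule borel_measurable_continuous_onI)
  show ?thesis
  proof (rule Bochner_Integration.integrable_bound[OF integrable_mult_right[OF integrable_abs[OF D], of "\<bar>B\<bar>"]])
    show "(\<lambda>r. D r * \<theta> r) \<in> borel_measurable lborel" using borel_measurable_integrable[OF D] by measurable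
    show "AE r in lborel. norm (D r * \<theta> r) \<le> norm (\<bar>B\<bar> * \<bar>D r\<bar>)"
    proof (rule AE_I2)
      fix r
      show "norm (D r * \<theta> r) \<le> norm (\<bar>B\<bar> * \<bar>D r\<bar>)"
        using mult_left_mono[OF b[of r], of "\<bar>D r\<bar>"] by (simp add: abs_mult mult.commute)
    qed
  qed
qed

lemma du_Bois_Reymond:
  fixes D :: "real \<Rightarrow> real"
  assumes ab: "\<alpha> < 1/4" "1/2 < \<beta>"
    and D: "integrable lborel D"
    and test: "\<And>\<psi> \<psi>'. bump_fun \<alpha> \<beta> \<psi> \<psi>' \<Longrightarrow> (LINT r|lborel. D r * \<psi>' r) = 0"
  shows "AE r in lborel. r \<in> {\<alpha><..<\<beta>} \<longrightarrow> D r = (LINT r|lborel. D r * (smooth_step' ((r - 1/4) / (1/4)) / (1/4)))"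
proof -
  define \<theta>0 where "\<theta>0 = (\<lambda>r::real. smooth_step' ((r - 1/4) / (1/4)) / (1/4))"
  define C where "C = (LINT r|lborel. D r * \<theta>0 r)"
  have c0: "continuous_on A \<theta>0" for A unfolding \<theta>0_def
    by (intro continuous_intros continuous_on_compose2[OF smooth_step'_continuous[of UNIV]]) auto
  have z0: "\<theta>0 r = 0" if "r \<notin> {1/4..1/2}" for r
    using that smooth_step'_0[of "(r - 1/4) / (1/4)"] by (auto simp: \<theta>0_def field_simps)
  have i0: "(\<theta>0 has_integral 1) {1/4..1/2}" using smooth_step_kernel[of "1/4" "1/4"] by (simp add: \<theta>0_def)
  have int0: "(LINT r|lborel. \<theta>0 r) = 1"
  proof -
    have "(LINT r|lborel. \<theta>0 r) = integral {1/4..1/2} \<theta>0" by (rule lint_eq_integral(2)[OF c0 z0])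
    then show ?thesis using integral_unique[OF i0] by simp
  qed
  have key: "(LINT r|lborel. D r * \<theta> r) = C * (LINT r|lborel. \<theta> r)"
    if c: "continuous_on UNIV \<theta>" and z: "\<And>r. r \<notin> {\<alpha>..\<beta>} \<Longrightarrow> \<theta> r = 0" for \<theta>
  proof -
    define I where "I = (LINT r|lborel. \<theta> r)"
    define p where "p = (\<lambda>r. \<theta> r - I * \<theta>0 r)"
    have cp: "continuous_on A p" for A unfolding p_def by (intro continuous_intros c0 continuous_on_subset[OF c]) auto
    have zp: "p r = 0" if "r \<notin> {\<alpha>..\<beta>}" for r using that z[of r] z0[of r] ab by (auto simp: p_def)
    obtain G where G: "\<And>x. (G has_vector_derivative p x) (at x)"
      using einterval_antiderivative[of "-\<infinity>" "\<infinity>" p] cp[of UNIV] by (auto simp: continuous_on_eq_continuous_at)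
    have DG: "(G has_real_derivative p x) (at x)" for x
      using G by (simp add: has_real_derivative_iff_has_vector_derivative)
    have ic: "integrable lborel \<theta>" by (rule lint_eq_integral(1)[of \<alpha> \<beta>, OF _ z]) (use c continuous_on_subset in auto)
    have ic0: "integrable lborel \<theta>0" by (rule lint_eq_integral(1)[OF c0 z0])
    have ip: "(p has_integral (G y - G x)) {x..y}" if "x \<le> y" for x y
      by (rule fundamental_theorem_of_calculus[OF that]) (use G has_vector_derivative_at_within in blast)
    have "integral {\<alpha>..\<beta>} p = (LINT r|lborel. p r)" by (rule lint_eq_integral(2)[OF cp zp, symmetric])
    also have "\<dots> = 0" unfolding p_def using ic ic0 int0 by (simp add: I_def)
    finally have Gb: "G \<beta> = G \<alpha>" using integral_unique[OF ip[of \<alpha> \<beta>]] ab by simp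
    have "bump_fun \<alpha> \<beta> (\<lambda>r. G r - G \<alpha>) p"
      unfolding bump_fun_def
    proof (intro conjI allI impI)
      show "((\<lambda>r. G r - G \<alpha>) has_real_derivative p r) (at r)" for r
        using DERIV_diff[OF DG DERIV_const] by simp
      show "G r - G \<alpha> = 0" if r: "r \<notin> {\<alpha>..\<beta>}" for r
      proof (cases "r < \<alpha>")
        case True
        have "(p has_integral 0) {r..\<alpha>}"
          by (rule has_integral_spike[of "{\<alpha>}" _ _ "\<lambda>x. 0"]) (auto simp: zp)
        from has_integral_unique[OF ip[OF less_imp_le[OF True]] this] show ?thesis by simp
      next
        case False
        then have "\<beta> < r" using r by auto
        have "(p has_integral 0) {\<beta>..r}"
          by (rule has_integral_spike[of "{\<beta>}" _ _ "\<lambda>x. 0"]) (auto simp: zp)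
        from has_integral_unique[OF ip[OF less_imp_le[OF \<open>\<beta> < r\<close>]] this] show ?thesis using Gb by simp
      qed
    qed (rule cp)
    then have "(LINT r|lborel. D r * p r) = 0" by (rule test)
    moreover have "(LINT r|lborel. D r * p r) = (LINT r|lborel. D r * \<theta> r) - I * (LINT r|lborel. D r * \<theta>0 r)"
      unfolding p_def right_diff_distrib
      using integrable_mult_continuous_support[where \<alpha>=\<alpha> and \<beta>=\<beta>, OF D c z] integrable_mult_continuous_support[where \<alpha>="1/4" and \<beta>="1/2", OF D c0 z0]
      by (subst Bochner_Integration.integral_diff) (auto simp: mult.left_commute[of _ I])
    ultimately show ?thesis by (simp add: C_def I_def)
  qed
  have op: "open {\<alpha><..<\<beta>}" by simp
  define g where "g = (\<lambda>r. D r - C)"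
  have Dset: "set_integrable lborel A D" if "A \<in> sets borel" for A
    unfolding set_integrable_def using integrable_mult_indicator[OF _ D, of A] that by simp
  have lebD: "D integrable_on A" "integral A D = (LINT r|lborel. indicator A r * D r)" if "A \<in> sets borel" for A
    using set_borel_integral_eq_integral[OF Dset[OF that]] by (auto simp: set_lebesgue_integral_def)
  have zero: "integral (cbox a b) g = 0" if sub: "cbox a b \<subseteq> {\<alpha><..<\<beta>}" for a b
  proof (cases "a < b")
    case False
    then show ?thesis by (cases "a = b") auto
  next
    case True
    then have a: "\<alpha> < a" "b < \<beta>" using sub by (auto simp: subset_eq)
    define \<theta> where "\<theta> = (\<lambda>(j::nat) r. smooth_step (real (Suc j) * (r - a)) * smooth_step (real (Suc j) * (b - r)))"
    have cs: "continuous_on UNIV smooth_step" by (meson smooth_step_DERIV DERIV_isCont continuous_at_imp_continuous_on)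
    have c\<theta>: "continuous_on UNIV (\<theta> j)" for j
      unfolding \<theta>_def by (intro continuous_intros continuous_on_compose2[OF cs]) auto
    have z\<theta>: "\<theta> j r = 0" if "r \<le> a \<or> b \<le> r" for j r
      using that unfolding \<theta>_def by (auto simp: smooth_step_0 mult_le_0_iff)
    have r\<theta>: "0 \<le> \<theta> j r" "\<theta> j r \<le> 1" for j r
      unfolding \<theta>_def using smooth_step_range by (auto intro: mult_le_one)
    have l\<theta>: "(\<lambda>j. \<theta> j r) \<longlonglongrightarrow> indicator {a<..<b} r" for r
    proof (cases "r \<in> {a<..<b}")
      case False
      then have "\<theta> j r = 0" for j by (intro z\<theta>) auto
      then show ?thesis using False by simp
    next
      case True
      have S: "(\<lambda>j. smooth_step (real (Suc j) * y)) \<longlonglongrightarrow> 1" if y: "0 < y" for y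
      proof -
        obtain J where J: "1 < real J * y" using reals_Archimedean3[OF y] by blast
        have "smooth_step (real (Suc j) * y) = 1" if "J \<le> j" for j
        proof (rule smooth_step_1)
          have "real J * y \<le> real (Suc j) * y" using that y by (intro mult_right_mono) auto
          then show "1 \<le> real (Suc j) * y" using J by linarith
        qed
        then show ?thesis by (intro tendsto_eventually) (auto simp: eventually_sequentially)
      qed
      have "(\<lambda>j. \<theta> j r) \<longlonglongrightarrow> 1 * 1" unfolding \<theta>_def using True by (intro tendsto_mult S) auto
      then show ?thesis using True by simp
    qed
    have k: "(LINT r|lborel. D r * \<theta> j r) = C * (LINT r|lborel. \<theta> j r)" for j
      by (rule key[OF c\<theta>], rule z\<theta>) (use a in auto)
    have [measurable]: "\<theta> j \<in> borel_measurable borel" for j by (rule borel_measurable_continuous_onI[OF c\<theta>])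
    have [measurable]: "D \<in> borel_measurable borel" using borel_measurable_integrable[OF D] by simp
    have "(\<lambda>j. LINT r|lborel. D r * \<theta> j r) \<longlonglongrightarrow> (LINT r|lborel. D r * indicator {a<..<b} r)"
    proof (rule integral_dominated_convergence[where w = "\<lambda>r. \<bar>D r\<bar>"])
      show "AE r in lborel. norm (D r * \<theta> j r) \<le> \<bar>D r\<bar>" for j
        using r\<theta> by (intro AE_I2) (simp add: abs_mult mult_left_le)
      show "AE r in lborel. (\<lambda>j. D r * \<theta> j r) \<longlonglongrightarrow> D r * indicator {a<..<b} r"
        by (intro AE_I2 tendsto_mult tendsto_const l\<theta>)
    qed (use D in auto)
    moreover have "(\<lambda>j. LINT r|lborel. \<theta> j r) \<longlonglongrightarrow> (LINT r|lborel. indicator {a<..<b} r)"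
    proof (rule integral_dominated_convergence[where w = "\<lambda>r. indicator {a..b} r"])
      show "AE r in lborel. norm (\<theta> j r) \<le> indicator {a..b} r" for j
        using r\<theta> z\<theta> by (intro AE_I2) (auto simp: indicator_def)
      show "AE r in lborel. (\<lambda>j. \<theta> j r) \<longlonglongrightarrow> indicator {a<..<b} r" by (intro AE_I2 l\<theta>)
    qed (auto simp: integrable_indicator_Icc)
    then have "(\<lambda>j. C * (LINT r|lborel. \<theta> j r)) \<longlonglongrightarrow> C * (LINT r|lborel. indicator {a<..<b} r)" by (rule tendsto_mult_left)
    ultimately have "(LINT r|lborel. D r * indicator {a<..<b} r) = C * (LINT r|lborel. indicator {a<..<b} r)"
      unfolding k by (rule LIMSEQ_unique)
    also have "(LINT r|lborel. indicator {a<..<b} r) = b - a" using True by simp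
    finally have "integral {a<..<b} D = C * (b - a)" using lebD(2)[of "{a<..<b}"] by (simp add: mult.commute)
    then have "integral {a..b} D = C * (b - a)" by (simp add: integral_open_interval_real)
    moreover have "integral {a..b} g = integral {a..b} D - integral {a..b} (\<lambda>r::real. C)"
      unfolding g_def by (rule Henstock_Kurzweil_Integration.integral_diff) (use lebD(1)[of "{a..b}"] in auto)
    ultimately show ?thesis using True by (simp add: mult.commute)
  qed
  have "g absolutely_integrable_on {\<alpha><..<\<beta>}"
  proof -
    have "integrable lebesgue D" using D by (simp add: integrable_completion borel_measurable_integrable)
    then have "D absolutely_integrable_on {\<alpha><..<\<beta>}"
      unfolding set_integrable_def by (intro integrable_mult_indicator) auto
    moreover have "(\<lambda>r. C) absolutely_integrable_on {\<alpha><..<\<beta>}" by (rule absolutely_integrable_on_const) auto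
    ultimately show ?thesis unfolding g_def by (rule set_integral_diff(1))
  qed
  from zero_ae_if_zero_on_boxes[OF op this zero]
  obtain N where N: "negligible N" "\<And>x. x \<in> {\<alpha><..<\<beta>} - N \<Longrightarrow> g x = 0" by metis
  have "N \<in> null_sets lebesgue" using N(1) by (simp add: negligible_iff_null_sets)
  then have "AE x in lebesgue. x \<notin> N" by (rule AE_not_in)
  then have "AE x in lborel. x \<notin> N" by (simp add: AE_completion_iff)
  then show ?thesis
  proof eventually_elim
    case (elim x)
    then show ?case using N(2)[of x] by (auto simp: g_def C_def \<theta>0_def)
  qed
qed

context radial_sobolev
begin

lemma m_power_integrable:
  assumes ab: "0 < \<alpha>" "\<beta> < 1" and k: "1 \<le> k" "k \<le> CARD('n)"
  shows "integrable lborel (\<lambda>r. indicator {\<alpha>..\<beta>} r * (r ^ (CARD('n) - k) * m r ^ k))"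
proof (rule Bochner_Integration.integrable_bound)
  have "integrable lborel (indicator {\<alpha>..\<beta>} :: real \<Rightarrow> real)" by (rule integrable_indicator_Icc)
  moreover have "integrable lborel (\<lambda>r. indicator {\<alpha>..\<beta>} r * (r ^ (CARD('n) - k) * m r ^ (k + 1)))"
    by (rule energy_comparison(1)) (use ab k in auto)
  ultimately show "integrable lborel (\<lambda>r. indicator {\<alpha>..\<beta>} r + indicator {\<alpha>..\<beta>} r * (r ^ (CARD('n) - k) * m r ^ (k + 1)))"
    by (rule Bochner_Integration.integrable_add)
  show "AE r in lborel. norm (indicator {\<alpha>..\<beta>} r * (r ^ (CARD('n) - k) * m r ^ k))
      \<le> norm (indicator {\<alpha>..\<beta>} r + indicator {\<alpha>..\<beta>} r * (r ^ (CARD('n) - k) * m r ^ (k + 1)))"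
  proof (rule AE_I2)
    fix r :: real
    show "norm (indicator {\<alpha>..\<beta>} r * (r ^ (CARD('n) - k) * m r ^ k))
      \<le> norm (indicator {\<alpha>..\<beta>} r + indicator {\<alpha>..\<beta>} r * (r ^ (CARD('n) - k) * m r ^ (k + 1)))"
    proof (cases "r \<in> {\<alpha>..\<beta>}")
      case True
      then have r: "0 < r" "r \<le> 1" using ab by auto
      have q: "0 \<le> r ^ (CARD('n) - k)" "r ^ (CARD('n) - k) \<le> 1" using r by (auto intro: power_le_one)
      have p: "m r ^ k \<le> 1 + m r ^ (k + 1)"
      proof (cases "m r \<le> 1")
        case True
        have "m r ^ k \<le> 1" using True m_nonneg by (intro power_le_one) auto
        then show ?thesis using m_nonneg[of r] by (simp add: add_increasing2)
      next
        case False
        then have "m r ^ k \<le> m r ^ (k + 1)" by (intro power_increasing) auto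
        then show ?thesis by linarith
      qed
      have "r ^ (CARD('n) - k) * m r ^ k \<le> r ^ (CARD('n) - k) * (1 + m r ^ (k + 1))"
        by (rule mult_left_mono[OF p q(1)])
      also have "\<dots> \<le> 1 + r ^ (CARD('n) - k) * m r ^ (k + 1)" using q(2) by (simp add: distrib_left)
      finally show ?thesis using True q(1) m_nonneg[of r] by simp
    qed simp
  qed
qed measurable

lemma weak_equation_1D:
  assumes sol: "radial_weak_solution k g u Du" and g: "continuous_on UNIV g"
    and k: "1 \<le> k" "k \<le> CARD('n)"
    and b: "bump_fun \<alpha> \<beta> \<psi> \<psi>'" and ab: "0 < \<alpha>" "\<beta> < 1"
  shows "c_const CARD('n) k * (LINT r|lborel. (indicator {\<alpha>..\<beta>} r * (r ^ (CARD('n) - k) * m r ^ k)) * \<psi>' r)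
      + (LINT r|lborel. indicator {\<alpha>..\<beta>} r * (r ^ (CARD('n) - 1) * g (v r) * \<psi> r)) = 0"
proof -
  let ?n = "CARD('n)"
  define c where "c = c_const ?n k"
  define gv where "gv = (\<lambda>r. if r \<in> {\<alpha>..\<beta>} then g (v r) else 0)"
  define \<Phi> where "\<Phi> = (\<lambda>r. c * (m r / r) ^ k * (r * \<psi>' r) + gv r * \<psi> r)"
  have c\<psi>: "continuous_on UNIV \<psi>" "continuous_on UNIV \<psi>'" using bump_fun_continuous[OF b] by auto
  have z: "\<psi> r = 0" "\<psi>' r = 0" if "r \<notin> {\<alpha>..\<beta>}" for r
    using b bump_fun_deriv_0[OF b] that by (auto simp: bump_fun_def)
  have cgv: "continuous_on {\<alpha>..\<beta>} (\<lambda>r. g (v r))"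
    by (rule continuous_on_compose2[OF g continuous_on_subset[OF cv]]) (use ab in auto)
  have [measurable]: "gv \<in> borel_measurable borel"
    unfolding gv_def by (intro borel_measurable_continuous_on_if cgv) auto
  have [measurable]: "\<psi> \<in> borel_measurable borel" "\<psi>' \<in> borel_measurable borel"
    using c\<psi> by (auto intro: borel_measurable_continuous_onI)
  have [measurable]: "\<Phi> \<in> borel_measurable borel" unfolding \<Phi>_def by measurable
  define f1 where "f1 = (\<lambda>r. (indicator {\<alpha>..\<beta>} r * (r ^ (?n - k) * m r ^ k)) * \<psi>' r)"
  define f2 where "f2 = (\<lambda>r. indicator {\<alpha>..\<beta>} r * (r ^ (?n - 1) * g (v r) * \<psi> r))"
  have i1: "integrable lborel f1" unfolding f1_def
    by (rule integrable_mult_continuous_support[OF m_power_integrable[OF ab k] c\<psi>(2) z(2)])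
  have i2: "integrable lborel f2"
  proof -
    have "set_integrable lborel {\<alpha>..\<beta>} (\<lambda>r. r ^ (?n - 1) * g (v r) * \<psi> r)"
      by (intro borel_integrable_atLeastAtMost' continuous_intros cgv continuous_on_subset[OF c\<psi>(1)]) auto
    then show ?thesis by (simp add: set_integrable_def f2_def)
  qed
  have eq: "radial_density ?n r * \<Phi> r = \<kappa> * (c * f1 r + f2 r)" for r
  proof (cases "r \<in> {\<alpha>..\<beta>}")
    case True
    then have r: "0 < r" using ab by simp
    have "r ^ (?n - 1) * r = r ^ (?n - k) * r ^ k"
      using k by (simp flip: power_add power_Suc2)
    then have "r ^ (?n - 1) * ((m r / r) ^ k * (r * \<psi>' r)) = r ^ (?n - k) * m r ^ k * \<psi>' r"
      using r by (simp add: power_divide field_simps)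
    then show ?thesis using True r
      by (auto simp: radial_density_def \<kappa>_def \<Phi>_def f1_def f2_def gv_def distrib_left mult_ac)
  qed (use z in \<open>simp add: \<Phi>_def f1_def f2_def\<close>)
  have i\<Phi>: "integrable lebesgue (\<lambda>x::real^'n. \<Phi> (norm x))"
    unfolding integrable_radial_iff[OF \<open>\<Phi> \<in> borel_measurable borel\<close>] eq using i1 i2 by simp
  define \<eta> where "\<eta> = (\<lambda>x::real^'n. \<psi> (norm x))"
  have \<eta>: "\<eta> \<in> Cc1 B1"
    using radial_test_Cc1[OF b ab, where 'n = 'n] by (auto simp: Cc1_def \<eta>_def)
  have ae: "AE x in lebesgue. x \<in> B1 \<longrightarrow> 1 / real k * weak_form k Du \<eta> x + g (u x) * \<eta> x = \<Phi> (norm x)"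
    using radial_deriv_eq
  proof eventually_elim
    case (elim x)
    show ?case
    proof
      assume x: "x \<in> B1"
      show "1 / real k * weak_form k Du \<eta> x + g (u x) * \<eta> x = \<Phi> (norm x)"
      proof (cases "x = 0")
        case True
        then show ?thesis using z[of 0] ab by (simp add: weak_form_def \<Phi>_def \<eta>_def)
      next
        case False
        have "x \<bullet> grad \<eta> x = \<psi>' (norm x) / norm x * (\<Sum>i\<in>UNIV. x $ i * x $ i)"
          unfolding \<eta>_def grad_def inner_vec_def by (simp add: partial_radial_test[OF b ab(1)] sum_distrib_left algebra_simps)
        also have "(\<Sum>i\<in>UNIV. x $ i * x $ i) = (norm x)\<^sup>2"
          by (simp add: power2_norm_eq_inner inner_vec_def)
        finally have gr: "x \<bullet> grad \<eta> x = norm x * \<psi>' (norm x)" using False by (simp add: power2_eq_square)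
        have "g (u x) * \<eta> x = gv (norm x) * \<psi> (norm x)"
          using z(1)[of "norm x"] by (simp add: gv_def \<eta>_def radial)
        then show ?thesis using elim x False k by (simp add: weak_form_def \<Phi>_def gr c_def)
      qed
    qed
  qed
  then obtain N where N: "N \<in> null_sets lebesgue" "\<And>x. x \<in> B1 - N \<Longrightarrow> 1 / real k * weak_form k Du \<eta> x + g (u x) * \<eta> x = \<Phi> (norm x)"
    by (auto elim!: AE_E3)
  have neg: "negligible N" using N(1) by (simp add: negligible_iff_null_sets)
  have \<Phi>B: "(\<lambda>x. \<Phi> (norm x)) absolutely_integrable_on B1"
    unfolding set_integrable_def by (intro integrable_mult_indicator i\<Phi>) simp
  then have LB: "(\<lambda>x. 1 / real k * weak_form k Du \<eta> x + g (u x) * \<eta> x) absolutely_integrable_on B1"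
    by (rule absolutely_integrable_spike[OF _ neg N(2)])
  have "0 = (LINT x:B1|lebesgue. 1 / real k * weak_form k Du \<eta> x + g (u x) * \<eta> x)"
    using sol \<eta> by (simp add: radial_weak_solution_def)
  also have "\<dots> = integral B1 (\<lambda>x. 1 / real k * weak_form k Du \<eta> x + g (u x) * \<eta> x)"
    by (rule set_lebesgue_integral_eq_integral(2)[OF LB])
  also have "\<dots> = integral B1 (\<lambda>x. \<Phi> (norm x))" by (rule integral_spike[OF neg, symmetric]) (rule N(2))
  also have "\<dots> = (LINT x:B1|lebesgue. \<Phi> (norm x))" by (rule set_lebesgue_integral_eq_integral(2)[OF \<Phi>B, symmetric])
  also have "\<dots> = (LINT x|lebesgue. \<Phi> (norm (x::real^'n)))"
    unfolding set_lebesgue_integral_def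
    by (intro Bochner_Integration.integral_cong refl) (use z ab in \<open>auto simp: indicator_def \<Phi>_def\<close>)
  also have "\<dots> = (LINT r|lborel. \<kappa> * (c * f1 r + f2 r))"
    by (subst integral_radial) (auto simp: eq)
  also have "\<dots> = \<kappa> * (c * (LINT r|lborel. f1 r) + (LINT r|lborel. f2 r))"
    using i1 i2 by simp
  finally have "\<kappa> * (c * (LINT r|lborel. f1 r) + (LINT r|lborel. f2 r)) = 0" by simp
  then show ?thesis using \<kappa>_pos by (simp add: f1_def f2_def c_def)
qed

end

context radial_sobolev
begin

lemma flux_ae_eq:
  assumes sol: "radial_weak_solution k g u Du" and g: "continuous_on UNIV g"
    and k: "1 \<le> k" "k \<le> CARD('n)"
    and R: "\<And>r. 0 < r \<Longrightarrow> r < 1 \<Longrightarrow> (R has_real_derivative r ^ (CARD('n) - 1) * (g (v r) / c_const CARD('n) k)) (at r)"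
  obtains C where "AE r in lborel. r \<in> {0<..<1} \<longrightarrow> r ^ (CARD('n) - k) * m r ^ k = R r + C"
proof -
  let ?n = "CARD('n)"
  let ?c = "c_const ?n k"
  let ?f = "\<lambda>r. r ^ (?n - 1) * (g (v r) / ?c)"
  define \<theta> where "\<theta> = (\<lambda>r::real. smooth_step' ((r - 1/4) / (1/4)) / (1/4))"
  have \<theta>0: "\<theta> r = 0" if "r \<notin> {1/4..1/2}" for r
    using that smooth_step'_0[of "(r - 1/4) / (1/4)"] by (auto simp: \<theta>_def field_simps)
  have c: "0 < ?c" using k by (simp add: c_const_def)
  define C where "C = (LINT r|lborel. (r ^ (?n - k) * m r ^ k - R r) * \<theta> r)"
  have loc: "AE r in lborel. r \<in> {\<alpha><..<\<beta>} \<longrightarrow> r ^ (?n - k) * m r ^ k = R r + C"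
    if ab: "0 < \<alpha>" "\<alpha> < 1/4" "1/2 < \<beta>" "\<beta> < 1" for \<alpha> \<beta>
  proof -
    define I where "I = (\<lambda>r. indicator {\<alpha>..\<beta>} r :: real)"
    have cR: "continuous_on {\<alpha>..\<beta>} R"
      by (intro continuous_at_imp_continuous_on ballI DERIV_isCont[OF R]) (use ab in auto)
    have cf: "continuous_on {\<alpha>..\<beta>} ?f"
      by (intro continuous_intros continuous_on_compose2[OF g continuous_on_subset[OF cv]]) (use ab c in auto)
    define D1 where "D1 = (\<lambda>r. I r * (r ^ (?n - k) * m r ^ k))"
    define D2 where "D2 = (\<lambda>r. I r * R r)"
    have i1: "integrable lborel D1" unfolding D1_def I_def by (rule m_power_integrable[OF ab(1,4) k])
    have i2: "integrable lborel D2"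
      using borel_integrable_atLeastAtMost'[OF cR] by (simp add: set_integrable_def D2_def I_def)
    have AE: "AE r in lborel. r \<in> {\<alpha><..<\<beta>} \<longrightarrow> D1 r - D2 r = (LINT r|lborel. (D1 r - D2 r) * \<theta> r)"
      unfolding \<theta>_def
    proof (rule du_Bois_Reymond[OF ab(2,3)])
      show "integrable lborel (\<lambda>r. D1 r - D2 r)" using i1 i2 by simp
      fix \<psi> \<psi>' assume b: "bump_fun \<alpha> \<beta> \<psi> \<psi>'"
      have c\<psi>: "continuous_on A \<psi>" "continuous_on A \<psi>'" for A using bump_fun_continuous[OF b] by auto
      have D\<psi>: "(\<psi> has_real_derivative \<psi>' r) (at r)" for r using b by (simp add: bump_fun_def)
      have z: "\<psi> r = 0" "\<psi>' r = 0" if "r \<notin> {\<alpha>..\<beta>}" for r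
        using b bump_fun_deriv_0[OF b] that by (auto simp: bump_fun_def)
      have zb: "\<psi> r = 0" if "r = \<alpha> \<or> r = \<beta>" for r by (rule continuous_vanish_boundary[OF c\<psi>(1) z(1) that])
      have j1: "integrable lborel (\<lambda>r. D1 r * \<psi>' r)"
        by (rule integrable_mult_continuous_support[OF i1 c\<psi>(2) z(2)])
      have j2: "integrable lborel (\<lambda>r. D2 r * \<psi>' r)"
        by (rule integrable_mult_continuous_support[OF i2 c\<psi>(2) z(2)])
      have s1: "set_integrable lborel {\<alpha>..\<beta>} (\<lambda>r. ?f r * \<psi> r)"
        by (intro borel_integrable_atLeastAtMost' continuous_on_mult cf c\<psi>)
      have "((\<lambda>r. R r * \<psi>' r + ?f r * \<psi> r) has_integral (R \<beta> * \<psi> \<beta> - R \<alpha> * \<psi> \<alpha>)) {\<alpha>..\<beta>}"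
      proof (rule fundamental_theorem_of_calculus)
        fix r assume "r \<in> {\<alpha>..\<beta>}"
        then have "((\<lambda>r. R r * \<psi> r) has_real_derivative R r * \<psi>' r + ?f r * \<psi> r) (at r)"
          using DERIV_mult'[OF R D\<psi>, of r] ab by auto
        then show "((\<lambda>r. R r * \<psi> r) has_vector_derivative R r * \<psi>' r + ?f r * \<psi> r) (at r within {\<alpha>..\<beta>})"
          by (simp add: has_real_derivative_iff_has_vector_derivative has_vector_derivative_at_within)
      qed (use ab in auto)
      then have I0: "((\<lambda>r. R r * \<psi>' r + ?f r * \<psi> r) has_integral 0) {\<alpha>..\<beta>}" using zb by simp
      have s2: "set_integrable lborel {\<alpha>..\<beta>} (\<lambda>r. R r * \<psi>' r)"
        by (intro borel_integrable_atLeastAtMost' continuous_on_mult cR c\<psi>)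
      have L: "(LINT r|lborel. D2 r * \<psi>' r) = integral {\<alpha>..\<beta>} (\<lambda>r. R r * \<psi>' r)"
        using set_borel_integral_eq_integral(2)[OF s2] by (simp add: set_lebesgue_integral_def D2_def I_def mult.assoc)
      have M: "(LINT r|lborel. I r * (?f r * \<psi> r)) = integral {\<alpha>..\<beta>} (\<lambda>r. ?f r * \<psi> r)"
        using set_borel_integral_eq_integral(2)[OF s1] by (simp add: set_lebesgue_integral_def I_def)
      have "integral {\<alpha>..\<beta>} (\<lambda>r. R r * \<psi>' r) + integral {\<alpha>..\<beta>} (\<lambda>r. ?f r * \<psi> r) = 0"
        using integral_unique[OF I0] set_borel_integral_eq_integral(1)[OF s1] set_borel_integral_eq_integral(1)[OF s2]
        by (simp add: Henstock_Kurzweil_Integration.integral_add)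
      moreover have "?c * (LINT r|lborel. D1 r * \<psi>' r) + ?c * (LINT r|lborel. I r * (?f r * \<psi> r)) = 0"
      proof -
        have "(LINT r|lborel. I r * (r ^ (?n - 1) * g (v r) * \<psi> r)) = ?c * (LINT r|lborel. I r * (?f r * \<psi> r))"
          by (subst integral_mult_right_zero[symmetric], intro Bochner_Integration.integral_cong refl) (use c in simp)
        then show ?thesis using weak_equation_1D[OF sol g k b ab(1,4)] unfolding D1_def I_def by linarith
      qed
      then have "?c * ((LINT r|lborel. D1 r * \<psi>' r) + (LINT r|lborel. I r * (?f r * \<psi> r))) = 0"
        by (simp only: distrib_left)
      then have "(LINT r|lborel. D1 r * \<psi>' r) + (LINT r|lborel. I r * (?f r * \<psi> r)) = 0"
        using c by simp
      ultimately have "(LINT r|lborel. D1 r * \<psi>' r) - (LINT r|lborel. D2 r * \<psi>' r) = 0" using L M by linarith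
      then show "(LINT r|lborel. (D1 r - D2 r) * \<psi>' r) = 0"
        using j1 j2 by (simp add: left_diff_distrib)
    qed
    have "(LINT r|lborel. (D1 r - D2 r) * \<theta> r) = C"
      unfolding C_def
    proof (rule Bochner_Integration.integral_cong[OF refl])
      fix r show "(D1 r - D2 r) * \<theta> r = (r ^ (?n - k) * m r ^ k - R r) * \<theta> r"
        using \<theta>0[of r] ab by (cases "r \<in> {1/4..1/2}") (auto simp: D1_def D2_def I_def)
    qed
    with AE show ?thesis by (auto elim!: eventually_mono simp: D1_def D2_def I_def)
  qed
  have "AE r in lborel. r \<in> {0<..<1} \<longrightarrow> r ^ (?n - k) * m r ^ k = R r + C"
    by (rule AE_exhaust_unit_interval) (rule loc)
  then show ?thesis by (rule that)
qed

lemma radial_profile_of_flux: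
  assumes k: "1 \<le> k" "k \<le> CARD('n)" and G: "continuous_on {0<..<1} G" "\<And>r. 0 < r \<Longrightarrow> r < 1 \<Longrightarrow> 0 \<le> G r"
    and Q: "\<And>r. 0 < r \<Longrightarrow> r < 1 \<Longrightarrow> (Q has_real_derivative r ^ (CARD('n) - 1) * G r) (at r)"
    and ae: "AE r in lborel. r \<in> {0<..<1} \<longrightarrow> r ^ (CARD('n) - k) * m r ^ k = Q r"
  obtains w where "radial_profile CARD('n) k v w G" "AE r in lborel. r \<in> {0<..<1} \<longrightarrow> m r = w r"
proof -
  let ?n = "CARD('n)"
  have cQ: "continuous_on {0<..<1} Q"
    by (intro continuous_at_imp_continuous_on ballI DERIV_isCont[OF Q]) auto
  have Q0: "0 \<le> Q r" if r: "0 < r" "r < 1" for r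
  proof (rule ccontr)
    assume "\<not> 0 \<le> Q r"
    have "open ({0<..<1} \<inter> Q -` {..<0})" using cQ by (intro continuous_open_preimage) auto
    moreover have "r \<in> {0<..<1} \<inter> Q -` {..<0}" using r \<open>\<not> 0 \<le> Q r\<close> by auto
    moreover have "AE r in lborel. r \<notin> {0<..<1} \<inter> Q -` {..<0}"
      using ae
    proof eventually_elim
      case (elim r)
      have "0 \<le> r ^ (?n - k) * m r ^ k" if "0 < r" using that m_nonneg by simp
      then show ?case using elim by auto
    qed
    then have "AE r in lebesgue. r \<notin> {0<..<1} \<inter> Q -` {..<0}" by (simp add: AE_completion_iff)
    then have "{0<..<1} \<inter> Q -` {..<0} \<in> null_sets lebesgue"
      using \<open>open ({0<..<1} \<inter> Q -` {..<0})\<close> by (subst AE_iff_null_sets) auto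
    then have "negligible ({0<..<1} \<inter> Q -` {..<0})" by (simp add: negligible_iff_null_sets)
    ultimately show False using open_not_negligible[of "{0<..<1} \<inter> Q -` {..<0}"] by blast
  qed
  define w where "w = (\<lambda>r. root k (Q r / r ^ (?n - k)))"
  have wk: "w r ^ k = Q r / r ^ (?n - k)" if "0 < r" "r < 1" for r
    unfolding w_def using Q0[OF that] that k by (intro real_root_pow_pos2) auto
  have w0: "0 \<le> w r" if "0 < r" "r < 1" for r
    unfolding w_def using Q0[OF that] that by (intro real_root_ge_zero) auto
  have cw: "continuous_on {0<..<1} w"
    unfolding w_def by (intro continuous_intros cQ) auto
  have mw: "AE r in lborel. r \<in> {0<..<1} \<longrightarrow> m r = w r"
    using ae
  proof eventually_elim
    case (elim r)
    show ?case
    proof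
      assume r: "r \<in> {0<..<1}"
      then have "m r ^ k * r ^ (?n - k) = w r ^ k * r ^ (?n - k)" using elim wk[of r] by (simp add: field_simps)
      then have "m r ^ k = w r ^ k" using r by simp
      then show "m r = w r" using r k m_nonneg[of r] w0[of r] by (intro power_eq_imp_eq_base[of "m r" k]) auto
    qed
  qed
  have wint: "(w has_integral (v b - v a)) {a..b}" if ab: "0 < a" "a \<le> b" "b < 1" for a b
  proof -
    obtain N where N: "N \<in> null_sets lborel" "\<And>r. r \<in> {0<..<1} - N \<Longrightarrow> m r = w r"
      using mw by (auto elim!: AE_E3)
    have "negligible N" using N(1) by (auto simp: negligible_iff_null_sets intro: null_sets_completionI)
    then show ?thesis by (rule has_integral_spike[OF _ _ v_increment[OF ab]]) (use N(2) ab in auto)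
  qed
  have dv: "(v has_real_derivative w r) (at r)" if r: "0 < r" "r < 1" for r
  proof -
    define a b where "a = r / 2" and "b = (r + 1) / 2"
    have ab: "0 < a" "a < r" "r < b" "b < 1" using r by (auto simp: a_def b_def)
    have "((\<lambda>x. integral {a..x} w) has_real_derivative w r) (at r within {a..b})"
      using ab by (intro integral_has_real_derivative continuous_on_subset[OF cw]) auto
    then have "((\<lambda>x. integral {a..x} w) has_real_derivative w r) (at r)"
      using ab by (simp add: at_within_Icc_at)
    then have "((\<lambda>x. v a + integral {a..x} w) has_real_derivative w r) (at r)"
      using DERIV_add[OF DERIV_const[of "v a"]] by fastforce
    then show ?thesis
    proof (rule has_field_derivative_transform_within_open)
      show "v a + integral {a..x} w = v x" if "x \<in> {a<..<b}" for x
        using integral_unique[OF wint[of a x]] that ab by auto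
    qed (use ab in auto)
  qed
  have "((\<lambda>r. r ^ (?n - k) * w r ^ k) has_real_derivative r ^ (?n - 1) * G r) (at r)" if r: "0 < r" "r < 1" for r
    by (rule has_field_derivative_transform_within_open[OF Q[OF r], of "{0<..<1}"]) (use r wk in auto)
  then have "radial_profile ?n k v w G"
    using k cv dv cw w0 G by unfold_locales auto
  then show ?thesis using mw by (rule that)
qed

lemma weak_solution_profile:
  assumes sol: "radial_weak_solution k g u Du" and g: "continuous_on UNIV g" "\<And>t. 0 \<le> g t"
    and k: "1 \<le> k" "k \<le> CARD('n)"
  obtains w where "radial_profile CARD('n) k v w (\<lambda>r. g (v r) / c_const CARD('n) k)" "AE r in lborel. r \<in> {0<..<1} \<longrightarrow> m r = w r"
proof -
  let ?n = "CARD('n)"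
  let ?G = "\<lambda>r. g (v r) / c_const ?n k"
  have c: "0 < c_const ?n k" using k by (simp add: c_const_def)
  have cG: "continuous_on {0<..<1} ?G"
    by (intro continuous_intros continuous_on_compose2[OF g(1) continuous_on_subset[OF cv]]) (use c in auto)
  have "\<exists>R. \<forall>x. ereal 0 < ereal x \<longrightarrow> ereal x < ereal 1 \<longrightarrow> (R has_vector_derivative x ^ (?n - 1) * ?G x) (at x)"
  proof (rule einterval_antiderivative)
    fix x assume "ereal 0 < ereal x" "ereal x < ereal 1"
    then have "x \<in> {0<..<1}" by auto
    moreover have "continuous_on {0<..<1} (\<lambda>x. x ^ (?n - 1) * ?G x)" by (intro continuous_on_mult cG continuous_intros)
    ultimately show "isCont (\<lambda>x. x ^ (?n - 1) * ?G x) x" by (simp add: continuous_on_eq_continuous_at)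
  qed simp
  then obtain R where R: "\<And>r. 0 < r \<Longrightarrow> r < 1 \<Longrightarrow> (R has_real_derivative r ^ (?n - 1) * ?G r) (at r)"
    by (auto simp: has_real_derivative_iff_has_vector_derivative)
  obtain C where C: "AE r in lborel. r \<in> {0<..<1} \<longrightarrow> r ^ (?n - k) * m r ^ k = R r + C"
    by (rule flux_ae_eq[OF sol g(1) k R]) auto
  have RC: "((\<lambda>r. R r + C) has_real_derivative r ^ (?n - 1) * ?G r) (at r)" if "0 < r" "r < 1" for r
    using DERIV_add[OF R[OF that] DERIV_const[of C]] by simp
  show ?thesis
    by (rule radial_profile_of_flux[OF k cG _ RC C]) (use g(2) c that in auto)
qed

end

context radial_sobolev
begin

lemma classical_solution_profile:
  assumes sol: "classical_solution k g u" and g: "continuous_on UNIV g" "\<And>t. 0 \<le> g t"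
    and k: "1 \<le> k" "k \<le> CARD('n)"
  obtains w where "radial_profile CARD('n) k v w (\<lambda>r. g (v r) / c_const CARD('n) k)" "AE r in lborel. r \<in> {0<..<1} \<longrightarrow> m r = w r"
proof -
  let ?n = "CARD('n)"
  let ?G = "\<lambda>r. g (v r) / c_const ?n k"
  fix i0 :: 'n
  let ?a = "axis i0 1 :: real^'n"
  have c: "0 < c_const ?n k" using k by (simp add: c_const_def)
  have C2: "C2_on B1 u" and eqn: "\<And>x. x \<in> B1 \<Longrightarrow> S_op k (hessian u x) = g (u x)"
    using sol by (auto simp: classical_solution_def)
  have C1: "C1_on B1 u" and C1p: "C1_on B1 (partial i0 u)" using C2 by (auto simp: C2_on_def)
  have na: "norm (r *\<^sub>R ?a) = r" if "0 \<le> r" for r using that by simp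
  define w where "w = (\<lambda>r. partial i0 u (r *\<^sub>R ?a))"
  define w2 where "w2 = (\<lambda>r. partial i0 (partial i0 u) (r *\<^sub>R ?a))"
  have along: "((\<lambda>r. f (r *\<^sub>R ?a)) has_real_derivative partial i0 f (r *\<^sub>R ?a)) (at r)"
    if f: "C1_on B1 f" and r: "0 < r" "r < 1" for f r
  proof -
    have d: "f differentiable (at (r *\<^sub>R ?a))" using f r by (simp add: C1_on_def)
    have "((\<lambda>r. r *\<^sub>R ?a) has_derivative (\<lambda>h. h *\<^sub>R ?a)) (at r)" by (auto intro!: derivative_eq_intros)
    from diff_chain_at[OF this has_derivative_partial[OF d]]
    have "((\<lambda>r. f (r *\<^sub>R ?a)) has_derivative (\<lambda>h. \<Sum>i\<in>UNIV. (h *\<^sub>R ?a) $ i * partial i f (r *\<^sub>R ?a))) (at r)"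
      by (simp add: o_def)
    moreover have "(\<Sum>i\<in>UNIV. (h *\<^sub>R ?a) $ i * partial i f (r *\<^sub>R ?a)) = partial i0 f (r *\<^sub>R ?a) * h" for h
    proof -
      have "(\<Sum>i\<in>UNIV. (h *\<^sub>R ?a) $ i * partial i f (r *\<^sub>R ?a)) = (\<Sum>i\<in>UNIV. if i = i0 then h * partial i f (r *\<^sub>R ?a) else 0)"
        by (intro sum.cong refl) (auto simp: axis_def)
      then show ?thesis by (simp add: mult.commute)
    qed
    ultimately show ?thesis by (simp add: has_field_derivative_def)
  qed
  have dv: "(v has_real_derivative w r) (at r)" if r: "0 < r" "r < 1" for r
    unfolding w_def
    by (rule has_field_derivative_transform_within_open[OF along[OF C1 r], of "{0<..}"]) (use r in \<open>auto simp: radial\<close>)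
  have dw: "(w has_real_derivative w2 r) (at r)" if r: "0 < r" "r < 1" for r
    unfolding w_def w2_def by (rule along[OF C1p r])
  have cw: "continuous_on {0<..<1} w"
    by (intro continuous_at_imp_continuous_on ballI DERIV_isCont[OF dw]) auto
  have w0: "0 \<le> w r" if r: "0 < r" "r < 1" for r
  proof (rule ccontr)
    assume n: "\<not> 0 \<le> w r"
    then obtain d where d: "0 < d" "\<forall>h>0. h < d \<longrightarrow> v (r + h) < v r"
      using DERIV_neg_dec_right[OF dv[OF r]] by auto
    define h' where "h' = min (d / 2) ((1 - r) / 2)"
    have "0 < h'" using d(1) r by (simp add: h'_def)
    moreover have "h' \<le> d / 2" unfolding h'_def by (rule min.cobounded1)
    moreover have "h' \<le> (1 - r) / 2" unfolding h'_def by (rule min.cobounded2)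
    ultimately have h': "0 < h' \<and> h' < d \<and> r + h' < 1" using d(1) r by (auto simp: field_simps)
    have "v (r + h') < v r" using h' d(2) by blast
    moreover have "v r \<le> v (r + h')" by (rule v_le) (use r h' in auto)
    ultimately show False by simp
  qed
  have eq: "real (?n - k) * (w r / r) ^ k + real k * (w r / r) ^ (k - 1) * w2 r = ?G r" if r: "0 < r" "r < 1" for r
  proof -
    define x where "x = r *\<^sub>R ?a"
    have nx: "norm x = r" using r by (simp add: x_def)
    have xB: "x \<in> B1" using nx r by simp
    have uv: "u = (\<lambda>x. v (norm x))" by (rule ext) (rule radial)
    have "hessian u x = (\<chi> i j. (if i = j then w r / r else 0) + (w2 r - w r / r) * sgn x $ i * sgn x $ j)"
      unfolding uv using hessian_radial[of 0 1 v w x "w2 r"] dv dw[OF r] nx r by auto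
    moreover have "norm (sgn x) = 1" using nx r by (auto simp: norm_sgn)
    ultimately have S: "S_op k (hessian u x) = real ((?n - 1) choose k) * (w r / r) ^ k + real ((?n - 1) choose (k - 1)) * (w r / r) ^ (k - 1) * w2 r"
      using S_op_rank_one[of "sgn x" k "w r / r" "w2 r - w r / r"] k by simp
    have "S_op k (hessian u x) = g (v r)" using eqn[OF xB] by (simp add: radial nx)
    moreover have b1: "real ((?n - 1) choose k) = real (?n - k) * c_const ?n k"
    proof -
      have "?n * ((?n - 1) choose k) = (?n - k) * (?n choose k)"
        using binomial_absorb_comp[of ?n k] by simp
      then have "real ?n * real ((?n - 1) choose k) = real (?n - k) * real (?n choose k)"
        by (metis of_nat_mult)
      then show ?thesis by (simp add: c_const_def field_simps)
    qed
    moreover have b2: "real ((?n - 1) choose (k - 1)) = real k * c_const ?n k"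
    proof -
      have "k * (?n choose k) = ?n * ((?n - 1) choose (k - 1))"
        using times_binomial_minus1_eq[of k ?n] k by simp
      then have "real k * real (?n choose k) = real ?n * real ((?n - 1) choose (k - 1))"
        by (metis of_nat_mult)
      then show ?thesis by (simp add: c_const_def field_simps)
    qed
    ultimately have "g (v r) = c_const ?n k * (real (?n - k) * (w r / r) ^ k + real k * (w r / r) ^ (k - 1) * w2 r)"
      using S by (simp add: algebra_simps)
    then show ?thesis using c by simp
  qed
  have dP: "((\<lambda>r. r ^ (?n - k) * w r ^ k) has_real_derivative r ^ (?n - 1) * ?G r) (at r)" if r: "0 < r" "r < 1" for r
  proof -
    have "((\<lambda>r. r ^ (?n - k) * w r ^ k) has_real_derivative
        r ^ (?n - k) * (real k * w r ^ (k - 1) * w2 r) + real (?n - k) * r ^ (?n - k - 1) * w r ^ k) (at r)"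
      using dw[OF r] by (auto intro!: derivative_eq_intros)
    moreover have "r ^ (?n - k) * (real k * w r ^ (k - 1) * w2 r) + real (?n - k) * r ^ (?n - k - 1) * w r ^ k = r ^ (?n - 1) * ?G r"
    proof -
      have p1: "r ^ (?n - 1) = r ^ (?n - k) * r ^ (k - 1)" using k by (simp flip: power_add)
      have "r ^ (?n - 1) * (real k * (w r / r) ^ (k - 1) * w2 r) = r ^ (?n - k) * (real k * w r ^ (k - 1) * w2 r)"
        unfolding p1 power_divide using r by simp
      moreover have "r ^ (?n - 1) * (real (?n - k) * (w r / r) ^ k) = real (?n - k) * r ^ (?n - k - 1) * w r ^ k"
      proof (cases "?n = k")
        case False
        then have "r ^ (?n - 1) = r ^ (?n - k - 1) * r ^ k" using k by (simp flip: power_add)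
        then have p2: "r ^ (?n - 1) = r ^ (?n - k - 1) * r ^ k" .
        show ?thesis unfolding p2 power_divide using r by simp
      qed simp
      ultimately show ?thesis unfolding eq[OF r, symmetric] distrib_left by linarith
    qed
    ultimately show ?thesis by simp
  qed
  have cG: "continuous_on {0<..<1} ?G"
    by (intro continuous_intros continuous_on_compose2[OF g(1) continuous_on_subset[OF cv]]) (use c in auto)
  have rp: "radial_profile ?n k v w ?G"
    using k cv dv cw w0 dP cG g(2) c by unfold_locales auto
  have "AE r in lborel. r \<in> {0<..<1} \<longrightarrow> m r = w r"
  proof -
    have "AE r in lborel. r \<in> {a<..<b} \<longrightarrow> m r = w r" if ab: "0 < a" "b < 1" for a b
    proof -
      obtain N where N: "negligible N" "\<And>r. r \<in> {a<..<b} - N \<Longrightarrow> (v has_real_derivative m r) (at r)"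
        using v_differentiable_ae[OF ab] by auto
      have mw: "m r = w r" if "r \<in> {a<..<b} - N" for r
        using DERIV_unique[OF N(2)[OF that] dv] that ab by auto
      have "AE x in lebesgue. x \<notin> N" using N(1) by (intro AE_not_in) (simp add: negligible_iff_null_sets)
      then have "AE x in lborel. x \<notin> N" by (simp add: AE_completion_iff)
      then show ?thesis by eventually_elim (use mw in auto)
    qed
    then show ?thesis by (rule AE_exhaust_unit_interval)
  qed
  with rp show ?thesis by (rule that)
qed

end

lemma locally_Lipschitz_continuous:
  assumes "locally_Lipschitz g"
  shows "continuous_on UNIV g"
proof (rule continuous_at_imp_continuous_on, rule ballI)
  fix t
  obtain e L where e: "0 < e" "L-lipschitz_on (cball t e) g" using assms unfolding locally_Lipschitz_def by blast
  have "continuous_on (cball t e) g" by (rule lipschitz_on_continuous_on[OF e(2)])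
  then have "continuous_on (ball t e) g" by (rule continuous_on_subset) auto
  then show "isCont g t" using e(1) by (simp add: continuous_on_eq_continuous_at)
qed

lemma locally_Lipschitz_on_compact:
  assumes g: "locally_Lipschitz g" and X: "compact X"
  obtains L where "L-lipschitz_on X g"
proof -
  have ll: "local_lipschitz {0::real} X (\<lambda>_. g)"
    unfolding local_lipschitz_def
  proof (intro ballI)
    fix x t assume "x \<in> X" "t \<in> {0::real}"
    obtain e L where e: "0 < e" "L-lipschitz_on (cball x e) g" using g unfolding locally_Lipschitz_def by blast
    then have "\<forall>t\<in>cball t e \<inter> {0}. L-lipschitz_on (cball x e \<inter> X) g" by (auto intro: lipschitz_on_subset)
    then show "\<exists>u>0. \<exists>L. \<forall>t\<in>cball t u \<inter> {0}. L-lipschitz_on (cball x u \<inter> X) g" using e(1) by blast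
  qed
  obtain L where "\<And>t. t \<in> {0::real} \<Longrightarrow> L-lipschitz_on X g"
    by (rule local_lipschitz_compact_implies_lipschitz[OF ll X]) auto
  then show ?thesis using that by blast
qed

text \<open>cancel\<close>
lemma DERIV_outer_of_composition:
  fixes g v w :: "real \<Rightarrow> real"
  assumes v: "\<And>x. a \<le> x \<Longrightarrow> x \<le> b \<Longrightarrow> (v has_real_derivative w x) (at x)" and w: "\<And>x. a \<le> x \<Longrightarrow> x \<le> b \<Longrightarrow> 0 < w x"
    and r: "a < r" "r < b" and d: "((\<lambda>x. g (v x)) has_real_derivative d) (at r)"
  shows "(g has_real_derivative d / w r) (at (v r))"
proof -
  have mono: "v x < v y" if "a \<le> x" "x < y" "y \<le> b" for x y
  proof (rule DERIV_pos_imp_increasing[OF that(2)])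
    fix z assume "x \<le> z" "z \<le> y"
    then show "\<exists>d. (v has_real_derivative d) (at z) \<and> 0 < d" using v[of z] w[of z] that by auto
  qed
  have cv: "continuous_on {a..b} v"
    by (intro continuous_at_imp_continuous_on ballI DERIV_isCont[OF v]) auto
  have inj: "inj_on v {a..b}"
  proof (rule inj_onI)
    fix x y assume "x \<in> {a..b}" "y \<in> {a..b}" "v x = v y"
    then show "x = y" using mono[of x y] mono[of y x] by (cases x y rule: linorder_cases) auto
  qed
  define \<tau> where "\<tau> = the_inv_into {a..b} v"
  have \<tau>v: "\<tau> (v x) = x" if "x \<in> {a..b}" for x unfolding \<tau>_def by (rule the_inv_into_f_f[OF inj that])
  have vr: "v a < v r" "v r < v b" using mono r by auto
  have img: "\<exists>x\<in>{a..b}. v x = y" if "v a \<le> y" "y \<le> v b" for y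
    using IVT'[of v a y b] that cv r by auto
  have v\<tau>: "v (\<tau> y) = y" if "v a < y" "y < v b" for y
    using img[of y] that \<tau>v by fastforce
  have "continuous_on (v ` {a..b}) \<tau>" by (rule continuous_on_inv[OF cv]) (use \<tau>v in auto)
  then have "continuous_on {v a<..<v b} \<tau>" 
  proof (rule continuous_on_subset)
    show "{v a<..<v b} \<subseteq> v ` {a..b}"
    proof
      fix y assume "y \<in> {v a<..<v b}"
      then show "y \<in> v ` {a..b}" using img[of y] by auto
    qed
  qed
  then have ic: "isCont \<tau> (v r)" using vr by (simp add: continuous_on_eq_continuous_at)
  have D\<tau>: "(\<tau> has_real_derivative inverse (w r)) (at (v r))"
    by (rule DERIV_inverse_function[where f = v and a = "v a" and b = "v b", OF _ _ vr v\<tau> ic])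
       (use v[of r] w[of r] r \<tau>v[of r] in auto)
  have "((\<lambda>x. g (v x)) has_real_derivative d) (at (\<tau> (v r)))" using d \<tau>v[of r] r by simp
  from DERIV_chain2[OF this D\<tau>]
  have "((\<lambda>y. g (v (\<tau> y))) has_real_derivative d * inverse (w r)) (at (v r))" .
  then have "(g has_real_derivative d * inverse (w r)) (at (v r))"
    by (rule has_field_derivative_transform_within_open[of _ _ _ "{v a<..<v b}"]) (use vr v\<tau> in auto)
  then show ?thesis by (simp add: divide_inverse)
qed

lemma DERIV_power_divide:
  assumes "0 < (r::real)"
  shows "((\<lambda>r. r ^ j) has_real_derivative real j * (r ^ j / r)) (at r)"
  using assms DERIV_pow[of j r UNIV] by (cases j) auto

context radial_profile
begin

definition wd :: "real \<Rightarrow> real" where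
  "wd r = (r ^ (n - 1) * G r - real (n - k) * (r ^ (n - k) * w r ^ k) / r) / (real k * r ^ (n - k) * w r ^ (k - 1))"

lemma wd_DERIV:
  assumes r: "0 < r" "r < 1" "0 < w r"
  shows "(w has_real_derivative wd r) (at r)"
proof -
  let ?q = "\<lambda>r. r ^ (n - k)"
  define y where "y = P r / ?q r"
  have yw: "y = w r ^ k" using r by (simp add: y_def P_def)
  have rt: "root k y = w r" unfolding yw using k1 r by (intro real_root_power_cancel) auto
  have DP: "(P has_real_derivative r ^ (n - 1) * G r) (at r)" using dP[OF r(1,2)] by (simp add: P_def [abs_def])
  have "((\<lambda>r. P r / ?q r) has_real_derivative (r ^ (n - 1) * G r * ?q r - P r * (real (n - k) * (?q r / r))) / (?q r * ?q r)) (at r)"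
    by (rule DERIV_divide[OF DP DERIV_power_divide[OF r(1)]]) (use r in auto)
  moreover have "(root k has_real_derivative inverse (real k * root k y ^ (k - Suc 0))) (at (P r / ?q r))"
    unfolding y_def[symmetric] by (rule DERIV_real_root) (use k1 r yw in auto)
  ultimately have "((\<lambda>r. root k (P r / ?q r)) has_real_derivative
     inverse (real k * root k y ^ (k - Suc 0)) * ((r ^ (n - 1) * G r * ?q r - P r * (real (n - k) * (?q r / r))) / (?q r * ?q r))) (at r)"
    by (intro DERIV_chain2)
  moreover have "inverse (real k * root k y ^ (k - Suc 0)) * ((r ^ (n - 1) * G r * ?q r - P r * (real (n - k) * (?q r / r))) / (?q r * ?q r)) = wd r"
  proof -
    have h1: "(r ^ (n - 1) * G r * ?q r - P r * (real (n - k) * (?q r / r))) / (?q r * ?q r)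
        = (r ^ (n - 1) * G r - real (n - k) * P r / r) / ?q r"
      using r by (simp add: field_simps)
    show ?thesis unfolding h1 rt unfolding wd_def P_def One_nat_def
      by (simp only: divide_inverse inverse_mult_distrib mult_ac)
  qed
  ultimately have "((\<lambda>r. root k (P r / ?q r)) has_real_derivative wd r) (at r)" by simp
  then show ?thesis
  proof (rule has_field_derivative_transform_within_open)
    show "root k (P x / ?q x) = w x" if "x \<in> {0<..<1}" for x
      using that k1 w0[of x] by (simp add: P_def real_root_power_cancel)
  qed (use r in auto)
qed

lemma wd_cont:
  assumes "0 < \<alpha>" "\<beta> < 1" "\<And>r. \<alpha> \<le> r \<Longrightarrow> r \<le> \<beta> \<Longrightarrow> 0 < w r"
  shows "continuous_on {\<alpha>..\<beta>} wd"
proof -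
  have nz: "r \<noteq> 0" "w r \<noteq> 0" if "r \<in> {\<alpha>..\<beta>}" for r using assms(3)[of r] that assms(1) by auto
  show ?thesis unfolding wd_def [abs_def]
    by (intro continuous_intros continuous_on_subset[OF cG] w_cont) (use assms(1,2) k1 nz in auto)
qed

lemma flux_deriv:
  assumes r: "0 < r" "r < 1" "0 < w r"
  shows "r ^ (n - 1) * G r = real (n - k) * (r ^ (n - k) * w r ^ k) / r + real k * r ^ (n - k) * w r ^ (k - 1) * wd r"
proof -
  have "real k * r ^ (n - k) * w r ^ (k - 1) \<noteq> 0" using r k1 by simp
  then show ?thesis by (simp add: wd_def)
qed

end

context radial_profile
begin

lemma stability_algebra:
  fixes z z' N A :: real
  assumes r: "0 < r" "r < 1" "0 < w r"
  defines "N \<equiv> real (n - k)"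
  defines "A \<equiv> (N + real k * (real n - 1)) / (real k + 1)"
  shows "real k * r ^ (n - k) * w r ^ (k - 1) * (wd r * z + w r * z')\<^sup>2
      - r ^ (n - 1) * G r * ((real n - 1) / r * w r * z\<^sup>2 + wd r * z\<^sup>2 + 2 * w r * z * z')
      + A * (r ^ (n - k) * w r ^ (k + 1) * z\<^sup>2 * (N - 1) / r\<^sup>2
           + (real k + 1) * r ^ (n - k) * w r ^ k * wd r * z\<^sup>2 / r
           + 2 * r ^ (n - k) * w r ^ (k + 1) * z * z' / r)
    = real k * (W r * (z'\<^sup>2 + 2 * ((real k - 1) / (real k + 1)) * z * z' / r
           - ((2 * real n - real k - 1) / (real k + 1)) * z\<^sup>2 / r\<^sup>2))"
proof -
  obtain j where j: "k = Suc j" using k1 by (cases k) auto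
  have nN: "real n = N + real k" using kn by (simp add: N_def of_nat_diff)
  define q where "q = r ^ (n - k)"
  define p where "p = w r ^ j"
  define y where "y = w r"
  define d where "d = wd r"
  define \<kappa> where "\<kappa> = real k"
  have k0: "\<kappa> + 1 \<noteq> 0" by (simp add: \<kappa>_def)
  have F: "r ^ (n - 1) * G r = N * (q * (p * y)) / r + \<kappa> * q * p * d"
    using flux_deriv[OF r] by (simp add: q_def p_def y_def d_def j N_def \<kappa>_def mult_ac)
  have "W r = q * w r ^ (k + 1)" by (simp add: W_def q_def)
  then have 1: "w r ^ (k - 1) = p" "w r ^ k = p * y" "w r ^ (k + 1) = p * y * y" "W r = q * (p * y * y)"
    by (simp_all add: j p_def y_def q_def mult_ac)
  define b where "b = (\<kappa> - 1) / (\<kappa> + 1)"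
  define g where "g = (2 * (N + \<kappa>) - \<kappa> - 1) / (\<kappa> + 1)"
  have A: "A * (\<kappa> + 1) = N + \<kappa> * (N + \<kappa> - 1)" using k0 by (simp add: A_def nN \<kappa>_def)
  have Ab: "A = N + \<kappa> * b" using A k0 by (simp add: b_def field_simps)
  have "(\<kappa> + 1) * (A * (N - 1)) = (\<kappa> + 1) * (N * (N + \<kappa> - 1) - \<kappa> * g)"
  proof -
    have "(\<kappa> + 1) * (A * (N - 1)) = (N + \<kappa> * (N + \<kappa> - 1)) * (N - 1)" unfolding A[symmetric] by simp
    moreover have "(\<kappa> + 1) * g = 2 * (N + \<kappa>) - \<kappa> - 1" using k0 by (simp add: g_def)
    then have "(\<kappa> + 1) * (N * (N + \<kappa> - 1) - \<kappa> * g) = (\<kappa> + 1) * (N * (N + \<kappa> - 1)) - \<kappa> * (2 * (N + \<kappa>) - \<kappa> - 1)"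
      by (metis mult.left_commute right_diff_distrib)
    ultimately show ?thesis by (simp add: algebra_simps)
  qed
  then have Ag: "A * (N - 1) = N * (N + \<kappa> - 1) - \<kappa> * g" using k0 by simp
  have S: "A * (X * (N - 1) / r\<^sup>2 + (\<kappa> + 1) * Y * Y' * d * Z / r + V)
      = (A * (N - 1)) * X / r\<^sup>2 + (A * (\<kappa> + 1)) * Y * Y' * d * Z / r + A * V" for X Y Y' Z V
    by (simp add: algebra_simps add_divide_distrib diff_divide_distrib)
  show ?thesis
    unfolding 1 F unfolding q_def[symmetric] y_def[symmetric] d_def[symmetric] nN \<kappa>_def[symmetric] S A Ag
    unfolding Ab b_def[symmetric] g_def[symmetric] using r(1)
    by (simp add: field_simps power2_eq_square)
qed

end

lemma stability_1D:
  fixes u :: "real^'n::finite \<Rightarrow> real"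
  assumes rp: "radial_profile CARD('n) k v w (\<lambda>r. g (v r) / c_const CARD('n) k)"
    and u: "\<And>x. u x = v (norm x)" and gL: "locally_Lipschitz g" and st: "semistable k g u"
    and ab: "0 < \<alpha>" "\<alpha> < \<beta>" "\<beta> < 1" and w: "\<And>r. \<alpha> \<le> r \<Longrightarrow> r \<le> \<beta> \<Longrightarrow> 0 < w r"
    and b: "bump_fun \<alpha> \<beta> \<zeta> \<zeta>'"
  shows "0 \<le> integral {\<alpha>..\<beta>} (\<lambda>r. radial_profile.W CARD('n) k w r * ((\<zeta>' r)\<^sup>2
     + 2 * ((real k - 1) / (real k + 1)) * \<zeta> r * \<zeta>' r / r
     - ((2 * real CARD('n) - real k - 1) / (real k + 1)) * (\<zeta> r)\<^sup>2 / r\<^sup>2))"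
proof -
  define c where "c = c_const CARD('n) k"
  define n where "n = CARD('n)"
  define G where "G = (\<lambda>r. g (v r) / c)"
  interpret radial_profile n k v w G using rp by (simp add: n_def G_def c_def)
  have c: "0 < c" using k1 kn by (simp add: c_def c_const_def n_def)
  define N where "N = n - k"
  have D\<zeta>: "(\<zeta> has_real_derivative \<zeta>' r) (at r)" for r using b by (simp add: bump_fun_def)
  have c\<zeta>': "continuous_on A \<zeta>'" for A using b continuous_on_subset by (auto simp: bump_fun_def)
  have c\<zeta>: "continuous_on A \<zeta>" for A by (intro continuous_at_imp_continuous_on ballI DERIV_isCont[OF D\<zeta>])
  have z: "\<zeta> r = 0" "\<zeta>' r = 0" if "r \<notin> {\<alpha>..\<beta>}" for r
    using b bump_fun_deriv_0[OF b] that by (auto simp: bump_fun_def)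
  have z0: "\<zeta> r = 0" if "r = \<alpha> \<or> r = \<beta>" for r
    by (rule continuous_vanish_boundary[OF c\<zeta> z(1) that])
  have in01: "0 < r" "r < 1" "0 < w r" if "r \<in> {\<alpha>..\<beta>}" for r using that ab w by auto
  have Dw: "(w has_real_derivative wd r) (at r)" if "r \<in> {\<alpha>..\<beta>}" for r by (rule wd_DERIV[OF in01[OF that]])
  have cwd: "continuous_on {\<alpha>..\<beta>} wd" by (rule wd_cont[OF ab(1,3) w])
  have cw': "continuous_on {\<alpha>..\<beta>} w" by (rule w_cont[OF ab(1,3)])
  define cl where "cl = (\<lambda>r. max \<alpha> (min \<beta> r))"
  define \<xi> where "\<xi> = (\<lambda>r. w r * \<zeta> r)"
  define \<xi>' where "\<xi>' = (\<lambda>r. wd (cl r) * \<zeta> r + w (cl r) * \<zeta>' r)"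
  have cl: "cl r = r" if "r \<in> {\<alpha>..\<beta>}" for r using that by (simp add: cl_def)
  have \<xi>'_eq: "\<xi>' r = wd r * \<zeta> r + w r * \<zeta>' r" if "r \<in> {\<alpha>..\<beta>}" for r using cl[OF that] by (simp add: \<xi>'_def)
  have b\<xi>: "bump_fun \<alpha> \<beta> \<xi> \<xi>'"
    unfolding bump_fun_def
  proof (intro conjI allI impI)
    show "\<xi> r = 0" if "r \<notin> {\<alpha>..\<beta>}" for r using z[OF that] by (simp add: \<xi>_def)
    have cc: "continuous_on UNIV cl" unfolding cl_def by (intro continuous_intros)
    show "continuous_on UNIV \<xi>'" unfolding \<xi>'_def
      by (intro continuous_intros c\<zeta> c\<zeta>' continuous_on_compose2[OF cwd cc] continuous_on_compose2[OF cw' cc])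
         (use ab in \<open>auto simp: cl_def\<close>)
    fix r
    show "(\<xi> has_real_derivative \<xi>' r) (at r)"
    proof (cases "r \<in> {\<alpha>..\<beta>}")
      case True
      then show ?thesis unfolding \<xi>'_eq[OF True] \<xi>_def using DERIV_mult[OF Dw[OF True] D\<zeta>] by (simp add: mult.commute)
    next
      case False
      have "(\<xi> has_real_derivative 0) (at r)"
        by (rule has_field_derivative_transform_within_open[OF DERIV_const[of 0], of "- {\<alpha>..\<beta>}"])
           (use False z in \<open>auto simp: \<xi>_def open_Compl\<close>)
      then show ?thesis using z[OF False] by (simp add: \<xi>'_def)
    qed
  qed
  define \<phi> where "\<phi> = (\<lambda>x::real^'n. \<xi> (norm x))"
  have \<phi>: "\<phi> \<in> Cc1 (ball 0 1 - {0})" unfolding \<phi>_def by (rule radial_test_Cc1[OF b\<xi> ab(1,3)])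
  define \<Theta> where "\<Theta> = (\<lambda>r. if r \<in> {\<alpha>..\<beta>} then real k * c * (w r / r) ^ (k - 1) * (\<xi>' r)\<^sup>2 + ae_deriv g (v r) * (\<xi> r)\<^sup>2 else 0)"
  have dens: "stability_density k g u \<phi> x = \<Theta> (norm x)" for x
  proof (cases "norm x \<in> {\<alpha>..\<beta>}")
    case True
    define r where "r = norm x"
    have r: "r \<in> {\<alpha>..\<beta>}" using True by (simp add: r_def)
    note r' = in01[OF r]
    have uv: "u = (\<lambda>x. v (norm x))" by (rule ext) (rule u)
    have H: "hessian u x = (\<chi> i j. (if i = j then w r / r else 0) + (wd r - w r / r) * sgn x $ i * sgn x $ j)"
      unfolding uv r_def using hessian_radial[of 0 1 v w x "wd r"] dv Dw[OF r] r' by (simp add: r_def)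
    have sn: "norm (sgn x) = 1" using r' by (auto simp: norm_sgn r_def)
    have p: "partial i \<phi> x = (\<xi>' r *\<^sub>R sgn x) $ i" for i
      unfolding \<phi>_def partial_radial_test[OF b\<xi> ab(1)] by (simp add: r_def sgn_div_norm divide_inverse mult.commute)
    have b2: "real ((n - 1) choose (k - 1)) = real k * c"
    proof -
      have "k * (n choose k) = n * ((n - 1) choose (k - 1))"
        using times_binomial_minus1_eq[of k n] k1 by simp
      then have "real k * real (n choose k) = real n * real ((n - 1) choose (k - 1))"
        by (metis of_nat_mult)
      moreover have "0 < n" using k1 kn by simp
      ultimately show ?thesis by (simp add: c_const_def c_def n_def[symmetric] field_simps)
    qed
    have "(\<Sum>i\<in>UNIV. \<Sum>j\<in>UNIV. partial i \<phi> x * partial j \<phi> x * S_deriv k (hessian u x) i j)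
        = real ((CARD('n) - 1) choose (k - 1)) * (w r / r) ^ (k - 1) * (\<xi>' r)\<^sup>2"
      unfolding p H using kn by (intro S_deriv_quadratic_rank_one[OF sn k1]) (auto simp: n_def)
    then show ?thesis using True b2 by (simp add: stability_density_def \<Theta>_def r_def n_def u \<phi>_def)
  next
    case False
    have "partial i \<phi> x = 0" for i
      unfolding \<phi>_def partial_radial_test[OF b\<xi> ab(1)] using bump_fun_deriv_0[OF b\<xi> False] by simp
    moreover have "\<phi> x = 0" using z[OF False] by (simp add: \<phi>_def \<xi>_def)
    ultimately show ?thesis using False by (auto simp: stability_density_def \<Theta>_def)
  qed
  have dI: "(\<lambda>x. \<Theta> (norm x)) absolutely_integrable_on ball (0::real^'n) 1"
    and dP: "0 \<le> (LINT x:ball (0::real^'n) 1|lebesgue. \<Theta> (norm x))"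
    using st \<phi> unfolding semistable_def dens[symmetric] by auto
  \<comment> \<open>1D by parts\<close>
  define \<psi> where "\<psi> = (\<lambda>r. r ^ (n - 1) * w r * (\<zeta> r)\<^sup>2)"
  define \<psi>' where "\<psi>' = (\<lambda>r. r ^ (n - 1) * ((real n - 1) / r * w r * (\<zeta> r)\<^sup>2 + wd r * (\<zeta> r)\<^sup>2 + 2 * w r * \<zeta> r * \<zeta>' r))"
  have D\<psi>: "(\<psi> has_real_derivative \<psi>' r) (at r)" if r: "r \<in> {\<alpha>..\<beta>}" for r
  proof -
    have n1: "real n = real (n - 1) + 1" using k1 kn by (simp add: of_nat_diff)
    have D2: "((\<lambda>r. (\<zeta> r)\<^sup>2) has_real_derivative 2 * \<zeta> r * \<zeta>' r) (at r)"
      using DERIV_power[OF D\<zeta>[of r], of 2] by (simp add: mult_ac)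
    from DERIV_mult[OF DERIV_mult[OF DERIV_power_divide[OF in01(1)[OF r], of "n - 1"] Dw[OF r]] D2]
    show ?thesis unfolding \<psi>_def
      by (rule DERIV_cong) (use in01[OF r] in \<open>simp add: \<psi>'_def n1 algebra_simps\<close>)
  qed
  have c\<psi>': "continuous_on {\<alpha>..\<beta>} \<psi>'"
    unfolding \<psi>'_def by (intro continuous_intros cw' cwd c\<zeta> c\<zeta>') (use ab in auto)
  obtain L where L: "L-lipschitz_on {\<alpha>..\<beta>} G"
  proof -
    have "compact (v ` {\<alpha>..\<beta>})" using ab by (intro compact_continuous_image continuous_on_subset[OF cv]) auto
    then obtain L1 where L1: "L1-lipschitz_on (v ` {\<alpha>..\<beta>}) g" using locally_Lipschitz_on_compact[OF gL] by blast
    have "bounded (w ` {\<alpha>..\<beta>})" by (intro compact_imp_bounded compact_continuous_image cw') auto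
    then obtain B where B: "\<forall>y\<in>w ` {\<alpha>..\<beta>}. norm y \<le> B" unfolding bounded_iff by blast
    have "\<bar>B\<bar>-lipschitz_on {\<alpha>..\<beta>} v"
    proof (rule bounded_derivative_imp_lipschitz[where f' = "\<lambda>r h. w r * h"])
      show "(v has_derivative (\<lambda>h. w r * h)) (at r within {\<alpha>..\<beta>})" if "r \<in> {\<alpha>..\<beta>}" for r
        using dv[OF in01(1,2)[OF that]] unfolding has_field_derivative_def by (rule has_derivative_at_withinI)
      show "onorm (\<lambda>h. w r * h) \<le> \<bar>B\<bar>" if "r \<in> {\<alpha>..\<beta>}" for r
      proof (rule onorm_le)
        fix h
        have "\<bar>w r\<bar> \<le> \<bar>B\<bar>" using bspec[OF B imageI[OF that]] by simp
        then show "norm (w r * h) \<le> \<bar>B\<bar> * norm h" by (simp add: abs_mult mult_right_mono)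
      qed
    qed auto
    from lipschitz_on_compose2[OF this L1]
    have "(L1 * \<bar>B\<bar>)-lipschitz_on {\<alpha>..\<beta>} (\<lambda>r. g (v r))" .
    from lipschitz_on_cmult_real[OF this, of "1 / c"] show ?thesis using that by (simp add: G_def)
  qed
  have "\<psi> \<alpha> = 0" "\<psi> \<beta> = 0" using z0[of \<alpha>] z0[of \<beta>] by (auto simp: \<psi>_def)
  then obtain Z G' where Z: "negligible Z" "\<And>x. x \<in> {\<alpha><..<\<beta>} - Z \<Longrightarrow> (G has_real_derivative G' x) (at x)"
      and parts: "((\<lambda>x. G' x * \<psi> x + G x * \<psi>' x) has_integral 0) {\<alpha>..\<beta>}"
    using lipschitz_by_parts[OF L ab(2) D\<psi> c\<psi>'] by metis
  have aed: "ae_deriv g (v r) * w r = c * G' r" if r: "r \<in> {\<alpha><..<\<beta>} - Z" for r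
  proof -
    have "((\<lambda>x. g (v x)) has_real_derivative c * G' r) (at r)"
      using DERIV_cmult[OF Z(2)[OF r], of c] c by (simp add: G_def)
    then have "(g has_real_derivative c * G' r / w r) (at (v r))"
      by (intro DERIV_outer_of_composition[where a = \<alpha> and b = \<beta>]) (use r ab w dv in auto)
    then have "ae_deriv g (v r) = c * G' r / w r"
      using DERIV_imp_deriv real_differentiable_def unfolding ae_deriv_def by fastforce
    then show ?thesis using in01(3)[of r] r by auto
  qed
  define I1 where "I1 = (\<lambda>r. real k * r ^ (n - k) * w r ^ (k - 1) * (wd r * \<zeta> r + w r * \<zeta>' r)\<^sup>2)"
  define T0 where "T0 = (\<lambda>r. I1 r + G' r * \<psi> r)"
  have cI1: "continuous_on {\<alpha>..\<beta>} I1" unfolding I1_def by (intro continuous_intros cw' cwd c\<zeta> c\<zeta>')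
  have cGr: "continuous_on {\<alpha>..\<beta>} G" by (rule continuous_on_subset[OF cG]) (use ab in auto)
  have T0i: "T0 integrable_on {\<alpha>..\<beta>}"
  proof -
    have "(\<lambda>r. I1 r - G r * \<psi>' r) integrable_on {\<alpha>..\<beta>}"
      by (intro integrable_continuous_real continuous_intros cI1 cGr c\<psi>')
    from integrable_add[OF this has_integral_integrable[OF parts]] show ?thesis by (simp add: T0_def)
  qed
  have \<Theta>T: "\<Theta> r = c / r ^ (n - 1) * T0 r" if r: "r \<in> {\<alpha><..<\<beta>} - Z" for r
  proof -
    have r1: "r \<in> {\<alpha>..\<beta>}" using r by auto
    note r' = in01[OF r1]
    have "r ^ (n - 1) = r ^ (n - k) * r ^ (k - 1)" using k1 kn by (simp flip: power_add)
    then have e1: "real k * c * (w r / r) ^ (k - 1) = c / r ^ (n - 1) * (real k * r ^ (n - k) * w r ^ (k - 1))"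
      using r' by (simp add: power_divide)
    have e2: "ae_deriv g (v r) * (\<xi> r)\<^sup>2 = c / r ^ (n - 1) * (G' r * \<psi> r)"
    proof -
      have "ae_deriv g (v r) * (\<xi> r)\<^sup>2 = (ae_deriv g (v r) * w r) * w r * (\<zeta> r)\<^sup>2"
        by (simp add: \<xi>_def power2_eq_square)
      also have "\<dots> = c / r ^ (n - 1) * (G' r * \<psi> r)" unfolding aed[OF r] using r' by (simp add: \<psi>_def)
      finally show ?thesis .
    qed
    show ?thesis using r1 unfolding \<Theta>_def e1 e2 by (simp add: \<xi>'_eq[OF r1] T0_def I1_def distrib_left mult.assoc)
  qed
  define T1 where "T1 = (\<lambda>r. if r \<in> {\<alpha>..\<beta>} then T0 r else 0)"
  have "T1 integrable_on UNIV" unfolding T1_def by (rule iffD2[OF integrable_restrict_UNIV T0i])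
  then have "T1 \<in> borel_measurable lebesgue" using integrable_imp_measurable[of T1 UNIV] by (simp add: lebesgue_on_UNIV_eq)
  then obtain Tb where Tb [measurable]: "Tb \<in> borel_measurable borel" and aeT: "AE r in lborel. T1 r = Tb r"
    using completion_ex_borel_measurable_real[of T1 lborel] by auto
  define \<Theta>b where "\<Theta>b = (\<lambda>r. indicator {\<alpha>..\<beta>} r * (c / r ^ (n - 1) * Tb r))"
  have [measurable]: "\<Theta>b \<in> borel_measurable borel" unfolding \<Theta>b_def by measurable
  have "AE r in lborel. r \<notin> Z"
  proof -
    have "AE r in lebesgue. r \<notin> Z" using Z(1) by (intro AE_not_in) (simp add: negligible_iff_null_sets)
    then show ?thesis by (simp add: AE_completion_iff)
  qed
  then have "AE r in lborel. \<Theta> r = \<Theta>b r"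
    using aeT AE_lborel_singleton[of \<alpha>] AE_lborel_singleton[of \<beta>]
  proof eventually_elim
    case (elim r)
    show ?case
    proof (cases "r \<in> {\<alpha>..\<beta>}")
      case True
      then have "r \<in> {\<alpha><..<\<beta>} - Z" using elim by auto
      from \<Theta>T[OF this] show ?thesis using True elim by (simp add: \<Theta>b_def T1_def)
    qed (auto simp: \<Theta>_def \<Theta>b_def)
  qed
  from AE_radial[OF this, where 'n = 'n] obtain Y where
    Y: "Y \<in> null_sets lebesgue" "\<And>x. x \<in> ball 0 1 - Y \<Longrightarrow> \<Theta>b (norm (x::real^'n)) = \<Theta> (norm x)"
    by (elim AE_E3) auto
  have negY: "negligible Y" using Y(1) by (simp add: negligible_iff_null_sets)
  have bI: "(\<lambda>x. \<Theta>b (norm x)) absolutely_integrable_on ball (0::real^'n) 1"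
    by (rule absolutely_integrable_spike[OF dI negY Y(2)])
  have ind: "indicat_real (ball (0::real^'n) 1) x *\<^sub>R \<Theta>b (norm x) = \<Theta>b (norm x)" for x
    using ab by (auto simp: indicator_def \<Theta>b_def)
  have bi: "integrable lebesgue (\<lambda>x::real^'n. \<Theta>b (norm x))" using bI unfolding set_integrable_def ind .
  have bP: "0 \<le> (LINT x|lebesgue. \<Theta>b (norm (x::real^'n)))"
  proof -
    have "(LINT x|lebesgue. \<Theta>b (norm (x::real^'n))) = (LINT x:ball (0::real^'n) 1|lebesgue. \<Theta>b (norm x))"
      unfolding set_lebesgue_integral_def ind by (rule refl)
    also have "\<dots> = integral (ball (0::real^'n) 1) (\<lambda>x. \<Theta>b (norm x))" by (rule set_lebesgue_integral_eq_integral(2)[OF bI])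
    also have "\<dots> = integral (ball (0::real^'n) 1) (\<lambda>x. \<Theta> (norm x))" by (rule integral_spike[OF negY]) (simp add: Y(2))
    also have "\<dots> = (LINT x:ball (0::real^'n) 1|lebesgue. \<Theta> (norm x))" by (rule set_lebesgue_integral_eq_integral(2)[OF dI, symmetric])
    finally show ?thesis using dP by simp
  qed
  define \<omega> where "\<omega> = real n * unit_ball_vol (real n) * c"
  have \<omega>: "0 < \<omega>" using c k1 kn by (simp add: \<omega>_def)
  have dT: "radial_density CARD('n) r * \<Theta>b r = \<omega> * (indicator {\<alpha>..\<beta>} r * Tb r)" for r
    using in01[of r] by (cases "r \<in> {\<alpha>..\<beta>}") (auto simp: radial_density_def \<Theta>b_def \<omega>_def n_def)
  have si: "set_integrable lborel {\<alpha>..\<beta>} Tb"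
    using bi integrable_radial_iff[of \<Theta>b, where 'n = 'n] \<omega> by (simp add: dT set_integrable_def)
  have "0 \<le> \<omega> * (LINT r:{\<alpha>..\<beta>}|lborel. Tb r)"
    using bP integral_radial[of \<Theta>b, where 'n = 'n] by (simp add: dT set_lebesgue_integral_def)
  then have "0 \<le> (LINT r:{\<alpha>..\<beta>}|lborel. Tb r)" using \<omega> by (simp add: zero_le_mult_iff)
  also have "\<dots> = integral {\<alpha>..\<beta>} Tb" by (rule set_borel_integral_eq_integral(2)[OF si])
  also have "\<dots> = integral {\<alpha>..\<beta>} T0"
  proof -
    obtain X where X: "X \<in> null_sets lborel" "\<And>r. r \<in> UNIV - X \<Longrightarrow> T1 r = Tb r" using aeT by (auto elim: AE_E3)
    have "negligible X" using X(1) by (auto simp: negligible_iff_null_sets intro: null_sets_completionI)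
    then show ?thesis
    proof (rule integral_spike)
      show "T0 r = Tb r" if "r \<in> {\<alpha>..\<beta>} - X" for r using X(2)[of r] that by (simp add: T1_def)
    qed
  qed
  finally have J: "0 \<le> integral {\<alpha>..\<beta>} T0" .
  define A where "A = (real (n - k) + real k * (real n - 1)) / (real k + 1)"
  define E where "E = (\<lambda>r. r ^ (n - k) * w r ^ (k + 1) * (\<zeta> r)\<^sup>2 / r)"
  define E' where "E' = (\<lambda>r. r ^ (n - k) * w r ^ (k + 1) * (\<zeta> r)\<^sup>2 * (real (n - k) - 1) / r\<^sup>2
           + (real k + 1) * r ^ (n - k) * w r ^ k * wd r * (\<zeta> r)\<^sup>2 / r
           + 2 * r ^ (n - k) * w r ^ (k + 1) * \<zeta> r * \<zeta>' r / r)"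
  have DE: "(E has_real_derivative E' r) (at r)" if r: "r \<in> {\<alpha>..\<beta>}" for r
  proof -
    have D2: "((\<lambda>r. (\<zeta> r)\<^sup>2) has_real_derivative 2 * \<zeta> r * \<zeta>' r) (at r)"
      using DERIV_power[OF D\<zeta>[of r], of 2] by (simp add: mult_ac)
    have D1: "((\<lambda>r. w r ^ (k + 1)) has_real_derivative (real k + 1) * w r ^ k * wd r) (at r)"
      using DERIV_power[OF Dw[OF r], of "k + 1"] by (simp add: mult_ac add.commute)
    from DERIV_divide[OF DERIV_mult[OF DERIV_mult[OF DERIV_power_divide[OF in01(1)[OF r], of "n - k"] D1] D2] DERIV_ident]
    show ?thesis unfolding E_def
      by (rule DERIV_cong) (use in01[OF r] in \<open>auto simp: E'_def field_simps power2_eq_square\<close>)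
  qed
  have "(E' has_integral (E \<beta> - E \<alpha>)) {\<alpha>..\<beta>}"
    by (rule fundamental_theorem_of_calculus[OF less_imp_le[OF ab(2)]])
       (rule has_vector_derivative_at_within[OF iffD1[OF has_real_derivative_iff_has_vector_derivative DE]])
  then have E0: "(E' has_integral 0) {\<alpha>..\<beta>}" using z0[of \<alpha>] z0[of \<beta>] by (simp add: E_def)
  define R where "R = (\<lambda>r. W r * ((\<zeta>' r)\<^sup>2
     + 2 * ((real k - 1) / (real k + 1)) * \<zeta> r * \<zeta>' r / r
     - ((2 * real n - real k - 1) / (real k + 1)) * (\<zeta> r)\<^sup>2 / r\<^sup>2))"
  from has_integral_add[OF has_integral_diff[OF integrable_integral[OF T0i] parts] has_integral_mult_right[OF E0, of A]]
  have "((\<lambda>r. T0 r - (G' r * \<psi> r + G r * \<psi>' r) + A * E' r) has_integral integral {\<alpha>..\<beta>} T0) {\<alpha>..\<beta>}" by simp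
  then have "((\<lambda>r. real k * R r) has_integral integral {\<alpha>..\<beta>} T0) {\<alpha>..\<beta>}"
  proof (rule has_integral_eq[rotated])
    fix r assume r: "r \<in> {\<alpha>..\<beta>}"
    show "T0 r - (G' r * \<psi> r + G r * \<psi>' r) + A * E' r = real k * R r"
      using stability_algebra[OF in01[OF r], of "\<zeta> r" "\<zeta>' r"]
      by (simp only: T0_def I1_def \<psi>'_def E'_def R_def A_def) (simp only: algebra_simps)
  qed
  then have "integral {\<alpha>..\<beta>} (\<lambda>r. real k * R r) = integral {\<alpha>..\<beta>} T0" by (rule integral_unique)
  then have "0 \<le> real k * integral {\<alpha>..\<beta>} R" using J by simp
  then have "0 \<le> integral {\<alpha>..\<beta>} R" using k1 by (simp add: zero_le_mult_iff)
  then show ?thesis by (simp add: R_def n_def)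
qed

locale profiled_sobolev = radial_sobolev u Du v k + radial_profile "CARD('n)" k v w G
  for u :: "real^'n::finite \<Rightarrow> real" and Du :: "real^'n \<Rightarrow> real^'n" and v w G :: "real \<Rightarrow> real" and k :: nat +
  assumes m_eq_w: "AE r in lborel. r \<in> {0<..<1} \<longrightarrow> m r = w r"
begin

abbreviation "annulus \<equiv> ball (0::real^'n) 1 - cball 0 (1/2)"

definition energy :: real where
  "energy = (LINT x:annulus|lebesgue. \<bar>u x\<bar> ^ (k + 1)) + (LINT x:annulus|lebesgue. norm x powr (1 - real k) * norm (Du x) ^ (k + 1))"

lemma annulus_mono:
  fixes f :: "real^'n \<Rightarrow> real"
  assumes f: "f absolutely_integrable_on B1" and f0: "\<And>x. 0 \<le> f x" and S: "S \<in> sets borel" "S \<subseteq> annulus"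
  shows "(LINT x:S|lebesgue. f x) \<le> (LINT x:annulus|lebesgue. f x)"
proof -
  have "annulus \<in> sets borel" by (intro sets.Diff) auto
  then have i: "f absolutely_integrable_on annulus" "f absolutely_integrable_on S"
    using S by (auto intro: set_integrable_subset[OF f])
  show ?thesis unfolding set_lebesgue_integral_def
    by (rule integral_mono) (use i S f0 in \<open>auto simp: set_integrable_def indicator_def\<close>)
qed

lemma W_lborel:
  assumes "A \<in> sets borel" "A \<subseteq> {0<..<1}"
  shows "AE r in lborel. indicator A r * (r ^ (CARD('n) - k) * m r ^ (k + 1)) = indicator A r * W r"
  using m_eq_w
proof eventually_elim
  case (elim r)
  then show ?case using assms by (cases "r \<in> A") (auto simp: W_def)
qed

lemma energy_parts_nonneg:
  "0 \<le> (LINT x:annulus|lebesgue. \<bar>u x\<bar> ^ (k + 1))"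
  "0 \<le> (LINT x:annulus|lebesgue. norm x powr (1 - real k) * norm (Du x) ^ (k + 1))"
  unfolding set_lebesgue_integral_def by (rule Bochner_Integration.integral_nonneg; simp)+

lemma energy_nonneg: "0 \<le> energy"
  using energy_parts_nonneg by (simp add: energy_def)

lemma integral_W_le_energy:
  assumes ab: "1/2 \<le> a" "a \<le> b" "b < 1"
  shows "\<kappa> * integral {a..b} W \<le> energy"
proof -
  have i: "set_integrable lborel {a..b} W" by (rule borel_integrable_atLeastAtMost'[OF W_cont]) (use ab in auto)
  have Im: "integrable lborel (\<lambda>r. indicator {a<..b} r * (r ^ (CARD('n) - k) * m r ^ (k + 1)))"
    by (rule energy_comparison(1)) (use ab k1 kn in auto)
  have "integral {a..b} W = (LINT r|lborel. indicator {a..b} r * W r)"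
    using set_borel_integral_eq_integral(2)[OF i] by (simp add: set_lebesgue_integral_def)
  also have "\<dots> = (LINT r|lborel. indicator {a<..b} r * (r ^ (CARD('n) - k) * m r ^ (k + 1)))"
  proof (rule integral_cong_AE)
    show "(\<lambda>r. indicator {a..b} r * W r) \<in> borel_measurable lborel" using i by (auto simp: set_integrable_def)
    show "(\<lambda>r. indicator {a<..b} r * (r ^ (CARD('n) - k) * m r ^ (k + 1))) \<in> borel_measurable lborel" by measurable
    have "AE r in lborel. indicator {a<..b} r * (r ^ (CARD('n) - k) * m r ^ (k + 1)) = indicator {a<..b} r * W r"
      by (rule W_lborel) (use ab in auto)
    then show "AE r in lborel. indicator {a..b} r * W r = indicator {a<..b} r * (r ^ (CARD('n) - k) * m r ^ (k + 1))"
      using AE_lborel_singleton[of a]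
    proof eventually_elim
      case (elim r)
      have "indicat_real {a..b} r = indicator {a<..b} r" using elim(2) by (auto simp: indicator_def)
      then show ?case using elim(1) by auto
    qed
  qed
  finally have I: "integral {a..b} W = (LINT r|lborel. indicator {a<..b} r * (r ^ (CARD('n) - k) * m r ^ (k + 1)))" .
  have "\<kappa> * integral {a..b} W \<le> (LINT x:{x. norm x \<in> {a<..b}}|lebesgue. norm x powr (1 - real k) * norm (Du x) ^ (k + 1))"
    unfolding I by (rule energy_comparison(2)) (use ab k1 kn in auto)
  also have "\<dots> \<le> (LINT x:annulus|lebesgue. norm x powr (1 - real k) * norm (Du x) ^ (k + 1))"
  proof (rule annulus_mono)
    show "(\<lambda>x. norm x powr (1 - real k) * norm (Du x) ^ (k + 1)) absolutely_integrable_on B1"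
      using W by (simp add: in_W_def)
    have "{x::real^'n. norm x \<in> {a<..b}} = norm -` {a<..b}" by auto
    then show "{x::real^'n. norm x \<in> {a<..b}} \<in> sets borel" using measurable_sets[of norm borel borel "{a<..b}"] by simp
  qed (use ab in auto)
  also have "\<dots> \<le> energy" using energy_parts_nonneg by (simp add: energy_def)
  finally show ?thesis .
qed

lemma integral_v_le_energy:
  "\<kappa> * (1/2) ^ (CARD('n) - 1) * integral {5/8..3/4} (\<lambda>r. \<bar>v r\<bar> ^ (k + 1)) \<le> energy"
proof -
  let ?n = "CARD('n)"
  define f where "f = (\<lambda>r. if r \<in> {5/8..3/4} then \<bar>v r\<bar> ^ (k + 1) else 0)"
  have cvk: "continuous_on {5/8..3/4} (\<lambda>r. \<bar>v r\<bar> ^ (k + 1))"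
    by (intro continuous_intros continuous_on_subset[OF cv]) auto
  have [measurable]: "f \<in> borel_measurable borel"
    unfolding f_def by (intro borel_measurable_continuous_on_if cvk) auto
  have i: "set_integrable lborel {5/8..3/4} (\<lambda>r. \<bar>v r\<bar> ^ (k + 1))" by (rule borel_integrable_atLeastAtMost'[OF cvk])
  have j: "set_integrable lborel {5/8..3/4} (\<lambda>r. r ^ (?n - 1) * \<bar>v r\<bar> ^ (k + 1))"
    by (intro borel_integrable_atLeastAtMost' continuous_on_mult cvk continuous_intros)
  define S where "S = {x::real^'n. norm x \<in> {5/8..3/4}}"
  have eqf: "radial_density ?n r * f r = \<kappa> * (indicator {5/8..3/4} r * (r ^ (?n - 1) * \<bar>v r\<bar> ^ (k + 1)))" for r
    by (simp add: radial_density_def f_def \<kappa>_def indicator_def)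
  have "\<kappa> * (1/2) ^ (?n - 1) * integral {5/8..3/4} (\<lambda>r. \<bar>v r\<bar> ^ (k + 1))
      = \<kappa> * (LINT r|lborel. indicator {5/8..3/4} r * ((1/2) ^ (?n - 1) * \<bar>v r\<bar> ^ (k + 1)))"
  proof -
    have "(LINT r|lborel. indicator {5/8..3/4} r * ((1/2) ^ (?n - 1) * \<bar>v r\<bar> ^ (k + 1)))
        = (LINT r|lborel. (1/2) ^ (?n - 1) * (indicator {5/8..3/4} r * \<bar>v r\<bar> ^ (k + 1)))"
      by (intro Bochner_Integration.integral_cong refl mult.left_commute)
    also have "\<dots> = (1/2) ^ (?n - 1) * (LINT r|lborel. indicator {5/8..3/4} r * \<bar>v r\<bar> ^ (k + 1))"
      by (rule integral_mult_right_zero)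
    finally show ?thesis
      using set_borel_integral_eq_integral(2)[OF i] by (simp only: set_lebesgue_integral_def real_scaleR_def mult.assoc)
  qed
  also have "\<dots> \<le> \<kappa> * (LINT r|lborel. indicator {5/8..3/4} r * (r ^ (?n - 1) * \<bar>v r\<bar> ^ (k + 1)))"
  proof (rule mult_left_mono, rule integral_mono)
    show "integrable lborel (\<lambda>r. indicator {5/8..3/4} r * ((1/2) ^ (?n - 1) * \<bar>v r\<bar> ^ (k + 1)))"
    proof -
      have "integrable lborel (\<lambda>r. (1/2) ^ (?n - 1) * (indicator {5/8..3/4} r *\<^sub>R \<bar>v r\<bar> ^ (k + 1)))"
        by (rule integrable_mult_right) (use i in \<open>simp only: set_integrable_def\<close>)
      then show "integrable lborel (\<lambda>r. indicator {5/8..3/4} r * ((1/2) ^ (?n - 1) * \<bar>v r\<bar> ^ (k + 1)))"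
        by (simp only: real_scaleR_def mult.left_commute)
    qed
    show "integrable lborel (\<lambda>r. indicator {5/8..3/4} r * (r ^ (?n - 1) * \<bar>v r\<bar> ^ (k + 1)))"
      using j by (simp add: set_integrable_def)
    show "indicator {5/8..3/4} r * ((1/2) ^ (?n - 1) * \<bar>v r\<bar> ^ (k + 1)) \<le> indicator {5/8..3/4} r * (r ^ (?n - 1) * \<bar>v r\<bar> ^ (k + 1))" for r :: real
      by (cases "r \<in> {5/8..3/4}") (auto intro!: mult_right_mono power_mono)
  qed (use \<kappa>_pos in simp)
  also have "\<dots> = (LINT x|lebesgue. f (norm (x::real^'n)))"
    by (subst integral_radial) (simp_all add: eqf)
  also have "\<dots> = (LINT x:S|lebesgue. \<bar>u x\<bar> ^ (k + 1))"
    unfolding set_lebesgue_integral_def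
    by (intro Bochner_Integration.integral_cong refl) (auto simp: f_def radial S_def indicator_def)
  also have "\<dots> \<le> (LINT x:annulus|lebesgue. \<bar>u x\<bar> ^ (k + 1))"
  proof (rule annulus_mono)
    show "(\<lambda>x. \<bar>u x\<bar> ^ (k + 1)) absolutely_integrable_on B1" using W by (simp add: in_W_def)
    have "S = norm -` {5/8..3/4}" by (auto simp: S_def)
    then show "S \<in> sets borel" using measurable_sets[of norm borel borel "{5/8..3/4}"] by simp
  qed (auto simp: S_def)
  also have "\<dots> \<le> energy" using energy_parts_nonneg by (simp add: energy_def)
  finally show ?thesis .
qed

lemma W_integrable_near_0: "W integrable_on {0..1/2}"
proof -
  define f where "f = (\<lambda>r. indicator {0<..1/2} r * (r ^ (CARD('n) - k) * m r ^ (k + 1)))"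
  have "integrable lborel f" unfolding f_def by (rule energy_comparison(1)) (use k1 kn in auto)
  then have fi: "f integrable_on UNIV" by (rule integrable_on_lborel)
  have "AE r in lborel. (if r \<in> {0..1/2} then W r else 0) = f r"
  proof -
    have "AE r in lborel. f r = indicator {0<..1/2} r * W r" unfolding f_def by (rule W_lborel) auto
    then show ?thesis using AE_lborel_singleton[of "0::real"]
    proof eventually_elim
      case (elim r)
      then show ?case by (auto simp: indicator_def)
    qed
  qed
  then obtain X where X: "X \<in> null_sets lborel" "\<And>r. r \<in> UNIV - X \<Longrightarrow> (if r \<in> {0..1/2} then W r else 0) = f r"
    by (auto elim: AE_E3)
  have "negligible X" using X(1) by (auto simp: negligible_iff_null_sets intro: null_sets_completionI)
  from integrable_spike[OF fi this X(2)]
  have "(\<lambda>r. if r \<in> {0..1/2} then W r else 0) integrable_on UNIV" .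
  then show ?thesis by (simp only: integrable_restrict_UNIV)
qed

end

definition virial_exponent :: "nat \<Rightarrow> nat \<Rightarrow> real" where
  "virial_exponent n k = (real k - 1 + sqrt (2 * (real k + 1) * real n - 4 * real k)) / (real k + 1)"

definition growth_exponent :: "nat \<Rightarrow> nat \<Rightarrow> real" where
  "growth_exponent n k = (- (real k + 1) * real n + 2 * sqrt (2 * (real k + 1) * real n - 4 * real k)
     + 2 * (real k)\<^sup>2 + 6 * real k) / (real k + 1)\<^sup>2"

lemma virial_exponent:
  assumes k: "1 \<le> k" "2 * k \<le> n"
  defines "b \<equiv> (real k - 1) / (real k + 1)"
  shows "0 \<le> b" "b < 1" "1 \<le> virial_exponent n k - 2 * b" "1 \<le> virial_exponent n k"
    "(2 * real n - real k - 1) / (real k + 1) = (virial_exponent n k)\<^sup>2 - 2 * b * virial_exponent n k"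
    "(real k + 1) * growth_exponent n k = 2 * virial_exponent n k + 2 * real k + 2 - real n"
proof -
  define \<kappa> where "\<kappa> = real k"
  define t where "t = sqrt (2 * (\<kappa> + 1) * real n - 4 * \<kappa>)"
  have \<kappa>: "1 \<le> \<kappa>" "2 * \<kappa> \<le> real n" using k by (auto simp: \<kappa>_def)
  have "(\<kappa> + 1) * (2 * \<kappa>) \<le> (\<kappa> + 1) * real n" using \<kappa> by (intro mult_left_mono) auto
  then have S: "(2 * \<kappa>)\<^sup>2 \<le> 2 * (\<kappa> + 1) * real n - 4 * \<kappa>" by (simp add: power2_eq_square algebra_simps)
  have t2: "2 * \<kappa> \<le> t" unfolding t_def by (rule real_le_rsqrt[OF S])
  have tt: "t * t = 2 * (\<kappa> + 1) * real n - 4 * \<kappa>"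
    unfolding t_def using order_trans[OF zero_le_power2 S] by simp
  have s: "virial_exponent n k = (\<kappa> - 1 + t) / (\<kappa> + 1)" by (simp add: virial_exponent_def t_def \<kappa>_def)
  have b: "b = (\<kappa> - 1) / (\<kappa> + 1)" by (simp add: b_def \<kappa>_def)
  show b01: "0 \<le> b" "b < 1" using \<kappa> by (simp_all add: b)
  have "virial_exponent n k - 2 * b = (t - (\<kappa> - 1)) / (\<kappa> + 1)"
    by (simp add: s b diff_divide_distrib add_divide_distrib)
  then show sb: "1 \<le> virial_exponent n k - 2 * b" using \<kappa> t2 by (simp add: le_divide_eq)
  then show "1 \<le> virial_exponent n k" using b01 by linarith
  have "(virial_exponent n k)\<^sup>2 - 2 * b * virial_exponent n k = (t * t - (\<kappa> - 1)\<^sup>2) / (\<kappa> + 1)\<^sup>2"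
  proof -
    have q: "(X / d)\<^sup>2 - 2 * (Y / d) * (X / d) = (X * X - 2 * Y * X) / d\<^sup>2" for X Y d :: real
      by (simp add: power2_eq_square diff_divide_distrib)
    show ?thesis unfolding s b q by (simp add: power2_eq_square algebra_simps)
  qed
  also have "\<dots> = ((\<kappa> + 1) * (2 * real n - \<kappa> - 1)) / (\<kappa> + 1)\<^sup>2"
    unfolding tt by (simp add: power2_eq_square algebra_simps)
  also have "\<dots> = (2 * real n - \<kappa> - 1) / (\<kappa> + 1)" using \<kappa> by (simp add: power2_eq_square)
  finally show "(2 * real n - real k - 1) / (real k + 1) = (virial_exponent n k)\<^sup>2 - 2 * b * virial_exponent n k"
    by (simp add: \<kappa>_def)
  have g: "growth_exponent n k = (- (\<kappa> + 1) * real n + 2 * t + 2 * \<kappa>\<^sup>2 + 6 * \<kappa>) / (\<kappa> + 1)\<^sup>2"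
    by (simp add: growth_exponent_def t_def \<kappa>_def)
  have "(\<kappa> + 1) * growth_exponent n k = 2 * ((\<kappa> - 1 + t) / (\<kappa> + 1)) + 2 * \<kappa> + 2 - real n"
  proof -
    have "(\<kappa> + 1) * growth_exponent n k = (- (\<kappa> + 1) * real n + 2 * t + 2 * \<kappa>\<^sup>2 + 6 * \<kappa>) / (\<kappa> + 1)"
      unfolding g using \<kappa> by (simp add: power2_eq_square)
    also have "- (\<kappa> + 1) * real n + 2 * t + 2 * \<kappa>\<^sup>2 + 6 * \<kappa> = 2 * (\<kappa> - 1 + t) + (2 * \<kappa> + 2 - real n) * (\<kappa> + 1)"
      by (simp add: power2_eq_square algebra_simps)
    also have "\<dots> / (\<kappa> + 1) = 2 * ((\<kappa> - 1 + t) / (\<kappa> + 1)) + (2 * \<kappa> + 2 - real n)"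
      using \<kappa> by (subst add_divide_distrib) simp
    finally show ?thesis by simp
  qed
  then show "(real k + 1) * growth_exponent n k = 2 * virial_exponent n k + 2 * real k + 2 - real n"
    by (simp add: s \<kappa>_def)
qed

lemma growth_exponent_sign:
  assumes k: "1 \<le> k" "2 * k \<le> n"
  shows "n < 2 * k + 8 \<Longrightarrow> 0 < growth_exponent n k" "n = 2 * k + 8 \<Longrightarrow> growth_exponent n k = 0"
    "2 * k + 8 < n \<Longrightarrow> growth_exponent n k < 0"
proof -
  define \<kappa> where "\<kappa> = real k"
  define t where "t = sqrt (2 * (\<kappa> + 1) * real n - 4 * \<kappa>)"
  have \<kappa>: "1 \<le> \<kappa>" "2 * \<kappa> \<le> real n" using k by (auto simp: \<kappa>_def)
  have "(\<kappa> + 1) * (2 * \<kappa>) \<le> (\<kappa> + 1) * real n" using \<kappa> by (intro mult_left_mono) auto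
  moreover have "1 * (2 * \<kappa>) \<le> (\<kappa> + 1) * (2 * \<kappa>)" using \<kappa> by (intro mult_right_mono) auto
  moreover have "2 * (\<kappa> + 1) * real n = 2 * ((\<kappa> + 1) * real n)" by simp
  ultimately have S: "0 \<le> 2 * (\<kappa> + 1) * real n - 4 * \<kappa>" by linarith
  have t0: "0 \<le> t" unfolding t_def using S by simp
  have tt: "t\<^sup>2 = 2 * (\<kappa> + 1) * real n - 4 * \<kappa>" unfolding t_def using S by simp
  have num: "- (\<kappa> + 1) * real n + 2 * t + 2 * \<kappa>\<^sup>2 + 6 * \<kappa> = (1 / 2) * (2 * \<kappa> + 4 - t) * (t + 2 * \<kappa>)"
    using tt by (simp add: power2_eq_square algebra_simps)
  have g0: "growth_exponent n k = (- (\<kappa> + 1) * real n + 2 * t + 2 * \<kappa>\<^sup>2 + 6 * \<kappa>) / (\<kappa> + 1)\<^sup>2"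
    by (simp add: growth_exponent_def t_def \<kappa>_def)
  have g: "growth_exponent n k = ((2 * \<kappa> + 4 - t) * (t + 2 * \<kappa>)) / (2 * (\<kappa> + 1)\<^sup>2)"
    unfolding g0 num by simp
  have d: "t\<^sup>2 - (2 * \<kappa> + 4)\<^sup>2 = 2 * (\<kappa> + 1) * (real n - (2 * \<kappa> + 8))"
    unfolding tt by (simp add: power2_eq_square algebra_simps)
  have pos: "0 < t + 2 * \<kappa>" "0 < 2 * (\<kappa> + 1)\<^sup>2" using t0 \<kappa> by auto
  show "0 < growth_exponent n k" if "n < 2 * k + 8"
  proof -
    have "real n < 2 * \<kappa> + 8" using that by (simp add: \<kappa>_def)
    then have "2 * (\<kappa> + 1) * (real n - (2 * \<kappa> + 8)) < 0" using \<kappa> by (intro mult_pos_neg) auto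
    then have "t\<^sup>2 < (2 * \<kappa> + 4)\<^sup>2" using d by linarith
    then have "t < 2 * \<kappa> + 4" by (rule power2_less_imp_less) (use \<kappa> in simp)
    then show ?thesis unfolding g using pos by simp
  qed
  show "growth_exponent n k = 0" if "n = 2 * k + 8"
  proof -
    have "real n = 2 * \<kappa> + 8" using that by (simp add: \<kappa>_def)
    then have "t\<^sup>2 = (2 * \<kappa> + 4)\<^sup>2" using d by simp
    then have "t = 2 * \<kappa> + 4" by (rule power2_eq_imp_eq) (use t0 \<kappa> in auto)
    then show ?thesis unfolding g by simp
  qed
  show "growth_exponent n k < 0" if "2 * k + 8 < n"
  proof -
    have "2 * \<kappa> + 8 < real n" using that by (simp add: \<kappa>_def)
    then have "0 < 2 * (\<kappa> + 1) * (real n - (2 * \<kappa> + 8))" using \<kappa> by (intro mult_pos_pos) auto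
    then have "(2 * \<kappa> + 4)\<^sup>2 < t\<^sup>2" using d by linarith
    then have "2 * \<kappa> + 4 < t" by (rule power2_less_imp_less) (use t0 in simp)
    then have "(2 * \<kappa> + 4 - t) * (t + 2 * \<kappa>) < 0" using pos by (intro mult_neg_pos) auto
    then show ?thesis unfolding g using pos by (simp add: divide_neg_pos)
  qed
qed

definition step_exponent :: "nat \<Rightarrow> nat \<Rightarrow> real" where
  "step_exponent n k = (if n < 2 * k then 1 - real (n - k) / real k else growth_exponent n k)"

definition step_const :: "nat \<Rightarrow> nat \<Rightarrow> real" where
  "step_const n k = (if n < 2 * k then 4 * (1 / 2 powr (1 - real (n - k) / real k))
     else (let s = virial_exponent n k in
       1 + 2 ^ (n - k) * (2 powr (s + 1) * (4 powr (s + 1) * (64 + 32 * (s + 1))) * 10 / (s + 1)\<^sup>2)))"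

lemma step_const_nonneg:
  assumes "1 \<le> k" shows "0 \<le> step_const n k"
proof (cases "n < 2 * k")
  case False
  then have "1 \<le> virial_exponent n k" using virial_exponent(4)[of k n] assms by simp
  then show ?thesis using False by (simp add: step_const_def Let_def)
qed (simp add: step_const_def)

definition growth_bound :: "nat \<Rightarrow> nat \<Rightarrow> real \<Rightarrow> real" where
  "growth_bound n k r = (if n < 2 * k + 8 then 1 else if n = 2 * k + 8 then \<bar>ln r\<bar> + 1 else r powr growth_exponent n k)"

lemma growth_bound_ge_1:
  assumes k: "1 \<le> k" and r: "0 < r" "r \<le> 1"
  shows "1 \<le> growth_bound n k r"
proof -
  have "1 \<le> r powr growth_exponent n k" if "2 * k + 8 < n"
  proof -
    have "growth_exponent n k \<le> 0" using growth_exponent_sign(3)[OF k _ that] that by simp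
    then have "r powr 0 \<le> r powr growth_exponent n k" using r by (intro powr_mono') auto
    then show ?thesis using r by simp
  qed
  then show ?thesis by (auto simp: growth_bound_def)
qed

lemma dyadic_growth:
  assumes k: "1 \<le> k" "k \<le> n"
  obtains K where "0 \<le> K"
    "\<And>v A r. (\<And>r s. 0 < r \<Longrightarrow> r \<le> s \<Longrightarrow> s \<le> 1/2 \<Longrightarrow> v r \<le> v s) \<Longrightarrow> 0 \<le> A \<Longrightarrow>
      (\<And>r. 0 < r \<Longrightarrow> r \<le> 1/2 \<Longrightarrow> v r - v (r/2) \<le> A * r powr step_exponent n k) \<Longrightarrow> 0 < r \<Longrightarrow> r \<le> 1/2 \<Longrightarrow>
      v (1/2) - v r \<le> A * (K * growth_bound n k (r::real))"
proof -
  let ?e = "step_exponent n k"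
  consider "n < 2 * k + 8" | "n = 2 * k + 8" | "2 * k + 8 < n" by linarith
  then show ?thesis
  proof cases
    case 1
    have e: "0 < ?e"
    proof (cases "n < 2 * k")
      case True
      then have "real (n - k) / real k < 1" using k by auto
      then show ?thesis using True by (simp add: step_exponent_def)
    next
      case False
      then show ?thesis using growth_exponent_sign(1)[OF k(1) _ 1] by (simp add: step_exponent_def)
    qed
    obtain K where K: "0 \<le> K" "\<And>v A r. (\<And>r s. 0 < r \<Longrightarrow> r \<le> s \<Longrightarrow> s \<le> 1/2 \<Longrightarrow> v r \<le> v s) \<Longrightarrow> 0 \<le> A \<Longrightarrow>
      (\<And>r. 0 < r \<Longrightarrow> r \<le> 1/2 \<Longrightarrow> v r - v (r/2) \<le> A * r powr ?e) \<Longrightarrow> 0 < r \<Longrightarrow> r \<le> 1/2 \<Longrightarrow> v (1/2) - v r \<le> A * K"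
      by (rule dyadic_powr_pos[OF e]) blast
    show ?thesis by (rule that[OF K(1)]) (use K(2) 1 in \<open>simp add: growth_bound_def\<close>)
  next
    case 2
    then have e: "?e = 0" using growth_exponent_sign(2)[OF k(1) _ 2] by (simp add: step_exponent_def)
    show ?thesis
    proof (rule that[of "1 / ln 2"])
      fix v :: "real \<Rightarrow> real" and A r :: real
      assume m: "\<And>r s. 0 < r \<Longrightarrow> r \<le> s \<Longrightarrow> s \<le> 1/2 \<Longrightarrow> v r \<le> v s" and A: "0 \<le> A"
        and st: "\<And>r. 0 < r \<Longrightarrow> r \<le> 1/2 \<Longrightarrow> v r - v (r/2) \<le> A * r powr ?e" and r: "0 < r" "r \<le> 1/2"
      have "v (1/2) - v r \<le> A * (- ln r / ln 2)"
        by (rule dyadic_zero[OF m A _ r]) (use st e in auto)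
      also have "\<dots> \<le> A * (1 / ln 2 * growth_bound n k r)"
      proof (rule mult_left_mono[OF _ A])
        have "- ln r \<le> \<bar>ln r\<bar> + 1" by linarith
        from divide_right_mono[OF this, of "ln 2"]
        show "- ln r / ln 2 \<le> 1 / ln 2 * growth_bound n k r" using 2 by (simp add: growth_bound_def)
      qed
      finally show "v (1/2) - v r \<le> A * (1 / ln 2 * growth_bound n k r)" .
    qed simp
  next
    case 3
    then have e: "?e < 0" "?e = growth_exponent n k" using growth_exponent_sign(3)[OF k(1) _ 3] by (simp_all add: step_exponent_def)
    obtain K where K: "0 \<le> K" "\<And>v A r. (\<And>r s. 0 < r \<Longrightarrow> r \<le> s \<Longrightarrow> s \<le> 1/2 \<Longrightarrow> v r \<le> v s) \<Longrightarrow> 0 \<le> A \<Longrightarrow>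
      (\<And>r. 0 < r \<Longrightarrow> r \<le> 1/2 \<Longrightarrow> v r - v (r/2) \<le> A * r powr ?e) \<Longrightarrow> 0 < r \<Longrightarrow> r \<le> 1/2 \<Longrightarrow> v (1/2) - v r \<le> A * (K * r powr ?e)"
      by (rule dyadic_powr_neg[OF e(1)]) blast
    have gb: "growth_bound n k r = r powr ?e" for r using 3 e(2) by (simp add: growth_bound_def)
    show ?thesis by (rule that[OF K(1)]) (use K(2) in \<open>simp add: gb\<close>)
  qed
qed

context profiled_sobolev
begin

lemma profile_bound:
  fixes N K :: real
  assumes G: "G = (\<lambda>r. g (v r) / c_const CARD('n) k)" and gL: "locally_Lipschitz g" and st: "semistable k g u"
    and N: "0 < N" "(1 + 2 ^ (CARD('n) - 1)) / \<kappa> * energy \<le> N ^ (k + 1)"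
    and K: "0 \<le> K" "\<And>v A r. (\<And>r s. 0 < r \<Longrightarrow> r \<le> s \<Longrightarrow> s \<le> 1/2 \<Longrightarrow> v r \<le> v s) \<Longrightarrow> 0 \<le> A \<Longrightarrow>
      (\<And>r. 0 < r \<Longrightarrow> r \<le> 1/2 \<Longrightarrow> v r - v (r/2) \<le> A * r powr step_exponent CARD('n) k) \<Longrightarrow> 0 < r \<Longrightarrow> r \<le> 1/2 \<Longrightarrow>
      v (1/2) - v r \<le> A * (K * growth_bound CARD('n) k (r::real))"
    and r: "0 < r" "r \<le> 1"
  shows "\<bar>v r\<bar> \<le> (9 + 2 ^ (CARD('n) - k) + step_const CARD('n) k * K) * N * growth_bound CARD('n) k r"
proof -
  let ?n = "CARD('n)"
  let ?B = "growth_bound ?n k r"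
  have q: "energy / \<kappa> \<le> N ^ (k + 1)" "2 ^ (?n - 1) * (energy / \<kappa>) \<le> N ^ (k + 1)"
  proof -
    have "(1 + 2 ^ (?n - 1)) / \<kappa> * energy = energy / \<kappa> + 2 ^ (?n - 1) * (energy / \<kappa>)" by (simp add: add_divide_distrib distrib_right)
    moreover have e0: "0 \<le> energy / \<kappa>" using energy_nonneg \<kappa>_pos by simp
    moreover have "0 \<le> 2 ^ (?n - 1) * (energy / \<kappa>)" by (rule mult_nonneg_nonneg[OF _ e0]) simp
    ultimately show "energy / \<kappa> \<le> N ^ (k + 1)" "2 ^ (?n - 1) * (energy / \<kappa>) \<le> N ^ (k + 1)" using N(2) by linarith+
  qed
  have Wb: "integral {a..b} W \<le> N ^ (k + 1)" if "1/2 \<le> a" "a \<le> b" "b < 1" for a b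
  proof -
    have "integral {a..b} W \<le> energy / \<kappa>" using integral_W_le_energy[OF that] \<kappa>_pos by (simp add: field_simps)
    then show ?thesis using q(1) by linarith
  qed
  have Vb: "integral {5/8..3/4} (\<lambda>r. \<bar>v r\<bar> ^ (k + 1)) \<le> N ^ (k + 1)"
  proof -
    have "integral {5/8..3/4} (\<lambda>r. \<bar>v r\<bar> ^ (k + 1)) \<le> 2 ^ (?n - 1) * (energy / \<kappa>)"
      using integral_v_le_energy \<kappa>_pos by (simp add: field_simps)
    then show ?thesis using q(2) by linarith
  qed
  have outer: "\<bar>v r\<bar> \<le> (9 + 2 ^ (?n - k)) * N" if "1/2 \<le> r" "r \<le> 1" for r
    by (rule outer_bound[OF N(1) _ Vb that]) (rule Wb; simp)
  have M: "integral {1/2..3/4} W \<le> N ^ (k + 1)" by (rule Wb) auto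
  have step: "v r - v (r / 2) \<le> (step_const ?n k * N) * r powr step_exponent ?n k" if r: "0 < r" "r \<le> 1/2" for r
  proof (cases "?n < 2 * k")
    case True
    then show ?thesis using low_dimension_step[OF less_imp_le[OF N(1)] M r] by (simp add: step_const_def step_exponent_def mult_ac)
  next
    case False
    then have k2: "2 * k \<le> ?n" by simp
    note ve = virial_exponent[OF k1 k2]
    have rp: "radial_profile ?n k v w (\<lambda>r. g (v r) / c_const ?n k)" using radial_profile_axioms unfolding G .
    define s where "s = virial_exponent ?n k"
    define b where "b = (real k - 1) / (real k + 1)"
    define \<gamma> where "\<gamma> = (2 * real ?n - real k - 1) / (real k + 1)"
    have stab: "0 \<le> integral {\<alpha>..\<beta>} (\<lambda>r. W r * ((\<zeta>' r)\<^sup>2 + 2 * b * \<zeta> r * \<zeta>' r / r - \<gamma> * (\<zeta> r)\<^sup>2 / r\<^sup>2))"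
      if "0 < \<alpha>" "\<alpha> < \<beta>" "\<beta> < 1" "\<And>r. \<alpha> \<le> r \<Longrightarrow> r \<le> \<beta> \<Longrightarrow> 0 < w r" "bump_fun \<alpha> \<beta> \<zeta> \<zeta>'" for \<alpha> \<beta> \<zeta> \<zeta>'
      unfolding b_def \<gamma>_def by (rule stability_1D[OF rp radial gL st that])
    have sc: "step_const ?n k = 1 + 2 ^ (?n - k) * (2 powr (s + 1) * (4 powr (s + 1) * (64 + 32 * (s + 1))) * 10 / (s + 1)\<^sup>2)"
      unfolding step_const_def Let_def s_def using False by (rule if_not_P)
    have "v r - v (r / 2) \<le> step_const ?n k * N * r powr growth_exponent ?n k"
      unfolding sc
      by (rule high_dimension_step[where b = b and \<gamma> = \<gamma>, OF _ _ _ _ _ stab W_integrable_near_0 N(1) M r])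
         (use ve in \<open>auto simp: s_def b_def \<gamma>_def\<close>)
    then show ?thesis using False by (simp add: step_exponent_def)
  qed
  have B1: "1 \<le> ?B" by (rule growth_bound_ge_1[OF k1 r])
  have sc: "0 \<le> step_const ?n k * K * N * ?B" using step_const_nonneg[OF k1, of ?n] K(1) N(1) B1 by simp
  have le: "(9 + 2 ^ (?n - k)) * N \<le> (9 + 2 ^ (?n - k)) * N * ?B"
    using mult_left_mono[OF B1, of "(9 + 2 ^ (?n - k)) * N"] N(1) by simp
  have "\<bar>v r\<bar> \<le> (9 + 2 ^ (?n - k)) * N + step_const ?n k * K * N * ?B"
  proof (cases "r \<le> 1/2")
    case True
    have "v (1/2) - v r \<le> (step_const ?n k * N) * (K * ?B)"
      by (rule K(2)[OF _ _ step r(1) True]) (use v_mono step_const_nonneg[OF k1, of ?n] N(1) in auto)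
    moreover have "v r \<le> v (1/2)" by (rule v_mono) (use r True in auto)
    moreover have "\<bar>v (1/2)\<bar> \<le> (9 + 2 ^ (?n - k)) * N" by (rule outer) auto
    ultimately show ?thesis by (simp add: mult_ac abs_le_iff)
  next
    case False
    then show ?thesis using outer[of r] r sc by simp
  qed
  also have "\<dots> \<le> (9 + 2 ^ (?n - k) + step_const ?n k * K) * N * ?B" using le by (simp add: algebra_simps)
  finally show ?thesis .
qed

end

theorem theorem1p9:
  fixes k :: nat
  assumes "CARD('n::finite) \<ge> 2" and "k \<in> {1..CARD('n)}"
  shows "\<exists>D::real. \<forall>(g::real \<Rightarrow> real) (u::real^'n \<Rightarrow> real) (Du::real^'n \<Rightarrow> real^'n) (v::real \<Rightarrow> real).
    (\<forall>t. g t \<ge> 0) \<longrightarrow> locally_Lipschitz g \<longrightarrow>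
    (\<forall>x. u x = v (norm x)) \<longrightarrow> continuous_on {0<..1} v \<longrightarrow>
    in_W k (ball 0 1) u Du \<longrightarrow>
    (AE x in lebesgue. x \<in> ball 0 1 \<longrightarrow> radial_deriv Du x \<ge> 0) \<longrightarrow>
    (classical_solution k g u \<or> radial_weak_solution k g u Du) \<longrightarrow>
    semistable k g u \<longrightarrow>
    (let C = D * W_norm k (ball 0 1 - cball 0 (1/2)) u Du in
      (CARD('n) < 2 * k + 8 \<longrightarrow> (\<forall>r\<in>{0<..1}. \<bar>v r\<bar> \<le> C)) \<and>
      (CARD('n) = 2 * k + 8 \<longrightarrow> (\<forall>r\<in>{0<..1}. \<bar>v r\<bar> \<le> C * (\<bar>ln r\<bar> + 1))) \<and>
      (CARD('n) > 2 * k + 8 \<longrightarrow> (\<forall>r\<in>{0<..1}. \<bar>v r\<bar> \<le>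
         C * r powr ((- (real k + 1) * real CARD('n)
                      + 2 * sqrt (2 * (real k + 1) * real CARD('n) - 4 * real k)
                      + 2 * (real k)\<^sup>2 + 6 * real k) / (real k + 1)\<^sup>2))))"
proof -
  let ?n = "CARD('n)"
  have k: "1 \<le> k" "k \<le> ?n" using assms(2) by auto
  obtain K where K: "0 \<le> K"
    "\<And>v A r. (\<And>r s. 0 < r \<Longrightarrow> r \<le> s \<Longrightarrow> s \<le> 1/2 \<Longrightarrow> v r \<le> v s) \<Longrightarrow> 0 \<le> A \<Longrightarrow>
      (\<And>r. 0 < r \<Longrightarrow> r \<le> 1/2 \<Longrightarrow> v r - v (r/2) \<le> A * r powr step_exponent ?n k) \<Longrightarrow> 0 < r \<Longrightarrow> r \<le> 1/2 \<Longrightarrow>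
      v (1/2) - v r \<le> A * (K * growth_bound ?n k (r::real))"
    by (rule dyadic_growth[OF k]) blast
  define Q where "Q = (1 + 2 ^ (?n - 1)) / (real ?n * unit_ball_vol (real ?n))"
  have Q0: "0 < Q" unfolding Q_def by (intro divide_pos_pos add_pos_pos) auto
  define q where "q = root (k + 1) Q"
  have q0: "0 < q" using Q0 by (simp add: q_def)
  have qk: "q ^ (k + 1) = Q" using Q0 unfolding q_def by (intro real_root_pow_pos2) auto
  define D0 where "D0 = 9 + 2 ^ (?n - k) + step_const ?n k * K"
  have D0: "0 < D0" using step_const_nonneg[OF k(1), of ?n] K(1) by (simp add: D0_def add_pos_nonneg)
  have bound: "\<bar>v r\<bar> \<le> (D0 * q) * W_norm k (ball 0 1 - cball 0 (1/2)) u Du * growth_bound ?n k r"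
    if g: "\<forall>t. g t \<ge> 0" "locally_Lipschitz g" and u: "\<forall>x. u x = v (norm x)" and cv: "continuous_on {0<..1} v"
      and W: "in_W k (ball 0 1) u Du" and rd: "AE x in lebesgue. x \<in> ball 0 1 \<longrightarrow> radial_deriv Du x \<ge> 0"
      and sol: "classical_solution k g u \<or> radial_weak_solution k g u Du" and st: "semistable k g u"
      and r: "r \<in> {0<..1}"
    for g u and Du :: "real^'n \<Rightarrow> real^'n" and v r
  proof -
    interpret S: radial_sobolev u Du v k using u cv W rd by unfold_locales auto
    note gc = locally_Lipschitz_continuous[OF g(2)]
    let ?G = "\<lambda>r. g (v r) / c_const ?n k"
    have "\<exists>w. radial_profile ?n k v w ?G \<and> (AE r in lborel. r \<in> {0<..<1} \<longrightarrow> S.m r = w r)"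
      using sol
    proof
      assume c: "classical_solution k g u"
      show ?thesis by (rule S.classical_solution_profile[OF c gc _ k]) (use g(1) in auto)
    next
      assume c: "radial_weak_solution k g u Du"
      show ?thesis by (rule S.weak_solution_profile[OF c gc _ k]) (use g(1) in auto)
    qed
    then obtain w where w: "radial_profile ?n k v w ?G" "AE r in lborel. r \<in> {0<..<1} \<longrightarrow> S.m r = w r" by blast
    interpret P: profiled_sobolev u Du v w ?G k
      by (intro profiled_sobolev.intro profiled_sobolev_axioms.intro S.radial_sobolev_axioms w)
    define M where "M = W_norm k (ball 0 1 - cball 0 (1/2)) u Du"
    have M0: "0 \<le> M" by (simp add: M_def W_norm_def)
    have Me: "M = P.energy powr (1 / (real k + 1))" by (simp add: M_def W_norm_def P.energy_def)
    have Mk: "M ^ (k + 1) = P.energy"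
    proof (cases "P.energy = 0")
      case False
      then have e: "0 < P.energy" using P.energy_nonneg by simp
      have "M ^ (k + 1) = M powr real (k + 1)"
        using Me e by (intro powr_realpow[symmetric]) simp
      also have "\<dots> = P.energy powr (1 / (real k + 1) * real (k + 1))" unfolding Me by (rule powr_powr)
      also have "1 / (real k + 1) * real (k + 1) = 1" by simp
      finally show ?thesis using e by simp
    qed (simp add: Me)
    define B where "B = growth_bound ?n k r"
    have B1: "1 \<le> B" unfolding B_def by (rule growth_bound_ge_1[OF k(1)]) (use r in auto)
    have "\<bar>v r\<bar> \<le> D0 * q * M * B + e" if e: "0 < e" for e
    proof -
      define d where "d = e / (D0 * B)"
      have d: "0 < d" using e D0 B1 by (simp add: d_def)
      have N0: "0 < q * M + d" using q0 M0 d by (simp add: add_nonneg_pos)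
      have "(1 + 2 ^ (?n - 1)) / S.\<kappa> * P.energy = (q * M) ^ (k + 1)"
        by (simp only: power_mult_distrib qk Mk) (simp add: Q_def S.\<kappa>_def)
      also have "\<dots> \<le> (q * M + d) ^ (k + 1)" using q0 M0 d by (intro power_mono) auto
      finally have "\<bar>v r\<bar> \<le> D0 * (q * M + d) * B"
        unfolding D0_def B_def using r by (intro P.profile_bound[OF refl g(2) st N0 _ K]) auto
      also have "\<dots> = D0 * q * M * B + e" using D0 B1 by (simp add: d_def distrib_left distrib_right)
      finally show ?thesis .
    qed
    then have "\<bar>v r\<bar> \<le> D0 * q * M * B" by (rule field_le_epsilon)
    then show ?thesis by (simp add: M_def B_def)
  qed
  show ?thesis
  proof (intro exI[of _ "D0 * q"] allI impI)
    fix g :: "real \<Rightarrow> real" and u and Du :: "real^'n \<Rightarrow> real^'n" and v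
    assume H: "\<forall>t. g t \<ge> 0" "locally_Lipschitz g" "\<forall>x. u x = v (norm x)" "continuous_on {0<..1} v"
      "in_W k (ball 0 1) u Du" "AE x in lebesgue. x \<in> ball 0 1 \<longrightarrow> radial_deriv Du x \<ge> 0"
      "classical_solution k g u \<or> radial_weak_solution k g u Du" "semistable k g u"
    have fin: "\<bar>v r\<bar> \<le> D0 * q * W_norm k (ball 0 1 - cball 0 (1/2)) u Du * growth_bound ?n k r" if "r \<in> {0<..1}" for r
      by (rule bound[OF H that])
    show "let C = D0 * q * W_norm k (ball 0 1 - cball 0 (1/2)) u Du in
      (CARD('n) < 2 * k + 8 \<longrightarrow> (\<forall>r\<in>{0<..1}. \<bar>v r\<bar> \<le> C)) \<and>
      (CARD('n) = 2 * k + 8 \<longrightarrow> (\<forall>r\<in>{0<..1}. \<bar>v r\<bar> \<le> C * (\<bar>ln r\<bar> + 1))) \<and>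
      (CARD('n) > 2 * k + 8 \<longrightarrow> (\<forall>r\<in>{0<..1}. \<bar>v r\<bar> \<le>
         C * r powr ((- (real k + 1) * real CARD('n)
                      + 2 * sqrt (2 * (real k + 1) * real CARD('n) - 4 * real k)
                      + 2 * (real k)\<^sup>2 + 6 * real k) / (real k + 1)\<^sup>2)))"
      unfolding Let_def growth_exponent_def[symmetric]
    proof (intro conjI impI ballI)
      fix r :: real assume r: "r \<in> {0<..1}"
      show "\<bar>v r\<bar> \<le> D0 * q * W_norm k (ball 0 1 - cball 0 (1/2)) u Du" if "?n < 2 * k + 8"
        using fin[OF r] that by (simp add: growth_bound_def)
      show "\<bar>v r\<bar> \<le> D0 * q * W_norm k (ball 0 1 - cball 0 (1/2)) u Du * (\<bar>ln r\<bar> + 1)" if "?n = 2 * k + 8"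
        using fin[OF r] that by (simp add: growth_bound_def)
      show "\<bar>v r\<bar> \<le> D0 * q * W_norm k (ball 0 1 - cball 0 (1/2)) u Du * r powr growth_exponent ?n k" if "?n > 2 * k + 8"
        using fin[OF r] that by (simp add: growth_bound_def)
    qed
  qed
qed

end
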